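(* Let $\phi$ be a smooth metric on $L$ over $U\times Z$ satisfying $\omega^\phi:=i\partial\bar\partial\phi\ge 0$. Let $u$ be an element in $F_t$. Then the curvature $\Theta^F$ of $F$ satisfies $$\langle\Theta^F u,u\rangle\le (n+1)\int_{\{t\}\times Z}|u|^2\,c(\phi)\,e^{-\phi}\,\omega_n .$$
   Context: $Z$ is a compact complex manifold of dimension $n$, $\hat L$ a positive line bundle over $Z$, $U\subset\mathbb{C}$ a domain, and $L$ the pullback of $\hat L$ to $U\times Z$. Metrics are written additively: a metric $\phi$ is locally a real function and $|u|^2e^{-\phi}$ is the pointwise squared norm of a section. Write $\phi=\phi_0+\psi$ with $\phi_0$ a fixed metric on $\hat L$ and $\psi=\psi(t,z)$ a smooth real function. Throughout, $\phi$ restricts to a positive metric on each fiber: $\omega=\omega^t:=i\partial\bar\partial_z\phi|_{\{t\}\times Z}>0$. Notation: $\omega_n=\omega^{n}/n!$. $F=U\times H^0(Z,\hat L)$ is the trivial holomorphic vector bundle over $U$ with the Hermitian metric $\|u\|_t^2=\int_{\{t\}\times Z}|u|^2e^{-\phi}\omega_n$. $\Theta^F$ is its Chern curvature, viewed as an endomorphism (coefficient of $dt\wedge d\bar t$), so that $\langle\Theta^F u,u\rangle=-\frac{\partial^2}{\partial t\partial\bar t}\|u(t)\|^2_t$ at $t$ for a holomorphic section extending $u$ with $D'u=0$ at $t$ ($D'$ the $(1,0)$-part of the Chern connection). $c(\phi)=\psi_{t\bar t}-|\bar\partial_z\psi_t|^2_{\omega^t}$, with $\psi_t=\partial\psi/\partial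 t$ and the norm measured by $\omega^t$ ($dz_j$ orthonormal when $\omega^t=i\sum dz_j\wedge d\bar z_j$ at the point). *)

theory Defs
  imports "HOL-Analysis.Analysis" "HOL-Library.Complex_Order"
begin

text \<open>Complex numbers carry the order of \<^theory>\<open>HOL-Library.Complex_Order\<close>: \<open>a \<le> b\<close> means
  \<open>Re a \<le> Re b\<close> and \<open>Im a = Im b\<close>, and similarly for \<open><\<close>.\<close>


section \<open>Calculus on open subsets of complex coordinate spaces\<close>

fun Ck_on :: "nat \<Rightarrow> 'a::real_normed_vector set \<Rightarrow> ('a \<Rightarrow> 'b::real_normed_vector) \<Rightarrow> bool" where
  "Ck_on 0 S f \<longleftrightarrow> continuous_on S f"
| "Ck_on (Suc k) S f \<longleftrightarrow> (\<forall>p\<in>S. f differentiable (at p)) \<and>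
     (\<forall>v. Ck_on k S (\<lambda>p. frechet_derivative f (at p) v))"

definition Cinf_on :: "'a::real_normed_vector set \<Rightarrow> ('a \<Rightarrow> 'b::real_normed_vector) \<Rightarrow> bool" where
  "Cinf_on S f \<longleftrightarrow> (\<forall>k. Ck_on k S f)"

definition several_holomorphic_on :: "(complex^'n \<Rightarrow> complex) \<Rightarrow> (complex^'n) set \<Rightarrow> bool" where
  "several_holomorphic_on f S \<longleftrightarrow>
     (\<forall>p\<in>S. \<exists>f'. (f has_derivative f') (at p) \<and> (\<forall>c v. f' (c *s v) = c * f' v))"

text \<open>\<open>v\<close> and \<open>w\<close> are the real directions \<open>\<partial>/\<partial>x\<close> and \<open>\<partial>/\<partial>y\<close> of a complex coordinate \<open>x + iy\<close>.\<close>

definition wirtinger ::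
  "'a::real_normed_vector \<Rightarrow> 'a \<Rightarrow> ('a \<Rightarrow> complex) \<Rightarrow> 'a \<Rightarrow> complex" where
  "wirtinger v w f p =
     (frechet_derivative f (at p) v - \<i> * frechet_derivative f (at p) w) / 2"

definition wirtinger_bar ::
  "'a::real_normed_vector \<Rightarrow> 'a \<Rightarrow> ('a \<Rightarrow> complex) \<Rightarrow> 'a \<Rightarrow> complex" where
  "wirtinger_bar v w f p =
     (frechet_derivative f (at p) v + \<i> * frechet_derivative f (at p) w) / 2"

text \<open>A coordinate frame \<open>e\<close> sends \<open>k\<close> and \<open>c\<close> to the vector whose \<open>k\<close>-th complex coordinate is \<open>c\<close>
  and whose other coordinates vanish: \<^const>\<open>axis\<close> on \<open>complex^'n\<close>, and the following on
  \<open>complex \<times> complex^'n\<close>, whose coordinates \<open>(t, z)\<close> are indexed by \<open>'n option\<close>.\<close>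

definition tz_axis :: "'n::finite option \<Rightarrow> complex \<Rightarrow> complex \<times> (complex^'n)" where
  "tz_axis k c = (case k of None \<Rightarrow> (c, 0) | Some j \<Rightarrow> (0, axis j c))"

text \<open>The matrix \<open>(f\<^sub>k\<^sub>l)\<close> of coefficients in \<open>i\<partial>dbar f = i \<Sum> f\<^sub>k\<^sub>l dz\<^sub>k \<and> dzbar\<^sub>l\<close>.\<close>

definition complex_hessian ::
  "('k::finite \<Rightarrow> complex \<Rightarrow> 'a::real_normed_vector) \<Rightarrow> ('a \<Rightarrow> real) \<Rightarrow> 'a \<Rightarrow> complex^'k^'k" where
  "complex_hessian e f p = (\<chi> k l.
     wirtinger (e k 1) (e k \<i>)
       (wirtinger_bar (e l 1) (e l \<i>) (\<lambda>q. complex_of_real (f q))) p)"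

definition positive_semidefinite :: "complex^'k::finite^'k \<Rightarrow> bool" where
  "positive_semidefinite A \<longleftrightarrow> (\<forall>\<xi>. 0 \<le> (\<Sum>k\<in>UNIV. \<Sum>l\<in>UNIV. A $ k $ l * \<xi> $ k * cnj (\<xi> $ l)))"

definition positive_definite :: "complex^'k::finite^'k \<Rightarrow> bool" where
  "positive_definite A \<longleftrightarrow>
     (\<forall>\<xi>. \<xi> \<noteq> 0 \<longrightarrow> 0 < (\<Sum>k\<in>UNIV. \<Sum>l\<in>UNIV. A $ k $ l * \<xi> $ k * cnj (\<xi> $ l)))"


section \<open>Compact complex manifolds\<close>

type_synonym ('z, 'n) chart = "'z set \<times> ('z \<Rightarrow> complex^'n)"

definition chart_inv :: "('z, 'n) chart \<Rightarrow> complex^'n \<Rightarrow> 'z" where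
  "chart_inv c = inv_into (fst c) (snd c)"

text \<open>The image in the coordinates of \<open>c\<close> of the part of \<open>A\<close> that the chart covers.\<close>

definition chart_image :: "('z, 'n) chart \<Rightarrow> 'z set \<Rightarrow> (complex^'n) set" where
  "chart_image c A = snd c ` (fst c \<inter> A)"

definition compact_complex_manifold ::
  "('z::t2_space, 'n::finite) chart set \<Rightarrow> bool" where
  "compact_complex_manifold atlas \<longleftrightarrow>
     compact (UNIV :: 'z set) \<and>
     (\<Union>c\<in>atlas. fst c) = UNIV \<and>
     (\<forall>c\<in>atlas. open (fst c) \<and> open (chart_image c UNIV) \<and>
        homeomorphism (fst c) (chart_image c UNIV) (snd c) (chart_inv c)) \<and>
     (\<forall>c\<in>atlas. \<forall>d\<in>atlas. \<forall>k.
        several_holomorphic_on (\<lambda>w. snd d (chart_inv c w) $ k) (chart_image c (fst d)))"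

definition manifold_holomorphic_on ::
  "('z, 'n::finite) chart set \<Rightarrow> ('z \<Rightarrow> complex) \<Rightarrow> 'z set \<Rightarrow> bool" where
  "manifold_holomorphic_on atlas f A \<longleftrightarrow>
     (\<forall>c\<in>atlas. several_holomorphic_on (\<lambda>w. f (chart_inv c w)) (chart_image c A))"

definition manifold_smooth_on ::
  "('z, 'n::finite) chart set \<Rightarrow> ('z \<Rightarrow> real) \<Rightarrow> 'z set \<Rightarrow> bool" where
  "manifold_smooth_on atlas f A \<longleftrightarrow>
     (\<forall>c\<in>atlas. Cinf_on (chart_image c A) (\<lambda>w. f (chart_inv c w)))"

definition product_smooth_on ::
  "('z, 'n::finite) chart set \<Rightarrow> (complex \<Rightarrow> 'z \<Rightarrow> real) \<Rightarrow> complex set \<Rightarrow> 'z set \<Rightarrow> bool" where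
  "product_smooth_on atlas f U A \<longleftrightarrow>
     (\<forall>c\<in>atlas. Cinf_on (U \<times> chart_image c A) (\<lambda>(t, w). f t (chart_inv c w)))"


section \<open>Line bundles, metrics and sections\<close>

text \<open>A line bundle is given by an open trivialising cover \<open>W\<close> and transition functions \<open>g\<close>; the
  local representatives of a section satisfy \<open>u\<^sub>i = g\<^sub>i\<^sub>j u\<^sub>j\<close>. Members of the cover may be empty.\<close>

definition holomorphic_line_bundle ::
  "('z::t2_space, 'n::finite) chart set \<Rightarrow> ('i \<Rightarrow> 'z set) \<Rightarrow> ('i \<Rightarrow> 'i \<Rightarrow> 'z \<Rightarrow> complex) \<Rightarrow> bool" where
  "holomorphic_line_bundle atlas W g \<longleftrightarrow>
     (\<forall>i. open (W i)) \<and> (\<Union>i. W i) = UNIV \<and>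
     (\<forall>i j. manifold_holomorphic_on atlas (g i j) (W i \<inter> W j)) \<and>
     (\<forall>i j. \<forall>z\<in>W i \<inter> W j. g i j z \<noteq> 0) \<and>
     (\<forall>i j k. \<forall>z\<in>W i \<inter> W j \<inter> W k. g i j z * g j k z = g i k z)"

text \<open>A metric is a family of local functions \<open>\<phi>\<^sub>i\<close> for which \<open>|u\<^sub>i|\<^sup>2 exp (-\<phi>\<^sub>i)\<close> does not depend
  on \<open>i\<close>.\<close>

definition metric_compatible ::
  "('i \<Rightarrow> 'z set) \<Rightarrow> ('i \<Rightarrow> 'i \<Rightarrow> 'z \<Rightarrow> complex) \<Rightarrow> ('i \<Rightarrow> 'z \<Rightarrow> real) \<Rightarrow> bool" where
  "metric_compatible W g \<phi> \<longleftrightarrow>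
     (\<forall>i j. \<forall>z\<in>W i \<inter> W j. \<phi> i z = \<phi> j z + ln ((cmod (g i j z))\<^sup>2))"

definition smooth_metric ::
  "('z, 'n::finite) chart set \<Rightarrow> ('i \<Rightarrow> 'z set) \<Rightarrow> ('i \<Rightarrow> 'i \<Rightarrow> 'z \<Rightarrow> complex) \<Rightarrow>
    ('i \<Rightarrow> 'z \<Rightarrow> real) \<Rightarrow> bool" where
  "smooth_metric atlas W g \<phi> \<longleftrightarrow>
     metric_compatible W g \<phi> \<and> (\<forall>i. manifold_smooth_on atlas (\<phi> i) (W i))"

text \<open>Smooth metrics on the pullback of the bundle to \<open>U \<times> Z\<close>, which is trivialised over the
  sets \<open>U \<times> W i\<close> with the transition functions \<open>(t, z) \<mapsto> g i j z\<close>.\<close>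

definition smooth_metric_pullback ::
  "('z, 'n::finite) chart set \<Rightarrow> ('i \<Rightarrow> 'z set) \<Rightarrow> ('i \<Rightarrow> 'i \<Rightarrow> 'z \<Rightarrow> complex) \<Rightarrow>
    complex set \<Rightarrow> (complex \<Rightarrow> 'i \<Rightarrow> 'z \<Rightarrow> real) \<Rightarrow> bool" where
  "smooth_metric_pullback atlas W g U \<phi> \<longleftrightarrow>
     (\<forall>t\<in>U. metric_compatible W g (\<phi> t)) \<and>
     (\<forall>i. product_smooth_on atlas (\<lambda>t. \<phi> t i) U (W i))"

text \<open>The coefficient matrix of \<open>\<omega> = i\<partial>dbar \<phi>\<close> at \<open>z\<close> in the coordinates of the chart \<open>c\<close>. It does not
  depend on the trivialisation \<open>i\<close>, as \<open>ln |g|\<^sup>2\<close> is pluriharmonic.\<close>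

definition curvature_matrix ::
  "('i \<Rightarrow> 'z set) \<Rightarrow> ('i \<Rightarrow> 'z \<Rightarrow> real) \<Rightarrow> ('z, 'n::finite) chart \<Rightarrow> 'z \<Rightarrow> complex^'n^'n" where
  "curvature_matrix W \<phi> c z =
     (let i = (SOME i. z \<in> W i) in complex_hessian axis (\<lambda>w. \<phi> i (chart_inv c w)) (snd c z))"

definition positive_metric ::
  "('z, 'n::finite) chart set \<Rightarrow> ('i \<Rightarrow> 'z set) \<Rightarrow> ('i \<Rightarrow> 'z \<Rightarrow> real) \<Rightarrow> bool" where
  "positive_metric atlas W \<phi> \<longleftrightarrow>
     (\<forall>c\<in>atlas. \<forall>z\<in>fst c. positive_definite (curvature_matrix W \<phi> c z))"

definition positive_line_bundle ::
  "('z::t2_space, 'n::finite) chart set \<Rightarrow> ('i \<Rightarrow> 'z set) \<Rightarrow> ('i \<Rightarrow> 'i \<Rightarrow> 'z \<Rightarrow> complex) \<Rightarrow> bool" where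
  "positive_line_bundle atlas W g \<longleftrightarrow>
     holomorphic_line_bundle atlas W g \<and>
     (\<exists>\<eta>. smooth_metric atlas W g \<eta> \<and> positive_metric atlas W \<eta>)"

definition semipositive_on_product ::
  "('z, 'n::finite) chart set \<Rightarrow> ('i \<Rightarrow> 'z set) \<Rightarrow> complex set \<Rightarrow>
    (complex \<Rightarrow> 'i \<Rightarrow> 'z \<Rightarrow> real) \<Rightarrow> bool" where
  "semipositive_on_product atlas W U \<phi> \<longleftrightarrow>
     (\<forall>c\<in>atlas. \<forall>i. \<forall>t\<in>U. \<forall>w\<in>chart_image c (W i).
        positive_semidefinite
          (complex_hessian tz_axis (\<lambda>(s, w'). \<phi> s i (chart_inv c w')) (t, w)))"

text \<open>\<open>H\<^sup>0(Z, L)\<close>. The value of a local representative outside its domain is fixed to be \<open>0\<close>, so that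
  equality of sections is equality of functions.\<close>

definition global_sections ::
  "('z, 'n::finite) chart set \<Rightarrow> ('i \<Rightarrow> 'z set) \<Rightarrow> ('i \<Rightarrow> 'i \<Rightarrow> 'z \<Rightarrow> complex) \<Rightarrow>
    ('i \<Rightarrow> 'z \<Rightarrow> complex) set" where
  "global_sections atlas W g = {u.
     (\<forall>i. manifold_holomorphic_on atlas (u i) (W i)) \<and>
     (\<forall>i j. \<forall>z\<in>W i \<inter> W j. u i z = g i j z * u j z) \<and>
     (\<forall>i. \<forall>z. z \<notin> W i \<longrightarrow> u i z = 0)}"

definition pointwise_inner ::
  "('i \<Rightarrow> 'z set) \<Rightarrow> ('i \<Rightarrow> 'z \<Rightarrow> real) \<Rightarrow> ('i \<Rightarrow> 'z \<Rightarrow> complex) \<Rightarrow> ('i \<Rightarrow> 'z \<Rightarrow> complex) \<Rightarrow>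
    'z \<Rightarrow> complex" where
  "pointwise_inner W \<phi> u v z =
     (let i = (SOME i. z \<in> W i) in u i z * cnj (v i z) * complex_of_real (exp (- \<phi> i z)))"

definition pointwise_normsq ::
  "('i \<Rightarrow> 'z set) \<Rightarrow> ('i \<Rightarrow> 'z \<Rightarrow> real) \<Rightarrow> ('i \<Rightarrow> 'z \<Rightarrow> complex) \<Rightarrow> 'z \<Rightarrow> real" where
  "pointwise_normsq W \<phi> u z =
     (let i = (SOME i. z \<in> W i) in (cmod (u i z))\<^sup>2 * exp (- \<phi> i z))"


section \<open>Integration over the fibres\<close>

text \<open>In coordinates \<open>\<omega>\<^sup>n / n! = det (\<omega>\<^sub>j\<^sub>k) \<Prod> (i dz\<^sub>j \<and> dzbar\<^sub>j)\<close> and \<open>i dz \<and> dzbar = 2 dx \<and> dy\<close>.\<close>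

definition volume_density ::
  "('i \<Rightarrow> 'z set) \<Rightarrow> ('i \<Rightarrow> 'z \<Rightarrow> real) \<Rightarrow> ('z, 'n::finite) chart \<Rightarrow> complex^'n \<Rightarrow> real" where
  "volume_density W \<phi> c w = 2 ^ CARD('n) * Re (det (curvature_matrix W \<phi> c (chart_inv c w)))"

text \<open>The measure \<open>\<omega>\<^sub>n\<close> on \<open>Z\<close>: the unique Borel measure that is given in every chart by the
  volume form.\<close>

definition volume_measure ::
  "('z::t2_space, 'n::finite) chart set \<Rightarrow> ('i \<Rightarrow> 'z set) \<Rightarrow> ('i \<Rightarrow> 'z \<Rightarrow> real) \<Rightarrow> 'z measure" where
  "volume_measure atlas W \<phi> = (THE M. sets M = sets borel \<and>
     (\<forall>c\<in>atlas. \<forall>A\<in>sets borel. A \<subseteq> fst c \<longrightarrow>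
        emeasure M A =
          (\<integral>\<^sup>+ w\<in>chart_image c A. ennreal (volume_density W \<phi> c w) \<partial>lborel)))"

definition L2_inner ::
  "('z::t2_space, 'n::finite) chart set \<Rightarrow> ('i \<Rightarrow> 'z set) \<Rightarrow> ('i \<Rightarrow> 'z \<Rightarrow> real) \<Rightarrow>
    ('i \<Rightarrow> 'z \<Rightarrow> complex) \<Rightarrow> ('i \<Rightarrow> 'z \<Rightarrow> complex) \<Rightarrow> complex" where
  "L2_inner atlas W \<phi> u v = (LINT z|volume_measure atlas W \<phi>. pointwise_inner W \<phi> u v z)"


section \<open>The Chern connection and its curvature\<close>

text \<open>A section of the trivial bundle \<open>F = U \<times> H\<^sup>0(Z, L)\<close> is a map \<open>s\<close> from parameters to global
  sections. The \<open>(1,0)\<close>-part \<open>D'\<close> of the Chern connection (coefficient of \<open>dt\<close>) is determined by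
  \<open>\<partial>\<^sub>t \<langle>s, v\<rangle> = \<langle>D's, v\<rangle> + \<langle>s, dbar\<^sub>t v\<rangle>\<close>, where it suffices to test with constant \<open>v\<close>, since these
  contain a global holomorphic frame; for them the last term vanishes.\<close>

definition chern_D1 ::
  "('z::t2_space, 'n::finite) chart set \<Rightarrow> ('i \<Rightarrow> 'z set) \<Rightarrow> ('i \<Rightarrow> 'i \<Rightarrow> 'z \<Rightarrow> complex) \<Rightarrow>
    (complex \<Rightarrow> 'i \<Rightarrow> 'z \<Rightarrow> real) \<Rightarrow> (complex \<Rightarrow> 'i \<Rightarrow> 'z \<Rightarrow> complex) \<Rightarrow>
    complex \<Rightarrow> 'i \<Rightarrow> 'z \<Rightarrow> complex" where
  "chern_D1 atlas W g \<phi> s t = (THE w. w \<in> global_sections atlas W g \<and>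
     (\<forall>v\<in>global_sections atlas W g.
        wirtinger 1 \<i> (\<lambda>\<tau>. L2_inner atlas W (\<phi> \<tau>) (s \<tau>) v) t = L2_inner atlas W (\<phi> t) w v))"

text \<open>The \<open>(0,1)\<close>-part, i.e. the holomorphic structure of the trivial bundle.\<close>

definition chern_D2 ::
  "(complex \<Rightarrow> 'i \<Rightarrow> 'z \<Rightarrow> complex) \<Rightarrow> complex \<Rightarrow> 'i \<Rightarrow> 'z \<Rightarrow> complex" where
  "chern_D2 s t i z = wirtinger_bar 1 \<i> (\<lambda>\<tau>. s \<tau> i z) t"

text \<open>The square of \<open>D = D' dt + D'' dtbar\<close> is \<open>(D'D'' - D''D') dt \<and> dtbar\<close>. As this operator is
  tensorial, its value on \<open>u \<in> F\<^sub>t\<close> can be computed with the constant extension of \<open>u\<close>.\<close>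

definition chern_curvature ::
  "('z::t2_space, 'n::finite) chart set \<Rightarrow> ('i \<Rightarrow> 'z set) \<Rightarrow> ('i \<Rightarrow> 'i \<Rightarrow> 'z \<Rightarrow> complex) \<Rightarrow>
    (complex \<Rightarrow> 'i \<Rightarrow> 'z \<Rightarrow> real) \<Rightarrow> complex \<Rightarrow> ('i \<Rightarrow> 'z \<Rightarrow> complex) \<Rightarrow> 'i \<Rightarrow> 'z \<Rightarrow> complex" where
  "chern_curvature atlas W g \<phi> t u = (let s = (\<lambda>_. u) in
     (\<lambda>i z. chern_D1 atlas W g \<phi> (chern_D2 s) t i z - chern_D2 (chern_D1 atlas W g \<phi> s) t i z))"


section \<open>The function \<open>c(\<phi>)\<close>\<close>

text \<open>The squared norm of the \<open>(0,1)\<close>-form \<open>\<Sum> a\<^sub>j dzbar\<^sub>j\<close> for the Hermitian metric with matrix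
  \<open>G = (\<omega>\<^sub>j\<^sub>k)\<close>; it is \<open>\<Sum> |a\<^sub>j|\<^sup>2\<close> if \<open>G\<close> is the identity.\<close>

definition form01_normsq :: "complex^'n^'n \<Rightarrow> complex^'n \<Rightarrow> real" where
  "form01_normsq G a =
     Re (\<Sum>j\<in>UNIV. \<Sum>k\<in>UNIV. matrix_inv G $ j $ k * a $ j * cnj (a $ k))"

text \<open>\<open>\<phi>\<close> only enters through \<open>\<omega>\<^sup>t\<close>, and \<open>\<psi>\<close> is the function with \<open>\<phi> = \<phi>\<^sub>0 + \<psi>\<close>. The result does
  not depend on the chart \<open>c\<close> at \<open>z\<close>.\<close>

definition c_phi ::
  "('z, 'n::finite) chart set \<Rightarrow> ('i \<Rightarrow> 'z set) \<Rightarrow> (complex \<Rightarrow> 'i \<Rightarrow> 'z \<Rightarrow> real) \<Rightarrow>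
    (complex \<Rightarrow> 'z \<Rightarrow> real) \<Rightarrow> complex \<Rightarrow> 'z \<Rightarrow> real" where
  "c_phi atlas W \<phi> \<psi> t z =
     (let c = (SOME c. c \<in> atlas \<and> z \<in> fst c);
          \<psi>\<^sub>t = (\<lambda>z'. wirtinger 1 \<i> (\<lambda>\<tau>. complex_of_real (\<psi> \<tau> z')) t);
          \<psi>\<^sub>t\<^sub>t = wirtinger 1 \<i> (wirtinger_bar 1 \<i> (\<lambda>\<tau>. complex_of_real (\<psi> \<tau> z))) t
      in Re \<psi>\<^sub>t\<^sub>t -
         form01_normsq (curvature_matrix W (\<phi> t) c z)
           (\<chi> j. wirtinger_bar (axis j 1) (axis j \<i>) (\<lambda>w. \<psi>\<^sub>t (chart_inv c w)) (snd c z)))"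

end

theory Submission
  imports Defs "HOL-Complex_Analysis.Cauchy_Integral_Formula"
begin

text \<open>Let \<open>T\<close> be the lift of \<open>\<partial>/\<partial>t\<close> to \<open>U \<times> Z\<close> that is orthogonal to the fibres for \<open>i\<partial>dbar \<phi>\<close>. Its flow
  accounts for the change of \<open>\<omega>\<^sub>n\<close>, so that \<open>\<partial>\<^sub>t \<integral> f \<omega>\<^sub>n = \<integral> T f \<omega>\<^sub>n\<close>. Write \<open>f = |u|\<^sup>2 exp (-\<phi>)\<close> for a
  fixed section \<open>u\<close> and let \<open>\<eta>\<close> be the covariant derivative of \<open>u\<close> along \<open>T\<close>. Then
  \<open>Tbar T f = |\<eta>|\<^sup>2 exp (-\<phi>) - c f - \<langle>\<partial>f, \<partial>c\<rangle>\<close>, and integration by parts on the fibre turns the last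
  term into \<open>c \<Delta>f\<close>, where \<open>\<Delta>f \<ge> -n f\<close> because \<open>u\<close> is holomorphic and the curvature of the metric is
  \<open>\<omega>\<close> itself. As \<open>c \<ge> 0\<close> by semipositivity (a Schur complement),
  \<open>\<partial>\<^sub>t\<partial>dbar\<^sub>t \<parallel>u\<parallel>\<^sup>2 \<ge> \<integral> |\<eta>|\<^sup>2 exp (-\<phi>) \<omega>\<^sub>n - (n + 1) \<integral> c f \<omega>\<^sub>n\<close>. Finally
  \<open>\<langle>\<Theta>u, u\<rangle> = \<parallel>D'u\<parallel>\<^sup>2 - \<partial>\<^sub>t\<partial>dbar\<^sub>t \<parallel>u\<parallel>\<^sup>2\<close> for the constant extension of \<open>u\<close>, and \<open>D'u\<close> is the orthogonal
  projection of \<open>\<eta>\<close> to the holomorphic sections.\<close>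

section \<open>Smooth functions\<close>

text \<open>The inequality loses in two places: D'u is no longer than \<eta>, whose projection it
  is, and the square of the fibrewise covariant derivative of u is dropped from the Laplacian of f.
  The constant is 1 for the term -c f plus n, the trace of \<omega> against itself. No flow is ever
  built: the logarithmic t-derivative of the volume density is the fibre Laplacian of \<psi>_t by
  Jacobi's formula, and integration by parts turns it into the vertical part of T. Two objects are
  given by unique descriptions and must first be shown to exist. The measure \<omega>_n is glued
  from charts, for which the real Jacobian of a holomorphic map has to be the squared modulus of the
  complex one. D'u is a Riesz vector, for which the sections must form a finite-dimensional space;
  this comes from a Schwarz-type decay estimate near finitely many points. The curvature also
  differentiates D'u in t, and that this is possible is a claim of its own: it is read off from the
  Gram matrix of a basis orthonormal at the one parameter t.\<close>

lemma frechet_derivative_cong_open: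
  assumes "open S" "p \<in> S" "\<And>q. q \<in> S \<Longrightarrow> f q = g q"
  shows "frechet_derivative f (at p) = frechet_derivative g (at p)"
proof -
  have "(f has_derivative f') (at p) \<longleftrightarrow> (g has_derivative f') (at p)" for f'
    using has_derivative_transform_within_open[OF _ assms(1,2), of f f' UNIV g]
      has_derivative_transform_within_open[OF _ assms(1,2), of g f' UNIV f] assms(3) by auto
  then show ?thesis by (simp add: frechet_derivative_def)
qed

lemma differentiable_cong_open:
  assumes "open S" "p \<in> S" "\<And>q. q \<in> S \<Longrightarrow> f q = g q"
  shows "f differentiable (at p) \<longleftrightarrow> g differentiable (at p)"
  unfolding differentiable_def
  using has_derivative_transform_within_open[OF _ assms(1,2), of f _ UNIV g]
      has_derivative_transform_within_open[OF _ assms(1,2), of g _ UNIV f] assms(3) by metis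

section \<open>Closure properties of the classes \<open>Ck_on\<close> and
  \<open>Cinf_on\<close>\<close>

lemma Ck_on_cong:
  assumes "open S" "\<And>p. p \<in> S \<Longrightarrow> f p = g p"
  shows "Ck_on k S f \<longleftrightarrow> Ck_on k S g"
  using assms(2)
proof (induction k arbitrary: f g)
  case 0
  then show ?case by (auto cong: continuous_on_cong)
next
  case (Suc k)
  have "Ck_on k S (\<lambda>p. frechet_derivative f (at p) v) \<longleftrightarrow> Ck_on k S (\<lambda>p. frechet_derivative g (at p) v)" for v
    by (rule Suc.IH) (simp add: frechet_derivative_cong_open[OF assms(1) _ Suc.prems])
  moreover have "f differentiable (at p) \<longleftrightarrow> g differentiable (at p)" if "p \<in> S" for p
    by (rule differentiable_cong_open[OF assms(1) that]) (rule Suc.prems)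
  ultimately show ?case by simp
qed

lemma Ck_on_Suc_imp: "Ck_on (Suc k) S f \<Longrightarrow> Ck_on k S f"
proof (induction k arbitrary: f)
  case 0
  then show ?case
    by (auto intro!: continuous_at_imp_continuous_on differentiable_imp_continuous_within)
next
  case (Suc k)
  then show ?case by (metis Ck_on.simps(2))
qed

lemma Cinf_on_iff:
  "Cinf_on S f \<longleftrightarrow> (\<forall>p\<in>S. f differentiable (at p)) \<and> (\<forall>v. Cinf_on S (\<lambda>p. frechet_derivative f (at p) v))"
  unfolding Cinf_on_def by (metis Ck_on.simps(2) Ck_on_Suc_imp)

lemma Cinf_on_differentiable: "Cinf_on S f \<Longrightarrow> p \<in> S \<Longrightarrow> f differentiable (at p)"
  using Cinf_on_iff by blast

lemma Cinf_on_has_derivative: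
  "Cinf_on S f \<Longrightarrow> p \<in> S \<Longrightarrow> (f has_derivative frechet_derivative f (at p)) (at p)"
  using Cinf_on_differentiable frechet_derivative_works by blast

lemma Cinf_on_dir: "Cinf_on S f \<Longrightarrow> Cinf_on S (\<lambda>p. frechet_derivative f (at p) v)"
  using Cinf_on_iff by blast

lemma Cinf_on_continuous: "Cinf_on S f \<Longrightarrow> continuous_on S f"
  unfolding Cinf_on_def by (metis Ck_on.simps(1))

lemma Cinf_on_cong:
  "open S \<Longrightarrow> (\<And>p. p \<in> S \<Longrightarrow> f p = g p) \<Longrightarrow> Cinf_on S f \<longleftrightarrow> Cinf_on S g"
  unfolding Cinf_on_def using Ck_on_cong by blast

lemma Ck_on_subset: "Ck_on k S f \<Longrightarrow> T \<subseteq> S \<Longrightarrow> Ck_on k T f"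
  by (induction k arbitrary: f) (auto intro: continuous_on_subset)

lemma Cinf_on_subset: "Cinf_on S f \<Longrightarrow> T \<subseteq> S \<Longrightarrow> Cinf_on T f"
  unfolding Cinf_on_def using Ck_on_subset by blast

lemma Ck_on_const: "Ck_on k S (\<lambda>_. c)"
  by (induction k arbitrary: c) auto

lemma Cinf_on_const [simp]: "Cinf_on S (\<lambda>_. c)"
  unfolding Cinf_on_def using Ck_on_const by blast

lemma frechet_derivative_bounded_linear_comp:
  assumes "bounded_linear L" "f differentiable (at p)"
  shows "frechet_derivative (\<lambda>q. L (f q)) (at p) = (\<lambda>v. L (frechet_derivative f (at p) v))"
  using bounded_linear.has_derivative[OF assms(1), of f _ "at p"] assms(2)
  by (metis frechet_derivative_at frechet_derivative_works)

lemma Ck_on_bounded_linear: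
  assumes "open S" "bounded_linear L"
  shows "Ck_on k S f \<Longrightarrow> Ck_on k S (\<lambda>p. L (f p))"
proof (induction k arbitrary: f)
  case 0
  then show ?case using assms(2) by (auto intro: bounded_linear.continuous_on)
next
  case (Suc k)
  have "Ck_on k S (\<lambda>p. frechet_derivative (\<lambda>p. L (f p)) (at p) v)" for v
    using Suc by (subst Ck_on_cong[OF assms(1), of _ "\<lambda>p. L (frechet_derivative f (at p) v)"])
     (auto simp: frechet_derivative_bounded_linear_comp[OF assms(2)])
  moreover have "(\<lambda>p. L (f p)) differentiable (at p)" if "p \<in> S" for p
    using Suc.prems that bounded_linear.has_derivative[OF assms(2), of f _ "at p"]
    unfolding differentiable_def by (simp only: Ck_on.simps differentiable_def) blast
  ultimately show ?case by simp
qed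

lemma Cinf_on_bounded_linear: "open S \<Longrightarrow> bounded_linear L \<Longrightarrow> Cinf_on S f \<Longrightarrow> Cinf_on S (\<lambda>p. L (f p))"
  unfolding Cinf_on_def using Ck_on_bounded_linear by blast

lemma frechet_derivative_add:
  assumes "f differentiable (at p)" "g differentiable (at p)"
  shows "frechet_derivative (\<lambda>q. f q + g q) (at p) = (\<lambda>v. frechet_derivative f (at p) v + frechet_derivative g (at p) v)"
  using has_derivative_add[of f _ "at p" g] assms by (metis frechet_derivative_at frechet_derivative_works)

lemma frechet_derivative_mult:
  fixes f g :: "_ \<Rightarrow> 'b::real_normed_algebra"
  assumes "f differentiable (at p)" "g differentiable (at p)"
  shows "frechet_derivative (\<lambda>q. f q * g q) (at p) = 
    (\<lambda>v. f p * frechet_derivative g (at p) v + frechet_derivative f (at p) v * g p)"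
  using has_derivative_mult[of f _ p UNIV g] assms by (metis frechet_derivative_at frechet_derivative_works)

lemma Ck_on_add:
  assumes "open S"
  shows "Ck_on k S f \<Longrightarrow> Ck_on k S g \<Longrightarrow> Ck_on k S (\<lambda>p. f p + g p)"
proof (induction k arbitrary: f g)
  case 0
  then show ?case by (auto intro: continuous_intros)
next
  case (Suc k)
  have "Ck_on k S (\<lambda>p. frechet_derivative (\<lambda>p. f p + g p) (at p) v)" for v
    using Suc by (subst Ck_on_cong[OF assms(1), of _ "\<lambda>p. frechet_derivative f (at p) v + frechet_derivative g (at p) v"])
     (auto simp: frechet_derivative_add)
  then show ?case using Suc.prems by simp
qed

lemma Cinf_on_add: "open S \<Longrightarrow> Cinf_on S f \<Longrightarrow> Cinf_on S g \<Longrightarrow> Cinf_on S (\<lambda>p. f p + g p)"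
  unfolding Cinf_on_def using Ck_on_add by blast

lemma Ck_on_mult:
  fixes f g :: "_ \<Rightarrow> 'b::real_normed_algebra"
  assumes "open S"
  shows "Ck_on k S f \<Longrightarrow> Ck_on k S g \<Longrightarrow> Ck_on k S (\<lambda>p. f p * g p)"
proof (induction k arbitrary: f g)
  case 0
  then show ?case by (auto intro: continuous_intros)
next
  case (Suc k)
  have "Ck_on k S (\<lambda>p. frechet_derivative (\<lambda>p. f p * g p) (at p) v)" for v
    \<comment> \<open>The product rule leaves each factor undifferentiated once; those copies enter
      the induction hypothesis at the lower order k.\<close>
    using Suc.prems Suc.prems[THEN Ck_on_Suc_imp]
    by (subst Ck_on_cong[OF assms(1), of _ "\<lambda>p. f p * frechet_derivative g (at p) v + frechet_derivative f (at p) v * g p"])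
     (auto simp: frechet_derivative_mult intro!: Ck_on_add[OF assms] Suc.IH)
  then show ?case using Suc.prems by (auto intro: differentiable_mult)
qed

lemma Cinf_on_mult:
  fixes f g :: "_ \<Rightarrow> 'b::real_normed_algebra"
  shows "open S \<Longrightarrow> Cinf_on S f \<Longrightarrow> Cinf_on S g \<Longrightarrow> Cinf_on S (\<lambda>p. f p * g p)"
  unfolding Cinf_on_def using Ck_on_mult by blast

lemma Cinf_on_minus: "open S \<Longrightarrow> Cinf_on S f \<Longrightarrow> Cinf_on S (\<lambda>p. - f p)"
  by (rule Cinf_on_bounded_linear) (auto intro: bounded_linear_minus bounded_linear_ident)

lemma Cinf_on_diff: "open S \<Longrightarrow> Cinf_on S f \<Longrightarrow> Cinf_on S g \<Longrightarrow> Cinf_on S (\<lambda>p. f p - g p)"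
  using Cinf_on_add[of S f "\<lambda>p. - g p"] Cinf_on_minus[of S g] by simp

lemma Cinf_on_sum: "open S \<Longrightarrow> (\<And>i. i \<in> I \<Longrightarrow> Cinf_on S (f i)) \<Longrightarrow> Cinf_on S (\<lambda>p. \<Sum>i\<in>I. f i p)"
  by (induction I rule: infinite_finite_induct) (auto intro: Cinf_on_add)

lemma Cinf_on_prod:
  fixes f :: "'i \<Rightarrow> 'a::real_normed_vector \<Rightarrow> 'b::{real_normed_algebra_1,comm_monoid_mult}"
  shows "open S \<Longrightarrow> (\<And>i. i \<in> I \<Longrightarrow> Cinf_on S (f i)) \<Longrightarrow> Cinf_on S (\<lambda>p. \<Prod>i\<in>I. f i p)"
  by (induction I rule: infinite_finite_induct) (auto intro: Cinf_on_mult)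

lemma Cinf_on_cnj: "open S \<Longrightarrow> Cinf_on S f \<Longrightarrow> Cinf_on S (\<lambda>p. cnj (f p))"
  by (rule Cinf_on_bounded_linear) (auto intro: bounded_linear_cnj)

lemma Cinf_on_of_real: "open S \<Longrightarrow> Cinf_on S f \<Longrightarrow> Cinf_on S (\<lambda>p. complex_of_real (f p))"
  by (rule Cinf_on_bounded_linear) (auto intro: bounded_linear_of_real)

lemma Ck_on_exp:
  fixes f :: "_ \<Rightarrow> 'b::{real_normed_field,banach}"
  assumes "open S"
  shows "Ck_on k S f \<Longrightarrow> Ck_on k S (\<lambda>p. exp (f p))"
proof (induction k arbitrary: f)
  case 0
  then show ?case by (auto intro: continuous_intros)
next
  case (Suc k)
  have d: "((\<lambda>p. exp (f p)) has_derivative (\<lambda>v. exp (f p) * frechet_derivative f (at p) v)) (at p)" if "p \<in> S" for p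
    using has_derivative_compose[of f "frechet_derivative f (at p)" p UNIV exp "\<lambda>x. exp (f p) * x"]
      Suc.prems that DERIV_exp[of "f p"]
    by (auto simp: frechet_derivative_works[symmetric] has_field_derivative_def)
  have "Ck_on k S (\<lambda>p. frechet_derivative (\<lambda>p. exp (f p)) (at p) v)" for v
    using Suc.prems Suc.prems[THEN Ck_on_Suc_imp] by (subst Ck_on_cong[OF assms(1), of _ "\<lambda>p. exp (f p) * frechet_derivative f (at p) v"])
     (auto simp: frechet_derivative_at[OF d, symmetric] intro!: Ck_on_mult[OF assms] Suc.IH)
  then show ?case using Suc.prems d by (auto simp: differentiable_def)
qed

lemma Cinf_on_exp:
  fixes f :: "_ \<Rightarrow> 'b::{real_normed_field,banach}"
  shows "open S \<Longrightarrow> Cinf_on S f \<Longrightarrow> Cinf_on S (\<lambda>p. exp (f p))"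
  unfolding Cinf_on_def using Ck_on_exp by blast

lemma Ck_on_inverse:
  fixes f :: "_ \<Rightarrow> 'b::real_normed_field"
  assumes "open S" "\<And>p. p \<in> S \<Longrightarrow> f p \<noteq> 0"
  shows "Ck_on k S f \<Longrightarrow> Ck_on k S (\<lambda>p. inverse (f p))"
proof (induction k)
  case 0
  then show ?case using assms by (auto intro: continuous_intros)
next
  case (Suc k)
  have df: "(f has_derivative frechet_derivative f (at p)) (at p)" if "p \<in> S" for p
    using Suc.prems that by (simp add: frechet_derivative_works[symmetric])
  have d: "((\<lambda>p. inverse (f p)) has_derivative (\<lambda>v. - (inverse (f p) * frechet_derivative f (at p) v * inverse (f p)))) (at p)" if "p \<in> S" for p
    using Deriv.has_derivative_inverse[OF assms(2)[OF that] df[OF that]] .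
  \<comment> \<open>The derivative contains inverse f itself, so its class k, from the induction
    hypothesis, lifts to class k + 1.\<close>
  have ck: "Ck_on k S (\<lambda>p. inverse (f p))" using Suc.IH[OF Ck_on_Suc_imp[OF Suc.prems]] .
  have ck': "Ck_on k S (\<lambda>p. - (inverse (f p) * frechet_derivative f (at p) v * inverse (f p)))" for v
    using Suc.prems by (intro Ck_on_bounded_linear[OF assms(1), of "\<lambda>x. - x"] Ck_on_mult[OF assms(1)] ck
        bounded_linear_minus bounded_linear_ident) simp
  have "Ck_on k S (\<lambda>p. frechet_derivative (\<lambda>p. inverse (f p)) (at p) v)" for v
    using ck'[of v] by (subst Ck_on_cong[OF assms(1), of _ "\<lambda>p. - (inverse (f p) * frechet_derivative f (at p) v * inverse (f p))"])
     (simp_all add: frechet_derivative_at[OF d, symmetric])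
  moreover have "(\<lambda>p. inverse (f p)) differentiable (at p)" if "p \<in> S" for p
    using d[OF that] by (rule differentiableI)
  ultimately show ?case by simp
qed

lemma Cinf_on_inverse:
  fixes f :: "_ \<Rightarrow> 'b::real_normed_field"
  shows "open S \<Longrightarrow> (\<And>p. p \<in> S \<Longrightarrow> f p \<noteq> 0) \<Longrightarrow> Cinf_on S f \<Longrightarrow> Cinf_on S (\<lambda>p. inverse (f p))"
  unfolding Cinf_on_def using Ck_on_inverse by blast

lemma Cinf_on_divide:
  fixes f g :: "_ \<Rightarrow> 'b::real_normed_field"
  shows "open S \<Longrightarrow> (\<And>p. p \<in> S \<Longrightarrow> g p \<noteq> 0) \<Longrightarrow> Cinf_on S f \<Longrightarrow> Cinf_on S g \<Longrightarrow> Cinf_on S (\<lambda>p. f p / g p)"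
  using Cinf_on_mult[of S f "\<lambda>p. inverse (g p)"] Cinf_on_inverse[of S g] by (simp add: divide_inverse)

section \<open>Affine substitutions\<close>

lemma frechet_derivative_affine_comp:
  assumes "bounded_linear L" "f differentiable (at (a + L p))"
  shows "frechet_derivative (\<lambda>q. f (a + L q)) (at p) = (\<lambda>v. frechet_derivative f (at (a + L p)) (L v))"
proof -
  have "((\<lambda>q. a + L q) has_derivative L) (at p)"
    using assms(1) by (auto intro!: derivative_eq_intros simp: bounded_linear_imp_has_derivative)
  from has_derivative_compose[OF this] assms(2) show ?thesis
    by (metis frechet_derivative_at frechet_derivative_works)
qed

lemma differentiable_affine_comp:
  assumes "bounded_linear L" "f differentiable (at (a + L p))"
  shows "(\<lambda>q. f (a + L q)) differentiable (at p)"
proof -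
  have "((\<lambda>q. a + L q) has_derivative L) (at p)"
    using assms(1) by (auto intro!: derivative_eq_intros simp: bounded_linear_imp_has_derivative)
  from has_derivative_compose[OF this] assms(2) show ?thesis
    unfolding differentiable_def by blast
qed

text \<open>For an affine inner map the derivative in direction v is again such a composition, of
  the derivative of f in the fixed direction L v, so the induction closes without a general chain
  rule of order k. Slices and projections of U \<times> Z are all of this kind.\<close>

lemma Ck_on_affine_comp:
  assumes "bounded_linear L" "open T" "\<And>p. p \<in> T \<Longrightarrow> a + L p \<in> S"
  shows "Ck_on k S f \<Longrightarrow> Ck_on k T (\<lambda>p. f (a + L p))"
proof (induction k arbitrary: f)
  case 0
  have "continuous_on T (\<lambda>p. a + L p)"
    by (intro continuous_on_add continuous_on_const linear_continuous_on assms)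
  with 0 show ?case using assms(3)
    by (auto intro: continuous_on_compose2[of S f])
next
  case (Suc k)
  have "Ck_on k T (\<lambda>p. frechet_derivative (\<lambda>p. f (a + L p)) (at p) v)" for v
    using Suc assms by (subst Ck_on_cong[OF assms(2), of _ "\<lambda>p. frechet_derivative f (at (a + L p)) (L v)"])
     (auto simp: frechet_derivative_affine_comp)
  then show ?case using Suc.prems assms by (auto intro!: differentiable_affine_comp)
qed

lemma Cinf_on_affine_comp:
  assumes "bounded_linear L" "open T" "\<And>p. p \<in> T \<Longrightarrow> a + L p \<in> S" "Cinf_on S f"
  shows "Cinf_on T (\<lambda>p. f (a + L p))"
  using assms Ck_on_affine_comp unfolding Cinf_on_def by blast

section \<open>Smooth dependence of determinants and inverse matrices\<close>

lemma Cinf_on_det: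
  fixes A :: "'a::real_normed_vector \<Rightarrow> complex^'n^'n"
  assumes "open S" "\<And>i j. Cinf_on S (\<lambda>p. A p $ i $ j)"
  shows "Cinf_on S (\<lambda>p. det (A p))"
  unfolding det_def using assms by (intro Cinf_on_sum Cinf_on_mult Cinf_on_prod) auto

lemma matrix_inv_inverse:
  fixes A :: "'a::field^'n^'n"
  assumes "det A \<noteq> 0"
  shows "A ** matrix_inv A = mat 1 \<and> matrix_inv A ** A = mat 1"
  using assms unfolding invertible_det_nz[symmetric] invertible_def matrix_inv_def by (rule someI_ex)

text \<open>Cramer's rule makes each entry of the inverse a quotient of polynomials in the entries
  of A, from which smooth dependence on parameters can be read off.\<close>

lemma matrix_inv_cramer:
  fixes A :: "'a::field^'n^'n"
  assumes "det A \<noteq> 0"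
  shows "matrix_inv A $ k $ l = det (\<chi> i j. if j = k then (if i = l then 1 else 0) else A $ i $ j) / det A"
proof -
  have "A ** matrix_inv A = mat 1"
    using matrix_inv_inverse[OF assms] by blast
  then have "A *v (matrix_inv A *v axis l 1) = axis l 1"
    by (simp add: matrix_vector_mul_assoc)
  then have "matrix_inv A *v axis l 1 = (\<chi> k. det (\<chi> i j. if j = k then axis l 1 $ i else A $ i $ j) / det A)"
    unfolding cramer[OF assms] .
  then have "(matrix_inv A *v axis l 1) $ k = det (\<chi> i j. if j = k then axis l 1 $ i else A $ i $ j) / det A"
    by simp
  moreover have "axis l 1 $ i = (if i = l then 1 else (0::'a))" for i
    by (simp add: axis_def)
  ultimately show ?thesis by (simp add: matrix_vector_mult_def axis_def if_distrib cong: if_cong)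
qed

lemma Cinf_on_matrix_inv:
  fixes A :: "'a::real_normed_vector \<Rightarrow> complex^'n^'n"
  assumes "open S" "\<And>i j. Cinf_on S (\<lambda>p. A p $ i $ j)" "\<And>p. p \<in> S \<Longrightarrow> det (A p) \<noteq> 0"
  shows "Cinf_on S (\<lambda>p. matrix_inv (A p) $ k $ l)"
proof -
  have *: "Cinf_on S (\<lambda>p. (\<chi> i j. if j = k then (if i = l then 1 else 0) else A p $ i $ j) $ i $ j)" for i j
    using assms(2)[of i j] by (cases "j = k") simp_all
  have "Cinf_on S (\<lambda>p. det (\<chi> i j. if j = k then (if i = l then 1 else 0) else A p $ i $ j) / det (A p))"
    using assms by (intro Cinf_on_divide Cinf_on_det *)
  then show ?thesis
    by (subst Cinf_on_cong[OF assms(1)]) (auto simp: matrix_inv_cramer assms(3))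
qed

text \<open>Both mixed derivatives are limits of the same second difference.\<close>

lemma second_difference_mvt:
  fixes f :: "'a::real_normed_vector \<Rightarrow> real"
  assumes S: "open S" "convex S" and c: "Cinf_on S f"
    and s: "0 < s" "\<And>x y. 0 \<le> x \<Longrightarrow> x \<le> s \<Longrightarrow> 0 \<le> y \<Longrightarrow> y \<le> s \<Longrightarrow> p + x *\<^sub>R v + y *\<^sub>R w \<in> S"
  obtains x y where "0 < x" "x < s" "0 < y" "y < s"
    "f (p + s *\<^sub>R v + s *\<^sub>R w) - f (p + s *\<^sub>R v) - f (p + s *\<^sub>R w) + f p
      = s\<^sup>2 * frechet_derivative (\<lambda>q. frechet_derivative f (at q) v) (at (p + x *\<^sub>R v + y *\<^sub>R w)) w"
proof -
  have der: "((\<lambda>x. h (a + x *\<^sub>R b)) has_derivative (\<lambda>t. t * frechet_derivative h (at (a + x *\<^sub>R b)) b)) (at x)"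
    if "Cinf_on S h" "a + x *\<^sub>R b \<in> S" for h :: "'a \<Rightarrow> real" and a b x
  proof -
    have "((\<lambda>x. a + x *\<^sub>R b) has_derivative (\<lambda>t. t *\<^sub>R b)) (at x)"
      by (auto intro!: derivative_eq_intros)
    from has_derivative_compose[OF this, of h] Cinf_on_has_derivative[OF that]
    have "((\<lambda>x. h (a + x *\<^sub>R b)) has_derivative (\<lambda>t. frechet_derivative h (at (a + x *\<^sub>R b)) (t *\<^sub>R b))) (at x)" by simp
    then show ?thesis
      by (simp add: linear_cmul[OF linear_frechet_derivative[OF Cinf_on_differentiable[OF that]]])
  qed
  \<comment> \<open>\<open>F\<close> differences f in direction w and is treated by the mean value
    theorem along v; \<open>G\<close> then treats the resulting derivative along v as a function of
    the step along w.\<close>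
  define F where "F x = f ((p + s *\<^sub>R w) + x *\<^sub>R v) - f (p + x *\<^sub>R v)" for x
  have dF: "(F has_derivative (\<lambda>t. t * (frechet_derivative f (at ((p + s *\<^sub>R w) + x *\<^sub>R v)) v - frechet_derivative f (at (p + x *\<^sub>R v)) v))) (at x)"
    if "0 \<le> x" "x \<le> s" for x
  proof -
    have "(p + s *\<^sub>R w) + x *\<^sub>R v \<in> S" "p + x *\<^sub>R v \<in> S"
      using s(1) s(2)[of x s] s(2)[of x 0] that by (simp_all add: add_ac)
    from has_derivative_diff[OF der[OF c this(1)] der[OF c this(2)]] show ?thesis
      unfolding F_def by (simp add: right_diff_distrib)
  qed
  obtain x where x: "0 < x" "x < s" "F s - F 0 = s * (frechet_derivative f (at ((p + s *\<^sub>R w) + x *\<^sub>R v)) v - frechet_derivative f (at (p + x *\<^sub>R v)) v)"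
    using mvt_simple[OF s(1), of F, OF has_derivative_at_withinI[OF dF]] by auto
  define G where "G y = frechet_derivative f (at ((p + x *\<^sub>R v) + y *\<^sub>R w)) v" for y
  have dG: "(G has_derivative (\<lambda>t. t * frechet_derivative (\<lambda>q. frechet_derivative f (at q) v) (at ((p + x *\<^sub>R v) + y *\<^sub>R w)) w)) (at y)"
    if "0 \<le> y" "y \<le> s" for y
    unfolding G_def using s(2)[of x y] that x by (intro der Cinf_on_dir c) auto
  obtain y where y: "0 < y" "y < s" "G s - G 0 = s * frechet_derivative (\<lambda>q. frechet_derivative f (at q) v) (at ((p + x *\<^sub>R v) + y *\<^sub>R w)) w"
    using mvt_simple[OF s(1), of G, OF has_derivative_at_withinI[OF dG]] by auto
  show ?thesis
    using that[OF x(1,2) y(1,2)] x(3) y(3) unfolding F_def G_def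
    by (simp add: power2_eq_square algebra_simps)
qed

lemma mixed_derivative_commute_real:
  fixes f :: "'a::real_normed_vector \<Rightarrow> real"
  assumes S: "open S" and c: "Cinf_on S f" and p: "p \<in> S"
  shows "frechet_derivative (\<lambda>q. frechet_derivative f (at q) v) (at p) w
       = frechet_derivative (\<lambda>q. frechet_derivative f (at q) w) (at p) v"
proof -
  let ?D = "\<lambda>v w q. frechet_derivative (\<lambda>q. frechet_derivative f (at q) v) (at q) w"
  obtain r where r: "0 < r" "ball p r \<subseteq> S" using S p open_contains_ball by blast
  have cb: "Cinf_on (ball p r) f" using c r(2) Cinf_on_subset by blast
  define M where "M = 1 + norm v + norm w"
  have M: "M > 0" "norm v \<le> M" "norm w \<le> M" "norm v + norm w \<le> M" by (auto simp: M_def add_pos_nonneg)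
  have inb: "dist (p + x *\<^sub>R v + y *\<^sub>R w) p \<le> e * M" if "0 \<le> x" "x \<le> e" "0 \<le> y" "y \<le> e" for x y e
  proof -
    have "dist (p + x *\<^sub>R v + y *\<^sub>R w) p \<le> x * norm v + y * norm w"
      using that by (simp add: dist_norm algebra_simps) (metis abs_of_nonneg norm_scaleR norm_triangle_ineq)
    also have "\<dots> \<le> e * norm v + e * norm w" using that by (intro add_mono mult_right_mono) auto
    also have "\<dots> \<le> e * M" using M(4) that by (metis distrib_left mult_left_mono order_trans)
    finally show ?thesis .
  qed
  have close: "\<bar>?D v w p - ?D w v p\<bar> \<le> e" if e: "e > 0" for e
  proof -
    have ct: "isCont (?D v w) p" "isCont (?D w v) p"
      using Cinf_on_continuous[OF Cinf_on_dir[OF Cinf_on_dir[OF c]]] S p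
      by (auto simp: continuous_on_eq_continuous_at)
    obtain d1 where d1: "d1 > 0" "\<And>q. dist q p < d1 \<Longrightarrow> dist (?D v w q) (?D v w p) < e/2"
      using ct(1) e unfolding continuous_at_eps_delta by (metis half_gt_zero)
    obtain d2 where d2: "d2 > 0" "\<And>q. dist q p < d2 \<Longrightarrow> dist (?D w v q) (?D w v p) < e/2"
      using ct(2) e unfolding continuous_at_eps_delta by (metis half_gt_zero)
    \<comment> \<open>Every point of the parallelogram is within s * M of p; the factor 2 makes this
      bound strictly smaller than all three radii.\<close>
    define s where "s = min r (min d1 d2) / (2 * M)"
    have s: "s > 0" "s * M < r" "s * M < d1" "s * M < d2"
      using r(1) d1(1) d2(1) M(1) by (auto simp: s_def field_simps min_def)
    have in1: "p + x *\<^sub>R v + y *\<^sub>R w \<in> ball p r" if "0 \<le> x" "x \<le> s" "0 \<le> y" "y \<le> s" for x y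
      using inb[OF that] s(2) by (simp add: dist_commute)
    have in2: "p + x *\<^sub>R w + y *\<^sub>R v \<in> ball p r" if "0 \<le> x" "x \<le> s" "0 \<le> y" "y \<le> s" for x y
      using in1[OF that(3,4,1,2)] by (simp add: add_ac)
    obtain x y where xy: "0 < x" "x < s" "0 < y" "y < s"
      "f (p + s *\<^sub>R v + s *\<^sub>R w) - f (p + s *\<^sub>R v) - f (p + s *\<^sub>R w) + f p = s\<^sup>2 * ?D v w (p + x *\<^sub>R v + y *\<^sub>R w)"
      using second_difference_mvt[OF _ _ cb s(1) in1] by auto
    obtain x' y' where xy': "0 < x'" "x' < s" "0 < y'" "y' < s"
      "f (p + s *\<^sub>R w + s *\<^sub>R v) - f (p + s *\<^sub>R w) - f (p + s *\<^sub>R v) + f p = s\<^sup>2 * ?D w v (p + x' *\<^sub>R w + y' *\<^sub>R v)"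
      using second_difference_mvt[OF _ _ cb s(1) in2] by auto
    have "s\<^sup>2 * ?D v w (p + x *\<^sub>R v + y *\<^sub>R w) = s\<^sup>2 * ?D w v (p + x' *\<^sub>R w + y' *\<^sub>R v)"
      using xy(5) xy'(5) by (simp add: algebra_simps)
    then have eq: "?D v w (p + x *\<^sub>R v + y *\<^sub>R w) = ?D w v (p + x' *\<^sub>R w + y' *\<^sub>R v)" using s(1) by simp
    have "dist (?D v w (p + x *\<^sub>R v + y *\<^sub>R w)) (?D v w p) < e/2"
      using inb[of x s y] xy s by (intro d1(2)) auto
    moreover have "dist (?D w v (p + x' *\<^sub>R w + y' *\<^sub>R v)) (?D w v p) < e/2"
      using inb[of y' s x'] xy' s by (intro d2(2)) (auto simp: add_ac)
    ultimately show ?thesis using eq unfolding dist_real_def by linarith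
  qed
  show ?thesis using close field_le_epsilon[of "\<bar>?D v w p - ?D w v p\<bar>" 0] by auto
qed

text \<open>The mean value theorem behind the real case has no complex version. A bounded linear map
  to the reals commutes with differentiation, and the real and imaginary parts together determine
  the value.\<close>

lemma mixed_derivative_commute:
  fixes f :: "'a::real_normed_vector \<Rightarrow> complex"
  assumes S: "open S" and c: "Cinf_on S f" and p: "p \<in> S"
  shows "frechet_derivative (\<lambda>q. frechet_derivative f (at q) v) (at p) w
       = frechet_derivative (\<lambda>q. frechet_derivative f (at q) w) (at p) v"
proof -
  have *: "L (frechet_derivative (\<lambda>q. frechet_derivative f (at q) v) (at p) w)
       = L (frechet_derivative (\<lambda>q. frechet_derivative f (at q) w) (at p) v)"
    if L: "bounded_linear L" for L :: "complex \<Rightarrow> real"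
  proof -
    have "L (frechet_derivative (\<lambda>q. frechet_derivative f (at q) v) (at p) w) =
       frechet_derivative (\<lambda>q. frechet_derivative (\<lambda>q. L (f q)) (at q) v) (at p) w" for v w
    proof -
      have "L (frechet_derivative (\<lambda>q. frechet_derivative f (at q) v) (at p) w)
        = frechet_derivative (\<lambda>q. L (frechet_derivative f (at q) v)) (at p) w"
        using Cinf_on_differentiable[OF Cinf_on_dir[OF c] p]
        by (simp add: frechet_derivative_bounded_linear_comp[OF L])
      also have "\<dots> = frechet_derivative (\<lambda>q. frechet_derivative (\<lambda>q. L (f q)) (at q) v) (at p) w"
        using Cinf_on_differentiable[OF c]
        by (subst frechet_derivative_cong_open[OF S p, of _ "\<lambda>q. frechet_derivative (\<lambda>q. L (f q)) (at q) v"])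
          (auto simp: frechet_derivative_bounded_linear_comp[OF L])
      finally show ?thesis .
    qed
    then show ?thesis
      using mixed_derivative_commute_real[OF S Cinf_on_bounded_linear[OF S L c] p] by simp
  qed
  show ?thesis
    using *[OF bounded_linear_Re] *[OF bounded_linear_Im] by (simp add: complex_eq_iff)
qed

section \<open>Wirtinger derivatives\<close>

text \<open>Both Wirtinger derivatives at once: \<open>\<kappa> = - \<i>\<close> gives \<^const>\<open>wirtinger\<close> and \<open>\<kappa> = \<i>\<close> gives
  \<^const>\<open>wirtinger_bar\<close>.\<close>

definition dop :: "complex \<Rightarrow> 'a::real_normed_vector \<Rightarrow> 'a \<Rightarrow> ('a \<Rightarrow> complex) \<Rightarrow> 'a \<Rightarrow> complex" where
  "dop \<kappa> v w f p = (frechet_derivative f (at p) v + \<kappa> * frechet_derivative f (at p) w) / 2"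

lemma wirtinger_eq_dop: "wirtinger v w = dop (- \<i>) v w"
  by (auto simp: fun_eq_iff wirtinger_def dop_def)

lemma wirtinger_bar_eq_dop: "wirtinger_bar v w = dop \<i> v w"
  by (auto simp: fun_eq_iff wirtinger_bar_def dop_def)

lemma dop_cong:
  "open S \<Longrightarrow> p \<in> S \<Longrightarrow> (\<And>q. q \<in> S \<Longrightarrow> f q = g q) \<Longrightarrow> dop \<kappa> v w f p = dop \<kappa> v w g p"
  unfolding dop_def using frechet_derivative_cong_open[of S p f g] by simp

lemma dop_const [simp]: "dop \<kappa> v w (\<lambda>_. c) p = 0"
  by (simp add: dop_def)

lemma dop_add:
  "f differentiable (at p) \<Longrightarrow> g differentiable (at p) \<Longrightarrow>
    dop \<kappa> v w (\<lambda>q. f q + g q) p = dop \<kappa> v w f p + dop \<kappa> v w g p"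
  by (simp add: dop_def frechet_derivative_add add_divide_distrib algebra_simps)

lemma dop_mult:
  "f differentiable (at p) \<Longrightarrow> g differentiable (at p) \<Longrightarrow>
    dop \<kappa> v w (\<lambda>q. f q * g q) p = f p * dop \<kappa> v w g p + dop \<kappa> v w f p * g p"
  by (simp add: dop_def frechet_derivative_mult add_divide_distrib algebra_simps)

lemma dop_cmult:
  "f differentiable (at p) \<Longrightarrow> dop \<kappa> v w (\<lambda>q. c * f q) p = c * dop \<kappa> v w f p"
  by (simp add: dop_mult)

lemma dop_minus:
  "f differentiable (at p) \<Longrightarrow> dop \<kappa> v w (\<lambda>q. - f q) p = - dop \<kappa> v w f p"
  using dop_cmult[of f p \<kappa> v w "-1"] by simp

lemma dop_diff:
  "f differentiable (at p) \<Longrightarrow> g differentiable (at p) \<Longrightarrow>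
    dop \<kappa> v w (\<lambda>q. f q - g q) p = dop \<kappa> v w f p - dop \<kappa> v w g p"
  using dop_add[of f p "\<lambda>q. - g q"] by (simp add: dop_minus)

lemma dop_sum:
  "finite I \<Longrightarrow> (\<And>i. i \<in> I \<Longrightarrow> f i differentiable (at p)) \<Longrightarrow>
    dop \<kappa> v w (\<lambda>q. \<Sum>i\<in>I. f i q) p = (\<Sum>i\<in>I. dop \<kappa> v w (f i) p)"
  by (induction I rule: finite_induct) (auto simp: dop_add)

lemma differentiable_cnj: "f differentiable (at p) \<Longrightarrow> (\<lambda>q. cnj (f q)) differentiable (at p)"
  unfolding differentiable_def using bounded_linear.has_derivative[OF bounded_linear_cnj, of f _ "at p"] by blast

text \<open>Conjugation exchanges the two Wirtinger derivatives, because it sends the parameter \<i>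
  to - \<i>.\<close>

lemma dop_cnj:
  "f differentiable (at p) \<Longrightarrow> dop \<kappa> v w (\<lambda>q. cnj (f q)) p = cnj (dop (cnj \<kappa>) v w f p)"
  by (simp add: dop_def frechet_derivative_bounded_linear_comp[OF bounded_linear_cnj])

lemma has_derivative_exp_comp:
  fixes f :: "'a::real_normed_vector \<Rightarrow> complex"
  assumes "f differentiable (at p)"
  shows "((\<lambda>p. exp (f p)) has_derivative (\<lambda>v. exp (f p) * frechet_derivative f (at p) v)) (at p)"
  using has_derivative_compose[of f "frechet_derivative f (at p)" p UNIV exp "\<lambda>x. exp (f p) * x"]
    assms DERIV_exp[of "f p"]
  by (auto simp: frechet_derivative_works[symmetric] has_field_derivative_def)

lemma dop_exp:
  "f differentiable (at p) \<Longrightarrow> dop \<kappa> v w (\<lambda>q. exp (f q)) p = exp (f p) * dop \<kappa> v w f p"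
  by (simp add: dop_def frechet_derivative_at[OF has_derivative_exp_comp, symmetric] algebra_simps)

lemma dop_affine:
  "bounded_linear L \<Longrightarrow> f differentiable (at (a + L p)) \<Longrightarrow>
    dop \<kappa> v w (\<lambda>q. f (a + L q)) p = dop \<kappa> (L v) (L w) f (a + L p)"
  by (simp add: dop_def frechet_derivative_affine_comp)

lemma Cinf_on_dop: "open S \<Longrightarrow> Cinf_on S f \<Longrightarrow> Cinf_on S (dop \<kappa> v w f)"
  unfolding dop_def[abs_def]
  by (intro Cinf_on_divide Cinf_on_add Cinf_on_mult Cinf_on_const Cinf_on_dir) auto

lemma dop_commute:
  assumes "open S" "Cinf_on S f" "p \<in> S"
  shows "dop \<kappa> v w (dop \<mu> x y f) p = dop \<mu> x y (dop \<kappa> v w f) p"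
proof -
  have d: "(\<lambda>q. frechet_derivative f (at q) x) differentiable (at p)" for x
    using Cinf_on_differentiable[OF Cinf_on_dir[OF assms(2)] assms(3)] .
  have *: "frechet_derivative (dop \<mu> x y f) (at p) v =
     (frechet_derivative (\<lambda>q. frechet_derivative f (at q) x) (at p) v
       + \<mu> * frechet_derivative (\<lambda>q. frechet_derivative f (at q) y) (at p) v) / 2" for \<mu> x y v
  proof -
    have "frechet_derivative (dop \<mu> x y f) (at p) =
      (\<lambda>v. frechet_derivative (\<lambda>q. frechet_derivative f (at q) x + \<mu> * frechet_derivative f (at q) y) (at p) v / 2)"
      unfolding dop_def[abs_def]
      by (rule frechet_derivative_bounded_linear_comp[OF bounded_linear_divide]) (intro differentiable_add differentiable_mult differentiable_const d)
    then show ?thesis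
      using d by (simp add: frechet_derivative_add frechet_derivative_mult)
  qed
  show ?thesis
    unfolding dop_def[of \<kappa> v w "dop \<mu> x y f"] dop_def[of \<mu> x y "dop \<kappa> v w f"] *
    using mixed_derivative_commute[OF assms, of x v] mixed_derivative_commute[OF assms, of x w]
      mixed_derivative_commute[OF assms, of y v] mixed_derivative_commute[OF assms, of y w]
    by (simp add: field_simps)
qed

section \<open>Holomorphic functions of several variables\<close>

abbreviation dz :: "'n::finite \<Rightarrow> (complex^'n \<Rightarrow> complex) \<Rightarrow> complex^'n \<Rightarrow> complex" where
  "dz j \<equiv> dop (- \<i>) (axis j 1) (axis j \<i>)"

abbreviation dzb :: "'n::finite \<Rightarrow> (complex^'n \<Rightarrow> complex) \<Rightarrow> complex^'n \<Rightarrow> complex" where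
  "dzb j \<equiv> dop \<i> (axis j 1) (axis j \<i>)"

lemma several_holomorphic_on_has_derivative:
  "several_holomorphic_on f S \<Longrightarrow> p \<in> S \<Longrightarrow> (f has_derivative frechet_derivative f (at p)) (at p)"
  unfolding several_holomorphic_on_def using differentiableI frechet_derivative_works by blast

lemma several_holomorphic_on_derivative_scale:
  assumes "several_holomorphic_on f S" "p \<in> S"
  shows "frechet_derivative f (at p) (c *s v) = c * frechet_derivative f (at p) v"
  using assms unfolding several_holomorphic_on_def by (metis frechet_derivative_at)

lemma several_holomorphic_on_subset:
  "several_holomorphic_on f S \<Longrightarrow> T \<subseteq> S \<Longrightarrow> several_holomorphic_on f T"
  unfolding several_holomorphic_on_def by blast

lemma several_holomorphic_on_continuous:
  "several_holomorphic_on f S \<Longrightarrow> continuous_on S f"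
  unfolding several_holomorphic_on_def
  by (meson continuous_at_imp_continuous_on has_derivative_continuous)

lemma axis_i: "axis j (c::complex) = c *s axis j 1"
  by (vector axis_def) 

lemma bounded_linear_vector_scalar: "bounded_linear (\<lambda>c::complex. c *s (e::complex^'n))"
proof (rule linear_conv_bounded_linear[THEN iffD1], rule linearI)
qed (simp_all add: vec_eq_iff algebra_simps)

lemma several_holomorphic_line:
  assumes "several_holomorphic_on f S" "p + z *s e \<in> S"
  shows "((\<lambda>z. f (p + z *s e)) has_field_derivative frechet_derivative f (at (p + z *s e)) e) (at z)"
proof -
  have "((\<lambda>z. p + z *s e) has_derivative (\<lambda>z. z *s e)) (at z)"
    by (auto intro!: derivative_eq_intros bounded_linear_imp_has_derivative bounded_linear_vector_scalar)
  from has_derivative_compose[OF this several_holomorphic_on_has_derivative[OF assms]]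
  show ?thesis
    by (simp add: has_field_derivative_def several_holomorphic_on_derivative_scale[OF assms] mult_commute_abs)
qed

text \<open>Cauchy's formula for the derivative at 0 of the slice z \<mapsto> f (p + z e). The
  circle does not move with p, so the right-hand side can be differentiated in p under the integral
  sign; this is how regularity of derivatives is gained from mere pointwise
  differentiability.\<close>

lemma circle_integral_derivative:
  assumes "several_holomorphic_on f S" "r > 0" "\<And>z. norm z \<le> r \<Longrightarrow> p + z *s e \<in> S" "open S"
  shows "frechet_derivative f (at p) e =
    integral {0..1} (\<lambda>x. f (p + (of_real r * exp (2 * of_real pi * \<i> * of_real x)) *s e) / (of_real r * exp (2 * of_real pi * \<i> * of_real x)))"
proof -
  define h where "h z = f (p + z *s e)" for z
  have "h holomorphic_on {z. p + z *s e \<in> S}"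
    unfolding holomorphic_on_def h_def field_differentiable_def
    using several_holomorphic_line[OF assms(1)] has_field_derivative_at_within by blast
  then have h: "h holomorphic_on cball 0 r"
    by (rule holomorphic_on_subset) (use assms(3) in \<open>auto simp: dist_norm\<close>)
  have "(h has_field_derivative (1 / (2 * of_real pi * \<i>) * contour_integral (circlepath 0 r) (\<lambda>u. h u / (u - 0)^2))) (at 0)"
    using Cauchy_derivative_integral_circlepath(2)[of 0 r h 0, OF holomorphic_on_imp_continuous_on[OF h]
        holomorphic_on_subset[OF h ball_subset_cball]] assms(2) by simp
  moreover have "(h has_field_derivative frechet_derivative f (at p) e) (at 0)"
    using several_holomorphic_line[OF assms(1), of p 0 e] assms(3)[of 0] assms(2) unfolding h_def by simp
  ultimately have "frechet_derivative f (at p) e = 1 / (2 * of_real pi * \<i>) * contour_integral (circlepath 0 r) (\<lambda>u. h u / (u - 0)^2)"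
    by (rule DERIV_unique[symmetric])
  also have "contour_integral (circlepath 0 r) (\<lambda>u. h u / (u - 0)^2) =
     integral {0..1} (\<lambda>x. (2 * of_real pi * \<i>) * (h (of_real r * exp (2 * of_real pi * \<i> * of_real x)) / (of_real r * exp (2 * of_real pi * \<i> * of_real x))))"
    unfolding contour_integral_integral vector_derivative_circlepath
    using assms(2)
    by (intro integral_cong) (simp add: circlepath power2_eq_square field_simps)
  finally show ?thesis unfolding integral_mult_right h_def by simp
qed

text \<open>One radius has to serve all base points near p, since the formula is used as an identity
  between functions of the base point.\<close>

lemma circle_integral_domain:
  fixes e :: "complex^'n"
  assumes "open S" "p \<in> S"
  obtains r where "r > 0" "\<And>q z. q \<in> ball p r \<Longrightarrow> norm z \<le> r \<Longrightarrow> q + z *s e \<in> S"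
proof -
  obtain R where R: "R > 0" "ball p R \<subseteq> S" using assms open_contains_ball by blast
  obtain B where B: "B > 0" "\<And>z. norm (z *s e) \<le> norm z * B"
    using bounded_linear.pos_bounded[OF bounded_linear_vector_scalar[of e]] by blast
  \<comment> \<open>Moving the base point costs at most r and the circle at most r * B; the 2 in the
    denominator leaves the sum below R.\<close>
  define r where "r = R / (2 + B)"
  have "r > 0" "r * (2 + B) = R" using R(1) B(1) by (auto simp: r_def)
  then have r: "r > 0" "r + r * B < R" by (simp_all add: distrib_left)
  show ?thesis
  proof (rule that[OF r(1)])
    fix q z assume z: "q \<in> ball p r" "norm (z::complex) \<le> r"
    then have "norm z * B \<le> r * B" using B(1) by (intro mult_right_mono) auto
    with z have "dist p (q + z *s e) < r + r * B"
      using B(2)[of z] dist_triangle[of p "q + z *s e" q] by (simp add: dist_norm)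
    then show "q + z *s e \<in> S" using R(2) r(2) by auto
  qed
qed

lemma continuous_circle [continuous_intros]:
  "continuous_on A f \<Longrightarrow> continuous_on A (\<lambda>x. f x *s (e::complex^'n))"
  using bounded_linear.continuous_on[OF bounded_linear_vector_scalar] by blast

text \<open>Continuity of the derivative is no part of \<open>several_holomorphic_on\<close>. It is
  obtained first, because the Leibniz rule in the next lemma asks for a continuous derivative of the
  integrand.\<close>

lemma several_holomorphic_derivative_continuous:
  fixes f :: "complex^'n \<Rightarrow> complex"
  assumes f: "several_holomorphic_on f S" and S: "open S"
  shows "continuous_on S (\<lambda>p. frechet_derivative f (at p) e)"
proof (rule continuous_at_imp_continuous_on, rule ballI)
  fix p assume "p \<in> S"
  obtain r where r: "r > 0" "\<And>q z. q \<in> ball p r \<Longrightarrow> norm z \<le> r \<Longrightarrow> q + z *s e \<in> S"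
    using circle_integral_domain[OF S \<open>p \<in> S\<close>] by metis
  define E where "E x = of_real r * exp (2 * of_real pi * \<i> * of_real x)" for x
  have E: "norm (E x) = r" for x using r(1) by (simp add: E_def norm_mult)
  have [continuous_intros]: "continuous_on A (\<lambda>x. E (g x))" if "continuous_on A g" for A and g :: "(complex^'n) \<times> real \<Rightarrow> real"
    unfolding E_def using that by (auto intro!: continuous_intros)
  have "continuous_on (ball p r \<times> cbox 0 1) (\<lambda>(q, x). f (q + E x *s e) / E x)"
    unfolding split_beta
    using E r by (intro continuous_on_divide continuous_on_compose2[OF several_holomorphic_on_continuous[OF f]] continuous_intros) (auto, metis norm_zero less_irrefl)
  from integral_continuous_on_param[OF this]
  have "continuous_on (ball p r) (\<lambda>q. integral {0..1} (\<lambda>x. f (q + E x *s e) / E x))" by simp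
  moreover have "integral {0..1} (\<lambda>x. f (q + E x *s e) / E x) = frechet_derivative f (at q) e" if "q \<in> ball p r" for q
    using circle_integral_derivative[OF f r(1) r(2)[OF that] S] by (simp add: E_def)
  ultimately have "continuous_on (ball p r) (\<lambda>p. frechet_derivative f (at p) e)"
    by (metis (no_types, lifting) continuous_on_cong)
  then show "isCont (\<lambda>p. frechet_derivative f (at p) e) p"
    using r(1) by (simp add: continuous_on_eq_continuous_at)
qed

text \<open>The Cauchy integral is differentiated under the integral sign, and complex linearity of
  the new derivative is inherited from the integrand. Iteration makes holomorphic functions
  smooth.\<close>

lemma several_holomorphic_derivative:
  fixes f :: "complex^'n \<Rightarrow> complex"
  assumes f: "several_holomorphic_on f S" and S: "open S"
  shows "several_holomorphic_on (\<lambda>p. frechet_derivative f (at p) e) S"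
  unfolding several_holomorphic_on_def
proof (rule ballI)
  fix p assume "p \<in> S"
  obtain r where r: "r > 0" "\<And>q z. q \<in> ball p r \<Longrightarrow> norm z \<le> r \<Longrightarrow> q + z *s e \<in> S"
    using circle_integral_domain[OF S \<open>p \<in> S\<close>] by metis
  define E where "E x = of_real r * exp (2 * of_real pi * \<i> * of_real x)" for x
  have E: "norm (E x) = r" for x using r(1) by (simp add: E_def norm_mult)
  then have E0: "E x \<noteq> 0" for x using r(1) by (metis norm_zero less_irrefl)
  have contE: "continuous_on A (\<lambda>x. E (g x))" if "continuous_on A g" for A and g :: "(complex^'n) \<times> real \<Rightarrow> real"
    unfolding E_def using that by (auto intro!: continuous_intros)
  \<comment> \<open>The Leibniz rule takes derivatives as points of a space of bounded operators; in
    finite dimensions continuity there can be tested on each direction.\<close>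
  define F where "F q = Blinfun (frechet_derivative f (at q))" for q
  have F: "blinfun_apply (F q) = frechet_derivative f (at q)" if "q \<in> S" for q
    unfolding F_def using several_holomorphic_on_has_derivative[OF f that]
    by (intro bounded_linear_Blinfun_apply has_derivative_bounded_linear)
  have contF: "continuous_on S F"
  proof (rule continuous_on_blinfun_componentwise)
    fix i :: "complex^'n"
    show "continuous_on S (\<lambda>x. blinfun_apply (F x) i)"
      using several_holomorphic_derivative_continuous[OF f S, of i] by (rule continuous_on_eq) (simp add: F)
  qed
  define fx where "fx q x = blinfun_mult_right (1 / E x) o\<^sub>L F (q + E x *s e)" for q x
  have inS: "q + E x *s e \<in> S" if "q \<in> ball p r" for q x using r(2)[OF that, of "E x"] E by simp
  have fxa: "blinfun_apply (fx q x) v = frechet_derivative f (at (q + E x *s e)) v / E x" if "q \<in> ball p r" for q x v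
    by (simp add: fx_def F[OF inS[OF that]])
  have "((\<lambda>q. integral (cbox 0 1) (\<lambda>x. f (q + E x *s e) / E x)) has_derivative integral (cbox 0 1) (fx p)) (at p within ball p r)"
  proof (rule leibniz_rule)
    fix q x assume q: "q \<in> ball p r"
    have "((\<lambda>q. q + E x *s e) has_derivative (\<lambda>v. v)) (at q)" by (auto intro!: derivative_eq_intros)
    from has_derivative_compose[OF this several_holomorphic_on_has_derivative[OF f inS[OF q]]]
    have "((\<lambda>q. f (q + E x *s e)) has_derivative frechet_derivative f (at (q + E x *s e))) (at q)" .
    from bounded_linear.has_derivative[OF bounded_linear_divide this, of "E x"]
    show "((\<lambda>q. f (q + E x *s e) / E x) has_derivative blinfun_apply (fx q x)) (at q within ball p r)"
      unfolding fxa[OF q, abs_def] by (rule has_derivative_at_withinI)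
  next
    fix q assume q: "q \<in> ball p r"
    have "continuous_on (cbox 0 1) (\<lambda>x. f (q + E x *s e) / E x)"
      using inS[OF q] E0 unfolding E_def
      by (intro continuous_on_divide continuous_on_compose2[OF several_holomorphic_on_continuous[OF f]] continuous_intros) auto
    then show "(\<lambda>x. f (q + E x *s e) / E x) integrable_on cbox 0 1" by (rule integrable_continuous)
  next
    have 1: "continuous_on (ball p r \<times> cbox (0::real) 1) (\<lambda>y. F (fst y + E (snd y) *s e))"
      using inS by (intro continuous_on_compose2[OF contF] continuous_intros contE) auto
    have 2: "continuous_on (ball p r \<times> cbox (0::real) 1) (\<lambda>y. blinfun_mult_right (1 / E (snd y)))"
      using E0 by (intro bounded_linear.continuous_on[OF bounded_linear_blinfun_mult_right] continuous_intros contE) auto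
    show "continuous_on (ball p r \<times> cbox 0 1) (\<lambda>(x, t). fx x t)"
      unfolding fx_def split_beta
      by (intro bounded_bilinear.continuous_on[OF bounded_bilinear_blinfun_compose] 1 2)
  qed (use r in auto)
  then have d: "((\<lambda>q. integral {0..1} (\<lambda>x. f (q + E x *s e) / E x)) has_derivative integral {0..1} (fx p)) (at p)"
    using r(1) by (simp add: at_within_open[of p "ball p r"])
  have eq: "integral {0..1} (\<lambda>x. f (q + E x *s e) / E x) = frechet_derivative f (at q) e" if "q \<in> ball p r" for q
    using circle_integral_derivative[OF f r(1) r(2)[OF that] S] by (simp add: E_def)
  have d': "((\<lambda>q. frechet_derivative f (at q) e) has_derivative blinfun_apply (integral {0..1} (fx p))) (at p)"
    using has_derivative_transform_within_open[OF d, of "ball p r"] r(1) eq by auto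
  have "continuous_on (cbox (0::real) 1) (\<lambda>x. F (p + E x *s e))"
    using inS r(1) unfolding E_def by (intro continuous_on_compose2[OF contF] continuous_intros) auto
  moreover have "continuous_on (cbox (0::real) 1) (\<lambda>x. blinfun_mult_right (1 / E x))"
    using E0 unfolding E_def by (intro bounded_linear.continuous_on[OF bounded_linear_blinfun_mult_right] continuous_intros) auto
  ultimately have "continuous_on (cbox 0 1) (fx p)" unfolding fx_def[abs_def]
    by (intro bounded_bilinear.continuous_on[OF bounded_bilinear_blinfun_compose])
  then have int: "fx p integrable_on {0..1}" using integrable_continuous[of 0 1 "fx p"] by simp
  have p: "p \<in> ball p r" using r by simp
  have "blinfun_apply (integral {0..1} (fx p)) (c *s v) = c * blinfun_apply (integral {0..1} (fx p)) v" for c v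
    unfolding blinfun_apply_integral[OF int] fxa[OF p] several_holomorphic_on_derivative_scale[OF f inS[OF p]]
      times_divide_eq_right[symmetric] by (rule integral_mult_right)
  then show "\<exists>f'. ((\<lambda>p. frechet_derivative f (at p) e) has_derivative f') (at p) \<and> (\<forall>c v. f' (c *s v) = c * f' v)"
    using d' by blast
qed

lemma several_holomorphic_Ck_on:
  assumes "open S"
  shows "several_holomorphic_on f S \<Longrightarrow> Ck_on k S f"
proof (induction k arbitrary: f)
  case 0
  then show ?case by (simp add: several_holomorphic_on_continuous)
next
  case (Suc k)
  then show ?case using several_holomorphic_derivative[OF Suc.prems assms] Suc.IH
    by (auto intro: differentiableI several_holomorphic_on_has_derivative)
qed

lemma several_holomorphic_Cinf_on: "open S \<Longrightarrow> several_holomorphic_on f S \<Longrightarrow> Cinf_on S f"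
  unfolding Cinf_on_def using several_holomorphic_Ck_on by blast

lemma several_holomorphic_dzb:
  assumes "several_holomorphic_on f S" "p \<in> S"
  shows "dzb j f p = 0"
  unfolding dop_def axis_i[of j \<i>] several_holomorphic_on_derivative_scale[OF assms]
  by (simp add: mult.assoc[symmetric])

lemma several_holomorphic_dz:
  assumes "several_holomorphic_on f S" "p \<in> S"
  shows "dz j f p = frechet_derivative f (at p) (axis j 1)"
  unfolding dop_def axis_i[of j \<i>] several_holomorphic_on_derivative_scale[OF assms]
  by (simp add: mult.assoc[symmetric])

section \<open>Determinants\<close>

text \<open>Complex coordinate space identified with a real one, whose index type is well-ordered as the
  change-of-variables theorems require.\<close>

definition ridx :: "'n::finite \<times> bool \<Rightarrow> 'n bit0" where "ridx = (SOME f. bij f)"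

lemma bij_ridx: "bij (ridx :: 'n::finite \<times> bool \<Rightarrow> 'n bit0)"
proof -
  have "card (UNIV :: ('n \<times> bool) set) = card (UNIV :: 'n bit0 set)"
    by (simp add: card_cartesian_product flip: UNIV_Times_UNIV)
  then obtain f :: "'n \<times> bool \<Rightarrow> 'n bit0" where "bij f"
    using finite_same_card_bij[of "UNIV :: ('n \<times> bool) set" "UNIV :: 'n bit0 set"] by auto
  then show ?thesis unfolding ridx_def by (rule someI[of bij f])
qed

lemma ridx_eq [simp]: "ridx x = ridx y \<longleftrightarrow> x = y"
  using bij_ridx by (metis bij_pointE)

lemma ridx_cases: obtains j b where "k = ridx (j, b)"
  using bij_ridx by (metis bij_pointE surj_pair)

lemma inv_ridx [simp]: "inv ridx (ridx x) = x"
  by (rule inv_f_f[OF bij_is_inj[OF bij_ridx]])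

definition creal :: "complex^'n \<Rightarrow> real^('n::finite bit0)" where
  "creal z = (\<chi> k. (if snd (inv ridx k) then Im else Re) (z $ fst (inv ridx k)))"

definition rcomplex :: "real^('n::finite bit0) \<Rightarrow> complex^'n" where
  "rcomplex v = (\<chi> j. Complex (v $ ridx (j, False)) (v $ ridx (j, True)))"

lemma creal_nth [simp]: "creal z $ ridx (j, b) = (if b then Im (z $ j) else Re (z $ j))"
  by (simp add: creal_def)

lemma vec_eq_ridx: "v = w \<longleftrightarrow> (\<forall>j b. v $ ridx (j, b) = w $ ridx (j, b))"
  unfolding vec_eq_iff by (metis ridx_cases)

lemma rcomplex_creal [simp]: "rcomplex (creal z) = z"
  by (simp add: rcomplex_def vec_eq_iff)

lemma creal_rcomplex [simp]: "creal (rcomplex v) = v"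
  by (simp add: vec_eq_ridx rcomplex_def)

lemma linear_creal: "linear creal"
  by (rule linearI) (simp_all add: vec_eq_ridx)

lemma linear_rcomplex: "linear rcomplex"
  by (rule linearI) (simp_all add: vec_eq_iff rcomplex_def complex_eq_iff)

lemma linear_mult_vec: "linear ((*v) (A :: complex^'n^'m))"
  by (rule linearI) (simp_all add: vec_eq_iff matrix_vector_mult_def scaleR_sum_right distrib_left sum.distrib)

definition rmat :: "complex^'n^'n \<Rightarrow> real^('n::finite bit0)^('n bit0)" where
  "rmat A = matrix (creal \<circ> (*v) A \<circ> rcomplex)"

lemma linear_rmat_fun: "linear (creal \<circ> (*v) (A :: complex^'n^'n) \<circ> rcomplex)"
  by (intro linear_compose linear_creal linear_rcomplex linear_mult_vec)

lemma rmat_vec: "rmat A *v v = creal (A *v rcomplex v)"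
  unfolding rmat_def using fun_cong[OF matrix_vector_mul(2)[OF linear_rmat_fun[of A]], of v] by simp

lemma rmat_mult: "rmat (A ** B) = rmat A ** rmat B"
proof -
  have "rmat (A ** B) *v v = (rmat A ** rmat B) *v v" for v
    by (simp add: rmat_vec matrix_vector_mul_assoc[symmetric])
  then show ?thesis by (simp add: matrix_eq)
qed

lemma rmat_1: "rmat (mat 1) = mat 1"
  by (simp add: matrix_eq rmat_vec)

text \<open>The elementary factors that Gaussian elimination splits off in
  \<open>det_rmat_aux\<close>.\<close>

definition colmat :: "'n \<Rightarrow> 'a::zero_neq_one^'n \<Rightarrow> 'a^'n^'n::finite" where
  "colmat k a = (\<chi> i j. if j = k then a $ i else if i = j then 1 else 0)"

lemma det_colmat: "det (colmat k a :: 'a::field^'n^'n) = a $ k"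
proof -
  have "colmat k a = (\<chi> i j. if j = k then (mat 1 *v a) $ i else mat 1 $ i $ j)"
    unfolding matrix_vector_mul_lid by (simp add: colmat_def vec_eq_iff mat_def)
  then show ?thesis using cramer_lemma[of k "mat 1" a] by simp
qed

lemma colmat_nth: "colmat k a $ i $ j = (if j = k then a $ i else if i = j then 1 else 0)"
  by (simp add: colmat_def)

lemma colmat_vec: "(colmat k a *v x) $ i = x $ k * a $ i + (if i = k then 0 else x $ i)" for a :: "'a::field^'n"
proof -
  have "(colmat k a *v x) $ i = (\<Sum>j\<in>UNIV. (if j = k then x $ k * a $ i else 0) + (if j = i \<and> i \<noteq> k then x $ i else 0))"
    unfolding matrix_vector_mult_def colmat_def by (auto intro!: sum.cong)
  then show ?thesis by (auto simp: sum.distrib)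
qed

lemma matrix_mult_nth_vec: "(A ** B) $ i $ j = (A *v column j B) $ i"
  by (simp add: matrix_matrix_mult_def matrix_vector_mult_def column_def)

text \<open>The real matrix differs from the identity in two columns only, those of a and of \<i> a,
  and the 2 by 2 block they form at k has determinant Re^2 + Im^2. Peeling off the first column
  divides by the real part of a k, hence the hypothesis.\<close>

lemma det_rmat_colmat_Re:
  assumes "Re (a $ k) \<noteq> 0"
  shows "det (rmat (colmat k a)) = (cmod (a $ k))\<^sup>2"
proof -
  define p where "p = ridx (k, False)"
  define q where "q = ridx (k, True)"
  define m where "m = creal a"
  define t where "t = creal (\<i> *s a)"
  \<comment> \<open>\<open>x\<close> expresses the second altered column through
    \<open>colmat p m\<close>, the shape in which Cramer's lemma applies.\<close>
  define x where "x = (\<chi> i. if i = p then t $ p / m $ p else t $ i - t $ p / m $ p * m $ i)"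
  have mp: "m $ p \<noteq> 0" using assms by (simp add: m_def p_def)
  have x: "colmat p m *v x = t"
    using mp by (auto simp: vec_eq_iff colmat_vec x_def)
  have "rmat (colmat k a) = (\<chi> i j. if j = q then (colmat p m *v x) $ i else colmat p m $ i $ j)"
  proof -
    have "rmat (colmat k a) *v v = (\<chi> i j. if j = q then t $ i else colmat p m $ i $ j) *v v" for v
    proof -
      have "((\<chi> i j. if j = q then t $ i else colmat p m $ i $ j) *v v) $ i
        = (\<Sum>j\<in>UNIV. (if j = q then v $ q * t $ i else 0) + (if j = p then v $ p * m $ i else 0)
            + (if j = i \<and> i \<noteq> p \<and> i \<noteq> q then v $ i else 0))" for i
        unfolding matrix_vector_mult_def colmat_def vec_lambda_beta
        by (intro sum.cong) (auto simp: p_def q_def)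
      then have *: "((\<chi> i j. if j = q then t $ i else colmat p m $ i $ j) *v v) $ i
        = v $ q * t $ i + v $ p * m $ i + (if i \<noteq> p \<and> i \<noteq> q then v $ i else 0)" for i
        by (simp add: sum.distrib)
      have "(rmat (colmat k a) *v v) $ ridx (i, b) = v $ q * t $ ridx (i, b) + v $ p * m $ ridx (i, b) + (if i \<noteq> k then v $ ridx (i, b) else 0)" for i b
        by (simp add: rmat_vec colmat_vec rcomplex_def t_def m_def p_def q_def)
      then show ?thesis
        unfolding vec_eq_ridx * by (auto simp: p_def q_def)
    qed
    then show ?thesis unfolding x by (simp add: matrix_eq)
  qed
  then have "det (rmat (colmat k a)) = x $ q * m $ p"
    using cramer_lemma[of q "colmat p m" x] by (simp add: det_colmat)
  also have "\<dots> = (cmod (a $ k))\<^sup>2"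
    using mp unfolding x_def cmod_power2
    by (simp add: m_def p_def q_def t_def power2_eq_square field_simps)
  finally show ?thesis .
qed

lemma det_rmat_colmat:
  assumes "a $ k \<noteq> 0"
  shows "det (rmat (colmat k a)) = (cmod (a $ k))\<^sup>2"
proof (cases "Re (a $ k) = 0")
  case False
  then show ?thesis by (rule det_rmat_colmat_Re)
next
  case True
  \<comment> \<open>Multiplication by 1 + \<i> moves a nonzero imaginary number off the imaginary
    axis, so both this factor and the product fall under the previous lemma.\<close>
  define b :: "complex^'a" where "b = Complex 1 1 *s axis k 1"
  define a' where "a' = colmat k b *v a"
  have bk: "b $ k = Complex 1 1" by (simp add: b_def axis_def)
  have a': "a' $ k = Complex 1 1 * a $ k" by (simp add: a'_def colmat_vec bk)
  have "colmat k b ** colmat k a = colmat k a'"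
  proof -
    have "(colmat k b *v column j (colmat k a)) $ i = colmat k a' $ i $ j" for i j
      by (auto simp: colmat_vec a'_def column_def colmat_nth b_def axis_def)
    then show ?thesis by (simp add: vec_eq_iff matrix_mult_nth_vec)
  qed
  then have "det (rmat (colmat k a')) = det (rmat (colmat k b)) * det (rmat (colmat k a))"
    by (metis det_mul rmat_mult)
  moreover have "det (rmat (colmat k a')) = (cmod (a' $ k))\<^sup>2"
  proof (rule det_rmat_colmat_Re)
    have "Im (a $ k) \<noteq> 0" using True assms by (simp add: complex_eq_iff)
    then show "Re (a' $ k) \<noteq> 0" using True by (simp add: a')
  qed
  moreover have "det (rmat (colmat k b)) = (cmod (b $ k))\<^sup>2"
    by (rule det_rmat_colmat_Re) (simp add: bk)
  ultimately have "(cmod (b $ k))\<^sup>2 * (cmod (a $ k))\<^sup>2 = (cmod (b $ k))\<^sup>2 * det (rmat (colmat k a))"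
    by (simp add: a' bk norm_mult power_mult_distrib)
  moreover have "(cmod (b $ k))\<^sup>2 \<noteq> 0" by (simp add: bk cmod_power2)
  ultimately show ?thesis by simp
qed

text \<open>Gaussian elimination: the columns outside \<open>K\<close> are already those of the identity.\<close>

lemma det_rmat_aux:
  fixes A :: "complex^'n^'n"
  assumes "finite K" "det A \<noteq> 0" "\<And>i j. j \<notin> K \<Longrightarrow> A $ i $ j = (if i = j then 1 else 0)"
  shows "det (rmat A) = (cmod (det A))\<^sup>2"
  using assms
proof (induction K arbitrary: A rule: finite_induct)
  case empty
  then have "A = mat 1" by (simp add: vec_eq_iff mat_def)
  then show ?case by (simp add: rmat_1)
next
  case (insert k K)
  have main: "det (rmat A) = (cmod (det A))\<^sup>2"
    if A: "det A \<noteq> 0" "\<And>i j. j \<notin> insert k K \<Longrightarrow> A $ i $ j = (if i = j then 1 else 0)" and ak: "A $ k $ k \<noteq> 0" for A :: "complex^'n^'n"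
  proof -
    define a where "a = column k A"
    have a: "a $ i = A $ i $ k" for i by (simp add: a_def column_def)
    \<comment> \<open>Dividing \<open>colmat k a\<close> out of A leaves B, whose column k is that
      of the identity, so that only K remains to be treated.\<close>
    define B where "B = (\<chi> i j. if i = k then A $ k $ j / a $ k else A $ i $ j - a $ i * A $ k $ j / a $ k)"
    have AB: "A = colmat k a ** B"
      using ak by (auto simp: vec_eq_iff matrix_mult_nth_vec colmat_vec column_def B_def a)
    have "det A = a $ k * det B" unfolding AB det_mul det_colmat using ak a by simp
    moreover have "det (rmat A) = (cmod (a $ k))\<^sup>2 * det (rmat B)"
      unfolding AB rmat_mult det_mul using det_rmat_colmat[of a k] ak a by simp
    moreover have "det (rmat B) = (cmod (det B))\<^sup>2"
    proof (rule insert.IH)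
      show "det B \<noteq> 0" using A(1) \<open>det A = a $ k * det B\<close> by auto
      show "B $ i $ j = (if i = j then 1 else 0)" if "j \<notin> K" for i j
        using A(2)[of j i] A(2)[of j k] that ak by (auto simp: B_def a)
    qed
    ultimately show ?thesis by (simp add: norm_mult power_mult_distrib)
  qed
  show ?case
  proof (cases "A $ k $ k = 0")
    case False
    then show ?thesis using main insert.prems by blast
  next
    case True
    obtain i where i: "i \<in> K" "A $ i $ k \<noteq> 0"
    proof (rule ccontr)
      assume "\<not> thesis"
      with that have z: "\<And>i. i \<in> K \<Longrightarrow> A $ i $ k = 0" by blast
      \<comment> \<open>If column k vanished in the rows of K as well as at the pivot, it would be a
        combination of the unit columns outside K and k; \<open>x\<close> is the resulting kernel
        vector.\<close>
      define x where "x = (\<chi> j. if j = k then 1 else if j \<in> K then 0 else - A $ j $ k)"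
      have "(A *v x) $ i = 0" for i
      proof -
        have "(A *v x) $ i = (\<Sum>j\<in>UNIV. (if j = k then A $ i $ k else 0) + (if j = i then (if i \<noteq> k \<and> i \<notin> K then - A $ i $ k else 0) else 0))"
          unfolding matrix_vector_mult_def x_def vec_lambda_beta
          by (intro sum.cong refl) (use insert.prems(2) insert.hyps(2) in auto)
        then show ?thesis using z True by (auto simp: sum.distrib)
      qed
      then have "A *v x = 0" by (simp add: vec_eq_iff)
      then have "x = 0" using insert.prems(1) by (metis invertible_det_nz invertible_def matrix_vector_mul_assoc matrix_vector_mul_lid matrix_vector_mult_0_right)
      then have "x $ k = 0" by simp
      then show False by (simp add: x_def)
    qed
    have ik: "i \<noteq> k" using i(1) insert.hyps by auto
    \<comment> \<open>Multiplying by \<open>colmat i e\<close> adds row i to row k. This makes the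
      pivot nonzero and changes neither the complex nor the real determinant.\<close>
    define e :: "complex^'n" where "e = axis i 1 + axis k 1"
    define B where "B = colmat i e ** A"
    have ei: "e $ i = 1" using ik by (simp add: e_def axis_def)
    have B: "B $ r $ j = A $ r $ j + (if r = k then A $ i $ j else 0)" for r j
      using ik by (auto simp: B_def matrix_mult_nth_vec colmat_vec column_def e_def axis_def)
    have dB: "det B = det A" by (simp add: B_def det_mul det_colmat ei)
    have "det (rmat B) = (cmod (det B))\<^sup>2"
    proof (rule main)
      show "det B \<noteq> 0" using dB insert.prems by simp
      show "B $ k $ k \<noteq> 0" using i True by (simp add: B)
      show "B $ r $ j = (if r = j then 1 else 0)" if "j \<notin> insert k K" for r j
        using insert.prems(2)[OF that] that i by (auto simp: B)
    qed
    moreover have "det (rmat B) = det (rmat A)"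
      unfolding B_def rmat_mult det_mul using det_rmat_colmat[of e i] ei by simp
    ultimately show ?thesis using dB by simp
  qed
qed

theorem det_rmat: "det A \<noteq> 0 \<Longrightarrow> det (rmat A) = (cmod (det A))\<^sup>2"
  using det_rmat_aux[of UNIV A] by simp

section \<open>Jacobi's formula for the derivative of a determinant\<close>

lemma dop_prod:
  "finite I \<Longrightarrow> (\<And>i. i \<in> I \<Longrightarrow> f i differentiable (at p)) \<Longrightarrow>
    (\<lambda>q. \<Prod>i\<in>I. f i q) differentiable (at p) \<and>
    dop \<kappa> v w (\<lambda>q. \<Prod>i\<in>I. f i q) p = (\<Sum>i\<in>I. dop \<kappa> v w (f i) p * (\<Prod>j\<in>I-{i}. f j p))"
proof (induction I rule: finite_induct)
  case (insert x F)
  have *: "(\<Prod>j\<in>insert x F - {i}. f j p) = f x p * (\<Prod>j\<in>F - {i}. f j p)" if "i \<in> F" for i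
  proof -
    have "insert x F - {i} = insert x (F - {i})" using that insert.hyps by auto
    then show ?thesis using insert.hyps by simp
  qed
  have "insert x F - {x} = F" using insert.hyps by auto
  then have "dop \<kappa> v w (\<lambda>q. \<Prod>i\<in>insert x F. f i q) p = (\<Sum>i\<in>insert x F. dop \<kappa> v w (f i) p * (\<Prod>j\<in>insert x F-{i}. f j p))"
    using insert by (simp add: dop_mult * sum_distrib_left mult_ac)
  then show ?case using insert by (simp add: differentiable_mult)
qed auto

text \<open>Differentiating the product in each permutation replaces one row at a time. The
  derivative of row i, written in the rows of A with coefficients \<open>x i\<close>, multiplies the
  determinant by its i-th coefficient.\<close>

theorem dop_det:
  fixes A :: "'a::real_normed_vector \<Rightarrow> complex^'n^'n"
  assumes A: "\<And>i j. (\<lambda>q. A q $ i $ j) differentiable (at p)" and det: "det (A p) \<noteq> 0"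
  shows "dop \<kappa> v w (\<lambda>q. det (A q)) p =
    det (A p) * (\<Sum>i\<in>UNIV. \<Sum>j\<in>UNIV. matrix_inv (A p) $ j $ i * dop \<kappa> v w (\<lambda>q. A q $ i $ j) p)"
proof -
  let ?P = "{\<sigma>. \<sigma> permutes (UNIV::'n set)}"
  define D where "D i j = dop \<kappa> v w (\<lambda>q. A q $ i $ j) p" for i j
  define x where "x i = (\<chi> m. \<Sum>k\<in>UNIV. D i k * matrix_inv (A p) $ k $ m)" for i
  have inv: "matrix_inv (A p) ** A p = mat 1" using matrix_inv_inverse[OF det] by blast
  have x: "(\<Sum>m\<in>UNIV. x i $ m *s row m (A p)) $ j = D i j" for i j
  proof -
    have "(\<Sum>m\<in>UNIV. x i $ m *s row m (A p)) $ j = (\<Sum>m\<in>UNIV. \<Sum>k\<in>UNIV. D i k * (matrix_inv (A p) $ k $ m * A p $ m $ j))"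
      by (simp add: x_def row_def sum_distrib_right mult.assoc)
    also have "\<dots> = (\<Sum>k\<in>UNIV. D i k * (matrix_inv (A p) ** A p) $ k $ j)"
      by (subst sum.swap) (simp add: matrix_matrix_mult_def sum_distrib_left)
    also have "\<dots> = D i j" by (simp add: inv mat_def if_distrib cong: if_cong)
    finally show ?thesis .
  qed
  have pd: "(\<lambda>q. \<Prod>i\<in>UNIV. A q $ i $ \<sigma> i) differentiable (at p)" for \<sigma> :: "'n \<Rightarrow> 'n"
    using dop_prod[of UNIV "\<lambda>i q. A q $ i $ \<sigma> i" p] A by auto
  have "dop \<kappa> v w (\<lambda>q. det (A q)) p = (\<Sum>\<sigma>\<in>?P. of_int (sign \<sigma>) * (\<Sum>i\<in>UNIV. D i (\<sigma> i) * (\<Prod>m\<in>UNIV-{i}. A p $ m $ \<sigma> m)))"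
    unfolding det_def
    by (subst dop_sum) (auto intro!: sum.cong differentiable_mult pd simp: dop_cmult[OF pd] dop_prod A D_def)
  also have "\<dots> = (\<Sum>i\<in>UNIV. \<Sum>\<sigma>\<in>?P. of_int (sign \<sigma>) * (D i (\<sigma> i) * (\<Prod>m\<in>UNIV-{i}. A p $ m $ \<sigma> m)))"
    unfolding sum_distrib_left by (rule sum.swap)
  also have "\<dots> = (\<Sum>i\<in>UNIV. det (\<chi> r. if r = i then (\<Sum>m\<in>UNIV. x i $ m *s row m (A p)) else row r (A p)))"
  proof (rule sum.cong[OF refl])
    fix i :: 'n
    show "(\<Sum>\<sigma>\<in>?P. of_int (sign \<sigma>) * (D i (\<sigma> i) * (\<Prod>m\<in>UNIV-{i}. A p $ m $ \<sigma> m)))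
      = det (\<chi> r. if r = i then (\<Sum>m\<in>UNIV. x i $ m *s row m (A p)) else row r (A p))"
      unfolding det_def
    proof (rule sum.cong[OF refl])
      fix \<sigma>
      have "(\<Prod>m\<in>UNIV. (\<chi> r. if r = i then (\<Sum>m\<in>UNIV. x i $ m *s row m (A p)) else row r (A p)) $ m $ \<sigma> m)
        = D i (\<sigma> i) * (\<Prod>m\<in>UNIV-{i}. A p $ m $ \<sigma> m)"
      proof -
        have "(\<chi> r. if r = i then (\<Sum>m\<in>UNIV. x i $ m *s row m (A p)) else row r (A p)) $ m $ s = (if m = i then D i s else A p $ m $ s)" for m s
        proof (cases "m = i")
          case True
          show ?thesis unfolding vec_lambda_beta if_P[OF True] by (rule x)
        qed (simp add: row_def)
        then show ?thesis by (simp add: prod.remove[of UNIV i])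
      qed
      then show "of_int (sign \<sigma>) * (D i (\<sigma> i) * (\<Prod>m\<in>UNIV-{i}. A p $ m $ \<sigma> m)) = of_int (sign \<sigma>) * (\<Prod>m\<in>UNIV. (\<chi> r. if r = i then (\<Sum>m\<in>UNIV. x i $ m *s row m (A p)) else row r (A p)) $ m $ \<sigma> m)"
        by simp
    qed
  qed
  also have "\<dots> = (\<Sum>i\<in>UNIV. x i $ i * det (A p))"
    by (simp only: cramer_lemma_transpose)
  also have "\<dots> = det (A p) * (\<Sum>i\<in>UNIV. \<Sum>j\<in>UNIV. matrix_inv (A p) $ j $ i * D i j)"
    by (simp add: x_def sum_distrib_left sum_distrib_right mult_ac)
  finally show ?thesis by (simp add: D_def)
qed

section \<open>Hermitian matrices\<close>

definition hermitian :: "complex^'n^'n \<Rightarrow> bool" where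
  "hermitian A \<longleftrightarrow> (\<forall>i j. cnj (A $ i $ j) = A $ j $ i)"

lemma det_cnj: "det (\<chi> i j. cnj (A $ i $ j)) = cnj (det A)"
  by (simp add: det_def)

lemma hermitian_det_real: "hermitian A \<Longrightarrow> det A \<in> \<real>"
proof -
  assume "hermitian A"
  then have "(\<chi> i j. cnj (A $ i $ j)) = transpose A"
    by (simp add: hermitian_def transpose_def vec_eq_iff)
  then have "cnj (det A) = det A" using det_cnj[of A] by (simp add: det_transpose)
  then show ?thesis using complex_is_Real_iff[of "det A"] by (auto simp: complex_eq_iff)
qed

lemma positive_definite_det_nonzero:
  fixes A :: "complex^'n^'n"
  assumes "positive_definite A"
  shows "det A \<noteq> 0"
proof
  assume "det A = 0"
  then have "\<not> invertible (transpose A)" by (simp add: invertible_det_nz det_transpose)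
  then obtain \<xi> where xi: "\<xi> \<noteq> 0" "transpose A *v \<xi> = 0"
    unfolding invertible_left_inverse matrix_left_invertible_ker by blast
  have "(\<Sum>k\<in>UNIV. \<Sum>l\<in>UNIV. A $ k $ l * \<xi> $ k * cnj (\<xi> $ l)) = (\<Sum>l\<in>UNIV. (transpose A *v \<xi>) $ l * cnj (\<xi> $ l))"
    by (subst sum.swap) (simp add: matrix_vector_mult_def transpose_def sum_distrib_right)
  also have "\<dots> = 0" unfolding xi by simp
  finally have "(\<Sum>k\<in>UNIV. \<Sum>l\<in>UNIV. A $ k $ l * \<xi> $ k * cnj (\<xi> $ l)) = 0" .
  with assms[unfolded positive_definite_def, rule_format, OF xi(1)] show False by simp
qed

text \<open>The segment from the identity to A stays positive definite, so the determinant never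
  vanishes on it; being real and continuous, it keeps the sign it has at the identity.\<close>

lemma positive_definite_det_pos:
  fixes A :: "complex^'n^'n"
  assumes "positive_definite A" "hermitian A"
  shows "Re (det A) > 0" "Im (det A) = 0"
proof -
  show "Im (det A) = 0" using hermitian_det_real[OF assms(2)] complex_is_Real_iff by blast
  define B where "B s = (\<chi> i j. of_real s * A $ i $ j + of_real (1 - s) * (if i = j then 1 else 0))" for s
  have pd: "positive_definite (B s)" if "0 \<le> s" "s \<le> 1" for s
    unfolding positive_definite_def
  proof (intro allI impI)
    fix \<xi> :: "complex^'n" assume xi: "\<xi> \<noteq> 0"
    define q where "q = (\<Sum>k\<in>UNIV. \<Sum>l\<in>UNIV. A $ k $ l * \<xi> $ k * cnj (\<xi> $ l))"
    have q: "q > 0" using assms(1) xi unfolding positive_definite_def q_def by blast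
    define m where "m = (\<Sum>k\<in>UNIV. (cmod (\<xi> $ k))\<^sup>2)"
    obtain k where "\<xi> $ k \<noteq> 0" using xi by (auto simp: vec_eq_iff)
    then have m: "m > 0" unfolding m_def by (intro sum_pos2[of _ k]) auto
    have "(\<Sum>k\<in>UNIV. \<Sum>l\<in>UNIV. B s $ k $ l * \<xi> $ k * cnj (\<xi> $ l))
      = of_real s * q + (\<Sum>k\<in>UNIV. \<Sum>l\<in>UNIV. if l = k then of_real (1 - s) * (\<xi> $ k * cnj (\<xi> $ k)) else 0)"
      unfolding B_def q_def sum_distrib_left sum.distrib[symmetric]
      by (intro sum.cong) (auto simp: algebra_simps)
    also have "\<dots> = of_real s * q + of_real ((1 - s) * m)"
      by (simp add: m_def sum_distrib_left complex_norm_square[symmetric])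
    finally have eq: "(\<Sum>k\<in>UNIV. \<Sum>l\<in>UNIV. B s $ k $ l * \<xi> $ k * cnj (\<xi> $ l)) = of_real (s * Re q + (1 - s) * m)"
      using q by (simp add: complex_eq_iff less_complex_def)
    have "s * Re q + (1 - s) * m > 0"
      using q m that by (cases "s = 0") (auto simp: less_complex_def intro!: add_pos_nonneg)
    then show "0 < (\<Sum>k\<in>UNIV. \<Sum>l\<in>UNIV. B s $ k $ l * \<xi> $ k * cnj (\<xi> $ l))"
      unfolding eq by (simp add: less_complex_def)
  qed
  have herm: "hermitian (B s)" for s using assms(2) by (auto simp: hermitian_def B_def)
  have cont: "continuous_on {0..1} (\<lambda>s. Re (det (B s)))"
    unfolding det_def B_def by (auto intro!: continuous_intros)
  have B1: "B 1 = A" by (simp add: B_def vec_eq_iff)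
  have B0: "B 0 = mat 1" by (simp add: B_def vec_eq_iff mat_def)
  show "Re (det A) > 0"
  proof (rule ccontr)
    assume "\<not> Re (det A) > 0"
    then obtain s where s: "0 \<le> s" "s \<le> 1" "Re (det (B s)) = 0"
      using IVT2'[of "\<lambda>s. Re (det (B s))" 1 0 0] cont by (auto simp: B1 B0)
    have "det (B s) = 0" using s(3) hermitian_det_real[OF herm, of s]
      by (simp add: complex_eq_iff complex_is_Real_iff)
    then show False using positive_definite_det_nonzero[OF pd[OF s(1,2)]] by simp
  qed
qed

lemma matrix_inv_sum:
  fixes G :: "complex^'n^'n"
  assumes "det G \<noteq> 0"
  shows "(\<Sum>k\<in>UNIV. matrix_inv G $ j $ k * G $ k $ l) = (if j = l then 1 else 0)"
    "(\<Sum>k\<in>UNIV. G $ j $ k * matrix_inv G $ k $ l) = (if j = l then 1 else 0)"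
  using matrix_inv_inverse[OF assms]
  by (simp_all add: matrix_matrix_mult_def mat_def vec_eq_iff)

lemma hermitian_matrix_inv:
  fixes G :: "complex^'n^'n"
  assumes "hermitian G" "det G \<noteq> 0"
  shows "hermitian (matrix_inv G)"
proof -
  define N where "N = (\<chi> i j. cnj (matrix_inv G $ j $ i))"
  have "N ** G = mat 1"
  proof -
    have "(N ** G) $ i $ j = mat 1 $ i $ j" for i j
    proof -
      have "(N ** G) $ i $ j = cnj (\<Sum>k\<in>UNIV. G $ j $ k * matrix_inv G $ k $ i)"
        using assms(1) by (simp add: matrix_matrix_mult_def N_def hermitian_def mult.commute)
      then show ?thesis using matrix_inv_sum(2)[OF assms(2), of j i] by (simp add: mat_def)
    qed
    then show ?thesis by (simp add: vec_eq_iff)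
  qed
  then have "N = matrix_inv G"
    by (metis matrix_inv_inverse[OF assms(2)] matrix_mul_assoc matrix_mul_lid matrix_mul_rid)
  then show ?thesis unfolding hermitian_def N_def by (metis complex_cnj_cnj vec_lambda_beta)
qed

text \<open>\<open>V a\<close> is the tangent vector dual to the form a under G, and a form and its
  vector have the same length. This carries positivity over to the inverse matrix and computes the
  Schur complement.\<close>

lemma inverse_form:
  fixes G :: "complex^'n^'n"
  assumes "hermitian G" "det G \<noteq> 0"
  defines "V \<equiv> \<lambda>a k. \<Sum>j\<in>UNIV. matrix_inv G $ j $ k * a $ j"
  shows "(\<Sum>k\<in>UNIV. V a k * G $ k $ l) = a $ l"
    "(\<Sum>j\<in>UNIV. \<Sum>k\<in>UNIV. matrix_inv G $ j $ k * a $ j * cnj (a $ k))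
       = (\<Sum>k\<in>UNIV. \<Sum>l\<in>UNIV. G $ k $ l * V a k * cnj (V a l))"
    "(\<Sum>j\<in>UNIV. \<Sum>k\<in>UNIV. matrix_inv G $ j $ k * a $ j * cnj (a $ k)) = (\<Sum>k\<in>UNIV. V a k * cnj (a $ k))"
proof -
  show 1: "(\<Sum>k\<in>UNIV. V a k * G $ k $ l) = a $ l" for l
  proof -
    have "(\<Sum>k\<in>UNIV. V a k * G $ k $ l) = (\<Sum>j\<in>UNIV. a $ j * (\<Sum>k\<in>UNIV. matrix_inv G $ j $ k * G $ k $ l))"
      unfolding V_def sum_distrib_left sum_distrib_right by (subst sum.swap) (simp add: mult_ac)
    then show ?thesis by (simp add: matrix_inv_sum[OF assms(2)] if_distrib cong: if_cong)
  qed
  show 2: "(\<Sum>j\<in>UNIV. \<Sum>k\<in>UNIV. matrix_inv G $ j $ k * a $ j * cnj (a $ k)) = (\<Sum>k\<in>UNIV. V a k * cnj (a $ k))"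
    unfolding V_def sum_distrib_right by (rule sum.swap)
  have "cnj (a $ k) = (\<Sum>l\<in>UNIV. G $ k $ l * cnj (V a l))" for k
    unfolding 1[of k, symmetric] using assms(1) by (simp add: hermitian_def mult.commute)
  then show "(\<Sum>j\<in>UNIV. \<Sum>k\<in>UNIV. matrix_inv G $ j $ k * a $ j * cnj (a $ k))
       = (\<Sum>k\<in>UNIV. \<Sum>l\<in>UNIV. G $ k $ l * V a k * cnj (V a l))"
    unfolding 2 by (simp add: sum_distrib_left mult_ac)
qed

lemma inverse_form_nonneg:
  fixes G :: "complex^'n^'n"
  assumes "positive_definite G" "hermitian G"
  shows "0 \<le> (\<Sum>j\<in>UNIV. \<Sum>k\<in>UNIV. matrix_inv G $ j $ k * a $ j * cnj (a $ k))"
proof -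
  define \<xi> where "\<xi> = (\<chi> k. \<Sum>j\<in>UNIV. matrix_inv G $ j $ k * a $ j)"
  have "0 \<le> (\<Sum>k\<in>UNIV. \<Sum>l\<in>UNIV. G $ k $ l * \<xi> $ k * cnj (\<xi> $ l))"
    using assms(1) unfolding positive_definite_def by (cases "\<xi> = 0") (auto simp: less_imp_le)
  then show ?thesis
    using inverse_form(2)[OF assms(2) positive_definite_det_nonzero[OF assms(1)], of a] by (simp add: \<xi>_def)
qed

section \<open>Change of variables for holomorphic maps\<close>

text \<open>Translates between nonnegative Lebesgue integrals, in which the measure on Z is
  described, and absolutely integrable functions, for which the change of variables is stated. As an
  equivalence for every finite value it also decides when the integral is infinite.\<close>

lemma nn_integral_eq_has_integral:
  fixes f :: "'a::euclidean_space \<Rightarrow> real"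
  assumes f: "\<And>x. x \<in> S \<Longrightarrow> 0 \<le> f x" and m: "(\<lambda>x. indicator S x * f x) \<in> borel_measurable borel"
    and r: "0 \<le> r"
  shows "(\<integral>\<^sup>+x\<in>S. ennreal (f x) \<partial>lborel) = ennreal r \<longleftrightarrow> f absolutely_integrable_on S \<and> integral S f = r"
proof
  assume *: "(\<integral>\<^sup>+x\<in>S. ennreal (f x) \<partial>lborel) = ennreal r"
  have "(\<integral>\<^sup>+x\<in>S. ennreal (f x) \<partial>lborel) = (\<integral>\<^sup>+x. ennreal (indicator S x * f x) \<partial>lborel)"
    by (intro nn_integral_cong) (auto simp: indicator_def)
  moreover have eq: "(\<lambda>x. indicator S x * f x) = (\<lambda>x. if x \<in> S then f x else 0)"
    by (auto simp: indicator_def)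
  ultimately have "((\<lambda>x. indicator S x * f x) has_integral r) UNIV"
    using nn_integral_has_integral[OF m _ _ r] * f by (auto simp: indicator_def)
  then have "(f has_integral r) S"
    by (simp only: eq has_integral_restrict_UNIV)
  then show "f absolutely_integrable_on S \<and> integral S f = r"
    using nonnegative_absolutely_integrable_1 f has_integral_integrable integral_unique by blast
next
  assume *: "f absolutely_integrable_on S \<and> integral S f = r"
  then have "(f has_integral r) S"
    using absolutely_integrable_on_def has_integral_integral by blast
  from nn_integral_has_integral_lebesgue'[OF f this]
  show "(\<integral>\<^sup>+x\<in>S. ennreal (f x) \<partial>lborel) = ennreal r" .
qed

lemma has_absolute_integral_change_of_variables_real_valued:
  fixes f :: "real^'m::{finite,wellorder} \<Rightarrow> real" and g :: "real^'m::_ \<Rightarrow> real^'m::_"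
  assumes "S \<in> sets lebesgue" "\<And>x. x \<in> S \<Longrightarrow> (g has_derivative g' x) (at x within S)" "inj_on g S"
  shows "(\<lambda>x. \<bar>det (matrix (g' x))\<bar> * f (g x)) absolutely_integrable_on S \<and>
           integral S (\<lambda>x. \<bar>det (matrix (g' x))\<bar> * f (g x)) = b
     \<longleftrightarrow> f absolutely_integrable_on (g ` S) \<and> integral (g ` S) f = b"
  using has_absolute_integral_change_of_variables[OF assms, of "\<lambda>x. vec (f x) :: real^1" "vec b"]
  by (simp add: absolutely_integrable_on_1_iff integral_on_1_eq vec_eq_iff)

lemma nn_integral_change_of_variables_real:
  fixes f :: "real^'m::{finite,wellorder} \<Rightarrow> real" and g :: "real^'m::_ \<Rightarrow> real^'m::_"
  assumes S: "S \<in> sets lebesgue" "\<And>x. x \<in> S \<Longrightarrow> (g has_derivative g' x) (at x within S)" "inj_on g S"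
    and f: "\<And>y. y \<in> g ` S \<Longrightarrow> 0 \<le> f y"
    and m: "(\<lambda>y. indicator (g ` S) y * f y) \<in> borel_measurable borel"
      "(\<lambda>x. indicator S x * (\<bar>det (matrix (g' x))\<bar> * f (g x))) \<in> borel_measurable borel"
  shows "(\<integral>\<^sup>+y\<in>g ` S. ennreal (f y) \<partial>lborel) = (\<integral>\<^sup>+x\<in>S. ennreal (\<bar>det (matrix (g' x))\<bar> * f (g x)) \<partial>lborel)"
    (is "?L = ?R")
proof -
  \<comment> \<open>Both sides attain the same finite values, hence one is infinite exactly if the
    other is.\<close>
  have eq: "?L = ennreal r \<longleftrightarrow> ?R = ennreal r" if "0 \<le> r" for r
    using nn_integral_eq_has_integral[OF f m(1) that] nn_integral_eq_has_integral[OF _ m(2) that]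
      has_absolute_integral_change_of_variables_real_valued[OF S, of f r] f by auto
  show ?thesis
    by (cases ?L; cases ?R) (use eq in \<open>auto\<close>)
qed

section \<open>Lebesgue measure under the real identification\<close>

lemma mem_creal_image: "v \<in> creal ` X \<longleftrightarrow> rcomplex v \<in> X"
  by (metis creal_rcomplex image_iff rcomplex_creal)

lemma inner_creal: "creal x \<bullet> creal y = x \<bullet> y"
proof -
  have "creal x \<bullet> creal y = (\<Sum>p\<in>UNIV. creal x $ ridx p * creal y $ ridx p)"
    unfolding inner_vec_def inner_real_def by (rule sum.reindex_bij_betw[OF bij_ridx, symmetric])
  also have "\<dots> = (\<Sum>j\<in>UNIV. \<Sum>b\<in>UNIV. creal x $ ridx (j, b) * creal y $ ridx (j, b))"
    unfolding UNIV_Times_UNIV[symmetric] by (simp add: sum.cartesian_product case_prod_unfold del: creal_nth)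
  also have "\<dots> = x \<bullet> y"
    by (simp add: inner_vec_def inner_complex_def UNIV_bool)
  finally show ?thesis .
qed

lemma creal_Basis: "bij_betw creal Basis Basis"
proof -
  have "creal (axis j 1) = axis (ridx (j, False)) 1" "creal (axis j \<i>) = axis (ridx (j, True)) 1" for j
    by (auto simp: vec_eq_ridx axis_def)
  then have "creal ` Basis \<subseteq> Basis" by (auto simp: Basis_vec_def Basis_complex_def)
  moreover have "v \<in> creal ` Basis" if "v \<in> Basis" for v :: "real^('a bit0)"
  proof -
    from that obtain k where v: "v = axis k 1" by (auto simp: Basis_vec_def)
    obtain j b where k: "k = ridx (j, b)" by (rule ridx_cases)
    have "creal (axis j (if b then \<i> else 1)) = axis k 1" by (auto simp: vec_eq_ridx axis_def k)
    moreover have "axis j (if b then \<i> else 1) \<in> Basis" by (auto simp: Basis_vec_def Basis_complex_def)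
    ultimately show ?thesis unfolding v by (metis image_eqI)
  qed
  moreover have "inj_on creal Basis" by (metis inj_onI rcomplex_creal)
  ultimately show ?thesis unfolding bij_betw_def by blast
qed

lemma continuous_on_creal: "continuous_on A creal"
  by (rule linear_continuous_on[OF linear_creal[unfolded linear_conv_bounded_linear]])

lemma continuous_on_rcomplex: "continuous_on A rcomplex"
  by (rule linear_continuous_on[OF linear_rcomplex[unfolded linear_conv_bounded_linear]])

lemma measurable_creal [measurable]: "creal \<in> borel_measurable borel"
  by (rule borel_measurable_continuous_onI[OF continuous_on_creal])

lemma measurable_rcomplex [measurable]: "rcomplex \<in> borel_measurable borel"
  by (rule borel_measurable_continuous_onI[OF continuous_on_rcomplex])

text \<open>The identification permutes real coordinates, so it carries boxes to boxes with the same
  side lengths, and boxes determine Lebesgue measure.\<close>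

lemma lborel_creal: "distr lborel borel creal = lborel"
proof (rule lborel_eqI[symmetric])
  fix l u :: "real^('a bit0)"
  assume le: "\<And>b. b \<in> Basis \<Longrightarrow> l \<bullet> b \<le> u \<bullet> b"
  have *: "v \<bullet> creal b = rcomplex v \<bullet> b" for v :: "real^('a bit0)" and b
    using inner_creal[of "rcomplex v" b] by simp
  have "creal -` box l u = box (rcomplex l) (rcomplex u)"
  proof -
    have "creal z \<in> box l u \<longleftrightarrow> z \<in> box (rcomplex l) (rcomplex u)" for z
      unfolding mem_box using bij_betw_imp_surj_on[OF creal_Basis]
      by (metis (no_types, lifting) "*" image_iff rcomplex_creal)
    then show ?thesis by auto
  qed
  then have "emeasure (distr lborel borel creal) (box l u) = emeasure lborel (box (rcomplex l) (rcomplex u))"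
    by (simp add: emeasure_distr)
  also have "\<dots> = (\<Prod>b\<in>Basis. (rcomplex u - rcomplex l) \<bullet> b)"
    using le bij_betwE[OF creal_Basis] by (intro emeasure_lborel_box) (auto simp flip: *)
  also have "(\<Prod>b\<in>Basis. (rcomplex u - rcomplex l) \<bullet> b) = (\<Prod>b\<in>Basis. (u - l) \<bullet> creal b)"
    by (simp only: * linear_diff[OF linear_rcomplex])
  also have "\<dots> = (\<Prod>b\<in>Basis. (u - l) \<bullet> b)"
    by (rule prod.reindex_bij_betw[OF creal_Basis])
  finally show "emeasure (distr lborel borel creal) (box l u) = ennreal (\<Prod>b\<in>Basis. (u - l) \<bullet> b)" .
qed simp

lemma nn_integral_rcomplex:
  assumes [measurable]: "h \<in> borel_measurable borel"
  shows "(\<integral>\<^sup>+v. h (rcomplex v) \<partial>lborel) = (\<integral>\<^sup>+z. h z \<partial>lborel)"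
  by (subst lborel_creal[symmetric], subst nn_integral_distr) auto

text \<open>The real theorem is transported through \<open>creal\<close>; \<open>det_rmat\<close>
  turns the real Jacobian into the squared modulus of the complex one, which is exactly how the
  density of \<omega>_n transforms.\<close>

theorem nn_integral_change_of_variables_complex:
  fixes T :: "complex^'n \<Rightarrow> complex^'n" and f :: "complex^'n \<Rightarrow> real"
  assumes S: "S \<in> sets borel" "inj_on T S"
    and T: "\<And>x. x \<in> S \<Longrightarrow> (T has_derivative ((*v) (J x))) (at x)" "\<And>x. x \<in> S \<Longrightarrow> det (J x) \<noteq> 0"
    and f: "\<And>y. y \<in> T ` S \<Longrightarrow> 0 \<le> f y"
    and m: "(\<lambda>y. indicator (T ` S) y * f y) \<in> borel_measurable borel"
      "(\<lambda>x. indicator S x * ((cmod (det (J x)))\<^sup>2 * f (T x))) \<in> borel_measurable borel"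
  shows "(\<integral>\<^sup>+y\<in>T ` S. ennreal (f y) \<partial>lborel) = (\<integral>\<^sup>+x\<in>S. ennreal ((cmod (det (J x)))\<^sup>2 * f (T x)) \<partial>lborel)"
proof -
  define S' where "S' = creal ` S"
  define g where "g = creal \<circ> T \<circ> rcomplex"
  define g' where "g' v = creal \<circ> (*v) (J (rcomplex v)) \<circ> rcomplex" for v
  have S'eq: "v \<in> S' \<longleftrightarrow> rcomplex v \<in> S" for v unfolding S'_def by (rule mem_creal_image)
  have gS: "g ` S' = creal ` T ` S" by (auto simp: g_def S'_def image_iff)
  have gSeq: "v \<in> g ` S' \<longleftrightarrow> rcomplex v \<in> T ` S" for v
    unfolding gS by (rule mem_creal_image)
  have S'b: "S' \<in> sets borel"
  proof -
    have "S' = rcomplex -` S \<inter> space borel" using S'eq by auto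
    then show ?thesis using measurable_sets[OF measurable_rcomplex, of S] S(1) by simp
  qed
  have der: "(g has_derivative g' v) (at v within S')" if "v \<in> S'" for v
  proof -
    have r: "(rcomplex has_derivative rcomplex) (at v)" and c: "(creal has_derivative creal) (at z)" for z
      by (rule bounded_linear_imp_has_derivative[OF linear_rcomplex[unfolded linear_conv_bounded_linear]],
          rule bounded_linear_imp_has_derivative[OF linear_creal[unfolded linear_conv_bounded_linear]])
    have "(T has_derivative (*v) (J (rcomplex v))) (at (rcomplex v))"
      using T(1)[OF iffD1[OF S'eq that]] .
    from has_derivative_at_withinI[OF has_derivative_compose[OF has_derivative_compose[OF r this] c]]
    show ?thesis by (simp add: g_def g'_def o_def)
  qed
  have inj: "inj_on g S'"
  proof (rule inj_onI)
    fix x y assume xy: "x \<in> S'" "y \<in> S'" "g x = g y"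
    from arg_cong[OF xy(3), of rcomplex] have "T (rcomplex x) = T (rcomplex y)" by (simp add: g_def)
    then have "rcomplex x = rcomplex y" using inj_onD[OF S(2)] xy(1,2) unfolding S'eq by blast
    from arg_cong[OF this, of creal] show "x = y" by simp
  qed
  have dt: "\<bar>det (matrix (g' v))\<bar> = (cmod (det (J (rcomplex v))))\<^sup>2" if "v \<in> S'" for v
    using det_rmat[of "J (rcomplex v)"] T(2) that S'eq by (simp add: g'_def rmat_def)
  have indS: "indicator S' v = (indicator S (rcomplex v) :: real)" for v
    by (simp add: indicator_def S'eq)
  have indT: "indicator (g ` S') v = (indicator (T ` S) (rcomplex v) :: real)" for v
    by (simp add: indicator_def gSeq)
  have "(\<integral>\<^sup>+y\<in>T ` S. ennreal (f y) \<partial>lborel) = (\<integral>\<^sup>+y. ennreal (indicator (T ` S) y * f y) \<partial>lborel)"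
    by (intro nn_integral_cong) (auto simp: indicator_def)
  also have "\<dots> = (\<integral>\<^sup>+v. ennreal (indicator (g ` S') v * f (rcomplex v)) \<partial>lborel)"
    unfolding indT using m(1) by (subst nn_integral_rcomplex) auto
  also have "\<dots> = (\<integral>\<^sup>+v\<in>g ` S'. ennreal (f (rcomplex v)) \<partial>lborel)"
    by (intro nn_integral_cong) (auto simp: indicator_def)
  also have "\<dots> = (\<integral>\<^sup>+v\<in>S'. ennreal (\<bar>det (matrix (g' v))\<bar> * f (rcomplex (g v))) \<partial>lborel)"
  proof (rule nn_integral_change_of_variables_real)
    show "S' \<in> sets lebesgue" using S'b by simp
    show "0 \<le> f (rcomplex y)" if "y \<in> g ` S'" for y using that unfolding gSeq by (rule f)
    show "(\<lambda>y. indicator (g ` S') y * f (rcomplex y)) \<in> borel_measurable borel"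
      unfolding indT using measurable_compose[OF measurable_rcomplex m(1)] by simp
    have "(\<lambda>v. indicator S (rcomplex v) * ((cmod (det (J (rcomplex v))))\<^sup>2 * f (T (rcomplex v)))) \<in> borel_measurable borel"
      using measurable_compose[OF measurable_rcomplex m(2)] by simp
    then show "(\<lambda>x. indicator S' x * (\<bar>det (matrix (g' x))\<bar> * f (rcomplex (g x)))) \<in> borel_measurable borel"
      by (rule measurable_cong[THEN iffD1, rotated]) (simp add: indicator_def g_def dt S'eq)
  qed (use der inj in auto)
  also have "\<dots> = (\<integral>\<^sup>+v. ennreal (indicator S (rcomplex v) * ((cmod (det (J (rcomplex v))))\<^sup>2 * f (T (rcomplex v)))) \<partial>lborel)"
    by (intro nn_integral_cong) (simp add: indicator_def g_def dt S'eq)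
  also have "\<dots> = (\<integral>\<^sup>+x. ennreal (indicator S x * ((cmod (det (J x)))\<^sup>2 * f (T x))) \<partial>lborel)"
    using m(2) by (subst nn_integral_rcomplex[symmetric]) auto
  also have "\<dots> = (\<integral>\<^sup>+x\<in>S. ennreal ((cmod (det (J x)))\<^sup>2 * f (T x)) \<partial>lborel)"
    by (intro nn_integral_cong) (auto simp: indicator_def)
  finally show ?thesis .
qed

section \<open>Holomorphic changes of coordinates\<close>

definition holomorphic_map :: "(complex^'n \<Rightarrow> complex^'m) \<Rightarrow> (complex^'n) set \<Rightarrow> bool" where
  "holomorphic_map T S \<longleftrightarrow> (\<forall>k. several_holomorphic_on (\<lambda>w. T w $ k) S)"

definition jac :: "(complex^'n \<Rightarrow> complex^'m) \<Rightarrow> complex^'n \<Rightarrow> complex^'n^'m" where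
  "jac T w = (\<chi> k j. frechet_derivative (\<lambda>w. T w $ k) (at w) (axis j 1))"

definition cnjmat :: "complex^'n^'m \<Rightarrow> complex^'n^'m" where
  "cnjmat A = (\<chi> i j. cnj (A $ i $ j))"

lemma several_holomorphic_on_cong:
  assumes "open S" "several_holomorphic_on f S" "\<And>w. w \<in> S \<Longrightarrow> f w = g w"
  shows "several_holomorphic_on g S"
  unfolding several_holomorphic_on_def
proof
  fix p assume p: "p \<in> S"
  then obtain f' where f': "(f has_derivative f') (at p)" "\<forall>c v. f' (c *s v) = c * f' v"
    using assms(2) unfolding several_holomorphic_on_def by blast
  have "(g has_derivative f') (at p)"
    by (rule has_derivative_transform_within_open[OF f'(1) assms(1) p]) (rule assms(3))
  with f'(2) show "\<exists>f'. (g has_derivative f') (at p) \<and> (\<forall>c v. f' (c *s v) = c * f' v)" by blast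
qed

lemma holomorphic_map_has_derivative:
  assumes T: "holomorphic_map T S" and w: "w \<in> S"
  shows "(T has_derivative ((*v) (jac T w))) (at w)"
proof -
  have hol: "several_holomorphic_on (\<lambda>w. T w $ k) S" for k using T by (simp add: holomorphic_map_def)
  have D: "frechet_derivative (\<lambda>w. T w $ k) (at w) v = (jac T w *v v) $ k" for k v
  proof -
    have lin: "linear (frechet_derivative (\<lambda>w. T w $ k) (at w))"
      using several_holomorphic_on_has_derivative[OF hol w] has_derivative_linear by blast
    have "frechet_derivative (\<lambda>w. T w $ k) (at w) (\<Sum>j\<in>UNIV. v $ j *s axis j 1)
      = (\<Sum>j\<in>UNIV. v $ j * frechet_derivative (\<lambda>w. T w $ k) (at w) (axis j 1))"
      by (simp add: linear_sum[OF lin] several_holomorphic_on_derivative_scale[OF hol w])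
    then show ?thesis by (simp add: basis_expansion matrix_vector_mult_def jac_def mult.commute)
  qed
  have "((\<lambda>w. \<Sum>k\<in>UNIV. (T w $ k) *s axis k 1) has_derivative
     (\<lambda>v. \<Sum>k\<in>UNIV. frechet_derivative (\<lambda>w. T w $ k) (at w) v *s axis k 1)) (at w)"
    by (intro has_derivative_sum bounded_linear.has_derivative[OF bounded_linear_vector_scalar]
        several_holomorphic_on_has_derivative[OF hol w])
  then show ?thesis unfolding basis_expansion D by simp
qed

lemma frechet_derivative_wirtinger:
  fixes f :: "complex^'n \<Rightarrow> complex"
  assumes f: "f differentiable (at p)"
  shows "frechet_derivative f (at p) v = (\<Sum>k\<in>UNIV. dz k f p * v $ k + dzb k f p * cnj (v $ k))"
proof -
  have lin: "linear (frechet_derivative f (at p))" using linear_frechet_derivative[OF f] .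
  have v: "v = (\<Sum>k\<in>UNIV. Re (v $ k) *\<^sub>R axis k 1 + Im (v $ k) *\<^sub>R axis k \<i>)"
  proof -
    have "Re (v $ k) *\<^sub>R axis k 1 + Im (v $ k) *\<^sub>R axis k \<i> = v $ k *s axis k 1" for k
      by (simp add: vec_eq_iff axis_def complex_eq_iff)
    then show ?thesis by (simp add: basis_expansion)
  qed
  have "frechet_derivative f (at p) v
      = (\<Sum>k\<in>UNIV. Re (v $ k) *\<^sub>R frechet_derivative f (at p) (axis k 1) + Im (v $ k) *\<^sub>R frechet_derivative f (at p) (axis k \<i>))"
    by (subst v) (simp add: linear_sum[OF lin] linear_add[OF lin] linear_cmul[OF lin])
  also have "\<dots> = (\<Sum>k\<in>UNIV. dz k f p * v $ k + dzb k f p * cnj (v $ k))"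
    unfolding dop_def by (intro sum.cong refl) (simp add: complex_eq_iff algebra_simps add_divide_distrib diff_divide_distrib)
  finally show ?thesis .
qed

lemma holomorphic_chain:
  fixes f :: "complex^'m \<Rightarrow> complex" and T :: "complex^'n \<Rightarrow> complex^'m"
  assumes T: "holomorphic_map T S" and w: "w \<in> S" and f: "f differentiable (at (T w))"
  shows "(\<lambda>w. f (T w)) differentiable (at w)"
    "dz j (\<lambda>w. f (T w)) w = (\<Sum>k\<in>UNIV. dz k f (T w) * jac T w $ k $ j)"
    "dzb j (\<lambda>w. f (T w)) w = (\<Sum>k\<in>UNIV. dzb k f (T w) * cnj (jac T w $ k $ j))"
proof -
  have d: "((\<lambda>w. f (T w)) has_derivative (\<lambda>v. frechet_derivative f (at (T w)) (jac T w *v v))) (at w)"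
    using has_derivative_compose[OF holomorphic_map_has_derivative[OF T w]] f frechet_derivative_works by blast
  then show "(\<lambda>w. f (T w)) differentiable (at w)" by (rule differentiableI)
  have ax: "(jac T w *v axis j c) $ k = jac T w $ k $ j * c" for c k
    by (simp add: matrix_vector_mult_def axis_def if_distrib cong: if_cong)
  define X where "X = (\<Sum>k\<in>UNIV. dz k f (T w) * jac T w $ k $ j)"
  define Y where "Y = (\<Sum>k\<in>UNIV. dzb k f (T w) * cnj (jac T w $ k $ j))"
  have D: "frechet_derivative (\<lambda>w. f (T w)) (at w) (axis j c) = X * c + Y * cnj c" for c
    unfolding frechet_derivative_at[OF d, symmetric] frechet_derivative_wirtinger[OF f] ax
    by (simp add: X_def Y_def sum.distrib sum_distrib_left sum_distrib_right mult_ac)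
  show "dz j (\<lambda>w. f (T w)) w = X" "dzb j (\<lambda>w. f (T w)) w = Y"
    unfolding dop_def D by (simp_all add: algebra_simps)
qed

lemma jac_holomorphic:
  assumes "holomorphic_map T S" "open S"
  shows "several_holomorphic_on (\<lambda>w. jac T w $ k $ j) S"
  using assms several_holomorphic_derivative[of "\<lambda>w. T w $ k" S] by (simp add: jac_def holomorphic_map_def)

text \<open>Second derivatives of T do not appear: dbar produces only the conjugate Jacobian, and
  \<partial> annihilates that. Hence the complex Hessian transforms like a Hermitian form.\<close>

lemma hessian_chain:
  fixes f :: "complex^'m \<Rightarrow> complex" and T :: "complex^'n \<Rightarrow> complex^'m"
  assumes T: "holomorphic_map T S" and S: "open S" "w \<in> S" and f: "Cinf_on O' f" "open O'" "T ` S \<subseteq> O'"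
  shows "dz k (dzb l (\<lambda>w. f (T w))) w =
    (\<Sum>m\<in>UNIV. \<Sum>r\<in>UNIV. dz m (dzb r f) (T w) * jac T w $ m $ k * cnj (jac T w $ r $ l))"
proof -
  have fd: "f differentiable (at (T v))" if "v \<in> S" for v
    using Cinf_on_differentiable[OF f(1)] f(3) that by blast
  have gd: "dzb r f differentiable (at (T v))" if "v \<in> S" for v r
    using Cinf_on_differentiable[OF Cinf_on_dop[OF f(2,1)]] f(3) that by blast
  have jd: "(\<lambda>w. jac T w $ r $ l) differentiable (at w)" for r l
    using several_holomorphic_on_has_derivative[OF jac_holomorphic[OF T S(1)] S(2)] differentiableI by blast
  have jz: "dz k (\<lambda>w. cnj (jac T w $ r $ l)) w = 0" for r
    using several_holomorphic_dzb[OF jac_holomorphic[OF T S(1)] S(2), of k r l] by (simp add: dop_cnj[OF jd])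
  have "dz k (dzb l (\<lambda>w. f (T w))) w = dz k (\<lambda>v. \<Sum>r\<in>UNIV. dzb r f (T v) * cnj (jac T v $ r $ l)) w"
    by (rule dop_cong[OF S]) (rule holomorphic_chain(3)[OF T _ fd])
  also have "\<dots> = (\<Sum>r\<in>UNIV. dz k (\<lambda>v. dzb r f (T v) * cnj (jac T v $ r $ l)) w)"
    by (rule dop_sum) (auto intro!: differentiable_mult holomorphic_chain(1)[OF T S(2)] gd S(2) differentiable_cnj jd)
  also have "\<dots> = (\<Sum>r\<in>UNIV. dz k (\<lambda>v. dzb r f (T v)) w * cnj (jac T w $ r $ l))"
    by (intro sum.cong refl, subst dop_mult) (auto simp: jz intro!: holomorphic_chain(1)[OF T S(2)] gd S(2) differentiable_cnj jd)
  also have "\<dots> = (\<Sum>r\<in>UNIV. \<Sum>m\<in>UNIV. dz m (dzb r f) (T w) * jac T w $ m $ k * cnj (jac T w $ r $ l))"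
    by (simp add: holomorphic_chain(2)[OF T S(2) gd[OF S(2)]] sum_distrib_right)
  finally show ?thesis by (subst sum.swap)
qed

lemma complex_hessian_nth:
  "complex_hessian axis f p $ k $ l = dz k (dzb l (\<lambda>w. complex_of_real (f w))) p"
  by (simp add: complex_hessian_def wirtinger_eq_dop wirtinger_bar_eq_dop)

lemma complex_hessian_chain:
  fixes f :: "complex^'m \<Rightarrow> real" and T :: "complex^'n \<Rightarrow> complex^'m"
  assumes T: "holomorphic_map T S" and S: "open S" "w \<in> S" and f: "Cinf_on O' f" "open O'" "T ` S \<subseteq> O'"
  shows "complex_hessian axis (\<lambda>w. f (T w)) w =
    transpose (jac T w) ** complex_hessian axis f (T w) ** cnjmat (jac T w)"
proof -
  have "complex_hessian axis (\<lambda>w. f (T w)) w $ k $ l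
      = (transpose (jac T w) ** complex_hessian axis f (T w) ** cnjmat (jac T w)) $ k $ l" for k l
    unfolding complex_hessian_nth
    by (subst hessian_chain[OF T S Cinf_on_of_real[OF f(2,1)] f(2,3)], subst sum.swap)
      (simp add: matrix_matrix_mult_def complex_hessian_nth transpose_def cnjmat_def sum_distrib_left sum_distrib_right mult_ac)
  then show ?thesis by (simp add: vec_eq_iff)
qed

lemma complex_hessian_hermitian:
  assumes "Cinf_on S f" "open S" "p \<in> S"
  shows "hermitian (complex_hessian axis f p)"
proof -
  let ?f = "\<lambda>w. complex_of_real (f w)"
  have c: "Cinf_on S ?f" using Cinf_on_of_real assms by blast
  have "cnj (dz i (dzb j ?f) p) = dz j (dzb i ?f) p" for i j
  proof -
    have "cnj (dz i (dzb j ?f) p) = dzb i (\<lambda>q. cnj (dzb j ?f q)) p"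
      using Cinf_on_differentiable[OF Cinf_on_dop[OF assms(2) c] assms(3)] by (simp add: dop_cnj)
    also have "\<dots> = dzb i (dz j ?f) p"
    proof (rule dop_cong[OF assms(2,3)])
      fix q assume "q \<in> S"
      from dop_cnj[OF Cinf_on_differentiable[OF c this], of "- \<i>" "axis j 1" "axis j \<i>"]
      show "cnj (dzb j ?f q) = dz j ?f q" by simp
    qed
    also have "\<dots> = dz j (dzb i ?f) p" by (rule dop_commute[OF assms(2) c assms(3)])
    finally show ?thesis .
  qed
  then show ?thesis by (simp add: hermitian_def complex_hessian_nth)
qed

text \<open>If \<open>exp L = |h|\<^sup>2\<close> then \<open>dzbar L\<close> is the conjugate of the holomorphic function \<open>dz h / h\<close>.\<close>

lemma pluriharmonic_log:
  assumes h: "several_holomorphic_on h S" "open S" "\<And>w. w \<in> S \<Longrightarrow> h w \<noteq> 0" and p: "p \<in> S"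
    and L: "Cinf_on S L" "\<And>w. w \<in> S \<Longrightarrow> exp (L w) = h w * cnj (h w)"
  shows "dz k (dzb l L) p = 0"
proof -
  have hd: "h differentiable (at w)" if "w \<in> S" for w
    using several_holomorphic_on_has_derivative[OF h(1) that] differentiableI by blast
  have c: "Cinf_on S (\<lambda>w. dz l h w / h w)"
    using several_holomorphic_Cinf_on[OF h(2,1)] h by (intro Cinf_on_divide Cinf_on_dop) auto
  have 1: "dzb l L w = cnj (dz l h w / h w)" if w: "w \<in> S" for w
  proof -
    have "exp (L w) * dzb l L w = dzb l (\<lambda>w. exp (L w)) w"
      using dop_exp[OF Cinf_on_differentiable[OF L(1) w]] by simp
    also have "\<dots> = dzb l (\<lambda>w. h w * cnj (h w)) w" by (rule dop_cong[OF h(2) w]) (rule L(2))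
    also have "\<dots> = h w * cnj (dz l h w)"
      using several_holomorphic_dzb[OF h(1) w] by (simp add: dop_mult hd w differentiable_cnj dop_cnj)
    finally have "h w * (cnj (h w) * dzb l L w) = h w * cnj (dz l h w)" by (simp add: L(2) w)
    then show ?thesis using h(3)[OF w] by (simp add: field_simps)
  qed
  have hol: "dzb k (\<lambda>w. dz l h w / h w) p = 0"
  proof -
    have dzh: "several_holomorphic_on (dz l h) S"
      by (rule several_holomorphic_on_cong[OF h(2) several_holomorphic_derivative[OF h(1,2), of "axis l 1"]])
        (simp add: several_holomorphic_dz[OF h(1)])
    have "dzb k (\<lambda>w. h w * (dz l h w / h w)) p = dzb k (dz l h) p"
      by (rule dop_cong[OF h(2) p]) (simp add: h(3))
    also have "\<dots> = 0" by (rule several_holomorphic_dzb[OF dzh p])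
    finally have "h p * dzb k (\<lambda>w. dz l h w / h w) p = 0"
      unfolding dop_mult[OF hd[OF p] Cinf_on_differentiable[OF c p]] several_holomorphic_dzb[OF h(1) p] by simp
    then show ?thesis using h(3)[OF p] by simp
  qed
  have "dz k (dzb l L) p = dz k (\<lambda>w. cnj (dz l h w / h w)) p" by (rule dop_cong[OF h(2) p]) (rule 1)
  also have "\<dots> = 0" using hol by (simp add: dop_cnj[OF Cinf_on_differentiable[OF c p]] del: complex_cnj_divide)
  finally show ?thesis .
qed

text \<open>The pairing of the \<open>(1,0)\<close>-form with coefficients \<open>a\<close> and the \<open>(0,1)\<close>-form with coefficients \<open>b\<close>.\<close>

definition pform :: "complex^'n^'n \<Rightarrow> complex^'n \<Rightarrow> complex^'n \<Rightarrow> complex" where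
  "pform G a b = (\<Sum>j\<in>UNIV. \<Sum>k\<in>UNIV. matrix_inv G $ j $ k * b $ j * a $ k)"

lemma pform_eq: "pform G a b = (\<Sum>j\<in>UNIV. b $ j * (matrix_inv G *v a) $ j)"
  by (simp add: pform_def matrix_vector_mult_def sum_distrib_left mult_ac)

lemma det_transpose_cnjmat: "det (cnjmat J) = cnj (det J)"
  by (simp add: cnjmat_def det_cnj)

text \<open>The vector y dual to the transformed form is pushed by the conjugate Jacobian to the
  vector dual to a. This is what makes the fibrewise pairing independent of coordinates.\<close>

lemma pform_chain:
  fixes G :: "complex^'n^'n"
  assumes G: "det G \<noteq> 0" and J: "det J \<noteq> 0"
  shows "pform (transpose J ** G ** cnjmat J) (transpose J *v a) (transpose (cnjmat J) *v b) = pform G a b"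
proof -
  define G' where "G' = transpose J ** G ** cnjmat J"
  define y where "y = matrix_inv G' *v (transpose J *v a)"
  have G': "det G' \<noteq> 0" using G J by (simp add: G'_def det_mul det_transpose det_transpose_cnjmat)
  have "G' *v y = transpose J *v a"
    unfolding y_def matrix_vector_mul_assoc[of G'] using matrix_inv_inverse[OF G'] by (simp del: transpose_matrix_vector)
  then have "transpose J *v (G *v (cnjmat J *v y)) = transpose J *v a"
    by (simp add: G'_def matrix_vector_mul_assoc matrix_mul_assoc del: transpose_matrix_vector)
  then have "matrix_inv (transpose J) *v (transpose J *v (G *v (cnjmat J *v y))) = matrix_inv (transpose J) *v (transpose J *v a)"
    by (simp only:)
  then have "G *v (cnjmat J *v y) = a"
    using matrix_inv_inverse[of "transpose J"] J by (simp add: matrix_vector_mul_assoc[of "matrix_inv (transpose J)"] det_transpose del: transpose_matrix_vector)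
  then have "matrix_inv G *v (G *v (cnjmat J *v y)) = matrix_inv G *v a" by simp
  then have y: "cnjmat J *v y = matrix_inv G *v a"
    using matrix_inv_inverse[OF G] by (simp add: matrix_vector_mul_assoc[of "matrix_inv G"])
  have "pform G' (transpose J *v a) (transpose (cnjmat J) *v b) = (\<Sum>j\<in>UNIV. (transpose (cnjmat J) *v b) $ j * y $ j)"
    by (simp add: pform_eq y_def del: transpose_matrix_vector)
  also have "\<dots> = (\<Sum>j\<in>UNIV. \<Sum>r\<in>UNIV. b $ r * (cnjmat J $ r $ j * y $ j))"
    by (simp add: matrix_vector_mult_def transpose_def sum_distrib_left sum_distrib_right mult_ac del: transpose_matrix_vector)
  also have "\<dots> = (\<Sum>r\<in>UNIV. b $ r * (cnjmat J *v y) $ r)"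
    by (subst sum.swap) (simp add: matrix_vector_mult_def sum_distrib_left)
  finally show ?thesis by (simp add: y G'_def pform_eq)
qed

lemma pform_hermitian:
  fixes G :: "complex^'n^'n"
  assumes "hermitian G" "det G \<noteq> 0"
  shows "cnj (pform G a b) = pform G (\<chi> j. cnj (b $ j)) (\<chi> k. cnj (a $ k))"
proof -
  have "cnj (matrix_inv G $ j $ k) = matrix_inv G $ k $ j" for j k
    using hermitian_matrix_inv[OF assms] by (simp add: hermitian_def)
  then have "cnj (pform G a b) = (\<Sum>j\<in>UNIV. \<Sum>k\<in>UNIV. matrix_inv G $ k $ j * cnj (b $ j) * cnj (a $ k))"
    by (simp add: pform_def)
  also have "\<dots> = pform G (\<chi> j. cnj (b $ j)) (\<chi> k. cnj (a $ k))"
    by (subst sum.swap) (simp add: pform_def mult_ac)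
  finally show ?thesis .
qed

section \<open>Charts and the volume measure\<close>

lemma Ck_on_local:
  assumes "\<And>p. p \<in> S \<Longrightarrow> \<exists>N. open N \<and> p \<in> N \<and> Ck_on k N f"
  shows "Ck_on k S f"
  using assms
proof (induction k arbitrary: f)
  case 0
  show ?case
  proof (simp, rule continuous_at_imp_continuous_on, rule ballI)
    fix p assume "p \<in> S"
    with 0 obtain N where "open N" "p \<in> N" "continuous_on N f" by auto
    then show "isCont f p" by (simp add: continuous_on_eq_continuous_at)
  qed
next
  case (Suc k)
  have "f differentiable (at p)" if "p \<in> S" for p using Suc.prems[OF that] by auto
  moreover have "Ck_on k S (\<lambda>p. frechet_derivative f (at p) v)" for v
    by (rule Suc.IH) (use Suc.prems in fastforce)
  ultimately show ?case by simp
qed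

lemma Cinf_on_local:
  assumes "\<And>p. p \<in> S \<Longrightarrow> \<exists>N. open N \<and> p \<in> N \<and> Cinf_on N f"
  shows "Cinf_on S f"
  using assms unfolding Cinf_on_def by (metis Ck_on_local)

section \<open>Charts and transition maps of a compact complex manifold\<close>

locale complex_manifold =
  fixes atlas :: "('z::t2_space, 'n::finite) chart set"
  assumes manifold: "compact_complex_manifold atlas"
begin

lemma compact_space: "compact (UNIV :: 'z set)"
  using manifold by (simp add: compact_complex_manifold_def)

lemma chart_exists: obtains c where "c \<in> atlas" "z \<in> fst c"
  using manifold unfolding compact_complex_manifold_def by blast

lemma
  assumes "c \<in> atlas"
  shows open_chart: "open (fst c)"
    and open_chart_image_UNIV: "open (chart_image c UNIV)"
    and homeomorphism_chart: "homeomorphism (fst c) (chart_image c UNIV) (snd c) (chart_inv c)"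
  using manifold assms unfolding compact_complex_manifold_def by blast+

lemma chart_inv_in:
  "c \<in> atlas \<Longrightarrow> w \<in> chart_image c UNIV \<Longrightarrow> chart_inv c w \<in> fst c"
  using homeomorphism_chart[of c] unfolding homeomorphism_def by blast

lemma chart_chart_inv:
  "c \<in> atlas \<Longrightarrow> w \<in> chart_image c UNIV \<Longrightarrow> snd c (chart_inv c w) = w"
  using homeomorphism_chart[of c] unfolding homeomorphism_def by blast

lemma chart_inv_chart [simp]: "c \<in> atlas \<Longrightarrow> z \<in> fst c \<Longrightarrow> chart_inv c (snd c z) = z"
  using homeomorphism_chart[of c] unfolding homeomorphism_def by blast

lemma chart_in_image: "z \<in> fst c \<Longrightarrow> z \<in> A \<Longrightarrow> snd c z \<in> chart_image c A"
  by (auto simp: chart_image_def)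

lemma chart_image_subset: "chart_image c A \<subseteq> chart_image c UNIV"
  by (auto simp: chart_image_def)

lemma chart_image_mono: "A \<subseteq> B \<Longrightarrow> chart_image c A \<subseteq> chart_image c B"
  by (auto simp: chart_image_def)

lemma mem_chart_image:
  "c \<in> atlas \<Longrightarrow> w \<in> chart_image c A \<longleftrightarrow> w \<in> chart_image c UNIV \<and> chart_inv c w \<in> A"
  using chart_inv_in[of c w] chart_chart_inv[of c w] by (auto simp: chart_image_def)

lemma chart_imageD:
  assumes "c \<in> atlas" "w \<in> chart_image c A"
  shows "w \<in> chart_image c UNIV" "chart_inv c w \<in> A" "chart_inv c w \<in> fst c" "snd c (chart_inv c w) = w"
proof -
  show w: "w \<in> chart_image c UNIV" and "chart_inv c w \<in> A"
    using assms(2) unfolding mem_chart_image[OF assms(1), of w A] by blast+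
  show "chart_inv c w \<in> fst c" "snd c (chart_inv c w) = w"
    by (rule chart_inv_in[OF assms(1) w], rule chart_chart_inv[OF assms(1) w])
qed

lemma continuous_chart_inv: "c \<in> atlas \<Longrightarrow> continuous_on (chart_image c UNIV) (chart_inv c)"
  using homeomorphism_chart[of c] by (simp add: homeomorphism_def)

lemma continuous_chart: "c \<in> atlas \<Longrightarrow> continuous_on (fst c) (snd c)"
  using homeomorphism_chart[of c] by (simp add: homeomorphism_def)

lemma open_chart_image:
  assumes "c \<in> atlas" "open A"
  shows "open (chart_image c A)"
proof -
  have "chart_image c A = chart_image c UNIV \<inter> chart_inv c -` A"
    using mem_chart_image[OF assms(1), of _ A] by blast
  then show ?thesis
    using continuous_open_preimage[OF continuous_chart_inv open_chart_image_UNIV assms(2)] assms(1) by simp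
qed

lemma borel_chart_image:
  assumes "c \<in> atlas" "A \<in> sets borel"
  shows "chart_image c A \<in> sets borel"
proof -
  have "chart_image c A = chart_inv c -` A \<inter> chart_image c UNIV"
    using mem_chart_image[OF assms(1), of _ A] by blast
  moreover have "chart_inv c \<in> borel_measurable (restrict_space borel (chart_image c UNIV))"
    by (rule borel_measurable_continuous_on_restrict[OF continuous_chart_inv[OF assms(1)]])
  ultimately show ?thesis
    using measurable_sets[of "chart_inv c" "restrict_space borel (chart_image c UNIV)" borel A] assms(2)
      open_chart_image_UNIV[OF assms(1)]
    by (simp add: space_restrict_space sets_restrict_space_iff)
qed

definition trans :: "('z, 'n) chart \<Rightarrow> ('z, 'n) chart \<Rightarrow> complex^'n \<Rightarrow> complex^'n" where
  "trans c d w = snd d (chart_inv c w)"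

lemma trans_holomorphic: "c \<in> atlas \<Longrightarrow> d \<in> atlas \<Longrightarrow> holomorphic_map (trans c d) (chart_image c (fst d))"
  using manifold by (simp add: compact_complex_manifold_def holomorphic_map_def trans_def)

lemma
  assumes "c \<in> atlas" "d \<in> atlas" "w \<in> chart_image c (fst d)"
  shows chart_inv_trans: "chart_inv d (trans c d w) = chart_inv c w"
    and trans_in: "trans c d w \<in> chart_image d (fst c)"
    and trans_trans: "trans d c (trans c d w) = w"
  using assms chart_imageD[OF assms(1,3)] by (simp_all add: trans_def chart_in_image)

lemma trans_image:
  assumes "c \<in> atlas" "d \<in> atlas" "A \<subseteq> fst c" "A \<subseteq> fst d"
  shows "trans c d ` chart_image c A = chart_image d A"
  using assms by (force simp: trans_def chart_image_def image_iff)

lemma trans_inj: "c \<in> atlas \<Longrightarrow> d \<in> atlas \<Longrightarrow> inj_on (trans c d) (chart_image c (fst d))"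
  by (rule inj_on_inverseI[of _ "trans d c"]) (rule trans_trans)

text \<open>Differentiating the identity \<open>trans_trans\<close> exhibits an inverse of the
  Jacobian.\<close>

lemma det_jac_trans:
  assumes "c \<in> atlas" "d \<in> atlas" "w \<in> chart_image c (fst d)"
  shows "det (jac (trans c d) w) \<noteq> 0"
proof -
  have "((\<lambda>w. trans d c (trans c d w)) has_derivative
     (\<lambda>v. jac (trans d c) (trans c d w) *v (jac (trans c d) w *v v))) (at w)"
    by (rule has_derivative_compose[OF holomorphic_map_has_derivative[OF trans_holomorphic[OF assms(1,2)] assms(3)]
          holomorphic_map_has_derivative[OF trans_holomorphic[OF assms(2,1)] trans_in[OF assms]]])
  then have "((\<lambda>w. w) has_derivative
     (\<lambda>v. jac (trans d c) (trans c d w) *v (jac (trans c d) w *v v))) (at w)"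
    by (rule has_derivative_transform_within_open[OF _ open_chart_image[OF assms(1) open_chart[OF assms(2)]] assms(3)])
      (rule trans_trans[OF assms(1,2)])
  then have "(\<lambda>v. jac (trans d c) (trans c d w) *v (jac (trans c d) w *v v)) = (\<lambda>v. v)"
    using has_derivative_unique has_derivative_ident by blast
  then have "jac (trans d c) (trans c d w) ** jac (trans c d) w = mat 1"
    unfolding matrix_eq by (metis matrix_vector_mul_assoc matrix_vector_mul_lid)
  then have "det (jac (trans d c) (trans c d w)) * det (jac (trans c d) w) = 1"
    by (metis det_I det_mul)
  then show ?thesis by auto
qed

text \<open>A measure on Z can be assembled from such pieces, since they are disjoint and each sees
  a single chart.\<close>

lemma finite_chart_cover:
  obtains cs :: "('z, 'n) chart list" and E :: "nat \<Rightarrow> 'z set"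
  where "set cs \<subseteq> atlas" "disjoint_family E" "\<And>i. E i \<in> sets borel" "(\<Union>i<length cs. E i) = UNIV"
    "\<And>i. i < length cs \<Longrightarrow> E i \<subseteq> fst (cs ! i)"
proof -
  obtain C where C: "C \<subseteq> atlas" "finite C" "UNIV \<subseteq> (\<Union>c\<in>C. fst c)"
  proof (rule compactE_image[OF compact_space, of atlas fst])
    show "open (fst c)" if "c \<in> atlas" for c using open_chart[OF that] .
    show "UNIV \<subseteq> (\<Union>c\<in>atlas. fst c)" using chart_exists by blast
  qed
  obtain cs where cs: "set cs = C" using C(2) finite_list by blast
  define A where "A i = (if i < length cs then fst (cs ! i) else {})" for i
  define E where "E = disjointed A"
  have EA: "E i \<subseteq> A i" for i by (simp add: E_def disjointed_subset)
  have Ab: "A i \<in> sets borel" for i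
  proof -
    have "cs ! i \<in> atlas" if "i < length cs" using that cs C(1) by auto
    then show ?thesis using open_chart by (auto simp: A_def)
  qed
  have "(\<Union>i. E i) = (\<Union>i. A i)" by (simp add: E_def UN_disjointed_eq)
  also have "\<dots> = UNIV"
  proof -
    have "\<exists>i. z \<in> A i" for z
    proof -
      obtain c where "c \<in> set cs" "z \<in> fst c" using C(3) cs by blast
      then show ?thesis unfolding A_def by (metis in_set_conv_nth)
    qed
    then show ?thesis by blast
  qed
  finally have "z \<in> (\<Union>i<length cs. E i)" for z
  proof -
    assume "(\<Union>i. E i) = UNIV"
    then obtain i where "z \<in> E i" by blast
    moreover from this EA[of i] have "i < length cs" by (auto simp: A_def split: if_splits)
    ultimately show ?thesis by blast
  qed
  then have U: "(\<Union>i<length cs. E i) = UNIV" by blast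
  show ?thesis
  proof (rule that[of cs E])
    show "set cs \<subseteq> atlas" using cs C by simp
    show "disjoint_family E" by (simp add: E_def disjoint_family_disjointed)
    show "E i \<in> sets borel" for i
      using sets.range_disjointed_sets[of A borel] Ab by (auto simp: E_def)
    show "E i \<subseteq> fst (cs ! i)" if "i < length cs" for i using EA[of i] that by (simp add: A_def)
  qed (rule U)
qed

end

section \<open>Line bundles, metrics and their curvature matrices\<close>

locale line_bundle = complex_manifold atlas
  for atlas :: "('z::t2_space, 'n::finite) chart set" +
  fixes W :: "'i \<Rightarrow> 'z set" and g :: "'i \<Rightarrow> 'i \<Rightarrow> 'z \<Rightarrow> complex"
  assumes lb: "holomorphic_line_bundle atlas W g"
begin

lemma open_W: "open (W i)"
  using lb by (simp add: holomorphic_line_bundle_def)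

lemma W_exists: obtains i where "z \<in> W i"
  using lb unfolding holomorphic_line_bundle_def by blast

lemma W_some: "z \<in> W (SOME i. z \<in> W i)"
  using W_exists[of z] someI_ex[of "\<lambda>i. z \<in> W i"] by blast

lemma g_nonzero: "z \<in> W i \<Longrightarrow> z \<in> W j \<Longrightarrow> g i j z \<noteq> 0"
  using lb by (simp add: holomorphic_line_bundle_def)

lemma g_holomorphic:
  "c \<in> atlas \<Longrightarrow> several_holomorphic_on (\<lambda>w. g i j (chart_inv c w)) (chart_image c (W i \<inter> W j))"
  using lb by (simp add: holomorphic_line_bundle_def manifold_holomorphic_on_def)

end

locale metric = line_bundle atlas W g
  for atlas :: "('z::t2_space, 'n::finite) chart set" and W :: "'i \<Rightarrow> 'z set" and g +
  fixes \<eta> :: "'i \<Rightarrow> 'z \<Rightarrow> real"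
  assumes smooth: "smooth_metric atlas W g \<eta>"
    and positive: "positive_metric atlas W \<eta>"
begin

abbreviation "G \<equiv> curvature_matrix W \<eta>"

lemma metric_transform:
  "z \<in> W i \<Longrightarrow> z \<in> W j \<Longrightarrow> \<eta> i z = \<eta> j z + ln ((cmod (g i j z))\<^sup>2)"
  using smooth unfolding smooth_metric_def metric_compatible_def by blast

lemma metric_Cinf: "c \<in> atlas \<Longrightarrow> Cinf_on (chart_image c (W i)) (\<lambda>w. \<eta> i (chart_inv c w))"
  using smooth unfolding smooth_metric_def manifold_smooth_on_def by blast

text \<open>Frees the curvature matrix from the trivialisation picked by \<open>SOME\<close>: two
  weights differ by the logarithm of |g|^2, whose complex Hessian vanishes by
  \<open>pluriharmonic_log\<close>.\<close>

lemma curvature_matrix_eq: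
  assumes c: "c \<in> atlas" "z \<in> fst c" "z \<in> W i"
  shows "G c z = complex_hessian axis (\<lambda>w. \<eta> i (chart_inv c w)) (snd c z)"
proof -
  define j where "j = (SOME i. z \<in> W i)"
  have j: "z \<in> W j" unfolding j_def by (rule W_some)
  define S where "S = chart_image c (W j \<inter> W i)"
  have S: "open S" "snd c z \<in> S"
    using c j open_W by (auto simp: S_def intro!: open_chart_image chart_in_image)
  define L where "L w = complex_of_real (ln ((cmod (g j i (chart_inv c w)))\<^sup>2))" for w
  have Wi: "chart_inv c w \<in> W i" "chart_inv c w \<in> W j" if "w \<in> S" for w
    using chart_imageD(2)[OF c(1) that[unfolded S_def]] by blast+
  have eq: "complex_of_real (\<eta> j (chart_inv c w)) = complex_of_real (\<eta> i (chart_inv c w)) + L w" if "w \<in> S" for w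
    unfolding L_def by (subst metric_transform[OF Wi(2,1)[OF that]]) simp
  have ci: "Cinf_on S (\<lambda>w. complex_of_real (\<eta> i (chart_inv c w)))"
    if "S \<subseteq> chart_image c (W i)" for i
    using S(1) Cinf_on_subset[OF metric_Cinf[OF c(1)] that] by (rule Cinf_on_of_real)
  have Si: "S \<subseteq> chart_image c (W i)" and Sj: "S \<subseteq> chart_image c (W j)"
    by (auto simp: S_def chart_image_def)
  have L: "Cinf_on S L"
    by (subst Cinf_on_cong[OF S(1), of L "\<lambda>w. complex_of_real (\<eta> j (chart_inv c w)) - complex_of_real (\<eta> i (chart_inv c w))"])
      (auto simp: eq intro!: Cinf_on_diff S ci Si Sj)
  have expL: "exp (L w) = g j i (chart_inv c w) * cnj (g j i (chart_inv c w))" if "w \<in> S" for w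
    using g_nonzero[OF Wi(2,1)[OF that]] unfolding L_def exp_of_real by (simp flip: complex_norm_square)
  have "dz k (dzb l (\<lambda>w. complex_of_real (\<eta> j (chart_inv c w)))) (snd c z)
     = dz k (dzb l (\<lambda>w. complex_of_real (\<eta> i (chart_inv c w)))) (snd c z)" for k l
  proof -
    have "dz k (dzb l (\<lambda>w. complex_of_real (\<eta> j (chart_inv c w)))) (snd c z)
      = dz k (\<lambda>w. dzb l (\<lambda>w. complex_of_real (\<eta> i (chart_inv c w))) w + dzb l L w) (snd c z)"
    proof (rule dop_cong[OF S])
      fix q assume q: "q \<in> S"
      have "dzb l (\<lambda>w. complex_of_real (\<eta> j (chart_inv c w))) q = dzb l (\<lambda>w. complex_of_real (\<eta> i (chart_inv c w)) + L w) q"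
        by (rule dop_cong[OF S(1) q]) (rule eq)
      also have "\<dots> = dzb l (\<lambda>w. complex_of_real (\<eta> i (chart_inv c w))) q + dzb l L q"
        by (rule dop_add) (auto intro: Cinf_on_differentiable[OF _ q] ci[OF Si] L)
      finally show "dzb l (\<lambda>w. complex_of_real (\<eta> j (chart_inv c w))) q = dzb l (\<lambda>w. complex_of_real (\<eta> i (chart_inv c w))) q + dzb l L q" .
    qed
    also have "\<dots> = dz k (dzb l (\<lambda>w. complex_of_real (\<eta> i (chart_inv c w)))) (snd c z) + dz k (dzb l L) (snd c z)"
      by (rule dop_add) (auto intro!: Cinf_on_differentiable[OF _ S(2)] Cinf_on_dop S ci[OF Si] L)
    also have "dz k (dzb l L) (snd c z) = 0"
      by (rule pluriharmonic_log[OF _ S(1) _ S(2) L expL])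
        (use g_holomorphic[OF c(1), of j i] g_nonzero Wi in \<open>auto simp: S_def\<close>)
    finally show ?thesis by simp
  qed
  then show ?thesis
    unfolding curvature_matrix_def j_def[symmetric] Let_def by (simp add: vec_eq_iff complex_hessian_nth)
qed

lemma curvature_matrix_chart:
  assumes c: "c \<in> atlas" "w \<in> chart_image c (W i)"
  shows "G c (chart_inv c w) = complex_hessian axis (\<lambda>w. \<eta> i (chart_inv c w)) w"
  using curvature_matrix_eq[OF c(1), of "chart_inv c w" i] chart_imageD[OF c] by simp

lemma chart_image_W_exists:
  assumes "c \<in> atlas" "w \<in> chart_image c UNIV"
  obtains i where "w \<in> chart_image c (W i)"
  using W_exists[of "chart_inv c w"] mem_chart_image[OF assms(1)] assms(2) by blast

lemma curvature_matrix_hermitian: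
  assumes c: "c \<in> atlas" "z \<in> fst c"
  shows "hermitian (G c z)"
proof -
  obtain i where i: "z \<in> W i" by (rule W_exists)
  show ?thesis unfolding curvature_matrix_eq[OF c i]
    by (rule complex_hessian_hermitian[OF metric_Cinf[OF c(1)] open_chart_image[OF c(1) open_W]])
      (rule chart_in_image[OF c(2) i])
qed

lemma curvature_matrix_positive: "c \<in> atlas \<Longrightarrow> z \<in> fst c \<Longrightarrow> positive_definite (G c z)"
  using positive by (simp add: positive_metric_def)

lemma curvature_matrix_det:
  assumes "c \<in> atlas" "z \<in> fst c"
  shows "det (G c z) \<noteq> 0" "0 < Re (det (G c z))" "Im (det (G c z)) = 0"
  using positive_definite_det_pos[OF curvature_matrix_positive[OF assms] curvature_matrix_hermitian[OF assms]]
  by auto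

lemma curvature_matrix_Cinf:
  assumes c: "c \<in> atlas"
  shows "Cinf_on (chart_image c UNIV) (\<lambda>w. G c (chart_inv c w) $ k $ l)"
proof (rule Cinf_on_local)
  fix w assume "w \<in> chart_image c UNIV"
  then obtain i where i: "w \<in> chart_image c (W i)" using chart_image_W_exists[OF c] by blast
  have o: "open (chart_image c (W i))" by (rule open_chart_image[OF c open_W])
  have "Cinf_on (chart_image c (W i)) (\<lambda>w. complex_hessian axis (\<lambda>w. \<eta> i (chart_inv c w)) w $ k $ l)"
    unfolding complex_hessian_nth by (intro Cinf_on_dop Cinf_on_of_real o metric_Cinf c)
  then have "Cinf_on (chart_image c (W i)) (\<lambda>w. G c (chart_inv c w) $ k $ l)"
    by (rule Cinf_on_cong[OF o, THEN iffD1, rotated]) (simp add: curvature_matrix_chart[OF c])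
  then show "\<exists>N. open N \<and> w \<in> N \<and> Cinf_on N (\<lambda>w. G c (chart_inv c w) $ k $ l)" using o i by blast
qed

lemma curvature_matrix_trans:
  assumes c: "c \<in> atlas" and d: "d \<in> atlas" and z: "z \<in> fst c" "z \<in> fst d"
  shows "G c z = transpose (jac (trans c d) (snd c z)) ** G d z ** cnjmat (jac (trans c d) (snd c z))"
proof -
  obtain i where i: "z \<in> W i" by (rule W_exists)
  define S where "S = chart_image c (fst d \<inter> W i)"
  have S: "open S" "snd c z \<in> S"
    using z i c open_W open_chart[OF d] by (auto simp: S_def intro!: open_chart_image chart_in_image)
  have Sd: "S \<subseteq> chart_image c (fst d)" unfolding S_def by (rule chart_image_mono) auto
  have T: "holomorphic_map (trans c d) S"
    using trans_holomorphic[OF c d] Sd by (auto simp: holomorphic_map_def intro: several_holomorphic_on_subset)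
  have im: "trans c d ` S \<subseteq> chart_image d (W i)"
  proof safe
    fix w assume w: "w \<in> S"
    have "trans c d w \<in> chart_image d UNIV" using trans_in[OF c d] Sd w chart_image_subset by blast
    moreover have "chart_inv d (trans c d w) \<in> W i"
      using chart_inv_trans[OF c d, of w] Sd w chart_imageD(2)[OF c w[unfolded S_def]] by auto
    ultimately show "trans c d w \<in> chart_image d (W i)" using mem_chart_image[OF d] by blast
  qed
  have "complex_hessian axis (\<lambda>w. \<eta> i (chart_inv c w)) (snd c z) = complex_hessian axis (\<lambda>w. \<eta> i (chart_inv d (trans c d w))) (snd c z)"
  proof -
    have "dz k (dzb l (\<lambda>w. complex_of_real (\<eta> i (chart_inv c w)))) (snd c z) =
       dz k (dzb l (\<lambda>w. complex_of_real (\<eta> i (chart_inv d (trans c d w))))) (snd c z)" for k l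
      by (rule dop_cong[OF S], rule dop_cong[OF S(1)]) (use chart_inv_trans[OF c d] Sd in auto)
    then show ?thesis by (simp add: vec_eq_iff complex_hessian_nth)
  qed
  also have "\<dots> = transpose (jac (trans c d) (snd c z)) ** complex_hessian axis (\<lambda>w. \<eta> i (chart_inv d w)) (trans c d (snd c z)) ** cnjmat (jac (trans c d) (snd c z))"
    by (rule complex_hessian_chain[OF T S metric_Cinf[OF d] open_chart_image[OF d open_W] im])
  also have "trans c d (snd c z) = snd d z" by (simp add: trans_def c z)
  finally show ?thesis unfolding curvature_matrix_eq[OF c z(1) i] curvature_matrix_eq[OF d z(2) i] .
qed

section \<open>The measure of the volume form\<close>

abbreviation "dens \<equiv> volume_density W \<eta>"

text \<open>The factor is precisely the Jacobian of
  \<open>nn_integral_change_of_variables_complex\<close>, so chart integrals agree on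
  overlaps.\<close>

lemma dens_trans:
  assumes c: "c \<in> atlas" and d: "d \<in> atlas" and w: "w \<in> chart_image c (fst d)"
  shows "dens c w = (cmod (det (jac (trans c d) w)))\<^sup>2 * dens d (trans c d w)"
proof -
  have z: "chart_inv c w \<in> fst c" "chart_inv c w \<in> fst d" "snd c (chart_inv c w) = w"
    using chart_imageD[OF c w] by blast+
  define J where "J = det (jac (trans c d) w)"
  have "det (G c (chart_inv c w)) = J * det (G d (chart_inv c w)) * cnj J"
    using curvature_matrix_trans[OF c d z(1,2)] by (simp add: det_mul det_transpose det_transpose_cnjmat z J_def)
  also have "\<dots> = of_real ((cmod J)\<^sup>2) * det (G d (chart_inv c w))"
    by (simp add: complex_norm_square mult_ac del: of_real_power)
  finally show ?thesis
    by (simp add: volume_density_def chart_inv_trans[OF c d w] J_def)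
qed

lemma dens_pos: "c \<in> atlas \<Longrightarrow> w \<in> chart_image c UNIV \<Longrightarrow> 0 < dens c w"
  using curvature_matrix_det(2)[OF _ chart_inv_in] by (simp add: volume_density_def)

lemma dens_continuous:
  assumes "c \<in> atlas"
  shows "continuous_on (chart_image c UNIV) (dens c)"
  unfolding volume_density_def
  by (intro continuous_intros Cinf_on_continuous Cinf_on_det open_chart_image_UNIV curvature_matrix_Cinf assms)

lemma dens_borel:
  assumes c: "c \<in> atlas" and A: "A \<in> sets borel"
  shows "(\<lambda>w. indicator (chart_image c A) w * dens c w) \<in> borel_measurable borel"
  using borel_measurable_continuous_on_indicator[OF borel_chart_image[OF c A] continuous_on_subset[OF dens_continuous[OF c] chart_image_subset]]
  by simp

definition nu :: "('z, 'n) chart \<Rightarrow> 'z set \<Rightarrow> ennreal" where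
  "nu c A = (\<integral>\<^sup>+ w\<in>chart_image c A. ennreal (dens c w) \<partial>lborel)"

definition chart_measure :: "('z, 'n) chart \<Rightarrow> (complex^'n) measure" where
  "chart_measure c = density lborel (\<lambda>w. ennreal (indicator (chart_image c UNIV) w * dens c w))"

lemma nu_eq_emeasure:
  assumes "c \<in> atlas" "A \<in> sets borel"
  shows "nu c A = emeasure (chart_measure c) (chart_image c A)"
proof -
  have "emeasure (chart_measure c) (chart_image c A)
     = (\<integral>\<^sup>+ w. ennreal (indicator (chart_image c UNIV) w * dens c w) * indicator (chart_image c A) w \<partial>lborel)"
    unfolding chart_measure_def using dens_borel[OF assms(1), of UNIV] borel_chart_image[OF assms]
    by (intro emeasure_density) auto
  also have "\<dots> = nu c A"
    unfolding nu_def using chart_image_subset[of c A] by (intro nn_integral_cong) (auto simp: indicator_def)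
  finally show ?thesis by simp
qed

lemma nu_UN:
  fixes F :: "nat \<Rightarrow> 'z set"
  assumes c: "c \<in> atlas" and F: "\<And>i. F i \<in> sets borel" "disjoint_family F"
  shows "nu c (\<Union>i. F i) = (\<Sum>i. nu c (F i))"
proof -
  have "chart_image c (\<Union>i. F i) = (\<Union>i. chart_image c (F i))" by (auto simp: chart_image_def)
  moreover have "(\<Sum>i. emeasure (chart_measure c) (chart_image c (F i))) = emeasure (chart_measure c) (\<Union>i. chart_image c (F i))"
  proof (rule suminf_emeasure)
    show "range (\<lambda>i. chart_image c (F i)) \<subseteq> sets (chart_measure c)"
      using borel_chart_image[OF c F(1)] by (auto simp: chart_measure_def)
    show "disjoint_family (\<lambda>i. chart_image c (F i))"
      using F(2) mem_chart_image[OF c] unfolding disjoint_family_on_def by blast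
  qed
  moreover have "(\<Union>i. F i) \<in> sets borel" using F(1) by auto
  ultimately show ?thesis by (simp add: nu_eq_emeasure[OF c] F(1))
qed

lemma nu_sum:
  fixes F :: "nat \<Rightarrow> 'z set"
  assumes c: "c \<in> atlas" and F: "\<And>i. i < n \<Longrightarrow> F i \<in> sets borel" "disjoint_family_on F {..<n}"
  shows "nu c (\<Union>i<n. F i) = (\<Sum>i<n. nu c (F i))"
proof -
  have "chart_image c (\<Union>i<n. F i) = (\<Union>i<n. chart_image c (F i))" by (auto simp: chart_image_def)
  moreover have "(\<Sum>i<n. emeasure (chart_measure c) (chart_image c (F i))) = emeasure (chart_measure c) (\<Union>i<n. chart_image c (F i))"
  proof (rule sum_emeasure)
    show "(\<lambda>i. chart_image c (F i)) ` {..<n} \<subseteq> sets (chart_measure c)"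
      using borel_chart_image[OF c F(1)] by (auto simp: chart_measure_def)
    show "disjoint_family_on (\<lambda>i. chart_image c (F i)) {..<n}"
      using F(2) mem_chart_image[OF c] unfolding disjoint_family_on_def by blast
  qed simp
  moreover have "(\<Union>i<n. F i) \<in> sets borel" using F(1) by auto
  ultimately show ?thesis by (simp add: nu_eq_emeasure[OF c] F(1))
qed

lemma nu_trans:
  assumes c: "c \<in> atlas" and d: "d \<in> atlas" and A: "A \<in> sets borel" "A \<subseteq> fst c" "A \<subseteq> fst d"
  shows "nu d A = nu c A"
proof -
  have sub: "chart_image c A \<subseteq> chart_image c (fst d)" by (rule chart_image_mono[OF A(3)])
  have im: "trans c d ` chart_image c A = chart_image d A" by (rule trans_image[OF c d A(2,3)])
  have "nu d A = (\<integral>\<^sup>+ w\<in>trans c d ` chart_image c A. ennreal (dens d w) \<partial>lborel)"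
    by (simp add: nu_def im)
  also have "\<dots> = (\<integral>\<^sup>+ w\<in>chart_image c A. ennreal ((cmod (det (jac (trans c d) w)))\<^sup>2 * dens d (trans c d w)) \<partial>lborel)"
  proof (rule nn_integral_change_of_variables_complex)
    show "chart_image c A \<in> sets borel" by (rule borel_chart_image[OF c A(1)])
    show "inj_on (trans c d) (chart_image c A)" by (rule inj_on_subset[OF trans_inj[OF c d] sub])
    show "(trans c d has_derivative (*v) (jac (trans c d) x)) (at x)" if "x \<in> chart_image c A" for x
      by (rule holomorphic_map_has_derivative[OF trans_holomorphic[OF c d]]) (use sub that in blast)
    show "det (jac (trans c d) x) \<noteq> 0" if "x \<in> chart_image c A" for x
      by (rule det_jac_trans[OF c d]) (use sub that in blast)
    show "0 \<le> dens d y" if "y \<in> trans c d ` chart_image c A" for y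
    proof -
      have "y \<in> chart_image d UNIV" using that im chart_image_subset by blast
      from dens_pos[OF d this] show ?thesis by simp
    qed
    show "(\<lambda>y. indicator (trans c d ` chart_image c A) y * dens d y) \<in> borel_measurable borel"
      unfolding im by (rule dens_borel[OF d A(1)])
    have "(\<lambda>w. indicator (chart_image c A) w * dens c w) = (\<lambda>w. indicator (chart_image c A) w * ((cmod (det (jac (trans c d) w)))\<^sup>2 * dens d (trans c d w)))"
    proof
      fix w
      show "indicator (chart_image c A) w * dens c w = indicator (chart_image c A) w * ((cmod (det (jac (trans c d) w)))\<^sup>2 * dens d (trans c d w))"
        using dens_trans[OF c d, of w] sub by (cases "w \<in> chart_image c A") auto
    qed
    then show "(\<lambda>w. indicator (chart_image c A) w * ((cmod (det (jac (trans c d) w)))\<^sup>2 * dens d (trans c d w))) \<in> borel_measurable borel"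
      using dens_borel[OF c A(1)] by (simp only:)
  qed
  also have "\<dots> = nu c A"
    unfolding nu_def
  proof (rule nn_integral_cong)
    fix w
    show "ennreal ((cmod (det (jac (trans c d) w)))\<^sup>2 * dens d (trans c d w)) * indicator (chart_image c A) w
      = ennreal (dens c w) * indicator (chart_image c A) w"
      using dens_trans[OF c d, of w] sub by (cases "w \<in> chart_image c A") auto
  qed
  finally show ?thesis .
qed

abbreviation "vol \<equiv> volume_measure atlas W \<eta>"

text \<open>The measure is given by a unique description, so nothing is known of it until one such
  measure is found and any two agree. \<open>M0\<close> adds up the chart volumes over the disjoint
  pieces \<open>E i\<close>, and \<open>nu_trans\<close> shows that other charts see the same
  values. Uniqueness holds because the values on the parts of A inside the pieces are
  prescribed.\<close>

lemma
  shows sets_vol: "sets vol = sets borel"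
    and emeasure_vol: "c \<in> atlas \<Longrightarrow> A \<in> sets borel \<Longrightarrow> A \<subseteq> fst c \<Longrightarrow> emeasure vol A = nu c A"
proof -
  obtain cs :: "('z, 'n) chart list" and E :: "nat \<Rightarrow> 'z set"
    where cs: "set cs \<subseteq> atlas" and E: "disjoint_family E" "\<And>i. E i \<in> sets borel" "(\<Union>i<length cs. E i) = UNIV"
      "\<And>i. i < length cs \<Longrightarrow> E i \<subseteq> fst (cs ! i)"
    using finite_chart_cover by metis
  define n where "n = length cs"
  have ci: "cs ! i \<in> atlas" if "i < n" for i using cs that by (auto simp: n_def)
  define \<mu> where "\<mu> A = (\<Sum>i<n. nu (cs ! i) (A \<inter> E i))" for A
  define M0 where "M0 = measure_of UNIV (sets borel) \<mu>"
  have sM0: "sets M0 = sets borel"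
    unfolding M0_def using sets.sigma_sets_eq[of borel] by (simp add: sets_measure_of_conv sets.space_closed[of borel, simplified])
  have eM0: "emeasure M0 A = \<mu> A" if "A \<in> sets borel" for A
    unfolding M0_def
  proof (rule emeasure_measure_of_sigma)
    show "sigma_algebra UNIV (sets (borel :: 'z measure))" using sets.sigma_algebra_axioms[of borel] by simp
    show "positive (sets borel) \<mu>" by (simp add: positive_def \<mu>_def nu_def chart_image_def)
    show "countably_additive (sets borel) \<mu>"
    proof (rule countably_additiveI)
      fix F :: "nat \<Rightarrow> 'z set" assume F: "range F \<subseteq> sets borel" "disjoint_family F"
      have "nu (cs ! i) ((\<Union>k. F k) \<inter> E i) = (\<Sum>k. nu (cs ! i) (F k \<inter> E i))" if "i < n" for i
      proof -
        have "disjoint_family (\<lambda>k. F k \<inter> E i)" using F(2) unfolding disjoint_family_on_def by blast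
        moreover have "F k \<inter> E i \<in> sets borel" for k using F(1) E(2) by blast
        ultimately have "nu (cs ! i) (\<Union>k. F k \<inter> E i) = (\<Sum>k. nu (cs ! i) (F k \<inter> E i))"
          by (intro nu_UN ci[OF that])
        moreover have "(\<Union>k. F k) \<inter> E i = (\<Union>k. F k \<inter> E i)" by blast
        ultimately show ?thesis by (simp only:)
      qed
      then show "(\<Sum>k. \<mu> (F k)) = \<mu> (\<Union>k. F k)"
        unfolding \<mu>_def by (simp add: suminf_sum[OF summableI])
    qed
  qed (rule that)
  have split: "A = (\<Union>i<n. A \<inter> E i)" for A using E(3) unfolding n_def by blast
  have dis: "disjoint_family_on (\<lambda>i. A \<inter> E i) {..<n}" for A using E(1) unfolding disjoint_family_on_def by blast
  let ?P = "\<lambda>M. sets M = sets borel \<and> (\<forall>c\<in>atlas. \<forall>A\<in>sets borel. A \<subseteq> fst c \<longrightarrow> emeasure M A = nu c A)"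
  have P0: "?P M0"
  proof (intro conjI ballI impI sM0)
    fix c A assume c: "c \<in> atlas" and A: "A \<in> sets borel" "A \<subseteq> fst c"
    have "emeasure M0 A = (\<Sum>i<n. nu (cs ! i) (A \<inter> E i))" by (simp add: eM0[OF A(1)] \<mu>_def)
    also have "\<dots> = (\<Sum>i<n. nu c (A \<inter> E i))"
    proof (rule sum.cong[OF refl])
      fix i assume "i \<in> {..<n}"
      then have i: "i < n" by simp
      have "A \<inter> E i \<subseteq> fst (cs ! i)" using E(4)[of i] i unfolding n_def by blast
      then show "nu (cs ! i) (A \<inter> E i) = nu c (A \<inter> E i)"
        using A E(2)[of i] by (intro nu_trans c ci[OF i]) auto
    qed
    also have "\<dots> = nu c (\<Union>i<n. A \<inter> E i)"
      using nu_sum[OF c _ dis, of A] A(1) E(2) by auto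
    also have "(\<Union>i<n. A \<inter> E i) = A" using split[of A] by blast
    finally show "emeasure M0 A = nu c A" .
  qed
  have unique: "M = M'" if M: "?P M" "?P M'" for M M'
  proof (rule measure_eqI)
    show "sets M = sets M'" using M by simp
    fix A assume "A \<in> sets M"
    then have A: "A \<in> sets borel" using M by simp
    have "emeasure N A = (\<Sum>i<n. nu (cs ! i) (A \<inter> E i))" if N: "?P N" for N
    proof -
      have "(\<Sum>i<n. emeasure N (A \<inter> E i)) = emeasure N (\<Union>i<n. A \<inter> E i)"
        by (rule sum_emeasure) (use N A E(2) dis in auto)
      moreover have "emeasure N (A \<inter> E i) = nu (cs ! i) (A \<inter> E i)" if "i < n" for i
        using conjunct2[OF N, rule_format, OF ci[OF that], of "A \<inter> E i"] A E(2)[of i] E(4)[of i] that unfolding n_def by blast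
      moreover have "(\<Union>i<n. A \<inter> E i) = A" using split[of A] by blast
      ultimately show ?thesis by simp
    qed
    from this[OF M(1)] this[OF M(2)] show "emeasure M A = emeasure M' A" by (simp only:)
  qed
  have "\<exists>!M. ?P M" by (rule ex1I[of ?P M0, OF P0]) (rule unique[OF _ P0])
  from theI'[OF this] have "?P vol" unfolding volume_measure_def nu_def .
  then show "sets vol = sets borel" "c \<in> atlas \<Longrightarrow> A \<in> sets borel \<Longrightarrow> A \<subseteq> fst c \<Longrightarrow> emeasure vol A = nu c A"
    by blast+
qed

text \<open>A totalisation of \<open>chart_inv\<close> with a fixed value off the chart image, which
  makes measurability on the whole coordinate space visible; \<open>chart_measure\<close> gives that
  exterior no mass.\<close>

definition gext :: "('z, 'n) chart \<Rightarrow> complex^'n \<Rightarrow> 'z" where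
  "gext c w = (if w \<in> chart_image c UNIV then chart_inv c w else undefined)"

lemma gext_measurable: "c \<in> atlas \<Longrightarrow> gext c \<in> borel \<rightarrow>\<^sub>M borel"
proof (rule measurableI)
  fix A :: "'z set" assume c: "c \<in> atlas" and A: "A \<in> sets borel"
  have "gext c -` A = chart_image c A \<union> (if undefined \<in> A then - chart_image c UNIV else {})"
  proof (rule set_eqI)
    fix w
    show "w \<in> gext c -` A \<longleftrightarrow> w \<in> chart_image c A \<union> (if undefined \<in> A then - chart_image c UNIV else {})"
      using mem_chart_image[OF c, of w A] by (cases "w \<in> chart_image c UNIV") (simp_all add: gext_def)
  qed
  then show "gext c -` A \<inter> space borel \<in> sets borel"
    using borel_chart_image[OF c A] borel_chart_image[OF c, of UNIV] by auto
qed simp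

text \<open>Carries integrals of functions supported in one chart over to Lebesgue integrals with
  the volume density.\<close>

lemma vol_chart:
  assumes c: "c \<in> atlas"
  shows "density vol (\<lambda>z. ennreal (indicator (fst c) z)) = distr (chart_measure c) borel (gext c)"
proof (rule measure_eqI)
  show "sets (density vol (\<lambda>z. ennreal (indicator (fst c) z))) = sets (distr (chart_measure c) borel (gext c))"
    by (simp add: sets_vol)
  fix A assume "A \<in> sets (density vol (\<lambda>z. ennreal (indicator (fst c) z)))"
  then have A: "A \<in> sets borel" by (simp add: sets_vol)
  have fc: "fst c \<in> sets borel" using open_chart[OF c] by simp
  have "emeasure (density vol (\<lambda>z. ennreal (indicator (fst c) z))) A = emeasure vol (A \<inter> fst c)"
    using A fc by (subst emeasure_density) (auto simp: sets_vol measurable_cong_sets[OF sets_vol refl] nn_integral_indicator[symmetric] ennreal_indicator indicator_inter_arith mult.commute simp del: nn_integral_indicator)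
  also have "\<dots> = nu c (A \<inter> fst c)" using emeasure_vol[OF c] A fc by auto
  also have "\<dots> = (\<integral>\<^sup>+ w. ennreal (indicator (chart_image c UNIV) w * dens c w) * indicator (gext c -` A) w \<partial>lborel)"
    unfolding nu_def
  proof (rule nn_integral_cong)
    fix w
    have "w \<in> chart_image c (A \<inter> fst c) \<longleftrightarrow> w \<in> chart_image c UNIV \<and> chart_inv c w \<in> A"
      using mem_chart_image[OF c, of w "A \<inter> fst c"] chart_inv_in[OF c] by blast
    then show "ennreal (dens c w) * indicator (chart_image c (A \<inter> fst c)) w
      = ennreal (indicator (chart_image c UNIV) w * dens c w) * indicator (gext c -` A) w"
      by (simp add: indicator_def gext_def)
  qed
  also have "\<dots> = emeasure (chart_measure c) (gext c -` A)"
    unfolding chart_measure_def using dens_borel[OF c, of UNIV] measurable_sets[OF gext_measurable[OF c] A]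
    by (intro emeasure_density[symmetric]) auto
  also have "\<dots> = emeasure (distr (chart_measure c) borel (gext c)) A"
    using A gext_measurable[OF c] by (subst emeasure_distr) (auto simp: chart_measure_def)
  finally show "emeasure (density vol (\<lambda>z. ennreal (indicator (fst c) z))) A = emeasure (distr (chart_measure c) borel (gext c)) A" .
qed

lemma
  fixes f :: "'z \<Rightarrow> 'b::{banach, second_countable_topology}"
  assumes c: "c \<in> atlas" and f: "f \<in> borel_measurable borel" and z: "\<And>z. z \<notin> fst c \<Longrightarrow> f z = 0"
  shows integrable_vol_chart: "integrable vol f \<longleftrightarrow>
      integrable lborel (\<lambda>w. (indicator (chart_image c UNIV) w * dens c w) *\<^sub>R f (chart_inv c w))"
    and integral_vol_chart: "integral\<^sup>L vol f =
      integral\<^sup>L lborel (\<lambda>w. (indicator (chart_image c UNIV) w * dens c w) *\<^sub>R f (chart_inv c w))"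
proof -
  have fc: "fst c \<in> sets borel" using open_chart[OF c] by simp
  have fm: "f \<in> borel_measurable vol" using f by (simp add: measurable_cong_sets[OF sets_vol refl])
  have im: "(indicator (fst c) :: 'z \<Rightarrow> real) \<in> borel_measurable vol" using fc by (simp add: measurable_cong_sets[OF sets_vol refl])
  have eq: "(\<lambda>z. indicator (fst c) z *\<^sub>R f z) = f" using z by (auto simp: indicator_def)
  have eq2: "(\<lambda>w. (indicator (chart_image c UNIV) w * dens c w) *\<^sub>R f (gext c w)) = (\<lambda>w. (indicator (chart_image c UNIV) w * dens c w) *\<^sub>R f (chart_inv c w))"
    by (auto simp: indicator_def gext_def)
  have d: "AE w in lborel. 0 \<le> indicator (chart_image c UNIV) w * dens c w"
    using dens_pos[OF c] by (auto simp: indicator_def intro!: AE_I2 less_imp_le)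
  have gm: "gext c \<in> chart_measure c \<rightarrow>\<^sub>M borel" using gext_measurable[OF c] by (simp add: chart_measure_def)
  have fgm: "(\<lambda>w. f (gext c w)) \<in> borel_measurable lborel" using measurable_compose[OF gext_measurable[OF c] f] by simp
  have dm: "(\<lambda>w. indicator (chart_image c UNIV) w * dens c w) \<in> borel_measurable lborel" using dens_borel[OF c, of UNIV] by simp
  have "integrable vol f \<longleftrightarrow> integrable (density vol (\<lambda>z. ennreal (indicator (fst c) z))) f"
    by (subst integrable_density[OF fm im]) (simp_all add: eq)
  also have "\<dots> \<longleftrightarrow> integrable (chart_measure c) (\<lambda>w. f (gext c w))"
    unfolding vol_chart[OF c] by (rule integrable_distr_eq[OF gm f])
  also have "\<dots> \<longleftrightarrow> integrable lborel (\<lambda>w. (indicator (chart_image c UNIV) w * dens c w) *\<^sub>R f (gext c w))"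
    unfolding chart_measure_def by (rule integrable_density[OF fgm dm d])
  finally show "integrable vol f \<longleftrightarrow>
      integrable lborel (\<lambda>w. (indicator (chart_image c UNIV) w * dens c w) *\<^sub>R f (chart_inv c w))" unfolding eq2 .
  have "integral\<^sup>L vol f = integral\<^sup>L (density vol (\<lambda>z. ennreal (indicator (fst c) z))) f"
    by (subst integral_density[OF fm im]) (simp_all add: eq)
  also have "\<dots> = integral\<^sup>L (chart_measure c) (\<lambda>w. f (gext c w))"
    unfolding vol_chart[OF c] by (rule integral_distr[OF gm f])
  also have "\<dots> = integral\<^sup>L lborel (\<lambda>w. (indicator (chart_image c UNIV) w * dens c w) *\<^sub>R f (gext c w))"
    unfolding chart_measure_def by (rule integral_density[OF fgm dm d])
  finally show "integral\<^sup>L vol f =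
      integral\<^sup>L lborel (\<lambda>w. (indicator (chart_image c UNIV) w * dens c w) *\<^sub>R f (chart_inv c w))" unfolding eq2 .
qed

end

section \<open>Integration by parts\<close>

lemma max_square_derivative: "((\<lambda>y. (max 0 y)\<^sup>2) has_real_derivative 2 * max 0 x) (at x)"
proof -
  consider "x > 0" | "x < 0" | "x = 0" by linarith
  then show ?thesis
  proof cases
    case 1
    have "((\<lambda>y::real. y\<^sup>2) has_real_derivative 2 * max 0 x) (at x)"
      using 1 by (auto intro!: derivative_eq_intros)
    then show ?thesis
      by (rule has_field_derivative_transform_within_open[of _ _ _ "{0<..}"]) (use 1 in auto)
  next
    case 2
    have "((\<lambda>y::real. 0) has_real_derivative 2 * max 0 x) (at x)"
      using 2 by (auto intro!: derivative_eq_intros)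
    then show ?thesis
      by (rule has_field_derivative_transform_within_open[of _ _ _ "{..<0}"]) (use 2 in auto)
  next
    case 3
    have "((\<lambda>h. ((max 0 (0 + h))\<^sup>2 - (max 0 0)\<^sup>2) / h) \<longlongrightarrow> (0::real)) (at 0)"
    proof (rule Lim_null_comparison)
      have "norm (((max 0 (0 + h))\<^sup>2 - (max 0 0)\<^sup>2) / h) \<le> \<bar>h\<bar>" for h :: real
        by (cases "h = 0") (auto simp: max_def power2_eq_square)
      then show "eventually (\<lambda>h. norm (((max 0 (0 + h))\<^sup>2 - (max 0 0)\<^sup>2) / h) \<le> \<bar>h\<bar>) (at (0::real))"
        by simp
      show "((\<lambda>h::real. \<bar>h\<bar>) \<longlongrightarrow> 0) (at 0)" by (rule tendsto_eq_intros | simp)+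
    qed
    then show ?thesis using 3 by (simp add: DERIV_def)
  qed
qed

text \<open>The squared positive part is of class C^1 and supported in a closed ball. One derivative
  suffices, because integration by parts and the t-derivative never differentiate a cut-off
  twice.\<close>

definition bump :: "'a::real_inner \<Rightarrow> real \<Rightarrow> 'a \<Rightarrow> real" where
  "bump a r x = (max 0 (r\<^sup>2 - (x - a) \<bullet> (x - a)))\<^sup>2"

lemma bump_has_derivative:
  "(bump a r has_derivative (\<lambda>v. 2 * max 0 (r\<^sup>2 - (x - a) \<bullet> (x - a)) * (- 2 * ((x - a) \<bullet> v)))) (at x)"
proof -
  have "((\<lambda>x. r\<^sup>2 - (x - a) \<bullet> (x - a)) has_derivative (\<lambda>v. - 2 * ((x - a) \<bullet> v))) (at x)"
    by (auto intro!: derivative_eq_intros simp: inner_commute)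
  from has_derivative_compose[OF this max_square_derivative[unfolded has_field_derivative_def]]
  show ?thesis by (simp add: bump_def[abs_def])
qed

lemma bump_zero: "r > 0 \<Longrightarrow> x \<notin> cball a r \<Longrightarrow> bump a r x = 0"
proof -
  assume "r > 0" "x \<notin> cball a r"
  then have "r \<le> norm (x - a)" by (simp add: dist_norm norm_minus_commute)
  then have "r\<^sup>2 \<le> (norm (x - a))\<^sup>2" using \<open>r > 0\<close> by (intro power_mono) auto
  then show ?thesis by (simp add: bump_def power2_norm_eq_inner)
qed

lemma Ck_on_bump_holomorphic:
  fixes T :: "complex^'n \<Rightarrow> complex^'m"
  assumes T: "holomorphic_map T S" and S: "open S"
  shows "Ck_on (Suc 0) S (\<lambda>w. bump a r (T w))"
proof -
  have d: "((\<lambda>w. bump a r (T w)) has_derivative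
     (\<lambda>v. 2 * max 0 (r\<^sup>2 - (T w - a) \<bullet> (T w - a)) * (- 2 * ((T w - a) \<bullet> (jac T w *v v))))) (at w)" if "w \<in> S" for w
    by (rule has_derivative_compose[OF holomorphic_map_has_derivative[OF T that] bump_has_derivative])
  have cT: "continuous_on S T"
    using holomorphic_map_has_derivative[OF T]
    by (meson continuous_at_imp_continuous_on has_derivative_continuous)
  have cJ: "continuous_on S (\<lambda>w. jac T w *v v)" for v
    unfolding matrix_vector_mult_def
    by (intro continuous_on_vec_lambda continuous_intros several_holomorphic_on_continuous[OF jac_holomorphic[OF T S]])
  have "continuous_on S (\<lambda>w. frechet_derivative (\<lambda>w. bump a r (T w)) (at w) v)" for v
  proof -
    have "continuous_on S (\<lambda>w. 2 * max 0 (r\<^sup>2 - (T w - a) \<bullet> (T w - a)) * (- 2 * ((T w - a) \<bullet> (jac T w *v v))))"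
      by (intro continuous_intros cT cJ)
    then show ?thesis
      by (rule continuous_on_eq) (simp add: frechet_derivative_at[OF d, symmetric])
  qed
  then show ?thesis using differentiableI[OF d] by simp
qed

section \<open>Compactly supported integrands and differentiation under the integral\<close>

lemma Ck_on_extend_zero:
  fixes X :: "'a::{t2_space,real_normed_vector} \<Rightarrow> 'b::real_normed_vector"
  assumes S: "open S" and K: "compact K" "K \<subseteq> S" and X: "Ck_on k S X" "\<And>w. w \<in> S \<Longrightarrow> w \<notin> K \<Longrightarrow> X w = 0"
  shows "Ck_on k UNIV (\<lambda>w. if w \<in> S then X w else 0)"
proof (rule Ck_on_local)
  fix p
  show "\<exists>N. open N \<and> p \<in> N \<and> Ck_on k N (\<lambda>w. if w \<in> S then X w else 0)"
  proof (cases "p \<in> S")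
    case True
    have "Ck_on k S (\<lambda>w. if w \<in> S then X w else 0)"
      by (rule Ck_on_cong[OF S, THEN iffD1, OF _ X(1)]) simp
    then show ?thesis using True S by blast
  next
    case False
    have o: "open (- K)" using compact_imp_closed[OF K(1)] by (simp add: open_Compl)
    have "Ck_on k (- K) (\<lambda>w. if w \<in> S then X w else 0)"
      by (rule Ck_on_cong[OF o, THEN iffD1, OF _ Ck_on_const[of k _ 0]]) (simp add: X(2))
    moreover have "p \<in> - K" using False K(2) by blast
    ultimately show ?thesis using o by blast
  qed
qed

lemma frechet_derivative_extend_zero:
  assumes S: "open S" and K: "compact K" "K \<subseteq> S" and X: "\<And>w. w \<in> S \<Longrightarrow> w \<notin> K \<Longrightarrow> X w = 0"
  shows "frechet_derivative (\<lambda>w. if w \<in> S then X w else 0) (at w) v = (if w \<in> S then frechet_derivative X (at w) v else 0)"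
proof (cases "w \<in> S")
  case True
  then show ?thesis by (simp add: frechet_derivative_cong_open[OF S True, of "\<lambda>w. if w \<in> S then X w else 0" X])
next
  case False
  have o: "open (- K)" using compact_imp_closed[OF K(1)] by (simp add: open_Compl)
  have "w \<in> - K" using False K(2) by blast
  from frechet_derivative_cong_open[OF o this, of "\<lambda>w. if w \<in> S then X w else 0" "\<lambda>_. 0"] False X
  show ?thesis by simp
qed

lemma lborel_integral_cbox:
  fixes h :: "'a::euclidean_space \<Rightarrow> 'b::euclidean_space"
  assumes h: "continuous_on UNIV h" and z: "\<And>w. w \<notin> cbox a b \<Longrightarrow> h w = 0"
  shows "integrable lborel h" "integral\<^sup>L lborel h = integral (cbox a b) h"
proof -
  have "(\<lambda>x. indicator (cbox a b) x *\<^sub>R h x) = h" using z by (auto simp: indicator_def)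
  then show i: "integrable lborel h"
    using borel_integrable_compact[OF compact_cbox[of a b] continuous_on_subset[OF h]] by simp
  have "(h has_integral integral\<^sup>L lborel h) UNIV" by (rule has_integral_integral_lborel[OF i])
  moreover have "(\<lambda>x. if x \<in> cbox a b then h x else 0) = h" using z by auto
  ultimately have "(h has_integral integral\<^sup>L lborel h) (cbox a b)"
    using has_integral_restrict_UNIV[of "cbox a b" h] by simp
  then show "integral\<^sup>L lborel h = integral (cbox a b) h" by (simp add: integral_unique)
qed

lemma compact_subset_cbox:
  fixes K :: "'a::euclidean_space set"
  assumes "compact K"
  obtains a b where "K \<subseteq> cbox a b"
  using bounded_subset_cbox_symmetric[OF compact_imp_bounded[OF assms]] by blast

text \<open>Translation invariance of Lebesgue measure, differentiated at the identity.\<close>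

lemma integral_directional_derivative_zero:
  fixes X :: "'a::euclidean_space \<Rightarrow> complex"
  assumes X: "Ck_on (Suc 0) UNIV X" and K: "compact K" "\<And>w. w \<notin> K \<Longrightarrow> X w = 0"
  shows "integral\<^sup>L lborel (\<lambda>w. frechet_derivative X (at w) v) = 0"
proof -
  have d: "(X has_derivative frechet_derivative X (at w)) (at w)" for w
    using X frechet_derivative_works by auto
  have c: "continuous_on UNIV (\<lambda>w. frechet_derivative X (at w) v)" using X by simp
  have cX: "continuous_on UNIV X" using Ck_on_Suc_imp[OF X] by simp
  \<comment> \<open>\<open>K'\<close> contains all translates of the support by s v with |s| \<le>
    1, so one box carries every integral of the family.\<close>
  define K' where "K' = (\<lambda>(w, s). w - s *\<^sub>R v) ` (K \<times> {-1..1})"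
  have "compact K'" unfolding K'_def
    by (intro compact_continuous_image compact_Times K(1) compact_Icc) (auto simp: split_beta intro!: continuous_intros)
  then obtain a b where ab: "K' \<subseteq> cbox a b" using compact_subset_cbox by blast
  have z: "X (w + s *\<^sub>R v) = 0" if "w \<notin> cbox a b" "s \<in> {-1..1}" for w s
  proof (rule K(2), rule)
    assume "w + s *\<^sub>R v \<in> K"
    then have "w \<in> K'" unfolding K'_def using that(2) by (intro image_eqI[of _ _ "(w + s *\<^sub>R v, s)"]) auto
    then show False using ab that(1) by blast
  qed
  have cs: "continuous_on UNIV (\<lambda>w. X (w + s *\<^sub>R v))" for s
    by (intro continuous_on_compose2[OF cX] continuous_intros) auto
  have lei: "((\<lambda>s. integral (cbox a b) (\<lambda>w. X (w + s *\<^sub>R v))) has_vector_derivative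
    integral (cbox a b) (\<lambda>w. frechet_derivative X (at (w + 0 *\<^sub>R v)) v)) (at 0 within {-1..1})"
  proof (rule leibniz_rule_vector_derivative)
    fix s :: real and w
    have "((\<lambda>s. w + s *\<^sub>R v) has_derivative (\<lambda>s. s *\<^sub>R v)) (at s)" by (auto intro!: derivative_eq_intros)
    from has_derivative_compose[OF this d]
    have "((\<lambda>s. X (w + s *\<^sub>R v)) has_derivative (\<lambda>t. t *\<^sub>R frechet_derivative X (at (w + s *\<^sub>R v)) v)) (at s)"
      by (simp add: linear_cmul[OF has_derivative_linear[OF d]])
    then show "((\<lambda>s. X (w + s *\<^sub>R v)) has_vector_derivative frechet_derivative X (at (w + s *\<^sub>R v)) v) (at s within {-1..1})"
      unfolding has_vector_derivative_def by (rule has_derivative_at_withinI)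
  next
    show "(\<lambda>w. X (w + s *\<^sub>R v)) integrable_on cbox a b" for s
      by (intro integrable_continuous continuous_on_subset[OF cs]) auto
    show "continuous_on ({-1..1} \<times> cbox a b) (\<lambda>(s, w). frechet_derivative X (at (w + s *\<^sub>R v)) v)"
      unfolding split_beta by (intro continuous_on_compose2[OF c] continuous_intros) auto
  qed auto
  have const: "integral (cbox a b) (\<lambda>w. X (w + s *\<^sub>R v)) = integral\<^sup>L lborel X" if "s \<in> {-1..1}" for s
  proof -
    have "integral (cbox a b) (\<lambda>w. X (w + s *\<^sub>R v)) = integral\<^sup>L lborel (\<lambda>w. X (w + s *\<^sub>R v))"
      by (rule lborel_integral_cbox(2)[OF cs z, symmetric]) (use that in auto)
    also have "\<dots> = integral\<^sup>L (distr lborel borel ((+) (s *\<^sub>R v))) X"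
      using borel_measurable_continuous_onI[OF cX] by (subst integral_distr) (auto simp: add.commute)
    finally show ?thesis by (simp add: lborel_distr_plus)
  qed
  have "((\<lambda>s. integral (cbox a b) (\<lambda>w. X (w + s *\<^sub>R v))) has_vector_derivative 0) (at 0 within {-1..1})"
    by (rule has_vector_derivative_transform[OF _ _ has_vector_derivative_const[of "integral\<^sup>L lborel X"]]) (auto simp: const)
  with lei have "integral (cbox a b) (\<lambda>w. frechet_derivative X (at (w + 0 *\<^sub>R v)) v) = 0"
    by (rule vector_derivative_unique_within[rotated]) (simp add: trivial_limit_within islimpt_Icc)
  moreover have "integral\<^sup>L lborel (\<lambda>w. frechet_derivative X (at w) v) = integral (cbox a b) (\<lambda>w. frechet_derivative X (at w) v)"
  proof (rule lborel_integral_cbox(2)[OF c])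
    fix w assume w: "w \<notin> cbox a b"
    have "open (- K)" using compact_imp_closed[OF K(1)] by (simp add: open_Compl)
    moreover have "w \<in> - K"
    proof
      assume "w \<in> K"
      then have "w \<in> K'" unfolding K'_def by (intro image_eqI[of _ _ "(w, 0)"]) auto
      then show False using ab w by blast
    qed
    ultimately show "frechet_derivative X (at w) v = 0"
      using frechet_derivative_cong_open[of "- K" w X "\<lambda>_. 0"] K(2) by simp
  qed
  ultimately show ?thesis by simp
qed

lemma integral_dop_zero:
  fixes X :: "'a::euclidean_space \<Rightarrow> complex"
  assumes S: "open S" and K: "compact K" "K \<subseteq> S" and X: "Ck_on (Suc 0) S X" "\<And>w. w \<in> S \<Longrightarrow> w \<notin> K \<Longrightarrow> X w = 0"
  shows "integrable lborel (\<lambda>w. if w \<in> S then dop \<kappa> v v' X w else 0)"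
    "integral\<^sup>L lborel (\<lambda>w. if w \<in> S then dop \<kappa> v v' X w else 0) = 0"
proof -
  define X0 where "X0 w = (if w \<in> S then X w else 0)" for w
  have X0: "Ck_on (Suc 0) UNIV X0" unfolding X0_def by (rule Ck_on_extend_zero[OF S K X])
  have D: "frechet_derivative X0 (at w) v = (if w \<in> S then frechet_derivative X (at w) v else 0)" for w v
    unfolding X0_def by (rule frechet_derivative_extend_zero[OF S K X(2)])
  have z: "X0 w = 0" if "w \<notin> K" for w using X(2) that by (auto simp: X0_def)
  obtain a b where ab: "K \<subseteq> cbox a b" using compact_subset_cbox[OF K(1)] by blast
  have o: "open (- K)" using compact_imp_closed[OF K(1)] by (simp add: open_Compl)
  have i: "integrable lborel (\<lambda>w. frechet_derivative X0 (at w) v)" for v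
  proof (rule lborel_integral_cbox(1))
    show "continuous_on UNIV (\<lambda>w. frechet_derivative X0 (at w) v)" using X0 by simp
    show "frechet_derivative X0 (at w) v = 0" if "w \<notin> cbox a b" for w
    proof -
      have "w \<in> - K" using that ab by blast
      from frechet_derivative_cong_open[OF o this, of X0 "\<lambda>_. 0"] z show ?thesis by simp
    qed
  qed
  have eq: "(\<lambda>w. if w \<in> S then dop \<kappa> v v' X w else 0) = (\<lambda>w. (frechet_derivative X0 (at w) v + \<kappa> * frechet_derivative X0 (at w) v') / 2)"
    by (auto simp: dop_def D)
  show "integrable lborel (\<lambda>w. if w \<in> S then dop \<kappa> v v' X w else 0)" unfolding eq using i by simp
  show "integral\<^sup>L lborel (\<lambda>w. if w \<in> S then dop \<kappa> v v' X w else 0) = 0"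
    unfolding eq using i integral_directional_derivative_zero[OF X0 K(1) z] by simp
qed

lemma Ck_on_Times_extend_zero:
  fixes X :: "'c::real_normed_vector \<times> 'a::{t2_space,real_normed_vector} \<Rightarrow> 'b::real_normed_vector"
  assumes S: "open S" "open U" and K: "compact K" "K \<subseteq> S"
    and X: "Ck_on k (U \<times> S) X" "\<And>t w. t \<in> U \<Longrightarrow> w \<in> S \<Longrightarrow> w \<notin> K \<Longrightarrow> X (t, w) = 0"
  shows "Ck_on k (U \<times> UNIV) (\<lambda>q. if snd q \<in> S then X q else 0)"
proof (rule Ck_on_local)
  fix p assume p: "p \<in> U \<times> (UNIV :: 'a set)"
  show "\<exists>N. open N \<and> p \<in> N \<and> Ck_on k N (\<lambda>q. if snd q \<in> S then X q else 0)"
  proof (cases "snd p \<in> S")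
    case True
    have o: "open (U \<times> S)" using S by (simp add: open_Times)
    have "Ck_on k (U \<times> S) (\<lambda>q. if snd q \<in> S then X q else 0)"
      by (rule Ck_on_cong[OF o, THEN iffD1, OF _ X(1)]) auto
    moreover have "p \<in> U \<times> S" using p True by (auto simp: mem_Times_iff)
    ultimately show ?thesis using o by blast
  next
    case False
    have o: "open (U \<times> (- K))" using compact_imp_closed[OF K(1)] S(2) by (simp add: open_Compl open_Times)
    have "Ck_on k (U \<times> (- K)) (\<lambda>q. if snd q \<in> S then X q else 0)"
      by (rule Ck_on_cong[OF o, THEN iffD1, OF _ Ck_on_const[of k _ 0]]) (auto simp: X(2))
    moreover have "p \<in> U \<times> (- K)" using p False K(2) by (auto simp: mem_Times_iff)
    ultimately show ?thesis using o by blast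
  qed
qed

text \<open>The support stays in one compact K for every parameter, so all the integrals run over
  one box. Class C^1 is what the integrand has, as it will contain a cut-off.\<close>

lemma leibniz_dop:
  fixes X :: "complex \<times> 'a::euclidean_space \<Rightarrow> complex"
  assumes S: "open S" "open U" and K: "compact K" "K \<subseteq> S" and t: "t \<in> U"
    and X: "Ck_on (Suc 0) (U \<times> S) X" "\<And>t w. t \<in> U \<Longrightarrow> w \<in> S \<Longrightarrow> w \<notin> K \<Longrightarrow> X (t, w) = 0"
  shows "(\<lambda>\<tau>. integral\<^sup>L lborel (\<lambda>w. if w \<in> S then X (\<tau>, w) else 0)) differentiable (at t)"
    "dop \<kappa> 1 \<i> (\<lambda>\<tau>. integral\<^sup>L lborel (\<lambda>w. if w \<in> S then X (\<tau>, w) else 0)) t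
      = integral\<^sup>L lborel (\<lambda>w. if w \<in> S then dop \<kappa> (1, 0) (\<i>, 0) X (t, w) else 0)"
    "integrable lborel (\<lambda>w. if w \<in> S then dop \<kappa> (1, 0) (\<i>, 0) X (t, w) else 0)"
proof -
  define X0 where "X0 q = (if snd q \<in> S then X q else 0)" for q
  have X0: "Ck_on (Suc 0) (U \<times> UNIV) X0" unfolding X0_def by (rule Ck_on_Times_extend_zero[OF S K X])
  have d: "(X0 has_derivative frechet_derivative X0 (at (\<tau>, w))) (at (\<tau>, w))" if "\<tau> \<in> U" for \<tau> w
    using X0 frechet_derivative_works that by auto
  have c: "continuous_on (U \<times> UNIV) (\<lambda>q. frechet_derivative X0 (at q) v)" for v
    using X0 unfolding Ck_on.simps by blast
  have cX: "continuous_on (U \<times> UNIV) X0" using Ck_on_Suc_imp[OF X0] by simp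
  have oUS: "open (U \<times> S)" and oUK: "open (U \<times> - K)"
    using S compact_imp_closed[OF K(1)] by (simp_all add: open_Compl open_Times)
  have D: "frechet_derivative X0 (at (\<tau>, w)) v = (if w \<in> S then frechet_derivative X (at (\<tau>, w)) v else 0)" if "\<tau> \<in> U" for \<tau> w v
  proof (cases "w \<in> S")
    case True
    have "(\<tau>, w) \<in> U \<times> S" using True that by simp
    from frechet_derivative_cong_open[OF oUS this, of X0 X] True show ?thesis by (auto simp: X0_def)
  next
    case False
    have "(\<tau>, w) \<in> U \<times> - K" using False that K(2) by auto
    from frechet_derivative_cong_open[OF oUK this, of X0 "\<lambda>_. 0"] False X(2) show ?thesis by (auto simp: X0_def)
  qed
  obtain a b where ab: "K \<subseteq> cbox a b" using compact_subset_cbox[OF K(1)] by blast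
  obtain r where r: "r > 0" "ball t r \<subseteq> U" using S(2) t open_contains_ball by blast
  have z: "X0 (\<tau>, w) = 0" if "\<tau> \<in> U" "w \<notin> cbox a b" for \<tau> w using X(2) that ab by (auto simp: X0_def)
  have zD: "frechet_derivative X0 (at (\<tau>, w)) v = 0" if "\<tau> \<in> U" "w \<notin> cbox a b" for \<tau> w v
  proof -
    have "(\<tau>, w) \<in> U \<times> - K" using that ab by auto
    from frechet_derivative_cong_open[OF oUK this, of X0 "\<lambda>_. 0"] X(2) show ?thesis by (auto simp: X0_def)
  qed
  define P where "P \<tau> w = Blinfun (\<lambda>e. frechet_derivative X0 (at (\<tau>, w)) (e, 0))" for \<tau> w
  have bl: "bounded_linear (\<lambda>e. frechet_derivative X0 (at (\<tau>, w)) (e, 0))" if "\<tau> \<in> U" for \<tau> w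
    by (rule bounded_linear_compose[OF has_derivative_bounded_linear[OF d[OF that]]])
      (intro bounded_linear_Pair bounded_linear_ident bounded_linear_zero)
  have P: "blinfun_apply (P \<tau> w) = (\<lambda>e. frechet_derivative X0 (at (\<tau>, w)) (e, 0))" if "\<tau> \<in> U" for \<tau> w
    unfolding P_def by (rule bounded_linear_Blinfun_apply[OF bl[OF that]])
  have c1: "continuous_on UNIV (\<lambda>w. X0 (\<tau>, w))" if "\<tau> \<in> U" for \<tau>
    by (intro continuous_on_compose2[OF cX] continuous_intros) (use that in auto)
  have c2: "continuous_on UNIV (\<lambda>w. frechet_derivative X0 (at (\<tau>, w)) v)" if "\<tau> \<in> U" for \<tau> v
    by (intro continuous_on_compose2[OF c] continuous_intros) (use that in auto)
  have cP: "continuous_on (ball t r \<times> cbox a b) (\<lambda>(\<tau>, w). P \<tau> w)"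
    unfolding split_beta
  proof (rule continuous_on_blinfun_componentwise)
    fix e :: complex
    have "continuous_on (ball t r \<times> cbox a b) (\<lambda>q. frechet_derivative X0 (at q) (e, 0))"
      by (rule continuous_on_subset[OF c]) (use r in auto)
    then show "continuous_on (ball t r \<times> cbox a b) (\<lambda>q. blinfun_apply (P (fst q) (snd q)) e)"
      by (rule continuous_on_eq) (use P r in auto)
  qed
  have "((\<lambda>\<tau>. integral (cbox a b) (\<lambda>w. X0 (\<tau>, w))) has_derivative integral (cbox a b) (P t)) (at t within ball t r)"
  proof (rule leibniz_rule[OF _ _ cP])
    fix \<tau> and w :: 'a assume "\<tau> \<in> ball t r"
    then have \<tau>: "\<tau> \<in> U" using r by blast
    have "((\<lambda>\<tau>. (\<tau>, w)) has_derivative (\<lambda>e. (e, 0))) (at \<tau>)" by (auto intro!: derivative_eq_intros)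
    from has_derivative_compose[where f="\<lambda>\<tau>. (\<tau>, w)" and x=\<tau> and g=X0 and g'="frechet_derivative X0 (at (\<tau>, w))", OF this d[OF \<tau>]]
    show "((\<lambda>\<tau>. X0 (\<tau>, w)) has_derivative blinfun_apply (P \<tau> w)) (at \<tau> within ball t r)"
      unfolding P[OF \<tau>] by (rule has_derivative_at_withinI)
  next
    fix \<tau> assume "\<tau> \<in> ball t r"
    then have \<tau>: "\<tau> \<in> U" using r by blast
    show "(\<lambda>w. X0 (\<tau>, w)) integrable_on cbox a b"
      by (intro integrable_continuous continuous_on_subset[OF c1[OF \<tau>]]) auto
  qed (use r in auto)
  then have L: "((\<lambda>\<tau>. integral (cbox a b) (\<lambda>w. X0 (\<tau>, w))) has_derivative integral (cbox a b) (P t)) (at t)"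
    using r(1) by (simp add: at_within_open[of t "ball t r"])
  have L: "((\<lambda>\<tau>. integral\<^sup>L lborel (\<lambda>w. if w \<in> S then X (\<tau>, w) else 0)) has_derivative integral (cbox a b) (P t)) (at t)"
  proof (rule has_derivative_transform_within_open[OF L S(2) t])
    fix \<tau> assume \<tau>: "\<tau> \<in> U"
    from lborel_integral_cbox(2)[OF c1[OF \<tau>] z[OF \<tau>]]
    show "integral (cbox a b) (\<lambda>w. X0 (\<tau>, w)) = integral\<^sup>L lborel (\<lambda>w. if w \<in> S then X (\<tau>, w) else 0)"
      by (simp add: X0_def)
  qed
  then show "(\<lambda>\<tau>. integral\<^sup>L lborel (\<lambda>w. if w \<in> S then X (\<tau>, w) else 0)) differentiable (at t)"
    by (rule differentiableI)
  have "continuous_on (cbox a b) (\<lambda>w. (\<lambda>(\<tau>, w). P \<tau> w) (t, w))"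
    by (rule continuous_on_compose2[OF cP, of _ "\<lambda>w. (t, w)"]) (use r in \<open>auto intro!: continuous_intros\<close>)
  then have iP: "P t integrable_on cbox a b" by (intro integrable_continuous) simp
  have i: "integrable lborel (\<lambda>w. frechet_derivative X0 (at (t, w)) v)" for v
    by (rule lborel_integral_cbox(1)[OF c2[OF t] zD[OF t]])
  have A: "blinfun_apply (integral (cbox a b) (P t)) e = integral\<^sup>L lborel (\<lambda>w. frechet_derivative X0 (at (t, w)) (e, 0))" for e
    unfolding blinfun_apply_integral[OF iP] P[OF t]
    by (rule lborel_integral_cbox(2)[OF c2[OF t] zD[OF t], symmetric])
  have eq: "(\<lambda>w. if w \<in> S then dop \<kappa> (1, 0) (\<i>, 0) X (t, w) else 0)
     = (\<lambda>w. (frechet_derivative X0 (at (t, w)) (1, 0) + \<kappa> * frechet_derivative X0 (at (t, w)) (\<i>, 0)) / 2)"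
    by (auto simp: dop_def D[OF t])
  show "integrable lborel (\<lambda>w. if w \<in> S then dop \<kappa> (1, 0) (\<i>, 0) X (t, w) else 0)"
    unfolding eq using i by simp
  show "dop \<kappa> 1 \<i> (\<lambda>\<tau>. integral\<^sup>L lborel (\<lambda>w. if w \<in> S then X (\<tau>, w) else 0)) t
      = integral\<^sup>L lborel (\<lambda>w. if w \<in> S then dop \<kappa> (1, 0) (\<i>, 0) X (t, w) else 0)"
    unfolding eq unfolding dop_def frechet_derivative_at[OF L, symmetric] A using i by simp
qed

text \<open>The Kaehler identity: the coefficients of \<open>\<omega>\<^sup>(n-1)\<close> are divergence free.\<close>

lemma dop_matrix_inv:
  fixes G :: "'a::real_normed_vector \<Rightarrow> complex^'n^'n"
  assumes S: "open S" "p \<in> S" and G: "\<And>k l. Cinf_on S (\<lambda>q. G q $ k $ l)" "\<And>q. q \<in> S \<Longrightarrow> det (G q) \<noteq> 0"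
  shows "dop \<kappa> v w (\<lambda>q. matrix_inv (G q) $ j $ k) p =
    - (\<Sum>m\<in>UNIV. \<Sum>l\<in>UNIV. matrix_inv (G p) $ j $ m * dop \<kappa> v w (\<lambda>q. G q $ m $ l) p * matrix_inv (G p) $ l $ k)"
proof -
  have gd: "(\<lambda>q. G q $ k $ l) differentiable (at p)" for k l using Cinf_on_differentiable[OF G(1) S(2)] .
  have id: "(\<lambda>q. matrix_inv (G q) $ k $ l) differentiable (at p)" for k l
    using Cinf_on_differentiable[OF Cinf_on_matrix_inv[OF S(1) G] S(2)] .
  define D where "D j k = dop \<kappa> v w (\<lambda>q. matrix_inv (G q) $ j $ k) p" for j k
  define E where "E j k = dop \<kappa> v w (\<lambda>q. G q $ j $ k) p" for j k
  define N where "N = matrix_inv (G p)"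
  have eq: "(\<Sum>m\<in>UNIV. D j m * G p $ m $ l) = - (\<Sum>m\<in>UNIV. N $ j $ m * E m l)" for l
  proof -
    have "dop \<kappa> v w (\<lambda>q. \<Sum>m\<in>UNIV. matrix_inv (G q) $ j $ m * G q $ m $ l) p = dop \<kappa> v w (\<lambda>q. if j = l then 1 else 0) p"
      by (rule dop_cong[OF S]) (rule matrix_inv_sum(1)[OF G(2)])
    moreover have "dop \<kappa> v w (\<lambda>q. \<Sum>m\<in>UNIV. matrix_inv (G q) $ j $ m * G q $ m $ l) p
      = (\<Sum>m\<in>UNIV. N $ j $ m * E m l + D j m * G p $ m $ l)"
      by (subst dop_sum) (auto simp: dop_mult gd id differentiable_mult D_def E_def N_def)
    ultimately show ?thesis by (simp add: sum.distrib add_eq_0_iff)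
  qed
  have "D j k = (\<Sum>m\<in>UNIV. D j m * (\<Sum>l\<in>UNIV. G p $ m $ l * N $ l $ k))"
    unfolding N_def matrix_inv_sum(2)[OF G(2)[OF S(2)]] by (simp add: if_distrib cong: if_cong)
  also have "\<dots> = (\<Sum>l\<in>UNIV. (\<Sum>m\<in>UNIV. D j m * G p $ m $ l) * N $ l $ k)"
    unfolding sum_distrib_left sum_distrib_right by (subst sum.swap) (simp add: mult.assoc)
  also have "\<dots> = - (\<Sum>m\<in>UNIV. \<Sum>l\<in>UNIV. N $ j $ m * E m l * N $ l $ k)"
    unfolding eq minus_mult_left[symmetric] sum_negf sum_distrib_right by (subst sum.swap) simp
  finally show ?thesis by (simp add: D_def E_def N_def)
qed

text \<open>det G times the inverse is the cofactor matrix. Differentiating it gives one term from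
  the determinant and one from the inverse; they cancel after k and m are exchanged, and that
  exchange is \<open>sym\<close>, the closedness of \<omega>.\<close>

lemma kaehler_divergence:
  fixes G :: "complex^'n \<Rightarrow> complex^'n^'n"
  assumes S: "open S" "p \<in> S" and G: "\<And>k l. Cinf_on S (\<lambda>q. G q $ k $ l)" "\<And>q. q \<in> S \<Longrightarrow> det (G q) \<noteq> 0"
    and sym: "\<And>k l m. dz m (\<lambda>q. G q $ k $ l) p = dz k (\<lambda>q. G q $ m $ l) p"
  shows "(\<Sum>k\<in>UNIV. dz k (\<lambda>q. det (G q) * matrix_inv (G q) $ j $ k) p) = 0"
proof -
  have gd: "(\<lambda>q. G q $ k $ l) differentiable (at p)" for k l using Cinf_on_differentiable[OF G(1) S(2)] .
  have id: "(\<lambda>q. matrix_inv (G q) $ k $ l) differentiable (at p)" for k l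
    using Cinf_on_differentiable[OF Cinf_on_matrix_inv[OF S(1) G] S(2)] .
  have dd: "(\<lambda>q. det (G q)) differentiable (at p)"
    using Cinf_on_differentiable[OF Cinf_on_det[OF S(1) G(1)] S(2)] .
  define E where "E k m l = dz k (\<lambda>q. G q $ m $ l) p" for k m l
  define N where "N = matrix_inv (G p)"
  define A where "A = (\<Sum>k\<in>UNIV. \<Sum>m\<in>UNIV. \<Sum>l\<in>UNIV. N $ j $ k * N $ l $ m * E k m l)"
  have "dz k (\<lambda>q. det (G q) * matrix_inv (G q) $ j $ k) p
     = det (G p) * (- (\<Sum>m\<in>UNIV. \<Sum>l\<in>UNIV. N $ j $ m * E k m l * N $ l $ k))
       + det (G p) * (\<Sum>m\<in>UNIV. \<Sum>l\<in>UNIV. N $ l $ m * E k m l) * N $ j $ k" for k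
    by (subst dop_mult[OF dd id], subst dop_matrix_inv[OF S G], simp, simp, subst dop_det[OF gd G(2)[OF S(2)]])
      (simp add: E_def N_def)
  then have "(\<Sum>k\<in>UNIV. dz k (\<lambda>q. det (G q) * matrix_inv (G q) $ j $ k) p)
     = det (G p) * (- (\<Sum>k\<in>UNIV. \<Sum>m\<in>UNIV. \<Sum>l\<in>UNIV. N $ j $ m * E k m l * N $ l $ k))
       + (\<Sum>k\<in>UNIV. det (G p) * (\<Sum>m\<in>UNIV. \<Sum>l\<in>UNIV. N $ l $ m * E k m l) * N $ j $ k)"
    by (simp only: sum.distrib sum_distrib_left[symmetric] sum_negf)
  also have "(\<Sum>k\<in>UNIV. det (G p) * (\<Sum>m\<in>UNIV. \<Sum>l\<in>UNIV. N $ l $ m * E k m l) * N $ j $ k) = det (G p) * A"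
    by (simp add: A_def sum_distrib_left sum_distrib_right mult_ac)
  also have "(\<Sum>k\<in>UNIV. \<Sum>m\<in>UNIV. \<Sum>l\<in>UNIV. N $ j $ m * E k m l * N $ l $ k) = A"
    unfolding A_def by (subst sum.swap) (simp add: E_def sym mult_ac)
  finally show ?thesis by simp
qed

text \<open>The integrand is the divergence of a times the cofactor matrix applied to dbar b; by
  \<open>kaehler_divergence\<close> the derivatives of the metric drop out of it.\<close>

lemma kaehler_integration_by_parts:
  fixes G :: "complex^'n \<Rightarrow> complex^'n^'n" and a b :: "complex^'n \<Rightarrow> complex"
  assumes S: "open S" and K: "compact K" "K \<subseteq> S"
    and G: "\<And>k l. Cinf_on S (\<lambda>q. G q $ k $ l)" "\<And>q. q \<in> S \<Longrightarrow> det (G q) \<noteq> 0"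
    and sym: "\<And>k l m p. p \<in> S \<Longrightarrow> dz m (\<lambda>q. G q $ k $ l) p = dz k (\<lambda>q. G q $ m $ l) p"
    and a: "Ck_on (Suc 0) S a" "\<And>w. w \<in> S \<Longrightarrow> w \<notin> K \<Longrightarrow> a w = 0" and b: "Cinf_on S b"
  defines "h \<equiv> \<lambda>w. (a w * (\<Sum>j\<in>UNIV. \<Sum>k\<in>UNIV. matrix_inv (G w) $ j $ k * dz k (dzb j b) w)
         + pform (G w) (\<chi> k. dz k a w) (\<chi> j. dzb j b w)) * det (G w)"
  shows "integrable lborel (\<lambda>w. if w \<in> S then h w else 0)"
    "integral\<^sup>L lborel (\<lambda>w. if w \<in> S then h w else 0) = 0"
proof -
  define B where "B k w = (\<Sum>j\<in>UNIV. (det (G w) * matrix_inv (G w) $ j $ k) * dzb j b w)" for k w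
  have cd: "Cinf_on S (\<lambda>q. det (G q) * matrix_inv (G q) $ j $ k)" for j k
    by (intro Cinf_on_mult S Cinf_on_det Cinf_on_matrix_inv G)
  have cb: "Cinf_on S (dzb j b)" for j by (rule Cinf_on_dop[OF S b])
  have cB: "Cinf_on S (B k)" for k
    unfolding B_def[abs_def] by (intro Cinf_on_sum Cinf_on_mult S cd cb)
  have ad: "a differentiable (at w)" if "w \<in> S" for w using a(1) that by simp
  have X: "Ck_on (Suc 0) S (\<lambda>w. a w * B k w)" for k
    using cB[of k] by (intro Ck_on_mult S a(1)) (simp only: Cinf_on_def)
  have dB: "(\<Sum>k\<in>UNIV. dz k (B k) w) = det (G w) * (\<Sum>j\<in>UNIV. \<Sum>k\<in>UNIV. matrix_inv (G w) $ j $ k * dz k (dzb j b) w)" if w: "w \<in> S" for w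
  proof -
    have "dz k (B k) w = (\<Sum>j\<in>UNIV. (det (G w) * matrix_inv (G w) $ j $ k) * dz k (dzb j b) w
        + dz k (\<lambda>q. det (G q) * matrix_inv (G q) $ j $ k) w * dzb j b w)" for k
      unfolding B_def[abs_def]
      by (subst dop_sum) (auto intro!: sum.cong dop_mult differentiable_mult[OF Cinf_on_differentiable[OF cd w]] Cinf_on_differentiable[OF cd w] Cinf_on_differentiable[OF cb w])
    then have "(\<Sum>k\<in>UNIV. dz k (B k) w) = (\<Sum>k\<in>UNIV. \<Sum>j\<in>UNIV. (det (G w) * matrix_inv (G w) $ j $ k) * dz k (dzb j b) w)
       + (\<Sum>k\<in>UNIV. \<Sum>j\<in>UNIV. dz k (\<lambda>q. det (G q) * matrix_inv (G q) $ j $ k) w * dzb j b w)"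
      by (simp add: sum.distrib)
    also have "(\<Sum>k\<in>UNIV. \<Sum>j\<in>UNIV. dz k (\<lambda>q. det (G q) * matrix_inv (G q) $ j $ k) w * dzb j b w)
      = (\<Sum>j\<in>UNIV. (\<Sum>k\<in>UNIV. dz k (\<lambda>q. det (G q) * matrix_inv (G q) $ j $ k) w) * dzb j b w)"
      unfolding sum_distrib_right by (rule sum.swap)
    also have "\<dots> = 0" using kaehler_divergence[OF S w G sym[OF w]] by simp
    also have "(\<Sum>k\<in>UNIV. \<Sum>j\<in>UNIV. (det (G w) * matrix_inv (G w) $ j $ k) * dz k (dzb j b) w)
      = det (G w) * (\<Sum>j\<in>UNIV. \<Sum>k\<in>UNIV. matrix_inv (G w) $ j $ k * dz k (dzb j b) w)"
      by (subst sum.swap) (simp add: sum_distrib_left mult_ac)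
    finally show ?thesis by simp
  qed
  have eq: "h w = (\<Sum>k\<in>UNIV. dz k (\<lambda>w. a w * B k w) w)" if w: "w \<in> S" for w
  proof -
    have "(\<Sum>k\<in>UNIV. dz k (\<lambda>w. a w * B k w) w) = a w * (\<Sum>k\<in>UNIV. dz k (B k) w) + (\<Sum>k\<in>UNIV. dz k a w * B k w)"
      by (simp add: dop_mult[OF ad[OF w] Cinf_on_differentiable[OF cB w]] sum.distrib sum_distrib_left)
    also have "(\<Sum>k\<in>UNIV. dz k a w * B k w) = pform (G w) (\<chi> k. dz k a w) (\<chi> j. dzb j b w) * det (G w)"
      unfolding B_def pform_def sum_distrib_left sum_distrib_right by (subst sum.swap) (simp add: mult_ac)
    finally show ?thesis by (simp add: h_def dB[OF w] algebra_simps)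
  qed
  have eq': "(\<lambda>w. if w \<in> S then h w else 0) = (\<lambda>w. \<Sum>k\<in>UNIV. if w \<in> S then dz k (\<lambda>w. a w * B k w) w else 0)"
    by (auto simp: eq)
  have z: "a w * B k w = 0" if "w \<in> S" "w \<notin> K" for w k using a(2) that by simp
  have i: "integrable lborel (\<lambda>w. if w \<in> S then dz k (\<lambda>w. a w * B k w) w else 0)"
    and i0: "integral\<^sup>L lborel (\<lambda>w. if w \<in> S then dz k (\<lambda>w. a w * B k w) w else 0) = 0" for k
    by (rule integral_dop_zero[OF S K X z], assumption, assumption)+
  show "integrable lborel (\<lambda>w. if w \<in> S then h w else 0)"
    unfolding eq' by (rule Bochner_Integration.integrable_sum[OF i])
  show "integral\<^sup>L lborel (\<lambda>w. if w \<in> S then h w else 0) = 0"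
    unfolding eq' by (subst Bochner_Integration.integral_sum[OF i]) (simp only: i0 sum.neutral_const)
qed

section \<open>Partitions of unity\<close>

lemma Ck_on_sum:
  "open S \<Longrightarrow> (\<And>i. i \<in> I \<Longrightarrow> Ck_on k S (f i)) \<Longrightarrow> Ck_on k S (\<lambda>p. \<Sum>i\<in>I. f i p)"
  by (induction I rule: infinite_finite_induct) (auto intro: Ck_on_add Ck_on_const)

context complex_manifold
begin

definition CkM :: "nat \<Rightarrow> ('z \<Rightarrow> 'b::real_normed_vector) \<Rightarrow> bool" where
  "CkM k f \<longleftrightarrow> (\<forall>c\<in>atlas. Ck_on k (chart_image c UNIV) (\<lambda>w. f (chart_inv c w)))"

lemma CkM_chart: "CkM k f \<Longrightarrow> c \<in> atlas \<Longrightarrow> Ck_on k (chart_image c UNIV) (\<lambda>w. f (chart_inv c w))"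
  by (simp add: CkM_def)

lemma CkM_0: "CkM 0 f \<longleftrightarrow> continuous_on UNIV f"
proof
  assume f: "CkM 0 f"
  show "continuous_on UNIV f"
  proof (rule continuous_at_imp_continuous_on, rule ballI)
    fix z
    obtain c where c: "c \<in> atlas" "z \<in> fst c" by (rule chart_exists)
    have "continuous_on (fst c) (\<lambda>z. f (chart_inv c (snd c z)))"
      by (rule continuous_on_compose2[OF CkM_chart[OF f c(1), simplified] continuous_chart[OF c(1)]])
        (auto simp: chart_image_def)
    then have "continuous_on (fst c) f" by (rule continuous_on_eq) (simp add: c(1))
    then show "isCont f z" using open_chart[OF c(1)] c(2) by (simp add: continuous_on_eq_continuous_at)
  qed
next
  assume "continuous_on UNIV f"
  then show "CkM 0 f" unfolding CkM_def
    by (auto intro: continuous_on_compose2[OF _ continuous_chart_inv])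
qed

lemma CkM_Suc_imp: "CkM (Suc k) f \<Longrightarrow> CkM k f"
  unfolding CkM_def using Ck_on_Suc_imp by blast

lemma CkM_1_continuous: "CkM (Suc 0) f \<Longrightarrow> continuous_on UNIV f"
  using CkM_Suc_imp CkM_0 by blast

lemma CkM_mult:
  fixes f h :: "'z \<Rightarrow> 'b::real_normed_algebra"
  shows "CkM k f \<Longrightarrow> CkM k h \<Longrightarrow> CkM k (\<lambda>z. f z * h z)"
  unfolding CkM_def using Ck_on_mult open_chart_image_UNIV by blast

lemma CkM_of_real: "CkM k f \<Longrightarrow> CkM k (\<lambda>z. complex_of_real (f z))"
  unfolding CkM_def using Ck_on_bounded_linear[OF open_chart_image_UNIV bounded_linear_of_real] by blast

lemma CkM_differentiable:
  "CkM (Suc 0) f \<Longrightarrow> c \<in> atlas \<Longrightarrow> z \<in> fst c \<Longrightarrow> (\<lambda>w. f (chart_inv c w)) differentiable (at (snd c z))"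
  using CkM_chart[of "Suc 0" f c] chart_in_image[of z c UNIV] by simp

lemma chart_support_closed:
  assumes c: "c \<in> atlas" and K: "compact K" "K \<subseteq> chart_image c UNIV"
  shows "closed (chart_inv c ` K)"
  by (rule compact_imp_closed[OF compact_continuous_image[OF continuous_on_subset[OF continuous_chart_inv[OF c] K(2)] K(1)]])

lemma chart_support_iff:
  assumes c: "c \<in> atlas" and K: "K \<subseteq> chart_image c UNIV"
  shows "z \<in> chart_inv c ` K \<longleftrightarrow> z \<in> fst c \<and> snd c z \<in> K"
proof
  assume "z \<in> chart_inv c ` K"
  then obtain w where "w \<in> K" "z = chart_inv c w" by blast
  then show "z \<in> fst c \<and> snd c z \<in> K" using chart_inv_in[OF c] chart_chart_inv[OF c] K by auto
next
  assume "z \<in> fst c \<and> snd c z \<in> K"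
  then show "z \<in> chart_inv c ` K" using chart_inv_chart[OF c] by (metis image_eqI)
qed

text \<open>Inside the chart the function is a bump composed with a transition map. At a point
  outside it vanishes in a whole neighbourhood, because its support is the image of a compact ball
  and hence closed in the Hausdorff space Z.\<close>

lemma CkM_bump:
  assumes c: "c \<in> atlas" and r: "r > 0" "cball a r \<subseteq> chart_image c UNIV"
  shows "CkM (Suc 0) (\<lambda>z. if z \<in> fst c then bump a r (snd c z) else 0)" (is "CkM _ ?b")
  unfolding CkM_def
proof (intro ballI Ck_on_local)
  fix d w assume d: "d \<in> atlas" and w: "w \<in> chart_image d UNIV"
  show "\<exists>N. open N \<and> w \<in> N \<and> Ck_on (Suc 0) N (\<lambda>w. ?b (chart_inv d w))"
  proof (cases "chart_inv d w \<in> fst c")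
    case True
    define N where "N = chart_image d (fst c)"
    have N: "open N" "w \<in> N" unfolding N_def
      using open_chart_image[OF d open_chart[OF c]] mem_chart_image[OF d, of w "fst c"] w True by blast+
    have "Ck_on (Suc 0) N (\<lambda>w. bump a r (trans d c w))"
      by (rule Ck_on_bump_holomorphic[OF _ N(1)]) (use trans_holomorphic[OF d c] N_def in simp)
    then have "Ck_on (Suc 0) N (\<lambda>w. ?b (chart_inv d w))"
      by (rule Ck_on_cong[OF N(1), THEN iffD1, rotated]) (use chart_imageD(2)[OF d] N_def in \<open>simp add: trans_def\<close>)
    then show ?thesis using N by blast
  next
    case False
    define K where "K = chart_inv c ` cball a r"
    have oK: "open (- K)" using chart_support_closed[OF c _ r(2)] by (simp add: K_def open_Compl)
    have zK: "z \<in> K \<longleftrightarrow> z \<in> fst c \<and> snd c z \<in> cball a r" for z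
      unfolding K_def by (rule chart_support_iff[OF c r(2)])
    define N where "N = chart_image d (- K)"
    have N: "open N" "w \<in> N" unfolding N_def
      using open_chart_image[OF d oK] mem_chart_image[OF d, of w "- K"] w False zK by blast+
    have "Ck_on (Suc 0) N (\<lambda>w. ?b (chart_inv d w))"
    proof (rule Ck_on_cong[OF N(1), THEN iffD1, OF _ Ck_on_const[of "Suc 0" N 0]])
      fix q assume "q \<in> N"
      then have "chart_inv d q \<notin> K" using chart_imageD(2)[OF d] unfolding N_def by blast
      then show "0 = ?b (chart_inv d q)" using bump_zero[OF r(1)] zK by auto
    qed
    then show ?thesis using N by blast
  qed
qed

end

context line_bundle
begin

text \<open>Each member carries a chart, a trivialisation and a compact support in coordinates, so
  that every term of an integral over Z becomes a Lebesgue integral over a region where the metric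
  is given by one weight function.\<close>

definition partition_of_unity ::
  "'z set \<Rightarrow> ('z \<Rightarrow> ('z, 'n) chart) \<Rightarrow> ('z \<Rightarrow> 'i) \<Rightarrow> ('z \<Rightarrow> (complex^'n) set) \<Rightarrow> ('z \<Rightarrow> 'z \<Rightarrow> real) \<Rightarrow> bool" where
  "partition_of_unity P cc ii KK \<rho> \<longleftrightarrow> finite P \<and>
     (\<forall>p\<in>P. cc p \<in> atlas \<and> compact (KK p) \<and> KK p \<subseteq> chart_image (cc p) (W (ii p)) \<and> CkM (Suc 0) (\<rho> p) \<and>
        (\<forall>z. 0 \<le> \<rho> p z) \<and> (\<forall>z. \<rho> p z \<noteq> 0 \<longrightarrow> z \<in> fst (cc p) \<and> snd (cc p) z \<in> KK p)) \<and>
     (\<forall>z. (\<Sum>p\<in>P. \<rho> p z) = 1)"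

lemma partition_of_unity_exists: "\<exists>P cc ii KK \<rho>. partition_of_unity P cc ii KK \<rho>"
proof -
  have "\<exists>c i r. c \<in> atlas \<and> p \<in> fst c \<and> r > 0 \<and> cball (snd c p) r \<subseteq> chart_image c (W i)" for p
  proof -
    obtain c where c: "c \<in> atlas" "p \<in> fst c" by (rule chart_exists)
    obtain i where i: "p \<in> W i" by (rule W_exists)
    have "open (chart_image c (W i))" "snd c p \<in> chart_image c (W i)"
      using open_chart_image[OF c(1) open_W] chart_in_image[OF c(2) i] by auto
    then obtain r where "r > 0" "cball (snd c p) r \<subseteq> chart_image c (W i)"
      using open_contains_cball by blast
    then show ?thesis using c by blast
  qed
  then obtain cc ii rr where ch: "\<And>p. cc p \<in> atlas" "\<And>p. p \<in> fst (cc p)" "\<And>p. rr p > (0::real)"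
    "\<And>p. cball (snd (cc p) p) (rr p) \<subseteq> chart_image (cc p) (W (ii p))"
    by metis
  define bf where "bf p z = (if z \<in> fst (cc p) then bump (snd (cc p) p) (rr p) (snd (cc p) z) else 0)" for p z
  have bf1: "CkM (Suc 0) (bf p)" for p
    unfolding bf_def[abs_def] using ch chart_image_subset by (intro CkM_bump) blast+
  have bf0: "0 \<le> bf p z" for p z by (simp add: bf_def bump_def)
  have bfs: "z \<in> fst (cc p) \<and> snd (cc p) z \<in> cball (snd (cc p) p) (rr p)" if "bf p z \<noteq> 0" for p z
  proof -
    have "z \<in> fst (cc p)" using that by (auto simp: bf_def split: if_splits)
    moreover from this that have "bump (snd (cc p) p) (rr p) (snd (cc p) z) \<noteq> 0" by (simp add: bf_def)
    then have "snd (cc p) z \<in> cball (snd (cc p) p) (rr p)" using bump_zero[OF ch(3)] by blast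
    ultimately show ?thesis by blast
  qed
  have bfp: "bf p p > 0" for p using ch(2,3)[of p] by (simp add: bf_def bump_def)
  have op: "open {z. 0 < bf p z}" for p
    by (rule open_Collect_less[OF continuous_on_const CkM_1_continuous[OF bf1]])
  obtain P where P: "finite P" "UNIV \<subseteq> (\<Union>p\<in>P. {z. 0 < bf p z})"
    by (rule compactE_image[OF compact_space, of UNIV "\<lambda>p. {z. 0 < bf p z}"]) (use op bfp in auto)
  define \<sigma> where "\<sigma> z = (\<Sum>p\<in>P. bf p z)" for z
  have \<sigma>: "\<sigma> z > 0" for z
  proof -
    obtain p where "p \<in> P" "0 < bf p z" using P(2) by blast
    then show ?thesis unfolding \<sigma>_def using P(1) bf0 by (intro sum_pos2[of P p]) auto
  qed
  have \<rho>1: "CkM (Suc 0) (\<lambda>z. bf p z * inverse (\<sigma> z))" for p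
    unfolding CkM_def
  proof
    fix c assume c: "c \<in> atlas"
    have o: "open (chart_image c UNIV)" by (rule open_chart_image_UNIV[OF c])
    have "Ck_on (Suc 0) (chart_image c UNIV) (\<lambda>w. \<sigma> (chart_inv c w))"
      unfolding \<sigma>_def by (rule Ck_on_sum[OF o CkM_chart[OF bf1 c]])
    moreover have "\<sigma> (chart_inv c w) \<noteq> 0" for w using \<sigma>[of "chart_inv c w"] by simp
    ultimately have "Ck_on (Suc 0) (chart_image c UNIV) (\<lambda>w. inverse (\<sigma> (chart_inv c w)))"
      by (intro Ck_on_inverse[OF o])
    then show "Ck_on (Suc 0) (chart_image c UNIV) (\<lambda>w. bf p (chart_inv c w) * inverse (\<sigma> (chart_inv c w)))"
      by (rule Ck_on_mult[OF o CkM_chart[OF bf1 c]])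
  qed
  have "partition_of_unity P cc ii (\<lambda>p. cball (snd (cc p) p) (rr p)) (\<lambda>p z. bf p z * inverse (\<sigma> z))"
    unfolding partition_of_unity_def
  proof (intro conjI ballI allI impI P(1) ch \<rho>1 compact_cball)
    fix p z
    show "0 \<le> bf p z * inverse (\<sigma> z)" using bf0 \<sigma>[of z] by simp
    assume "bf p z * inverse (\<sigma> z) \<noteq> 0"
    then have "bf p z \<noteq> 0" by auto
    from bfs[OF this] show "z \<in> fst (cc p)" "snd (cc p) z \<in> cball (snd (cc p) p) (rr p)" by auto
  next
    fix z show "(\<Sum>p\<in>P. bf p z * inverse (\<sigma> z)) = 1"
      using \<sigma>[of z] unfolding sum_distrib_right[symmetric] \<sigma>_def[symmetric] by simp
  qed
  then show ?thesis by blast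
qed

end

section \<open>Families of metrics\<close>

abbreviation pd :: "'n::finite option \<Rightarrow> (complex \<times> (complex^'n) \<Rightarrow> complex) \<Rightarrow> complex \<times> (complex^'n) \<Rightarrow> complex" where
  "pd k \<equiv> dop (- \<i>) (tz_axis k 1) (tz_axis k \<i>)"

abbreviation pdb :: "'n::finite option \<Rightarrow> (complex \<times> (complex^'n) \<Rightarrow> complex) \<Rightarrow> complex \<times> (complex^'n) \<Rightarrow> complex" where
  "pdb k \<equiv> dop \<i> (tz_axis k 1) (tz_axis k \<i>)"

lemma bounded_linear_Pair_0: "bounded_linear (\<lambda>w. (0, w))" "bounded_linear (\<lambda>t. (t, 0))"
  by (intro bounded_linear_Pair bounded_linear_ident bounded_linear_zero)+

lemma dop_slice_snd:
  assumes "f differentiable (at (t, w))"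
  shows "dop \<kappa> v v' (\<lambda>w. f (t, w)) w = dop \<kappa> (0, v) (0, v') f (t, w)"
  using dop_affine[OF bounded_linear_Pair_0(1), of f "(t, 0)" w \<kappa> v v'] assms by simp

lemma dop_slice_fst:
  assumes "f differentiable (at (t, w))"
  shows "dop \<kappa> v v' (\<lambda>t. f (t, w)) t = dop \<kappa> (v, 0) (v', 0) f (t, w)"
  using dop_affine[OF bounded_linear_Pair_0(2), of f "(0, w)" t \<kappa> v v'] assms by simp

lemma Cinf_on_slice_snd:
  assumes "Cinf_on (U \<times> S) f" "open S" "t \<in> U"
  shows "Cinf_on S (\<lambda>w. f (t, w))"
  using Cinf_on_affine_comp[OF bounded_linear_Pair_0(1) assms(2), of "(t, 0)" "U \<times> S" f] assms by simp

lemma Ck_on_snd: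
  assumes "Ck_on k S f" "open S" "open U"
  shows "Ck_on k (U \<times> S) (\<lambda>q. f (snd q))"
  using Ck_on_affine_comp[OF bounded_linear_snd, of "U \<times> S" 0 S k f] assms by (simp add: open_Times mem_Times_iff)

lemma Cinf_on_snd: "Cinf_on S f \<Longrightarrow> open S \<Longrightarrow> open U \<Longrightarrow> Cinf_on (U \<times> S) (\<lambda>q. f (snd q))"
  unfolding Cinf_on_def using Ck_on_snd by blast

lemma dop_snd:
  assumes "f differentiable (at (snd q))"
  shows "dop \<kappa> v v' (\<lambda>q. f (snd q)) q = dop \<kappa> (snd v) (snd v') f (snd q)"
  using dop_affine[OF bounded_linear_snd, of f 0 q \<kappa> v v'] assms by simp

section \<open>The family of metrics in coordinates\<close>

locale family = line_bundle atlas W g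
  for atlas :: "('z::t2_space, 'n::finite) chart set" and W :: "'i \<Rightarrow> 'z set" and g +
  fixes U :: "complex set" and \<phi>\<^sub>0 :: "'i \<Rightarrow> 'z \<Rightarrow> real" and \<psi> :: "complex \<Rightarrow> 'z \<Rightarrow> real"
    and \<phi> :: "complex \<Rightarrow> 'i \<Rightarrow> 'z \<Rightarrow> real"
  assumes open_U: "open U"
    and smooth_\<phi>0: "smooth_metric atlas W g \<phi>\<^sub>0"
    and smooth_\<psi>: "product_smooth_on atlas \<psi> U UNIV"
    and smooth_\<phi>: "smooth_metric_pullback atlas W g U \<phi>"
    and \<phi>_eq: "\<forall>\<tau>\<in>U. \<forall>i. \<forall>z\<in>W i. \<phi> \<tau> i z = \<phi>\<^sub>0 i z + \<psi> \<tau> z"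
    and positive_\<phi>: "\<forall>\<tau>\<in>U. positive_metric atlas W (\<phi> \<tau>)"
    and semipositive: "semipositive_on_product atlas W U \<phi>"
begin

definition lift :: "('z, 'n) chart \<Rightarrow> (complex \<Rightarrow> 'z \<Rightarrow> 'b) \<Rightarrow> complex \<times> (complex^'n) \<Rightarrow> 'b" where
  "lift c F q = F (fst q) (chart_inv c (snd q))"

definition psm :: "(complex \<Rightarrow> 'z \<Rightarrow> complex) \<Rightarrow> bool" where
  "psm F \<longleftrightarrow> (\<forall>c\<in>atlas. Cinf_on (U \<times> chart_image c UNIV) (lift c F))"

definition Phi :: "'i \<Rightarrow> ('z, 'n) chart \<Rightarrow> complex \<times> (complex^'n) \<Rightarrow> complex" where
  "Phi i c q = complex_of_real (\<phi> (fst q) i (chart_inv c (snd q)))"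

definition Gm :: "('z, 'n) chart \<Rightarrow> complex \<times> (complex^'n) \<Rightarrow> complex^'n^'n" where
  "Gm c q = curvature_matrix W (\<phi> (fst q)) c (chart_inv c (snd q))"

lemma Cinf_\<phi>: "c \<in> atlas \<Longrightarrow> Cinf_on (U \<times> chart_image c (W i)) (\<lambda>q. \<phi> (fst q) i (chart_inv c (snd q)))"
  using smooth_\<phi> unfolding smooth_metric_pullback_def product_smooth_on_def by (simp add: case_prod_unfold)

lemma open_prod_W: "c \<in> atlas \<Longrightarrow> open (U \<times> chart_image c (W i))"
  using open_U open_chart_image open_W by (intro open_Times) blast+

lemma open_prod: "c \<in> atlas \<Longrightarrow> open (U \<times> chart_image c UNIV)"
  using open_U open_chart_image_UNIV by (intro open_Times) blast+

lemma Cinf_Phi: "c \<in> atlas \<Longrightarrow> Cinf_on (U \<times> chart_image c (W i)) (Phi i c)"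
  unfolding Phi_def[abs_def] by (intro Cinf_on_of_real open_prod_W Cinf_\<phi>)

lemma metric_\<phi>: assumes "\<tau> \<in> U" shows "metric atlas W g (\<phi> \<tau>)"
proof
  have "Cinf_on (chart_image c (W i)) (\<lambda>w. \<phi> \<tau> i (chart_inv c w))" if "c \<in> atlas" for c i
    using Cinf_on_slice_snd[OF Cinf_\<phi>[OF that, of i] open_chart_image[OF that open_W] assms] by simp
  then show "smooth_metric atlas W g (\<phi> \<tau>)"
    using smooth_\<phi> assms unfolding smooth_metric_pullback_def smooth_metric_def manifold_smooth_on_def by blast
  show "positive_metric atlas W (\<phi> \<tau>)" using positive_\<phi> assms by blast
qed

text \<open>\<open>Gm\<close> fixes t and differentiates on the fibre. Recognised as a block of the
  Hessian on U \<times> Z, it can be differentiated in t as well.\<close>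

lemma Gm_eq:
  assumes c: "c \<in> atlas" and q: "q \<in> U \<times> chart_image c (W i)"
  shows "Gm c q $ k $ l = pd (Some k) (pdb (Some l) (Phi i c)) q"
proof -
  obtain t w where tw: "q = (t, w)" "t \<in> U" "w \<in> chart_image c (W i)" using q by auto
  interpret metric atlas W g "\<phi> t" by (rule metric_\<phi>[OF tw(2)])
  have o: "open (chart_image c (W i))" by (rule open_chart_image[OF c open_W])
  have "Gm c q $ k $ l = dz k (dzb l (\<lambda>w. Phi i c (t, w))) w"
    unfolding Gm_def tw(1) fst_conv snd_conv curvature_matrix_chart[OF c tw(3)] complex_hessian_nth by (simp add: Phi_def)
  also have "\<dots> = dz k (\<lambda>w. pdb (Some l) (Phi i c) (t, w)) w"
    by (rule dop_cong[OF o tw(3)], subst dop_slice_snd)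
      (use Cinf_on_differentiable[OF Cinf_Phi[OF c, of i]] tw(2) in \<open>auto simp: tz_axis_def\<close>)
  also have "\<dots> = pd (Some k) (pdb (Some l) (Phi i c)) q"
    by (subst dop_slice_snd)
      (use Cinf_on_differentiable[OF Cinf_on_dop[OF open_prod_W[OF c] Cinf_Phi[OF c, of i]]] q in \<open>auto simp: tz_axis_def tw(1)\<close>)
  finally show ?thesis .
qed

lemma prod_W_exists:
  assumes "c \<in> atlas" "q \<in> U \<times> chart_image c UNIV"
  obtains i where "q \<in> U \<times> chart_image c (W i)"
  using W_exists[of "chart_inv c (snd q)"] mem_chart_image[OF assms(1)] assms(2)
  by (metis mem_Times_iff)

lemma Cinf_Gm:
  assumes c: "c \<in> atlas"
  shows "Cinf_on (U \<times> chart_image c UNIV) (\<lambda>q. Gm c q $ k $ l)"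
proof (rule Cinf_on_local)
  fix q assume q: "q \<in> U \<times> chart_image c UNIV"
  obtain i where i: "q \<in> U \<times> chart_image c (W i)" by (rule prod_W_exists[OF c q])
  have "Cinf_on (U \<times> chart_image c (W i)) (\<lambda>q. Gm c q $ k $ l)"
    by (rule Cinf_on_cong[OF open_prod_W[OF c], THEN iffD1, OF _ Cinf_on_dop[OF open_prod_W[OF c] Cinf_on_dop[OF open_prod_W[OF c] Cinf_Phi[OF c]]]])
      (rule Gm_eq[OF c, symmetric])
  then show "\<exists>N. open N \<and> q \<in> N \<and> Cinf_on N (\<lambda>q. Gm c q $ k $ l)" using i open_prod_W[OF c] by blast
qed

lemma
  assumes c: "c \<in> atlas" and q: "q \<in> U \<times> chart_image c UNIV"
  shows Gm_det: "det (Gm c q) \<noteq> 0" and Gm_hermitian: "hermitian (Gm c q)"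
    and Gm_positive: "positive_definite (Gm c q)"
    and Gm_dens: "complex_of_real (volume_density W (\<phi> (fst q)) c (snd q)) = 2 ^ CARD('n) * det (Gm c q)"
proof -
  obtain t w where tw: "q = (t, w)" "t \<in> U" "w \<in> chart_image c UNIV" using q by auto
  interpret metric atlas W g "\<phi> t" by (rule metric_\<phi>[OF tw(2)])
  have z: "chart_inv c w \<in> fst c" using chart_inv_in[OF c tw(3)] .
  show "det (Gm c q) \<noteq> 0" "hermitian (Gm c q)" "positive_definite (Gm c q)"
    using curvature_matrix_det(1)[OF c z] curvature_matrix_hermitian[OF c z] curvature_matrix_positive[OF c z]
    by (simp_all add: Gm_def tw)
  show "complex_of_real (volume_density W (\<phi> (fst q)) c (snd q)) = 2 ^ CARD('n) * det (Gm c q)"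
    using curvature_matrix_det(3)[OF c z] by (simp add: volume_density_def Gm_def tw complex_eq_iff)
qed

lemma psm_lift: "psm F \<Longrightarrow> c \<in> atlas \<Longrightarrow> Cinf_on (U \<times> chart_image c UNIV) (lift c F)"
  by (simp add: psm_def)

lemma psm_lift_differentiable:
  "psm F \<Longrightarrow> c \<in> atlas \<Longrightarrow> q \<in> U \<times> chart_image c UNIV \<Longrightarrow> lift c F differentiable (at q)"
  using psm_lift Cinf_on_differentiable by blast

lemma psm_CkM:
  assumes "psm F" "t \<in> U"
  shows "CkM k (F t)"
  unfolding CkM_def
proof
  fix c assume c: "c \<in> atlas"
  have "Cinf_on (chart_image c UNIV) (\<lambda>w. lift c F (t, w))"
    by (rule Cinf_on_slice_snd[OF psm_lift[OF assms(1) c] open_chart_image_UNIV[OF c] assms(2)])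
  then show "Ck_on k (chart_image c UNIV) (\<lambda>w. F t (chart_inv c w))" by (simp add: lift_def Cinf_on_def)
qed

lemma psm_continuous: "psm F \<Longrightarrow> t \<in> U \<Longrightarrow> continuous_on UNIV (F t)"
  using psm_CkM CkM_0 by blast

lemma psmI:
  assumes "\<And>c. c \<in> atlas \<Longrightarrow> Cinf_on (U \<times> chart_image c UNIV) (H c)"
    and "\<And>c t w. c \<in> atlas \<Longrightarrow> t \<in> U \<Longrightarrow> w \<in> chart_image c UNIV \<Longrightarrow> F t (chart_inv c w) = H c (t, w)"
  shows "psm F"
  unfolding psm_def
proof
  fix c assume c: "c \<in> atlas"
  show "Cinf_on (U \<times> chart_image c UNIV) (lift c F)"
    by (rule Cinf_on_cong[OF open_prod[OF c], THEN iffD1, OF _ assms(1)[OF c]]) (auto simp: lift_def assms(2)[OF c])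
qed

lemma psm_mult: "psm F \<Longrightarrow> psm H \<Longrightarrow> psm (\<lambda>t z. F t z * H t z)"
  by (rule psmI[where H="\<lambda>c q. lift c F q * lift c H q"], (intro Cinf_on_mult open_prod psm_lift; assumption), simp add: lift_def)

lemma psm_diff: "psm F \<Longrightarrow> psm H \<Longrightarrow> psm (\<lambda>t z. F t z - H t z)"
  by (rule psmI[where H="\<lambda>c q. lift c F q - lift c H q"], (intro Cinf_on_diff open_prod psm_lift; assumption), simp add: lift_def)

lemma psm_add: "psm F \<Longrightarrow> psm H \<Longrightarrow> psm (\<lambda>t z. F t z + H t z)"
  by (rule psmI[where H="\<lambda>c q. lift c F q + lift c H q"], (intro Cinf_on_add open_prod psm_lift; assumption), simp add: lift_def)

lemma psm_cnj: "psm F \<Longrightarrow> psm (\<lambda>t z. cnj (F t z))"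
  by (rule psmI[where H="\<lambda>c q. cnj (lift c F q)"], (intro Cinf_on_cnj open_prod psm_lift; assumption), simp add: lift_def)

section \<open>Derivatives in t and the fibrewise pairing\<close>

definition dtop :: "complex \<Rightarrow> (complex \<Rightarrow> 'z \<Rightarrow> complex) \<Rightarrow> complex \<Rightarrow> 'z \<Rightarrow> complex" where
  "dtop \<kappa> F t z = dop \<kappa> 1 \<i> (\<lambda>\<tau>. F \<tau> z) t"

abbreviation "dt \<equiv> dtop (- \<i>)"
abbreviation "dtb \<equiv> dtop \<i>"

lemma lift_dtop:
  assumes "psm F" "c \<in> atlas" "q \<in> U \<times> chart_image c UNIV"
  shows "lift c (dtop \<kappa> F) q = dop \<kappa> (tz_axis None 1) (tz_axis None \<i>) (lift c F) q"
proof -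
  obtain t w where tw: "q = (t, w)" by force
  have "dop \<kappa> 1 \<i> (\<lambda>t. lift c F (t, w)) t = dop \<kappa> (1, 0) (\<i>, 0) (lift c F) (t, w)"
    by (rule dop_slice_fst) (use psm_lift_differentiable[OF assms] tw in simp)
  then show ?thesis by (simp add: lift_def dtop_def tw tz_axis_def)
qed

lemma psm_dtop: "psm F \<Longrightarrow> psm (dtop \<kappa> F)"
  by (rule psmI[where H="\<lambda>c. dop \<kappa> (tz_axis None 1) (tz_axis None \<i>) (lift c F)"],
    (intro Cinf_on_dop open_prod psm_lift; assumption), subst lift_dtop[symmetric], assumption+, simp, simp add: lift_def)

text \<open>The pointwise pairing of \<partial>a with dbar b under \<omega> at t. It is bilinear,
  not sesquilinear: conjugates enter through a and b themselves.\<close>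

definition pairP :: "complex \<Rightarrow> ('z \<Rightarrow> complex) \<Rightarrow> ('z \<Rightarrow> complex) \<Rightarrow> 'z \<Rightarrow> complex" where
  "pairP t a b z = (let c = (SOME c. c \<in> atlas \<and> z \<in> fst c) in
     pform (curvature_matrix W (\<phi> t) c z) (\<chi> k. dz k (\<lambda>w. a (chart_inv c w)) (snd c z))
       (\<chi> j. dzb j (\<lambda>w. b (chart_inv c w)) (snd c z)))"

text \<open>Changing charts multiplies the two differentials by the transposed Jacobian and its
  conjugate, and \<open>pform_chain\<close> cancels them against the change of the metric.\<close>

lemma pairP_chart:
  assumes t: "t \<in> U" and c: "c \<in> atlas" "z \<in> fst c" and a: "CkM (Suc 0) a" and b: "CkM (Suc 0) b"
  shows "pairP t a b z = pform (curvature_matrix W (\<phi> t) c z) (\<chi> k. dz k (\<lambda>w. a (chart_inv c w)) (snd c z))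
       (\<chi> j. dzb j (\<lambda>w. b (chart_inv c w)) (snd c z))"
proof -
  interpret metric atlas W g "\<phi> t" by (rule metric_\<phi>[OF t])
  define d where "d = (SOME c. c \<in> atlas \<and> z \<in> fst c)"
  have "\<exists>d. d \<in> atlas \<and> z \<in> fst d" using c by blast
  then have d: "d \<in> atlas" "z \<in> fst d" unfolding d_def by (metis (mono_tags, lifting) someI_ex)+
  define J where "J = jac (trans c d) (snd c z)"
  have S: "open (chart_image c (fst d))" "snd c z \<in> chart_image c (fst d)"
    by (rule open_chart_image[OF c(1) open_chart[OF d(1)]], rule chart_in_image[OF c(2) d(2)])
  have T: "trans c d (snd c z) = snd d z" by (simp add: trans_def c)
  have J: "det J \<noteq> 0" unfolding J_def by (rule det_jac_trans[OF c(1) d(1) S(2)])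
  have eq: "(\<lambda>w. f (chart_inv c w)) w = f (chart_inv d (trans c d w))" if "w \<in> chart_image c (fst d)" for f :: "'z \<Rightarrow> complex" and w
    using chart_inv_trans[OF c(1) d(1) that] by simp
  have fd: "(\<lambda>w. f (chart_inv d w)) differentiable (at (trans c d (snd c z)))" if "CkM (Suc 0) f" for f :: "'z \<Rightarrow> complex"
    unfolding T by (rule CkM_differentiable[OF that d])
  have 1: "(\<chi> k. dz k (\<lambda>w. a (chart_inv c w)) (snd c z)) = transpose J *v (\<chi> k. dz k (\<lambda>w. a (chart_inv d w)) (snd d z))"
  proof -
    have "dz k (\<lambda>w. a (chart_inv c w)) (snd c z) = (\<Sum>m\<in>UNIV. dz m (\<lambda>w. a (chart_inv d w)) (snd d z) * J $ m $ k)" for k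
      unfolding J_def T[symmetric] holomorphic_chain(2)[OF trans_holomorphic[OF c(1) d(1)] S(2) fd[OF a], symmetric]
      by (rule dop_cong[OF S]) (rule eq)
    then show ?thesis by (simp add: vec_eq_iff matrix_vector_mult_def transpose_def mult.commute del: transpose_matrix_vector)
  qed
  have 2: "(\<chi> k. dzb k (\<lambda>w. b (chart_inv c w)) (snd c z)) = transpose (cnjmat J) *v (\<chi> k. dzb k (\<lambda>w. b (chart_inv d w)) (snd d z))"
  proof -
    have "dzb k (\<lambda>w. b (chart_inv c w)) (snd c z) = (\<Sum>m\<in>UNIV. dzb m (\<lambda>w. b (chart_inv d w)) (snd d z) * cnj (J $ m $ k))" for k
      unfolding J_def T[symmetric] holomorphic_chain(3)[OF trans_holomorphic[OF c(1) d(1)] S(2) fd[OF b], symmetric]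
      by (rule dop_cong[OF S]) (rule eq)
    then show ?thesis by (simp add: vec_eq_iff matrix_vector_mult_def transpose_def cnjmat_def mult.commute del: transpose_matrix_vector)
  qed
  show ?thesis
    unfolding pairP_def d_def[symmetric] Let_def 1 2 curvature_matrix_trans[OF c(1) d(1) c(2) d(2)] J_def[symmetric]
    by (rule pform_chain[OF curvature_matrix_det(1)[OF d] J, symmetric])
qed

lemma pairP_chart_inv:
  assumes t: "t \<in> U" and c: "c \<in> atlas" "w \<in> chart_image c UNIV" and a: "CkM (Suc 0) a" and b: "CkM (Suc 0) b"
  shows "pairP t a b (chart_inv c w) = pform (Gm c (t, w)) (\<chi> k. dz k (\<lambda>w. a (chart_inv c w)) w)
       (\<chi> j. dzb j (\<lambda>w. b (chart_inv c w)) w)"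
  using pairP_chart[OF t c(1) chart_inv_in[OF c] a b] chart_chart_inv[OF c] by (simp add: Gm_def)

lemma pairP_lift:
  assumes "psm F" "psm H" "c \<in> atlas" "t \<in> U" "w \<in> chart_image c UNIV"
  shows "pairP t (F t) (H t) (chart_inv c w) = pform (Gm c (t, w)) (\<chi> k. pd (Some k) (lift c F) (t, w)) (\<chi> j. pdb (Some j) (lift c H) (t, w))"
proof -
  have q: "(t, w) \<in> U \<times> chart_image c UNIV" using assms by simp
  have "dop \<kappa> (axis k 1) (axis k \<i>) (\<lambda>w. X t (chart_inv c w)) w = dop \<kappa> (tz_axis (Some k) 1) (tz_axis (Some k) \<i>) (lift c X) (t, w)"
    if "psm X" for X \<kappa> k
    using dop_slice_snd[OF psm_lift_differentiable[OF that assms(3) q]] by (simp add: lift_def tz_axis_def)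
  then show ?thesis
    using pairP_chart_inv[OF assms(4,3,5) psm_CkM[OF assms(1,4)] psm_CkM[OF assms(2,4)]] assms(1,2) by simp
qed

lemma psm_pairP:
  assumes "psm F" "psm H"
  shows "psm (\<lambda>t. pairP t (F t) (H t))"
proof (rule psmI[where H="\<lambda>c q. pform (Gm c q) (\<chi> k. pd (Some k) (lift c F) q) (\<chi> j. pdb (Some j) (lift c H) q)"])
  fix c assume c: "c \<in> atlas"
  show "Cinf_on (U \<times> chart_image c UNIV) (\<lambda>q. pform (Gm c q) (\<chi> k. pd (Some k) (lift c F) q) (\<chi> j. pdb (Some j) (lift c H) q))"
    unfolding pform_def vec_lambda_beta
    by (intro Cinf_on_sum Cinf_on_mult Cinf_on_matrix_inv Cinf_on_dop open_prod c psm_lift assms Cinf_Gm Gm_det)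
qed (rule pairP_lift[OF assms])

end

section \<open>The first variation of integrals over the fibres\<close>

lemma dop_zero_directions: "f differentiable (at p) \<Longrightarrow> dop \<kappa> 0 0 f p = 0"
  by (simp add: dop_def linear_0[OF linear_frechet_derivative])

lemma Ck_1_dop_continuous:
  "Ck_on (Suc 0) S f \<Longrightarrow> continuous_on S (dop \<kappa> v w f)"
  unfolding dop_def[abs_def] by (intro continuous_intros) auto

context family
begin

abbreviation volt :: "complex \<Rightarrow> 'z measure" where "volt t \<equiv> volume_measure atlas W (\<phi> t)"

definition supported_in :: "('z \<Rightarrow> complex) \<Rightarrow> ('z, 'n) chart \<Rightarrow> (complex^'n) set \<Rightarrow> bool" where
  "supported_in f c K \<longleftrightarrow> (\<forall>z. f z \<noteq> 0 \<longrightarrow> z \<in> fst c \<and> snd c z \<in> K)"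

lemma supported_in_zero:
  assumes "supported_in f c K" "c \<in> atlas" "w \<in> chart_image c UNIV" "w \<notin> K"
  shows "f (chart_inv c w) = 0"
  using assms chart_chart_inv[OF assms(2,3)] by (auto simp: supported_in_def)

lemma supported_in_mult_left: "supported_in f c K \<Longrightarrow> supported_in (\<lambda>z. f z * h z) c K"
  by (auto simp: supported_in_def)

lemma det_Gm_continuous:
  assumes "c \<in> atlas" "t \<in> U"
  shows "continuous_on (chart_image c UNIV) (\<lambda>w. det (Gm c (t, w)))"
  using Cinf_on_continuous[OF Cinf_on_slice_snd[OF Cinf_on_det[OF open_prod[OF assms(1)] Cinf_Gm[OF assms(1)]] open_chart_image_UNIV[OF assms(1)] assms(2)]] .

text \<open>The density appears as the complex number 2^n det, the form in which Jacobi's formula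
  for Wirtinger derivatives applies to it. The region is cut down to one trivialisation, where the
  weight is a single function.\<close>

lemma
  assumes t: "t \<in> U" and c: "c \<in> atlas" and K: "compact K" "K \<subseteq> chart_image c (W i)"
    and f: "CkM 0 f" and s: "supported_in f c K"
  shows integrable_supported: "integrable (volt t) f"
    and integral_supported: "integral\<^sup>L (volt t) f =
      integral\<^sup>L lborel (\<lambda>w. if w \<in> chart_image c (W i) then f (chart_inv c w) * (2 ^ CARD('n) * det (Gm c (t, w))) else 0)"
    and integrable_supported_chart: "integrable lborel (\<lambda>w. if w \<in> chart_image c (W i) then f (chart_inv c w) * (2 ^ CARD('n) * det (Gm c (t, w))) else 0)"
proof -
  interpret metric atlas W g "\<phi> t" by (rule metric_\<phi>[OF t])
  let ?O = "chart_image c (W i)"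
  have o: "open ?O" by (rule open_chart_image[OF c open_W])
  have z0: "f (chart_inv c w) = 0" if "w \<in> ?O" "w \<notin> K" for w
    using supported_in_zero[OF s c _ that(2)] that(1) chart_image_subset by blast
  have fm: "f \<in> borel_measurable borel"
    using f CkM_0 borel_measurable_continuous_onI by blast
  have z: "f z = 0" if "z \<notin> fst c" for z using s that by (auto simp: supported_in_def)
  have eq: "(\<lambda>w. (indicator (chart_image c UNIV) w * volume_density W (\<phi> t) c w) *\<^sub>R f (chart_inv c w))
    = (\<lambda>w. if w \<in> ?O then f (chart_inv c w) * (2 ^ CARD('n) * det (Gm c (t, w))) else 0)"
  proof
    fix w
    consider "w \<in> ?O" | "w \<notin> ?O" "w \<in> chart_image c UNIV" | "w \<notin> chart_image c UNIV" by blast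
    then show "(indicator (chart_image c UNIV) w * volume_density W (\<phi> t) c w) *\<^sub>R f (chart_inv c w)
       = (if w \<in> ?O then f (chart_inv c w) * (2 ^ CARD('n) * det (Gm c (t, w))) else 0)"
    proof cases
      case 1
      then have w: "w \<in> chart_image c UNIV" using chart_image_subset by blast
      then have "complex_of_real (volume_density W (\<phi> t) c w) = 2 ^ CARD('n) * det (Gm c (t, w))"
        using Gm_dens[OF c, of "(t, w)"] t by simp
      with 1 w show ?thesis by (simp only: scaleR_conv_of_real indicator_simps if_True mult_1 mult.commute)
    next
      case 2
      then have "f (chart_inv c w) = 0" using supported_in_zero[OF s c] K(2) by blast
      then show ?thesis using 2 by simp
    next
      case 3
      then have "w \<notin> ?O" using chart_image_subset by blast
      then show ?thesis using 3 by simp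
    qed
  qed
  have "continuous_on ?O (\<lambda>w. f (chart_inv c w) * (2 ^ CARD('n) * det (Gm c (t, w))))"
    by (rule continuous_on_subset[OF continuous_on_mult[OF CkM_chart[OF f c, unfolded Ck_on.simps]
          continuous_on_mult[OF continuous_on_const det_Gm_continuous[OF c t]]] chart_image_subset])
  then have "Ck_on 0 UNIV (\<lambda>w. if w \<in> ?O then f (chart_inv c w) * (2 ^ CARD('n) * det (Gm c (t, w))) else 0)"
    by (intro Ck_on_extend_zero[OF o K]) (simp_all add: z0)
  moreover obtain a b where "K \<subseteq> cbox a b" using compact_subset_cbox[OF K(1)] by blast
  ultimately show i: "integrable lborel (\<lambda>w. if w \<in> ?O then f (chart_inv c w) * (2 ^ CARD('n) * det (Gm c (t, w))) else 0)"
    by (intro lborel_integral_cbox(1)[of _ a b]) (use z0 in auto)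
  have "integrable (volt t) f \<longleftrightarrow> integrable lborel (\<lambda>w. (indicator (chart_image c UNIV) w * volume_density W (\<phi> t) c w) *\<^sub>R f (chart_inv c w))"
    by (rule integrable_vol_chart[OF c fm]) (rule z)
  then show "integrable (volt t) f" unfolding eq using i by blast
  show "integral\<^sup>L (volt t) f =
      integral\<^sup>L lborel (\<lambda>w. if w \<in> chart_image c (W i) then f (chart_inv c w) * (2 ^ CARD('n) * det (Gm c (t, w))) else 0)"
    unfolding eq[symmetric] by (rule integral_vol_chart[OF c fm]) (rule z)
qed

text \<open>Off the closed support a vanishes in a whole neighbourhood, so its differential vanishes
  there too.\<close>

lemma supported_in_pairP:
  assumes t: "t \<in> U" and c: "c \<in> atlas" and K: "compact K" "K \<subseteq> chart_image c UNIV"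
    and a: "CkM (Suc 0) a" and b: "CkM (Suc 0) b" and s: "supported_in a c K"
  shows "supported_in (pairP t a b) c K"
  unfolding supported_in_def
proof (intro allI impI)
  fix z assume nz: "pairP t a b z \<noteq> 0"
  show "z \<in> fst c \<and> snd c z \<in> K"
  proof (rule ccontr)
    assume "\<not> (z \<in> fst c \<and> snd c z \<in> K)"
    then have zK: "z \<in> - chart_inv c ` K" using chart_support_iff[OF c K(2)] by blast
    obtain d where d: "d \<in> atlas" "z \<in> fst d" by (rule chart_exists)
    define N where "N = chart_image d (- chart_inv c ` K)"
    have N: "open N" "snd d z \<in> N" unfolding N_def
      by (rule open_chart_image[OF d(1) open_Compl[OF chart_support_closed[OF c K]]], rule chart_in_image[OF d(2) zK])
    have "a (chart_inv d w) = 0" if "w \<in> N" for w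
      using chart_imageD(2)[OF d(1) that[unfolded N_def]] s chart_support_iff[OF c K(2), of "chart_inv d w"]
      by (auto simp: supported_in_def)
    then have "dz k (\<lambda>w. a (chart_inv d w)) (snd d z) = 0" for k
      using dop_cong[OF N, of "\<lambda>w. a (chart_inv d w)" "\<lambda>_. 0"] by simp
    then have "pairP t a b z = 0" unfolding pairP_chart[OF t d a b] by (simp add: pform_def)
    with nz show False by simp
  qed
qed

lemma slice_dop:
  assumes "psm X" "c \<in> atlas" "t \<in> U" "w \<in> chart_image c UNIV"
  shows "dop \<kappa> (axis k 1) (axis k \<i>) (\<lambda>w. X t (chart_inv c w)) w = dop \<kappa> (tz_axis (Some k) 1) (tz_axis (Some k) \<i>) (lift c X) (t, w)"
  using dop_slice_snd[OF psm_lift_differentiable[OF assms(1,2), of "(t, w)"], of \<kappa> "axis k 1" "axis k \<i>"] assms(3,4)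
  by (simp add: lift_def tz_axis_def)

lemma CkM_pairP:
  assumes t: "t \<in> U" and a: "CkM (Suc 0) a" and b: "psm b"
  shows "CkM 0 (pairP t a (b t))"
  unfolding CkM_def Ck_on.simps
proof
  fix c assume c: "c \<in> atlas"
  have o: "open (chart_image c UNIV)" by (rule open_chart_image_UNIV[OF c])
  have b1: "Cinf_on (chart_image c UNIV) (\<lambda>w. b t (chart_inv c w))"
    using psm_CkM[OF b t] unfolding CkM_def Cinf_on_def using c by blast
  have Gi: "Cinf_on (chart_image c UNIV) (\<lambda>w. matrix_inv (Gm c (t, w)) $ j $ k)" for j k
    by (rule Cinf_on_slice_snd[OF _ o t]) (intro Cinf_on_matrix_inv open_prod c Cinf_Gm Gm_det)
  have "continuous_on (chart_image c UNIV) (\<lambda>w. pform (Gm c (t, w)) (\<chi> k. dz k (\<lambda>w. a (chart_inv c w)) w) (\<chi> j. dzb j (\<lambda>w. b t (chart_inv c w)) w))"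
    unfolding pform_def vec_lambda_beta
    by (intro continuous_on_sum continuous_on_mult Cinf_on_continuous[OF Gi] Cinf_on_continuous[OF Cinf_on_dop[OF o b1]] Ck_1_dop_continuous CkM_chart[OF a c])
  then show "continuous_on (chart_image c UNIV) (\<lambda>w. pairP t a (b t) (chart_inv c w))"
    by (rule continuous_on_eq) (rule pairP_chart_inv[OF t c _ a psm_CkM[OF b t], symmetric])
qed

text \<open>The Laplacian with respect to \<open>\<omega>\<^sup>t\<close> in the coordinates of the chart \<open>c\<close>.\<close>

definition Lap :: "('z, 'n) chart \<Rightarrow> (complex \<Rightarrow> 'z \<Rightarrow> complex) \<Rightarrow> complex \<times> (complex^'n) \<Rightarrow> complex" where
  "Lap c H q = (\<Sum>j\<in>UNIV. \<Sum>k\<in>UNIV. matrix_inv (Gm c q) $ j $ k * pd (Some k) (pdb (Some j) (lift c H)) q)"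

text \<open>a times the Laplacian of H plus the pairing of \<partial>a with dbar H is a divergence
  on the fibre, and the compact support of a leaves no boundary term.\<close>

lemma integral_pairP_supported:
  assumes t: "t \<in> U" and c: "c \<in> atlas" and K: "compact K" "K \<subseteq> chart_image c (W i)"
    and a: "CkM (Suc 0) a" and s: "supported_in a c K" and H: "psm H"
  defines "h \<equiv> \<lambda>w. if w \<in> chart_image c (W i) then a (chart_inv c w) * Lap c H (t, w) * (2 ^ CARD('n) * det (Gm c (t, w))) else 0"
  shows "integrable lborel h" "integral\<^sup>L (volt t) (pairP t a (H t)) = - integral\<^sup>L lborel h"
proof -
  let ?O = "chart_image c (W i)"
  have o: "open ?O" by (rule open_chart_image[OF c open_W])
  have KU: "K \<subseteq> chart_image c UNIV" using K(2) chart_image_subset by blast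
  have OU: "w \<in> chart_image c UNIV" if "w \<in> ?O" for w using that chart_image_subset by blast
  have H1: "CkM (Suc 0) (H t)" by (rule psm_CkM[OF H t])
  have G: "Cinf_on ?O (\<lambda>w. Gm c (t, w) $ k $ l)" for k l
    by (rule Cinf_on_subset[OF Cinf_on_slice_snd[OF Cinf_Gm[OF c] open_chart_image_UNIV[OF c] t] chart_image_subset])
  \<comment> \<open>Closedness of \<omega>: G has a local potential, and its third derivatives
    commute.\<close>
  have sym: "dz m (\<lambda>w. Gm c (t, w) $ k $ l) w = dz k (\<lambda>w. Gm c (t, w) $ m $ l) w" if w: "w \<in> ?O" for k l m w
  proof -
    have q: "(t, w) \<in> U \<times> ?O" using t w by simp
    have *: "dz m (\<lambda>w. Gm c (t, w) $ k $ l) w = pd (Some m) (pd (Some k) (pdb (Some l) (Phi i c))) (t, w)" for m k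
    proof -
      have "dz m (\<lambda>w. Gm c (t, w) $ k $ l) w = pd (Some m) (\<lambda>q. Gm c q $ k $ l) (t, w)"
        using dop_slice_snd[OF Cinf_on_differentiable[OF Cinf_Gm[OF c], of "(t, w)"]] t OU[OF w] by (simp add: tz_axis_def)
      also have "\<dots> = pd (Some m) (pd (Some k) (pdb (Some l) (Phi i c))) (t, w)"
        by (rule dop_cong[OF open_prod_W[OF c] q]) (rule Gm_eq[OF c])
      finally show ?thesis .
    qed
    show ?thesis unfolding *
      by (rule dop_commute[OF open_prod_W[OF c] Cinf_on_dop[OF open_prod_W[OF c] Cinf_Phi[OF c]] q])
  qed
  have a1: "Ck_on (Suc 0) ?O (\<lambda>w. a (chart_inv c w))"
    using Ck_on_subset[OF CkM_chart[OF a c] chart_image_subset] .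
  have b1: "Cinf_on ?O (\<lambda>w. H t (chart_inv c w))"
    using psm_CkM[OF H t] c Ck_on_subset[OF _ chart_image_subset] unfolding CkM_def Cinf_on_def by blast
  have L: "(\<Sum>j\<in>UNIV. \<Sum>k\<in>UNIV. matrix_inv (Gm c (t, w)) $ j $ k * dz k (dzb j (\<lambda>w. H t (chart_inv c w))) w) = Lap c H (t, w)" if w: "w \<in> ?O" for w
  proof -
    have "dz k (dzb j (\<lambda>w. H t (chart_inv c w))) w = pd (Some k) (pdb (Some j) (lift c H)) (t, w)" for j k
    proof -
      have "dz k (dzb j (\<lambda>w. H t (chart_inv c w))) w = dz k (\<lambda>w. pdb (Some j) (lift c H) (t, w)) w"
        by (rule dop_cong[OF o w]) (rule slice_dop[OF H c t OU])
      also have "\<dots> = pd (Some k) (pdb (Some j) (lift c H)) (t, w)"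
        using dop_slice_snd[OF Cinf_on_differentiable[OF Cinf_on_dop[OF open_prod[OF c] psm_lift[OF H c]], of "(t, w)"], of "- \<i>" "axis k 1" "axis k \<i>"] t OU[OF w]
        by (simp add: tz_axis_def)
      finally show ?thesis .
    qed
    then show ?thesis by (simp add: Lap_def)
  qed
  have z: "a (chart_inv c w) = 0" if "w \<in> ?O" "w \<notin> K" for w
    using supported_in_zero[OF s c OU[OF that(1)] that(2)] .
  define P where "P w = (if w \<in> ?O then pairP t a (H t) (chart_inv c w) * (2 ^ CARD('n) * det (Gm c (t, w))) else 0)" for w
  have P: "integral\<^sup>L (volt t) (pairP t a (H t)) = integral\<^sup>L lborel P" "integrable lborel P"
    using integral_supported[OF t c K CkM_pairP[OF t a H] supported_in_pairP[OF t c K(1) KU a H1 s]]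
      integrable_supported_chart[OF t c K CkM_pairP[OF t a H] supported_in_pairP[OF t c K(1) KU a H1 s]]
    unfolding P_def by simp_all
  define X where "X w = (if w \<in> ?O then
      (a (chart_inv c w) * (\<Sum>j\<in>UNIV. \<Sum>k\<in>UNIV. matrix_inv (Gm c (t, w)) $ j $ k * dz k (dzb j (\<lambda>w. H t (chart_inv c w))) w)
         + pform (Gm c (t, w)) (\<chi> k. dz k (\<lambda>w. a (chart_inv c w)) w) (\<chi> j. dzb j (\<lambda>w. H t (chart_inv c w)) w)) * det (Gm c (t, w)) else 0)" for w
  have X: "integrable lborel X" "integral\<^sup>L lborel X = 0"
    unfolding X_def
    by (rule kaehler_integration_by_parts[OF o K G Gm_det[OF c] sym a1 z b1]; use t OU in simp)+
  have "h w = 2 ^ CARD('n) * X w - P w" for w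
    using L[of w] pairP_chart_inv[OF t c OU a H1, of w]
    by (cases "w \<in> ?O") (simp_all add: h_def X_def P_def algebra_simps)
  then have h: "h = (\<lambda>w. 2 ^ CARD('n) * X w - P w)" by blast
  show "integrable lborel h" unfolding h using X(1) P(2) by simp
  show "integral\<^sup>L (volt t) (pairP t a (H t)) = - integral\<^sup>L lborel h" unfolding h P(1) using X P(2) by simp
qed

lemma pairP_sum:
  assumes "finite I" "\<And>i. i \<in> I \<Longrightarrow> CkM (Suc 0) (a i)"
  shows "pairP t (\<lambda>z. \<Sum>i\<in>I. a i z) b z = (\<Sum>i\<in>I. pairP t (a i) b z)"
proof -
  define c where "c = (SOME c. c \<in> atlas \<and> z \<in> fst c)"
  have "\<exists>c. c \<in> atlas \<and> z \<in> fst c" using chart_exists by metis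
  then have c: "c \<in> atlas" "z \<in> fst c" unfolding c_def by (metis (mono_tags, lifting) someI_ex)+
  have "dz k (\<lambda>w. \<Sum>i\<in>I. a i (chart_inv c w)) (snd c z) = (\<Sum>i\<in>I. dz k (\<lambda>w. a i (chart_inv c w)) (snd c z))" for k
    by (rule dop_sum[OF assms(1)]) (rule CkM_differentiable[OF assms(2) c])
  moreover have "pform G (\<chi> k. \<Sum>i\<in>I. x i k) y = (\<Sum>i\<in>I. pform G (\<chi> k. x i k) y)" for G :: "complex^'n^'n" and x y
  proof -
    have "pform G (\<chi> k. \<Sum>i\<in>I. x i k) y = (\<Sum>j\<in>UNIV. \<Sum>i\<in>I. \<Sum>k\<in>UNIV. matrix_inv G $ j $ k * y $ j * x i k)"
      unfolding pform_def vec_lambda_beta sum_distrib_left by (intro sum.cong refl sum.swap)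
    also have "\<dots> = (\<Sum>i\<in>I. pform G (\<chi> k. x i k) y)"
      unfolding pform_def vec_lambda_beta by (rule sum.swap)
    finally show ?thesis .
  qed
  ultimately show ?thesis
    unfolding pairP_def c_def[symmetric] Let_def by simp
qed

section \<open>The derivative of the metric in t\<close>

definition psi :: "complex \<Rightarrow> 'z \<Rightarrow> complex" where "psi t z = complex_of_real (\<psi> t z)"

lemma psm_psi: "psm psi"
proof (rule psmI[where H="\<lambda>c q. complex_of_real (\<psi> (fst q) (chart_inv c (snd q)))"])
  fix c assume c: "c \<in> atlas"
  have "Cinf_on (U \<times> chart_image c UNIV) (\<lambda>q. \<psi> (fst q) (chart_inv c (snd q)))"
    using smooth_\<psi> c unfolding product_smooth_on_def by (simp add: case_prod_unfold)
  then show "Cinf_on (U \<times> chart_image c UNIV) (\<lambda>q. complex_of_real (\<psi> (fst q) (chart_inv c (snd q))))"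
    by (rule Cinf_on_of_real[OF open_prod[OF c]])
qed (simp add: psi_def)

text \<open>The reference weight does not depend on t, so the t-derivative of every local weight is
  that of \<psi>. This makes \<psi>_t a global function although the weights are only local.\<close>

lemma dop_None_Phi:
  assumes c: "c \<in> atlas" and q: "q \<in> U \<times> chart_image c (W i)"
  shows "dop \<kappa> (tz_axis None 1) (tz_axis None \<i>) (Phi i c) q = lift c (dtop \<kappa> psi) q"
proof -
  have qU: "q \<in> U \<times> chart_image c UNIV" using q chart_image_subset[of c "W i"] by (auto simp: mem_Times_iff)
  define f where "f w = complex_of_real (\<phi>\<^sub>0 i (chart_inv c w))" for w
  have f: "Cinf_on (chart_image c (W i)) f"
    using smooth_\<phi>0 c unfolding f_def[abs_def] smooth_metric_def manifold_smooth_on_def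
    by (intro Cinf_on_of_real open_chart_image[OF c open_W]) blast
  have fd: "f differentiable (at (snd q))" using Cinf_on_differentiable[OF f] q by auto
  have eq: "Phi i c p = f (snd p) + lift c psi p" if "p \<in> U \<times> chart_image c (W i)" for p
    using \<phi>_eq that chart_imageD(2)[OF c, of "snd p" "W i"] by (auto simp: Phi_def f_def lift_def psi_def)
  have "dop \<kappa> (tz_axis None 1) (tz_axis None \<i>) (Phi i c) q = dop \<kappa> (tz_axis None 1) (tz_axis None \<i>) (\<lambda>p. f (snd p) + lift c psi p) q"
    by (rule dop_cong[OF open_prod_W[OF c] q]) (rule eq)
  also have "\<dots> = dop \<kappa> (tz_axis None 1) (tz_axis None \<i>) (\<lambda>p. f (snd p)) q + dop \<kappa> (tz_axis None 1) (tz_axis None \<i>) (lift c psi) q"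
    by (intro dop_add psm_lift_differentiable[OF psm_psi c qU])
      (use differentiable_affine_comp[OF bounded_linear_snd, of f 0 q] fd in simp)
  also have "dop \<kappa> (tz_axis None 1) (tz_axis None \<i>) (\<lambda>p. f (snd p)) q = 0"
    using dop_snd[OF fd] dop_zero_directions[OF fd] by (simp add: tz_axis_def)
  finally show ?thesis by (simp add: lift_dtop[OF psm_psi c qU])
qed

text \<open>Mixed derivatives of the weight commute and its t-derivative is \<psi>_t, so \<omega>
  moves by i\<partial>dbar \<psi>_t.\<close>

lemma pd_None_Gm:
  assumes c: "c \<in> atlas" and q: "q \<in> U \<times> chart_image c UNIV"
  shows "pd None (\<lambda>q. Gm c q $ k $ j) q = pd (Some k) (pdb (Some j) (lift c (dt psi))) q"
proof -
  obtain i where i: "q \<in> U \<times> chart_image c (W i)" by (rule prod_W_exists[OF c q])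
  note o = open_prod_W[OF c, of i] and P = Cinf_Phi[OF c, of i]
  have "pd None (\<lambda>q. Gm c q $ k $ j) q = pd None (pd (Some k) (pdb (Some j) (Phi i c))) q"
    by (rule dop_cong[OF o i]) (rule Gm_eq[OF c])
  also have "\<dots> = pd (Some k) (pd None (pdb (Some j) (Phi i c))) q"
    by (rule dop_commute[OF o Cinf_on_dop[OF o P] i])
  also have "\<dots> = pd (Some k) (pdb (Some j) (pd None (Phi i c))) q"
    by (rule dop_cong[OF o i]) (rule dop_commute[OF o P])
  also have "\<dots> = pd (Some k) (pdb (Some j) (lift c (dt psi))) q"
    by (rule dop_cong[OF o i], rule dop_cong[OF o]) (auto intro: dop_None_Phi[OF c])
  finally show ?thesis .
qed

section \<open>Fibre integrals through a partition of unity\<close>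

lemma
  assumes pu: "partition_of_unity P cc ii KK \<rho>" and p: "p \<in> P"
  shows pu_atlas: "cc p \<in> atlas" and pu_compact: "compact (KK p)" and pu_subset: "KK p \<subseteq> chart_image (cc p) (W (ii p))"
    and pu_CkM: "CkM (Suc 0) (\<rho> p)" and pu_nonneg: "0 \<le> \<rho> p z"
    and pu_supported: "supported_in (\<lambda>z. complex_of_real (\<rho> p z)) (cc p) (KK p)"
  using pu p unfolding partition_of_unity_def supported_in_def by auto

lemma pu_sum: "partition_of_unity P cc ii KK \<rho> \<Longrightarrow> (\<Sum>p\<in>P. complex_of_real (\<rho> p z)) = 1"
  unfolding partition_of_unity_def by (metis of_real_1 of_real_sum)

lemma integrable_continuous_vol:
  fixes f :: "'z \<Rightarrow> complex"
  assumes t: "t \<in> U" and f: "continuous_on UNIV f"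
  shows "integrable (volt t) f"
proof -
  obtain P cc ii KK \<rho> where pu: "partition_of_unity P cc ii KK \<rho>" using partition_of_unity_exists by blast
  have "integrable (volt t) (\<lambda>z. \<Sum>p\<in>P. complex_of_real (\<rho> p z) * f z)"
  proof (rule Bochner_Integration.integrable_sum)
    fix p assume p: "p \<in> P"
    have "CkM 0 (\<lambda>z. complex_of_real (\<rho> p z))" by (rule CkM_of_real[OF CkM_Suc_imp[OF pu_CkM[OF pu p]]])
    from CkM_mult[OF this] f have "CkM 0 (\<lambda>z. complex_of_real (\<rho> p z) * f z)" unfolding CkM_0 by blast
    then show "integrable (volt t) (\<lambda>z. complex_of_real (\<rho> p z) * f z)"
      by (rule integrable_supported[OF t pu_atlas[OF pu p] pu_compact[OF pu p] pu_subset[OF pu p] _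
            supported_in_mult_left[OF pu_supported[OF pu p]]])
  qed
  then show ?thesis by (simp add: sum_distrib_right[symmetric] pu_sum[OF pu])
qed

lemma integral_partition:
  fixes f :: "'z \<Rightarrow> complex"
  assumes t: "t \<in> U" and f: "continuous_on UNIV f" and pu: "partition_of_unity P cc ii KK \<rho>"
  shows "integral\<^sup>L (volt t) f = (\<Sum>p\<in>P. integral\<^sup>L (volt t) (\<lambda>z. complex_of_real (\<rho> p z) * f z))"
proof -
  have "integrable (volt t) (\<lambda>z. complex_of_real (\<rho> p z) * f z)" if "p \<in> P" for p
    by (rule integrable_continuous_vol[OF t continuous_on_mult[OF continuous_on_of_real[OF CkM_1_continuous[OF pu_CkM[OF pu that]]] f]])
  then have "(\<Sum>p\<in>P. integral\<^sup>L (volt t) (\<lambda>z. complex_of_real (\<rho> p z) * f z)) = integral\<^sup>L (volt t) (\<lambda>z. \<Sum>p\<in>P. complex_of_real (\<rho> p z) * f z)"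
    by (subst Bochner_Integration.integral_sum) auto
  also have "\<dots> = integral\<^sup>L (volt t) f" by (simp add: sum_distrib_right[symmetric] pu_sum[OF pu])
  finally show ?thesis by simp
qed

text \<open>\<open>Lap\<close> is kept as a chart expression, so the global integration by parts
  stays a sum over the partition; both \<open>first_variation\<close> and the final estimate work
  with its terms.\<close>

lemma integral_pairP_partition:
  assumes t: "t \<in> U" and a: "psm a" and H: "psm H" and pu: "partition_of_unity P cc ii KK \<rho>"
  shows "integral\<^sup>L (volt t) (pairP t (a t) (H t)) = - (\<Sum>p\<in>P. integral\<^sup>L lborel (\<lambda>w.
     if w \<in> chart_image (cc p) (W (ii p)) then (complex_of_real (\<rho> p (chart_inv (cc p) w)) * a t (chart_inv (cc p) w)) * Lap (cc p) H (t, w) * (2 ^ CARD('n) * det (Gm (cc p) (t, w))) else 0))"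
proof -
  have fin: "finite P" using pu by (simp add: partition_of_unity_def)
  have C: "CkM (Suc 0) (\<lambda>z. complex_of_real (\<rho> p z) * a t z)" if "p \<in> P" for p
    by (rule CkM_mult[OF CkM_of_real[OF pu_CkM[OF pu that]] psm_CkM[OF a t]])
  have eq: "(\<lambda>z. \<Sum>p\<in>P. complex_of_real (\<rho> p z) * a t z) = a t"
    by (simp add: sum_distrib_right[symmetric] pu_sum[OF pu])
  have "pairP t (a t) (H t) = (\<lambda>z. \<Sum>p\<in>P. pairP t (\<lambda>z. complex_of_real (\<rho> p z) * a t z) (H t) z)"
  proof
    fix z
    have "pairP t (\<lambda>z. \<Sum>p\<in>P. complex_of_real (\<rho> p z) * a t z) (H t) z = (\<Sum>p\<in>P. pairP t (\<lambda>z. complex_of_real (\<rho> p z) * a t z) (H t) z)"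
      by (rule pairP_sum[OF fin]) (rule C)
    then show "pairP t (a t) (H t) z = (\<Sum>p\<in>P. pairP t (\<lambda>z. complex_of_real (\<rho> p z) * a t z) (H t) z)"
      unfolding eq .
  qed
  moreover have "integrable (volt t) (pairP t (\<lambda>z. complex_of_real (\<rho> p z) * a t z) (H t))" if "p \<in> P" for p
    by (rule integrable_continuous_vol[OF t]) (use CkM_pairP[OF t C[OF that] H] CkM_0 in blast)
  ultimately have "integral\<^sup>L (volt t) (pairP t (a t) (H t)) = (\<Sum>p\<in>P. integral\<^sup>L (volt t) (pairP t (\<lambda>z. complex_of_real (\<rho> p z) * a t z) (H t)))"
    by simp
  also have "\<dots> = (\<Sum>p\<in>P. - integral\<^sup>L lborel (\<lambda>w.
     if w \<in> chart_image (cc p) (W (ii p)) then (complex_of_real (\<rho> p (chart_inv (cc p) w)) * a t (chart_inv (cc p) w)) * Lap (cc p) H (t, w) * (2 ^ CARD('n) * det (Gm (cc p) (t, w))) else 0))"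
    by (rule sum.cong[OF refl], rule integral_pairP_supported(2)[OF t pu_atlas[OF pu] pu_compact[OF pu] pu_subset[OF pu] C
        supported_in_mult_left[OF pu_supported[OF pu]] H])
  finally show ?thesis by (simp add: sum_negf)
qed

text \<open>The partition of unity does not depend on t, so only F and the density are
  differentiated. The density contributes F times the Laplacian of \<psi>_t, which integrates to
  minus the pairing of \<partial>F with dbar \<psi>_t.\<close>

theorem first_variation:
  assumes F: "psm F" and t: "t \<in> U"
  shows "(\<lambda>\<tau>. integral\<^sup>L (volt \<tau>) (F \<tau>)) differentiable (at t)"
    "dop (- \<i>) 1 \<i> (\<lambda>\<tau>. integral\<^sup>L (volt \<tau>) (F \<tau>)) t = integral\<^sup>L (volt t) (\<lambda>z. dt F t z - pairP t (F t) (dt psi t) z)"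
proof -
  obtain P cc ii KK \<rho> where pu: "partition_of_unity P cc ii KK \<rho>" using partition_of_unity_exists by blast
  have fin: "finite P" using pu by (simp add: partition_of_unity_def)
  note pu' = pu_atlas[OF pu] pu_compact[OF pu] pu_subset[OF pu]
  define O' where "O' p = chart_image (cc p) (W (ii p))" for p
  define X where "X p q = complex_of_real (\<rho> p (chart_inv (cc p) (snd q))) * (lift (cc p) F q * (2 ^ CARD('n) * det (Gm (cc p) q)))" for p q
  define I where "I p \<tau> = integral\<^sup>L lborel (\<lambda>w. if w \<in> O' p then X p (\<tau>, w) else 0)" for p \<tau>
  have I: "integral\<^sup>L (volt \<tau>) (F \<tau>) = (\<Sum>p\<in>P. I p \<tau>)" if \<tau>: "\<tau> \<in> U" for \<tau>
  proof -
    have "integral\<^sup>L (volt \<tau>) (\<lambda>z. complex_of_real (\<rho> p z) * F \<tau> z) = I p \<tau>" if p: "p \<in> P" for p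
    proof -
      have "CkM 0 (\<lambda>z. complex_of_real (\<rho> p z) * F \<tau> z)"
        by (rule CkM_mult[OF CkM_of_real[OF CkM_Suc_imp[OF pu_CkM[OF pu p]]] psm_CkM[OF F \<tau>]])
      from integral_supported[OF \<tau> pu'[OF p] this supported_in_mult_left[OF pu_supported[OF pu p]]]
      show ?thesis unfolding I_def X_def O'_def by (simp add: lift_def mult.assoc cong: if_cong)
    qed
    then show ?thesis by (simp add: integral_partition[OF \<tau> psm_continuous[OF F \<tau>] pu])
  qed
  have oO: "open (O' p)" if "p \<in> P" for p unfolding O'_def by (rule open_chart_image[OF pu'(1)[OF that] open_W])
  have OU: "w \<in> chart_image (cc p) UNIV" if "w \<in> O' p" for w p using that chart_image_subset unfolding O'_def by blast
  have leib: "I p differentiable (at t)"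
    "dop (- \<i>) 1 \<i> (I p) t = integral\<^sup>L lborel (\<lambda>w. if w \<in> O' p then pd None (X p) (t, w) else 0)" if p: "p \<in> P" for p
  proof -
    have o: "open (U \<times> O' p)" by (rule open_Times[OF open_U oO[OF p]])
    have sub: "U \<times> O' p \<subseteq> U \<times> chart_image (cc p) UNIV" using OU by auto
    have r: "Ck_on (Suc 0) (U \<times> O' p) (\<lambda>q. complex_of_real (\<rho> p (chart_inv (cc p) (snd q))))"
      by (rule Ck_on_snd[OF Ck_on_subset[OF CkM_chart[OF CkM_of_real[OF pu_CkM[OF pu p]] pu'(1)[OF p]]] oO[OF p] open_U])
        (use OU in auto)
    have "Cinf_on (U \<times> O' p) (\<lambda>q. lift (cc p) F q * (2 ^ CARD('n) * det (Gm (cc p) q)))"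
      by (rule Cinf_on_subset[OF _ sub], intro Cinf_on_mult Cinf_on_const Cinf_on_det open_prod psm_lift F pu'(1)[OF p] Cinf_Gm)
    then have "Ck_on (Suc 0) (U \<times> O' p) (\<lambda>q. lift (cc p) F q * (2 ^ CARD('n) * det (Gm (cc p) q)))"
      unfolding Cinf_on_def by blast
    then have X1: "Ck_on (Suc 0) (U \<times> O' p) (X p)"
      unfolding X_def[abs_def] by (rule Ck_on_mult[OF o r])
    have K: "KK p \<subseteq> O' p" using pu'(3)[OF p] by (simp add: O'_def)
    have z: "X p (\<tau>, w) = 0" if "w \<in> O' p" "w \<notin> KK p" for \<tau> w
      using supported_in_zero[OF pu_supported[OF pu p] pu'(1)[OF p] OU[OF that(1)] that(2)] by (simp add: X_def)
    show "I p differentiable (at t)"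
      "dop (- \<i>) 1 \<i> (I p) t = integral\<^sup>L lborel (\<lambda>w. if w \<in> O' p then pd None (X p) (t, w) else 0)"
      using leibniz_dop(1)[OF oO[OF p] open_U pu'(2)[OF p] K t X1 z]
        leibniz_dop(2)[OF oO[OF p] open_U pu'(2)[OF p] K t X1 z, of "- \<i>"] unfolding I_def[abs_def]
      by (simp_all add: tz_axis_def cong: if_cong)
  qed
  have d: "(\<lambda>\<tau>. \<Sum>p\<in>P. I p \<tau>) differentiable (at t)"
    using fin leib(1) by (intro differentiable_sum) auto
  show "(\<lambda>\<tau>. integral\<^sup>L (volt \<tau>) (F \<tau>)) differentiable (at t)"
    using d differentiable_cong_open[OF open_U t, of "\<lambda>\<tau>. integral\<^sup>L (volt \<tau>) (F \<tau>)" "\<lambda>\<tau>. \<Sum>p\<in>P. I p \<tau>"] I by blast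
  define Y where "Y p = (\<lambda>w. if w \<in> O' p then (complex_of_real (\<rho> p (chart_inv (cc p) w)) * F t (chart_inv (cc p) w)) * Lap (cc p) (dt psi) (t, w) * (2 ^ CARD('n) * det (Gm (cc p) (t, w))) else 0)" for p
  define Z where "Z p = (\<lambda>w. if w \<in> O' p then (complex_of_real (\<rho> p (chart_inv (cc p) w)) * dt F t (chart_inv (cc p) w)) * (2 ^ CARD('n) * det (Gm (cc p) (t, w))) else 0)" for p
  \<comment> \<open>\<open>Z\<close> collects the derivative of F, \<open>Y\<close> that of the
    density.\<close>
  have XYZ: "(\<lambda>w. if w \<in> O' p then pd None (X p) (t, w) else 0) = (\<lambda>w. Z p w + Y p w)" if p: "p \<in> P" for p
  proof
    fix w
    show "(if w \<in> O' p then pd None (X p) (t, w) else 0) = Z p w + Y p w"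
    proof (cases "w \<in> O' p")
      case w: True
      let ?c = "cc p"
      have c: "?c \<in> atlas" by (rule pu'(1)[OF p])
      have q: "(t, w) \<in> U \<times> chart_image ?c UNIV" using t OU[OF w] by simp
      define r where "r w = complex_of_real (\<rho> p (chart_inv ?c w))" for w
      have rd: "r differentiable (at (snd (t, w)))"
        unfolding r_def[abs_def] using CkM_chart[OF CkM_of_real[OF pu_CkM[OF pu p]] c] OU[OF w] by simp
      have rd': "(\<lambda>q. r (snd q)) differentiable (at (t, w))"
        using differentiable_affine_comp[OF bounded_linear_snd, of r 0 "(t, w)"] rd by simp
      have r0: "pd None (\<lambda>q. r (snd q)) (t, w) = 0"
        using dop_snd[OF rd] dop_zero_directions[OF rd] by (simp add: tz_axis_def)
      have Fd: "lift ?c F differentiable (at (t, w))" by (rule psm_lift_differentiable[OF F c q])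
      have dd: "(\<lambda>q. det (Gm ?c q)) differentiable (at (t, w))"
        by (rule Cinf_on_differentiable[OF Cinf_on_det[OF open_prod[OF c] Cinf_Gm[OF c]] q])
      \<comment> \<open>Jacobi's formula meets \<open>pd_None_Gm\<close>: the logarithmic
        t-derivative of the density is the Laplacian of \<psi>_t.\<close>
      have ddet: "pd None (\<lambda>q. det (Gm ?c q)) (t, w) = det (Gm ?c (t, w)) * Lap ?c (dt psi) (t, w)"
        unfolding Lap_def
        by (subst dop_det[OF Cinf_on_differentiable[OF Cinf_Gm[OF c] q] Gm_det[OF c q]], subst sum.swap)
          (simp only: pd_None_Gm[OF c q])
      have "pd None (X p) (t, w) = r w * (lift ?c F (t, w) * (2 ^ CARD('n) * (det (Gm ?c (t, w)) * Lap ?c (dt psi) (t, w)))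
            + pd None (lift ?c F) (t, w) * (2 ^ CARD('n) * det (Gm ?c (t, w))))"
        unfolding X_def[abs_def] r_def[symmetric]
        by (subst dop_mult[OF rd']) (intro differentiable_mult differentiable_const Fd dd,
            subst dop_mult[OF Fd], intro differentiable_mult differentiable_const dd, simp add: dop_cmult[OF dd] ddet r0)
      also have "pd None (lift ?c F) (t, w) = dt F t (chart_inv ?c w)"
        using lift_dtop[OF F c q, of "- \<i>"] by (simp add: lift_def)
      finally show ?thesis using w by (simp add: Y_def Z_def r_def lift_def algebra_simps)
    qed (simp add: Y_def Z_def)
  qed
  have C1: "CkM (Suc 0) (\<lambda>z. complex_of_real (\<rho> p z) * F t z)" if "p \<in> P" for p
    by (rule CkM_mult[OF CkM_of_real[OF pu_CkM[OF pu that]] psm_CkM[OF F t]])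
  have iY: "integrable lborel (Y p)" if p: "p \<in> P" for p
    using integral_pairP_supported(1)[OF t pu'[OF p] C1[OF p] supported_in_mult_left[OF pu_supported[OF pu p]] psm_dtop[OF psm_psi]]
    unfolding Y_def O'_def .
  have Z0: "CkM 0 (\<lambda>z. complex_of_real (\<rho> p z) * dt F t z)" if "p \<in> P" for p
    by (rule CkM_mult[OF CkM_of_real[OF CkM_Suc_imp[OF pu_CkM[OF pu that]]] psm_CkM[OF psm_dtop[OF F] t]])
  have iZ: "integrable lborel (Z p)" "integral\<^sup>L lborel (Z p) = integral\<^sup>L (volt t) (\<lambda>z. complex_of_real (\<rho> p z) * dt F t z)" if p: "p \<in> P" for p
    using integrable_supported_chart[OF t pu'[OF p] Z0[OF p] supported_in_mult_left[OF pu_supported[OF pu p]]]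
      integral_supported[OF t pu'[OF p] Z0[OF p] supported_in_mult_left[OF pu_supported[OF pu p]]]
    unfolding Z_def O'_def by simp_all
  have "dop (- \<i>) 1 \<i> (\<lambda>\<tau>. integral\<^sup>L (volt \<tau>) (F \<tau>)) t = dop (- \<i>) 1 \<i> (\<lambda>\<tau>. \<Sum>p\<in>P. I p \<tau>) t"
    by (rule dop_cong[OF open_U t]) (rule I)
  also have "\<dots> = (\<Sum>p\<in>P. integral\<^sup>L lborel (\<lambda>w. if w \<in> O' p then pd None (X p) (t, w) else 0))"
    using leib by (subst dop_sum[OF fin]) auto
  also have "\<dots> = (\<Sum>p\<in>P. integral\<^sup>L lborel (Z p) + integral\<^sup>L lborel (Y p))"
    by (intro sum.cong refl) (use XYZ iY iZ(1) in simp)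
  also have "\<dots> = integral\<^sup>L (volt t) (dt F t) - integral\<^sup>L (volt t) (pairP t (F t) (dt psi t))"
    unfolding integral_pairP_partition[OF t F psm_dtop[OF psm_psi] pu]
      integral_partition[OF t psm_continuous[OF psm_dtop[OF F] t] pu]
    by (simp add: sum.distrib iZ(2) Y_def O'_def)
  also have "\<dots> = integral\<^sup>L (volt t) (\<lambda>z. dt F t z - pairP t (F t) (dt psi t) z)"
    using integrable_continuous_vol[OF t psm_continuous[OF psm_dtop[OF F] t]]
      integrable_continuous_vol[OF t psm_continuous[OF psm_pairP[OF F psm_dtop[OF psm_psi]] t]]
    by simp
  finally show "dop (- \<i>) 1 \<i> (\<lambda>\<tau>. integral\<^sup>L (volt \<tau>) (F \<tau>)) t = integral\<^sup>L (volt t) (\<lambda>z. dt F t z - pairP t (F t) (dt psi t) z)" .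
qed

end

section \<open>The horizontal vector field\<close>

text \<open>One coordinate patch of U \<times> Z with one trivialisation, where the metric is exp (-
  \<Phi>). All pointwise identities of the argument are proved here; \<open>family\<close> supplies
  the patches.\<close>

locale local_family =
  fixes N :: "(complex \<times> (complex^'n)) set" and \<Phi> :: "complex \<times> (complex^'n::finite) \<Rightarrow> complex"
    and G :: "complex \<times> (complex^'n) \<Rightarrow> complex^'n^'n"
  assumes oN: "open N" and c\<Phi>: "Cinf_on N \<Phi>" and real\<Phi>: "\<And>q. q \<in> N \<Longrightarrow> cnj (\<Phi> q) = \<Phi> q"
    and G: "\<And>q k l. q \<in> N \<Longrightarrow> G q $ k $ l = pd (Some k) (pdb (Some l) \<Phi>) q"
    and Gdet: "\<And>q. q \<in> N \<Longrightarrow> det (G q) \<noteq> 0"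
    and Gherm: "\<And>q. q \<in> N \<Longrightarrow> hermitian (G q)"
begin

lemma diffN: "Cinf_on N f \<Longrightarrow> q \<in> N \<Longrightarrow> f differentiable (at q)"
  by (rule Cinf_on_differentiable)

lemma CinfG: "Cinf_on N (\<lambda>q. G q $ k $ l)"
  by (rule Cinf_on_cong[OF oN, THEN iffD1, OF _ Cinf_on_dop[OF oN Cinf_on_dop[OF oN c\<Phi>]]]) (rule G[symmetric])

lemma CinfGinv: "Cinf_on N (\<lambda>q. matrix_inv (G q) $ k $ l)"
  by (rule Cinf_on_matrix_inv[OF oN CinfG Gdet])

text \<open>The vertical vector whose contraction with \<open>G\<close> gives the mixed derivatives
  of \<Phi> in t and the fibre (\<open>V_G\<close>). Subtracting it from \<partial>/\<partial>t
  cancels those mixed entries of i\<partial>dbar \<Phi>.\<close>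

definition V :: "'n \<Rightarrow> complex \<times> (complex^'n) \<Rightarrow> complex" where
  "V k q = (\<Sum>j\<in>UNIV. matrix_inv (G q) $ j $ k * pdb (Some j) (pd None \<Phi>) q)"

text \<open>\<open>T\<close> and \<open>Tb\<close> are the horizontal lifts of \<open>\<partial>/\<partial>t\<close> and its conjugate with respect to \<open>i\<partial>dbar \<Phi>\<close>.\<close>

definition T :: "(complex \<times> (complex^'n) \<Rightarrow> complex) \<Rightarrow> complex \<times> (complex^'n) \<Rightarrow> complex" where
  "T X q = pd None X q - (\<Sum>k\<in>UNIV. V k q * pd (Some k) X q)"

definition Tb :: "(complex \<times> (complex^'n) \<Rightarrow> complex) \<Rightarrow> complex \<times> (complex^'n) \<Rightarrow> complex" where
  "Tb X q = pdb None X q - (\<Sum>k\<in>UNIV. cnj (V k q) * pdb (Some k) X q)"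

text \<open>The squared length of the horizontal lift for i\<partial>dbar \<Phi>, that is c(\<phi>)
  in coordinates; \<open>cc_form\<close> brings it to the usual form.\<close>

definition cc :: "complex \<times> (complex^'n) \<Rightarrow> complex" where
  "cc = Tb (pd None \<Phi>)"

lemma CinfV: "Cinf_on N (V k)"
  unfolding V_def[abs_def] by (intro Cinf_on_sum Cinf_on_mult Cinf_on_dop oN c\<Phi> CinfGinv)

lemma CinfT: "Cinf_on N X \<Longrightarrow> Cinf_on N (T X)"
  unfolding T_def[abs_def] by (intro Cinf_on_diff Cinf_on_sum Cinf_on_mult Cinf_on_dop oN CinfV)

lemma T_mult:
  assumes "Cinf_on N X" "Cinf_on N Y" "q \<in> N"
  shows "T (\<lambda>q. X q * Y q) q = X q * T Y q + T X q * Y q"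
  by (simp add: T_def dop_mult[OF diffN[OF assms(1,3)] diffN[OF assms(2,3)]] algebra_simps sum.distrib sum_distrib_left)

lemma Tb_mult:
  assumes "Cinf_on N X" "Cinf_on N Y" "q \<in> N"
  shows "Tb (\<lambda>q. X q * Y q) q = X q * Tb Y q + Tb X q * Y q"
  by (simp add: Tb_def dop_mult[OF diffN[OF assms(1,3)] diffN[OF assms(2,3)]] algebra_simps sum.distrib sum_distrib_left)

lemma Tb_diff:
  assumes "Cinf_on N X" "Cinf_on N Y" "q \<in> N"
  shows "Tb (\<lambda>q. X q - Y q) q = Tb X q - Tb Y q"
  by (simp add: Tb_def dop_diff[OF diffN[OF assms(1,3)] diffN[OF assms(2,3)]] algebra_simps sum_subtractf)

lemma Tb_sum:
  assumes "finite I" "\<And>i. i \<in> I \<Longrightarrow> Cinf_on N (X i)" "q \<in> N"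
  shows "Tb (\<lambda>q. \<Sum>i\<in>I. X i q) q = (\<Sum>i\<in>I. Tb (X i) q)"
proof -
  have "dop \<kappa> v w (\<lambda>q. \<Sum>i\<in>I. X i q) q = (\<Sum>i\<in>I. dop \<kappa> v w (X i) q)" for \<kappa> v w
    by (rule dop_sum[OF assms(1) diffN[OF assms(2,3)]])
  then show ?thesis
    unfolding Tb_def sum_subtractf by (simp add: sum_distrib_left) (rule sum.swap)
qed

lemma T_exp_neg:
  assumes "q \<in> N"
  shows "T (\<lambda>q. exp (- \<Phi> q)) q = - exp (- \<Phi> q) * T \<Phi> q" "Tb (\<lambda>q. exp (- \<Phi> q)) q = - exp (- \<Phi> q) * Tb \<Phi> q"
  by (simp_all add: T_def Tb_def dop_exp[of "\<lambda>q. - \<Phi> q"] dop_minus diffN[OF c\<Phi> assms] algebra_simps sum_distrib_left sum_negf)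

lemma Tb_cnj:
  assumes "Cinf_on N X" "q \<in> N"
  shows "Tb (\<lambda>q. cnj (X q)) q = cnj (T X q)"
  by (simp add: Tb_def T_def dop_cnj[OF diffN[OF assms]])

lemma T_cnj:
  assumes "Cinf_on N X" "q \<in> N"
  shows "T (\<lambda>q. cnj (X q)) q = cnj (Tb X q)"
  by (simp add: Tb_def T_def dop_cnj[OF diffN[OF assms]])

lemma dop_cnj_\<Phi>:
  assumes "q \<in> N"
  shows "cnj (dop \<kappa> v w \<Phi> q) = dop (cnj \<kappa>) v w \<Phi> q"
proof -
  have "dop (cnj \<kappa>) v w (\<lambda>q. cnj (\<Phi> q)) q = dop (cnj \<kappa>) v w \<Phi> q"
    by (rule dop_cong[OF oN assms]) (rule real\<Phi>)
  then show ?thesis by (simp add: dop_cnj[OF diffN[OF c\<Phi> assms]])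
qed

lemma dop_cnj_\<Phi>2:
  assumes "q \<in> N"
  shows "cnj (dop \<kappa> v w (dop \<mu> x y \<Phi>) q) = dop (cnj \<kappa>) v w (dop (cnj \<mu>) x y \<Phi>) q"
proof -
  have "dop (cnj \<kappa>) v w (\<lambda>q. cnj (dop \<mu> x y \<Phi> q)) q = dop (cnj \<kappa>) v w (dop (cnj \<mu>) x y \<Phi>) q"
    by (rule dop_cong[OF oN assms]) (rule dop_cnj_\<Phi>)
  then show ?thesis by (simp add: dop_cnj[OF diffN[OF Cinf_on_dop[OF oN c\<Phi>] assms]])
qed

lemma Tb_\<Phi>: "q \<in> N \<Longrightarrow> Tb \<Phi> q = cnj (T \<Phi> q)"
  by (simp add: Tb_def T_def dop_cnj_\<Phi>)

section \<open>The horizontal lift, its commutator and its Schur complement\<close>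

lemma V_G:
  assumes "q \<in> N"
  shows "(\<Sum>k\<in>UNIV. V k q * G q $ k $ l) = pdb (Some l) (pd None \<Phi>) q"
  using inverse_form(1)[OF Gherm[OF assms] Gdet[OF assms], of "\<chi> j. pdb (Some j) (pd None \<Phi>) q" l]
  by (simp add: V_def)

lemma cnj_V_G:
  assumes q: "q \<in> N"
  shows "(\<Sum>l\<in>UNIV. cnj (V l q) * G q $ k $ l) = pd (Some k) (pdb None \<Phi>) q"
proof -
  have "(\<Sum>l\<in>UNIV. cnj (V l q) * G q $ k $ l) = cnj (\<Sum>l\<in>UNIV. V l q * G q $ l $ k)"
    using Gherm[OF q] by (simp add: hermitian_def)
  then show ?thesis unfolding V_G[OF q] by (simp add: dop_cnj_\<Phi>2[OF q])
qed

text \<open>This is the orthogonality of the horizontal lift to the fibre directions.\<close>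

lemma Tb_pd_\<Phi>:
  assumes q: "q \<in> N"
  shows "Tb (pd (Some k) \<Phi>) q = 0"
proof -
  have "pdb l (pd (Some k) \<Phi>) q = pd (Some k) (pdb l \<Phi>) q" for l
    by (rule dop_commute[OF oN c\<Phi> q])
  then show ?thesis using cnj_V_G[OF q, of k] by (simp add: Tb_def G[OF q])
qed

lemma cc_eq: "cc q = pdb None (pd None \<Phi>) q - (\<Sum>k\<in>UNIV. cnj (V k q) * pdb (Some k) (pd None \<Phi>) q)"
  by (simp add: cc_def Tb_def)

text \<open>Both sides of \<open>\<Sum>k. V k * G k l = \<Phi>\<^sub>t\<^sub>l\<close> are differentiated, once along \<open>Tb\<close> and once along
  \<open>dbar\<^sub>l\<close> inside \<open>cc\<close>; the third derivatives of \<open>\<Phi>\<close> cancel.\<close>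

lemma Tb_V_G:
  assumes q: "q \<in> N"
  shows "(\<Sum>k\<in>UNIV. Tb (V k) q * G q $ k $ l) = pdb (Some l) cc q"
proof -
  have cP: "Cinf_on N (pd k \<Phi>)" "Cinf_on N (pdb k \<Phi>)" for k by (intro Cinf_on_dop oN c\<Phi>)+
  have cPP: "Cinf_on N (pdb j (pd k \<Phi>))" "Cinf_on N (pd k (pdb j \<Phi>))" for j k by (intro Cinf_on_dop cP oN)+
  have cV: "Cinf_on N (\<lambda>q. cnj (V k q))" for k by (intro Cinf_on_cnj oN CinfV)
  have com: "pdb (Some l) (pdb m (pd k \<Phi>)) q = pdb m (pdb (Some l) (pd k \<Phi>)) q" for m k
    by (rule dop_commute[OF oN cP(1) q])
  have A: "(\<Sum>k\<in>UNIV. Tb (V k) q * G q $ k $ l) + (\<Sum>k\<in>UNIV. V k q * Tb (\<lambda>q. G q $ k $ l) q)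
     = Tb (pdb (Some l) (pd None \<Phi>)) q"
  proof -
    have "Tb (pdb (Some l) (pd None \<Phi>)) q = Tb (\<lambda>q. \<Sum>k\<in>UNIV. V k q * G q $ k $ l) q"
      unfolding Tb_def by (intro arg_cong2[where f="(-)"] sum.cong refl arg_cong2[where f="(*)"] dop_cong[OF oN q] V_G[symmetric])
    also have "\<dots> = (\<Sum>k\<in>UNIV. V k q * Tb (\<lambda>q. G q $ k $ l) q + Tb (V k) q * G q $ k $ l)"
      by (subst Tb_sum) (auto intro!: Cinf_on_mult oN CinfV CinfG q simp: Tb_mult[OF CinfV CinfG q])
    finally show ?thesis by (simp add: sum.distrib)
  qed
  have TbG: "Tb (\<lambda>q. G q $ k $ l) q = pdb (Some l) (pd (Some k) (pdb None \<Phi>)) q - (\<Sum>m\<in>UNIV. cnj (V m q) * pdb (Some l) (\<lambda>q. G q $ k $ m) q)" for k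
  proof -
    have Gkl: "pdb m (\<lambda>q. G q $ k $ l) q = pdb (Some l) (pdb m (pd (Some k) \<Phi>)) q" for m
    proof -
      have "pdb m (\<lambda>q. G q $ k $ l) q = pdb m (pdb (Some l) (pd (Some k) \<Phi>)) q"
        by (rule dop_cong[OF oN q]) (simp add: G dop_commute[OF oN c\<Phi>])
      then show ?thesis by (simp only: com)
    qed
    have G2: "pdb (Some l) (pdb (Some m) (pd (Some k) \<Phi>)) q = pdb (Some l) (\<lambda>q. G q $ k $ m) q" for m
      by (rule dop_cong[OF oN q]) (simp add: G dop_commute[OF oN c\<Phi>])
    have G3: "pdb (Some l) (pdb None (pd (Some k) \<Phi>)) q = pdb (Some l) (pd (Some k) (pdb None \<Phi>)) q"
      by (rule dop_cong[OF oN q]) (simp add: dop_commute[OF oN c\<Phi>])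
    show ?thesis by (simp add: Tb_def Gkl G2 G3)
  qed
  have B: "pdb (Some l) cc q = Tb (pdb (Some l) (pd None \<Phi>)) q - (\<Sum>m\<in>UNIV. pdb (Some l) (\<lambda>q. cnj (V m q)) q * pdb (Some m) (pd None \<Phi>) q)"
  proof -
    have "pdb (Some l) cc q = pdb (Some l) (\<lambda>q. pdb None (pd None \<Phi>) q - (\<Sum>k\<in>UNIV. cnj (V k q) * pdb (Some k) (pd None \<Phi>) q)) q"
      unfolding cc_eq[abs_def] ..
    also have "\<dots> = pdb (Some l) (pdb None (pd None \<Phi>)) q - (\<Sum>k\<in>UNIV. pdb (Some l) (\<lambda>q. cnj (V k q) * pdb (Some k) (pd None \<Phi>) q) q)"
      by (subst dop_diff, rule diffN[OF cPP(1) q], rule diffN[OF Cinf_on_sum[OF oN Cinf_on_mult[OF oN cV cPP(1)]] q],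
          subst dop_sum[OF finite diffN[OF Cinf_on_mult[OF oN cV cPP(1)] q]]) simp
    also have "(\<Sum>k\<in>UNIV. pdb (Some l) (\<lambda>q. cnj (V k q) * pdb (Some k) (pd None \<Phi>) q) q)
      = (\<Sum>k\<in>UNIV. cnj (V k q) * pdb (Some k) (pdb (Some l) (pd None \<Phi>)) q) + (\<Sum>m\<in>UNIV. pdb (Some l) (\<lambda>q. cnj (V m q)) q * pdb (Some m) (pd None \<Phi>) q)"
      by (simp add: dop_mult[OF diffN[OF cV q] diffN[OF cPP(1) q]] com sum.distrib)
    finally show ?thesis by (simp add: Tb_def com)
  qed
  \<comment> \<open>The conjugate relation \<open>cnj_V_G\<close>, differentiated along dbar l,
    trades the derivative of cnj V for \<open>Tb\<close> of G; through \<open>V_G\<close> the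
    surplus term of \<open>B\<close> then equals that of \<open>A\<close>.\<close>
  have D: "(\<Sum>m\<in>UNIV. pdb (Some l) (\<lambda>q. cnj (V m q)) q * G q $ k $ m) = Tb (\<lambda>q. G q $ k $ l) q" for k
  proof -
    have "pdb (Some l) (pd (Some k) (pdb None \<Phi>)) q = pdb (Some l) (\<lambda>q. \<Sum>m\<in>UNIV. cnj (V m q) * G q $ k $ m) q"
      by (rule dop_cong[OF oN q]) (rule cnj_V_G[symmetric])
    also have "\<dots> = (\<Sum>m\<in>UNIV. cnj (V m q) * pdb (Some l) (\<lambda>q. G q $ k $ m) q + pdb (Some l) (\<lambda>q. cnj (V m q)) q * G q $ k $ m)"
      by (subst dop_sum[OF finite diffN[OF Cinf_on_mult[OF oN cV CinfG] q]]) (simp add: dop_mult[OF diffN[OF cV q] diffN[OF CinfG q]])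
    finally show ?thesis unfolding TbG by (simp add: sum.distrib)
  qed
  have "(\<Sum>m\<in>UNIV. pdb (Some l) (\<lambda>q. cnj (V m q)) q * pdb (Some m) (pd None \<Phi>) q)
    = (\<Sum>m\<in>UNIV. \<Sum>k\<in>UNIV. V k q * (pdb (Some l) (\<lambda>q. cnj (V m q)) q * G q $ k $ m))"
    unfolding V_G[OF q, symmetric] by (simp add: sum_distrib_left sum_distrib_right mult_ac)
  also have "\<dots> = (\<Sum>k\<in>UNIV. V k q * Tb (\<lambda>q. G q $ k $ l) q)"
    by (subst sum.swap) (simp add: sum_distrib_left[symmetric] D)
  finally have E: "(\<Sum>m\<in>UNIV. pdb (Some l) (\<lambda>q. cnj (V m q)) q * pdb (Some m) (pd None \<Phi>) q)
    = (\<Sum>k\<in>UNIV. V k q * Tb (\<lambda>q. G q $ k $ l) q)" .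
  have "(\<Sum>k\<in>UNIV. Tb (V k) q * G q $ k $ l) + (\<Sum>k\<in>UNIV. V k q * Tb (\<lambda>q. G q $ k $ l) q)
    = pdb (Some l) cc q + (\<Sum>k\<in>UNIV. V k q * Tb (\<lambda>q. G q $ k $ l) q)"
    unfolding A B E by simp
  then show ?thesis by (rule add_right_imp_eq)
qed

text \<open>The commutator of the two horizontal lifts is vertical, and its (1,0)-part is, up to
  sign, the gradient of \<open>cc\<close>. This is where dbar c enters the estimate.\<close>

lemma Tb_V:
  assumes q: "q \<in> N"
  shows "Tb (V k) q = (\<Sum>j\<in>UNIV. matrix_inv (G q) $ j $ k * pdb (Some j) cc q)"
proof -
  have "(\<Sum>j\<in>UNIV. matrix_inv (G q) $ j $ k * pdb (Some j) cc q) = (\<Sum>j\<in>UNIV. \<Sum>m\<in>UNIV. Tb (V m) q * (G q $ m $ j * matrix_inv (G q) $ j $ k))"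
    unfolding Tb_V_G[OF q, symmetric] by (simp add: sum_distrib_left mult_ac)
  also have "\<dots> = (\<Sum>m\<in>UNIV. Tb (V m) q * (if m = k then 1 else 0))"
    by (subst sum.swap) (simp only: sum_distrib_left[symmetric] matrix_inv_sum(2)[OF Gdet[OF q]])
  also have "\<dots> = Tb (V k) q" by (simp add: if_distrib cong: if_cong)
  finally show ?thesis by simp
qed

text \<open>The correction term is the squared length of V, which by duality is that of the form
  dbar \<psi>_t.\<close>

lemma cc_form:
  assumes q: "q \<in> N"
  shows "cc q = pdb None (pd None \<Phi>) q - pform (G q) (\<chi> k. pd (Some k) (pdb None \<Phi>) q) (\<chi> j. pdb (Some j) (pd None \<Phi>) q)"
proof -
  define a where "a = (\<chi> j. pdb (Some j) (pd None \<Phi>) q)"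
  have ca: "cnj (a $ k) = pd (Some k) (pdb None \<Phi>) q" for k by (simp add: a_def dop_cnj_\<Phi>2[OF q])
  have V: "V k q = (\<Sum>j\<in>UNIV. matrix_inv (G q) $ j $ k * a $ j)" for k by (simp add: V_def a_def)
  have "pform (G q) (\<chi> k. pd (Some k) (pdb None \<Phi>) q) a = (\<Sum>j\<in>UNIV. \<Sum>k\<in>UNIV. matrix_inv (G q) $ j $ k * a $ j * cnj (a $ k))"
    by (simp add: pform_def ca)
  also have "\<dots> = (\<Sum>k\<in>UNIV. \<Sum>l\<in>UNIV. G q $ k $ l * V k q * cnj (V l q))"
    unfolding V by (rule inverse_form(2)[OF Gherm[OF q] Gdet[OF q]])
  also have "\<dots> = (\<Sum>l\<in>UNIV. (\<Sum>k\<in>UNIV. V k q * G q $ k $ l) * cnj (V l q))"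
    by (subst sum.swap) (simp add: sum_distrib_left sum_distrib_right mult_ac)
  also have "\<dots> = (\<Sum>l\<in>UNIV. cnj (V l q) * pdb (Some l) (pd None \<Phi>) q)"
    unfolding V_G[OF q] by (simp add: mult.commute)
  finally show ?thesis by (simp add: cc_eq a_def)
qed

lemma cc_nonneg:
  assumes q: "q \<in> N"
    and A: "\<And>\<xi>. 0 \<le> (\<Sum>k\<in>UNIV. \<Sum>l\<in>UNIV. pd k (pdb l \<Phi>) q * \<xi> $ k * cnj (\<xi> $ l))"
  shows "0 \<le> cc q"
proof -
  define a where "a l = pdb (Some l) (pd None \<Phi>) q" for l
  have a: "pd None (pdb (Some l) \<Phi>) q = a l" for l by (simp add: a_def dop_commute[OF oN c\<Phi> q])
  have ca: "pd (Some k) (pdb None \<Phi>) q = cnj (a k)" for k by (simp add: a_def dop_cnj_\<Phi>2[OF q])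
  have S: "(\<Sum>k\<in>UNIV. f k) = f None + (\<Sum>j\<in>UNIV. f (Some j))" for f :: "'n option \<Rightarrow> complex"
    by (simp add: UNIV_option_conv sum.reindex)
  \<comment> \<open>The coefficient vector of the horizontal lift: there the Hermitian form takes
    the value of the Schur complement, which is \<open>cc\<close>.\<close>
  define \<xi> where "\<xi> = (\<chi> k. case k of None \<Rightarrow> 1 | Some j \<Rightarrow> - V j q)"
  have GV: "(\<Sum>k\<in>UNIV. \<Sum>l\<in>UNIV. G q $ k $ l * V k q * cnj (V l q)) = (\<Sum>l\<in>UNIV. a l * cnj (V l q))"
    unfolding a_def V_G[OF q, symmetric] by (subst sum.swap) (simp add: sum_distrib_left sum_distrib_right mult_ac)
  have GV': "(\<Sum>k\<in>UNIV. \<Sum>l\<in>UNIV. G q $ k $ l * V k q * cnj (V l q)) = (\<Sum>k\<in>UNIV. V k q * cnj (a k))"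
  proof -
    have "(\<Sum>k\<in>UNIV. \<Sum>l\<in>UNIV. G q $ k $ l * V k q * cnj (V l q)) = (\<Sum>k\<in>UNIV. V k q * (\<Sum>l\<in>UNIV. cnj (V l q) * G q $ k $ l))"
      by (simp add: sum_distrib_left mult_ac)
    then show ?thesis by (simp only: cnj_V_G[OF q] ca)
  qed
  have "(\<Sum>k\<in>UNIV. \<Sum>l\<in>UNIV. pd k (pdb l \<Phi>) q * \<xi> $ k * cnj (\<xi> $ l))
    = pd None (pdb None \<Phi>) q - (\<Sum>l\<in>UNIV. a l * cnj (V l q)) - (\<Sum>k\<in>UNIV. V k q * cnj (a k))
      + (\<Sum>k\<in>UNIV. \<Sum>l\<in>UNIV. G q $ k $ l * V k q * cnj (V l q))"
    unfolding S by (simp add: \<xi>_def a ca G[OF q] sum.distrib sum_negf sum_subtractf mult_ac)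
  also have "\<dots> = pdb None (pd None \<Phi>) q - (\<Sum>l\<in>UNIV. a l * cnj (V l q))"
    unfolding GV' by (simp add: dop_commute[OF oN c\<Phi> q])
  also have "\<dots> = cc q" by (simp add: cc_eq a_def mult.commute)
  finally show ?thesis using A[of \<xi>] by simp
qed

text \<open>\<open>u\<close> is the local representative of a holomorphic section which does not depend on \<open>t\<close>, and
  \<open>exp (- \<Phi>)\<close> is the metric.\<close>

definition holo :: "(complex \<times> (complex^'n) \<Rightarrow> complex) \<Rightarrow> bool" where
  "holo u \<longleftrightarrow> Cinf_on N u \<and> (\<forall>q\<in>N. \<forall>k. pdb k u q = 0) \<and> (\<forall>q\<in>N. pd None u q = 0)"

definition eta :: "(complex \<times> (complex^'n) \<Rightarrow> complex) \<Rightarrow> complex \<times> (complex^'n) \<Rightarrow> complex" where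
  "eta u q = T u q - u q * T \<Phi> q"

text \<open>The covariant derivative of u along the k-th fibre coordinate, for the Chern connection
  of the metric exp (- \<Phi>); \<open>eta\<close> is the one along \<open>T\<close>.\<close>

definition nab :: "'n \<Rightarrow> (complex \<times> (complex^'n) \<Rightarrow> complex) \<Rightarrow> complex \<times> (complex^'n) \<Rightarrow> complex" where
  "nab k u q = pd (Some k) u q - u q * pd (Some k) \<Phi> q"

definition ip :: "(complex \<times> (complex^'n) \<Rightarrow> complex) \<Rightarrow> (complex \<times> (complex^'n) \<Rightarrow> complex) \<Rightarrow> complex \<times> (complex^'n) \<Rightarrow> complex" where
  "ip u v q = u q * cnj (v q) * exp (- \<Phi> q)"

section \<open>Derivatives of the norm of a holomorphic section\<close>

lemma Cinf_exp: "Cinf_on N (\<lambda>q. exp (- \<Phi> q))"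
  by (intro Cinf_on_exp Cinf_on_minus oN c\<Phi>)

lemma Tb_holo: "holo u \<Longrightarrow> q \<in> N \<Longrightarrow> Tb u q = 0"
  by (simp add: holo_def Tb_def)

lemma pd_cnj_holo:
  assumes "holo u" "q \<in> N"
  shows "pd k (\<lambda>q. cnj (u q)) q = 0"
  using assms dop_cnj[OF diffN, of u q "- \<i>" "tz_axis k 1" "tz_axis k \<i>"] by (simp add: holo_def)

lemma Cinf_eta: "holo u \<Longrightarrow> Cinf_on N (eta u)"
  unfolding eta_def[abs_def] holo_def by (intro Cinf_on_diff Cinf_on_mult CinfT oN c\<Phi>) auto

lemma T_ip:
  assumes u: "holo u" and v: "holo v" and q: "q \<in> N"
  shows "T (ip u v) q = eta u q * cnj (v q) * exp (- \<Phi> q)"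
proof -
  have c: "Cinf_on N u" "Cinf_on N v" using u v by (auto simp: holo_def)
  have cv: "Cinf_on N (\<lambda>q. cnj (v q))" by (intro Cinf_on_cnj oN c)
  show ?thesis
    unfolding ip_def[abs_def] T_mult[OF Cinf_on_mult[OF oN c(1) cv] Cinf_exp q] T_mult[OF c(1) cv q]
      T_exp_neg(1)[OF q] T_cnj[OF c(2) q] Tb_holo[OF v q]
    by (simp add: eta_def algebra_simps)
qed

text \<open>\<open>Tb\<close> annihilates u and its derivatives, and by orthogonality the
  derivatives of \<Phi> along the fibre. Exchanging it with \<open>T\<close> therefore leaves two
  terms: the curvature of the metric in the horizontal direction, which is \<open>cc\<close>, and
  the commutator through \<open>Tb (V k)\<close>.\<close>

lemma Tb_eta:
  assumes u: "holo u" and q: "q \<in> N"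
  shows "Tb (eta u) q = - cc q * u q - (\<Sum>k\<in>UNIV. Tb (V k) q * nab k u q)"
proof -
  have cu: "Cinf_on N u" using u by (simp add: holo_def)
  have z: "pdb l (pd k u) q = 0" for k l
  proof -
    have "pdb l (pd k u) q = pd k (pdb l u) q" by (rule dop_commute[OF oN cu q])
    also have "\<dots> = pd k (\<lambda>_. 0) q" by (rule dop_cong[OF oN q]) (use u in \<open>simp add: holo_def\<close>)
    finally show ?thesis by simp
  qed
  have cp: "Cinf_on N (pd k f)" if "Cinf_on N f" for k f by (rule Cinf_on_dop[OF oN that])
  have TT: "Tb (T X) q = Tb (pd None X) q - (\<Sum>k\<in>UNIV. V k q * Tb (pd (Some k) X) q + Tb (V k) q * pd (Some k) X q)"
    if X: "Cinf_on N X" for X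
    unfolding T_def[abs_def]
    by (subst Tb_diff[OF cp[OF X] Cinf_on_sum[OF oN Cinf_on_mult[OF oN CinfV cp[OF X]]] q],
        subst Tb_sum[OF finite Cinf_on_mult[OF oN CinfV cp[OF X]] q]) (simp add: Tb_mult[OF CinfV cp[OF X] q])
  have 1: "Tb (T u) q = - (\<Sum>k\<in>UNIV. Tb (V k) q * pd (Some k) u q)"
    unfolding TT[OF cu] by (simp add: Tb_def z)
  have 2: "Tb (T \<Phi>) q = cc q - (\<Sum>k\<in>UNIV. Tb (V k) q * pd (Some k) \<Phi> q)"
    unfolding TT[OF c\<Phi>] by (simp add: Tb_pd_\<Phi>[OF q] cc_def)
  have "Tb (eta u) q = Tb (T u) q - u q * Tb (T \<Phi>) q"
    unfolding eta_def[abs_def]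
    by (subst Tb_diff[OF CinfT[OF cu] Cinf_on_mult[OF oN cu CinfT[OF c\<Phi>]] q], subst Tb_mult[OF cu CinfT[OF c\<Phi>] q])
      (simp add: Tb_holo[OF u q])
  then show ?thesis by (simp add: 1 2 nab_def algebra_simps sum_subtractf sum_distrib_left)
qed

lemma pd_ip:
  assumes u: "holo u" and v: "holo v" and q: "q \<in> N"
  shows "pd (Some k) (ip u v) q = nab k u q * cnj (v q) * exp (- \<Phi> q)"
proof -
  have c: "Cinf_on N u" "Cinf_on N v" using u v by (auto simp: holo_def)
  have d: "u differentiable (at q)" "(\<lambda>q. cnj (v q)) differentiable (at q)" "\<Phi> differentiable (at q)" "(\<lambda>q. exp (- \<Phi> q)) differentiable (at q)"
    by (rule diffN[OF c(1) q] differentiable_cnj[OF diffN[OF c(2) q]] diffN[OF c\<Phi> q] diffN[OF Cinf_exp q])+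
  show ?thesis
    unfolding ip_def[abs_def]
    by (subst dop_mult[OF differentiable_mult[OF d(1,2)] d(4)], subst dop_mult[OF d(1,2)], subst dop_exp)
      (simp_all add: dop_minus d pd_cnj_holo[OF v q] nab_def algebra_simps)
qed

text \<open>By \<open>Tb_V\<close> the commutator term of \<open>Tb_eta\<close> becomes a pairing
  with dbar \<open>cc\<close>. It is left as it stands, since it is controlled only after
  integration over the fibre.\<close>

lemma Tb_T_ip:
  assumes u: "holo u" and q: "q \<in> N"
  shows "Tb (T (ip u u)) q = eta u q * cnj (eta u q) * exp (- \<Phi> q) - cc q * ip u u q
    - pform (G q) (\<chi> k. pd (Some k) (ip u u) q) (\<chi> j. pdb (Some j) cc q)"
proof -
  have cu: "Cinf_on N u" using u by (simp add: holo_def)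
  have cv: "Cinf_on N (\<lambda>q. cnj (u q))" by (intro Cinf_on_cnj oN cu)
  have ce: "Cinf_on N (\<lambda>q. cnj (u q) * exp (- \<Phi> q))" by (intro Cinf_on_mult oN cv Cinf_exp)
  have "Tb (T (ip u u)) q = Tb (\<lambda>q. eta u q * (cnj (u q) * exp (- \<Phi> q))) q"
    unfolding Tb_def by (intro arg_cong2[where f="(-)"] sum.cong refl arg_cong2[where f="(*)"] dop_cong[OF oN q])
      (simp_all add: T_ip[OF u u] mult.assoc)
  also have "\<dots> = eta u q * Tb (\<lambda>q. cnj (u q) * exp (- \<Phi> q)) q + Tb (eta u) q * (cnj (u q) * exp (- \<Phi> q))"
    by (rule Tb_mult[OF Cinf_eta[OF u] ce q])
  also have "Tb (\<lambda>q. cnj (u q) * exp (- \<Phi> q)) q = cnj (eta u q) * exp (- \<Phi> q)"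
    unfolding Tb_mult[OF cv Cinf_exp q] T_exp_neg(2)[OF q] Tb_cnj[OF cu q] Tb_\<Phi>[OF q]
    by (simp add: eta_def algebra_simps)
  also have "Tb (eta u) q * (cnj (u q) * exp (- \<Phi> q)) = - cc q * ip u u q - (\<Sum>k\<in>UNIV. Tb (V k) q * pd (Some k) (ip u u) q)"
    by (simp add: Tb_eta[OF u q] pd_ip[OF u u q] ip_def algebra_simps sum_distrib_left sum_distrib_right)
  also have "(\<Sum>k\<in>UNIV. Tb (V k) q * pd (Some k) (ip u u) q) = pform (G q) (\<chi> k. pd (Some k) (ip u u) q) (\<chi> j. pdb (Some j) cc q)"
    unfolding Tb_V[OF q] pform_def vec_lambda_beta sum_distrib_right by (rule sum.swap)
  finally show ?thesis by (simp add: algebra_simps)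
qed

text \<open>Applying dbar k to a covariant derivative of u returns - u G, the curvature of the
  metric. Traced against the inverse of G this is n times the norm: the origin of n in the constant
  n + 1.\<close>

lemma laplacian_ip:
  assumes u: "holo u" and q: "q \<in> N"
  shows "(\<Sum>j\<in>UNIV. \<Sum>k\<in>UNIV. matrix_inv (G q) $ j $ k * pd (Some k) (pdb (Some j) (ip u u)) q)
    = (\<Sum>j\<in>UNIV. \<Sum>k\<in>UNIV. matrix_inv (G q) $ j $ k * cnj (nab j u q) * nab k u q) * exp (- \<Phi> q) - of_nat CARD('n) * ip u u q"
proof -
  have cu: "Cinf_on N u" using u by (simp add: holo_def)
  have cnab: "Cinf_on N (nab k u)" for k
    unfolding nab_def[abs_def] by (intro Cinf_on_diff Cinf_on_mult Cinf_on_dop oN cu c\<Phi>)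
  have cip: "Cinf_on N (ip u u)" unfolding ip_def[abs_def] by (intro Cinf_on_mult Cinf_on_cnj Cinf_exp oN cu)
  have d: "u differentiable (at q)" "\<Phi> differentiable (at q)" "(\<lambda>q. exp (- \<Phi> q)) differentiable (at q)"
    by (rule diffN[OF cu q] diffN[OF c\<Phi> q] diffN[OF Cinf_exp q])+
  have ipb: "pdb (Some j) (ip u u) p = (u p * exp (- \<Phi> p)) * cnj (nab j u p)" if p: "p \<in> N" for j p
  proof -
    have "pdb (Some j) (ip u u) p = pdb (Some j) (\<lambda>q. cnj (ip u u q)) p"
      by (rule dop_cong[OF oN p]) (simp add: ip_def exp_cnj real\<Phi>)
    also have "\<dots> = cnj (pd (Some j) (ip u u) p)" using dop_cnj[OF diffN[OF cip p], of \<i>] by simp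
    also have "\<dots> = (u p * exp (- \<Phi> p)) * cnj (nab j u p)"
      by (simp add: pd_ip[OF u u p] exp_cnj real\<Phi>[OF p])
    finally show ?thesis .
  qed
  have nabb: "pdb (Some k) (nab j u) q = - u q * G q $ j $ k" for j k
  proof -
    have z: "pdb (Some k) (pd (Some j) u) q = 0"
    proof -
      have "pdb (Some k) (pd (Some j) u) q = pd (Some j) (pdb (Some k) u) q" by (rule dop_commute[OF oN cu q])
      also have "\<dots> = pd (Some j) (\<lambda>_. 0) q" by (rule dop_cong[OF oN q]) (use u in \<open>simp add: holo_def\<close>)
      finally show ?thesis by simp
    qed
    have "pdb (Some k) (nab j u) q = pdb (Some k) (pd (Some j) u) q - (u q * pdb (Some k) (pd (Some j) \<Phi>) q + pdb (Some k) u q * pd (Some j) \<Phi> q)"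
      unfolding nab_def[abs_def]
      by (subst dop_diff[OF diffN[OF Cinf_on_dop[OF oN cu] q] diffN[OF Cinf_on_mult[OF oN cu Cinf_on_dop[OF oN c\<Phi>]] q]],
          subst dop_mult[OF d(1) diffN[OF Cinf_on_dop[OF oN c\<Phi>] q]]) simp
    then show ?thesis using u q by (simp add: z holo_def G dop_commute[OF oN c\<Phi> q])
  qed
  have 2: "pd (Some k) (pdb (Some j) (ip u u)) q = cnj (nab j u q) * nab k u q * exp (- \<Phi> q) - ip u u q * G q $ k $ j" for j k
  proof -
    have "pd (Some k) (pdb (Some j) (ip u u)) q = pd (Some k) (\<lambda>p. (u p * exp (- \<Phi> p)) * cnj (nab j u p)) q"
      by (rule dop_cong[OF oN q]) (rule ipb)
    also have "\<dots> = (u q * exp (- \<Phi> q)) * pd (Some k) (\<lambda>p. cnj (nab j u p)) q + pd (Some k) (\<lambda>p. u p * exp (- \<Phi> p)) q * cnj (nab j u q)"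
      by (rule dop_mult[OF differentiable_mult[OF d(1,3)] differentiable_cnj[OF diffN[OF cnab q]]])
    also have "pd (Some k) (\<lambda>p. cnj (nab j u p)) q = - cnj (u q) * G q $ k $ j"
    proof -
      have "pd (Some k) (\<lambda>p. cnj (nab j u p)) q = cnj (pdb (Some k) (nab j u) q)"
        using dop_cnj[OF diffN[OF cnab q], of "- \<i>"] by simp
      then show ?thesis using Gherm[OF q] by (simp add: nabb hermitian_def)
    qed
    also have "pd (Some k) (\<lambda>p. u p * exp (- \<Phi> p)) q = nab k u q * exp (- \<Phi> q)"
      by (subst dop_mult[OF d(1,3)], subst dop_exp) (simp_all add: dop_minus d nab_def algebra_simps)
    finally show ?thesis by (simp add: ip_def[of u u q] algebra_simps)
  qed
  have tr: "(\<Sum>j\<in>UNIV. \<Sum>k\<in>UNIV. matrix_inv (G q) $ j $ k * G q $ k $ j) = of_nat CARD('n)"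
    by (simp add: matrix_inv_sum(1)[OF Gdet[OF q]])
  have "(\<Sum>j\<in>UNIV. \<Sum>k\<in>UNIV. matrix_inv (G q) $ j $ k * pd (Some k) (pdb (Some j) (ip u u)) q)
    = (\<Sum>j\<in>UNIV. \<Sum>k\<in>UNIV. matrix_inv (G q) $ j $ k * cnj (nab j u q) * nab k u q) * exp (- \<Phi> q)
      - (\<Sum>j\<in>UNIV. \<Sum>k\<in>UNIV. matrix_inv (G q) $ j $ k * G q $ k $ j) * ip u u q"
    by (simp add: 2 algebra_simps sum_subtractf sum_distrib_left sum_distrib_right)
  then show ?thesis unfolding tr .
qed

end

section \<open>The curvature estimate\<close>

context family
begin

section \<open>Sections and their pointwise inner products\<close>

abbreviation "H0 \<equiv> global_sections atlas W g"
abbreviation "PI \<equiv> (\<lambda>u v t. pointwise_inner W (\<phi> t) u v)"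

lemma section_transform: "u \<in> H0 \<Longrightarrow> z \<in> W i \<Longrightarrow> z \<in> W j \<Longrightarrow> u i z = g i j z * u j z"
  unfolding global_sections_def by blast

lemma section_holomorphic:
  "u \<in> H0 \<Longrightarrow> c \<in> atlas \<Longrightarrow> several_holomorphic_on (\<lambda>w. u i (chart_inv c w)) (chart_image c (W i))"
  unfolding global_sections_def manifold_holomorphic_on_def by blast

lemma PI_eq:
  assumes u: "u \<in> H0" and v: "v \<in> H0" and t: "t \<in> U" and z: "z \<in> W i"
  shows "PI u v t z = u i z * cnj (v i z) * complex_of_real (exp (- \<phi> t i z))"
proof -
  interpret metric atlas W g "\<phi> t" by (rule metric_\<phi>[OF t])
  define j where "j = (SOME i. z \<in> W i)"
  have j: "z \<in> W j" unfolding j_def by (rule W_some)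
  define h where "h = g j i z"
  have h: "h \<noteq> 0" unfolding h_def by (rule g_nonzero[OF j z])
  have e: "exp (- \<phi> t j z) = exp (- \<phi> t i z) / (cmod h)\<^sup>2"
    unfolding metric_transform[OF j z] h_def[symmetric] using h by (simp add: exp_diff exp_minus field_simps)
  have hh: "complex_of_real ((cmod h)\<^sup>2) = h * cnj h" by (simp only: complex_norm_square)
  have "PI u v t z = (h * u i z) * cnj (h * v i z) * (complex_of_real (exp (- \<phi> t i z)) / (h * cnj h))"
    unfolding pointwise_inner_def j_def[symmetric] Let_def section_transform[OF u j z] section_transform[OF v j z]
      h_def[symmetric] e of_real_divide hh ..
  then show ?thesis using h by (simp add: field_simps)
qed

lemma local_family: "c \<in> atlas \<Longrightarrow> local_family (U \<times> chart_image c (W i)) (Phi i c) (Gm c)"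
proof
  assume c: "c \<in> atlas"
  have sub: "q \<in> U \<times> chart_image c UNIV" if "q \<in> U \<times> chart_image c (W i)" for q
    using that chart_image_subset[of c "W i"] by (auto simp: mem_Times_iff)
  show "open (U \<times> chart_image c (W i))" by (rule open_prod_W[OF c])
  show "Cinf_on (U \<times> chart_image c (W i)) (Phi i c)" by (rule Cinf_Phi[OF c])
  show "cnj (Phi i c q) = Phi i c q" for q by (simp add: Phi_def)
  show "Gm c q $ k $ l = pd (Some k) (pdb (Some l) (Phi i c)) q" if "q \<in> U \<times> chart_image c (W i)" for q k l
    by (rule Gm_eq[OF c that])
  show "det (Gm c q) \<noteq> 0" "hermitian (Gm c q)" if "q \<in> U \<times> chart_image c (W i)" for q
    using Gm_det[OF c sub[OF that]] Gm_hermitian[OF c sub[OF that]] .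
qed

definition rep :: "('i \<Rightarrow> 'z \<Rightarrow> complex) \<Rightarrow> 'i \<Rightarrow> ('z, 'n) chart \<Rightarrow> complex \<times> (complex^'n) \<Rightarrow> complex" where
  "rep u i c q = u i (chart_inv c (snd q))"

lemma rep_holo:
  assumes c: "c \<in> atlas" and u: "u \<in> H0"
  shows "local_family.holo (U \<times> chart_image c (W i)) (rep u i c)"
proof -
  interpret local_family "U \<times> chart_image c (W i)" "Phi i c" "Gm c" by (rule local_family[OF c])
  define f where "f w = u i (chart_inv c w)" for w
  have f: "several_holomorphic_on f (chart_image c (W i))" unfolding f_def by (rule section_holomorphic[OF u c])
  have o: "open (chart_image c (W i))" by (rule open_chart_image[OF c open_W])
  have eq: "rep u i c = (\<lambda>q. f (snd q))" by (auto simp: rep_def f_def)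
  have fd: "f differentiable (at (snd q))" if "q \<in> U \<times> chart_image c (W i)" for q
    using Cinf_on_differentiable[OF several_holomorphic_Cinf_on[OF o f]] that by auto
  show ?thesis unfolding holo_def eq
  proof (intro conjI ballI allI)
    show "Cinf_on (U \<times> chart_image c (W i)) (\<lambda>q. f (snd q))"
      by (rule Cinf_on_snd[OF several_holomorphic_Cinf_on[OF o f] o open_U])
    fix q assume q: "q \<in> U \<times> chart_image c (W i)"
    show "pdb k (\<lambda>q. f (snd q)) q = 0" for k
    proof (cases k)
      case None
      then show ?thesis using dop_snd[OF fd[OF q]] dop_zero_directions[OF fd[OF q]] by (simp add: tz_axis_def)
    next
      case (Some j)
      then show ?thesis using dop_snd[OF fd[OF q]] several_holomorphic_dzb[OF f, of "snd q" j] q by (auto simp: tz_axis_def)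
    qed
    show "pd None (\<lambda>q. f (snd q)) q = 0"
      using dop_snd[OF fd[OF q]] dop_zero_directions[OF fd[OF q]] by (simp add: tz_axis_def)
  qed
qed

lemma lift_PI:
  assumes c: "c \<in> atlas" and u: "u \<in> H0" and v: "v \<in> H0" and q: "q \<in> U \<times> chart_image c (W i)"
  shows "lift c (PI u v) q = local_family.ip (Phi i c) (rep u i c) (rep v i c) q"
proof -
  interpret local_family "U \<times> chart_image c (W i)" "Phi i c" "Gm c" by (rule local_family[OF c])
  have "fst q \<in> U" "chart_inv c (snd q) \<in> W i" using q chart_imageD(2)[OF c] by auto
  then show ?thesis
    using PI_eq[OF u v, of "fst q" "chart_inv c (snd q)" i] by (simp add: lift_def ip_def rep_def Phi_def exp_of_real[symmetric])
qed

lemma psm_PI: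
  assumes u: "u \<in> H0" and v: "v \<in> H0"
  shows "psm (PI u v)"
  unfolding psm_def
proof (rule ballI, rule Cinf_on_local)
  fix c q assume c: "c \<in> atlas" and q: "q \<in> U \<times> chart_image c UNIV"
  obtain i where i: "q \<in> U \<times> chart_image c (W i)" by (rule prod_W_exists[OF c q])
  interpret local_family "U \<times> chart_image c (W i)" "Phi i c" "Gm c" by (rule local_family[OF c])
  have "Cinf_on (U \<times> chart_image c (W i)) (ip (rep u i c) (rep v i c))"
    unfolding ip_def[abs_def]
    by (intro Cinf_on_mult Cinf_on_cnj oN Cinf_exp conjunct1[OF rep_holo[OF c u, where i=i, unfolded holo_def]]
        conjunct1[OF rep_holo[OF c v, where i=i, unfolded holo_def]])
  then have "Cinf_on (U \<times> chart_image c (W i)) (lift c (PI u v))"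
    by (rule Cinf_on_cong[OF oN, THEN iffD1, rotated]) (rule lift_PI[OF c u v, symmetric])
  then show "\<exists>N. open N \<and> q \<in> N \<and> Cinf_on N (lift c (PI u v))" using i oN by blast
qed

text \<open>\<open>T\<close> written with the global function \<psi> and the chart-free pairing,
  hence an operator on functions on U \<times> Z; \<open>FTb\<close> does the same for
  \<open>Tb\<close>. In coordinates \<open>lift_FT\<close> and \<open>lift_FTb\<close> identify
  them.\<close>

definition FT :: "(complex \<Rightarrow> 'z \<Rightarrow> complex) \<Rightarrow> complex \<Rightarrow> 'z \<Rightarrow> complex" where
  "FT F t z = dt F t z - pairP t (F t) (dt psi t) z"

definition FTb :: "(complex \<Rightarrow> 'z \<Rightarrow> complex) \<Rightarrow> complex \<Rightarrow> 'z \<Rightarrow> complex" where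
  "FTb F t z = dtb F t z - pairP t (dtb psi t) (F t) z"

text \<open>c(\<phi>) as a complex-valued function, so that Wirtinger derivatives and the pairing
  apply to it.\<close>

definition Cphi :: "complex \<Rightarrow> 'z \<Rightarrow> complex" where
  "Cphi t z = dt (dtb psi) t z - pairP t (dtb psi t) (dt psi t) z"

lemma psm_FT: "psm F \<Longrightarrow> psm (FT F)"
  unfolding FT_def[abs_def] by (intro psm_diff psm_dtop psm_pairP psm_psi)

lemma psm_FTb: "psm F \<Longrightarrow> psm (FTb F)"
  unfolding FTb_def[abs_def] by (intro psm_diff psm_dtop psm_pairP psm_psi)

lemma psm_Cphi: "psm Cphi"
  unfolding Cphi_def[abs_def] by (intro psm_diff psm_dtop psm_pairP psm_psi)

lemma point_exists:
  obtains c i w where "c \<in> atlas" "w \<in> chart_image c (W i)" "z = chart_inv c w"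
proof -
  obtain c where c: "c \<in> atlas" "z \<in> fst c" by (rule chart_exists)
  obtain i where i: "z \<in> W i" by (rule W_exists)
  show ?thesis using that[OF c(1) chart_in_image[OF c(2) i]] c by simp
qed

lemma lift_pairP:
  assumes "psm F" "psm H" "c \<in> atlas" "q \<in> U \<times> chart_image c UNIV"
  shows "lift c (\<lambda>t. pairP t (F t) (H t)) q = pform (Gm c q) (\<chi> k. pd (Some k) (lift c F) q) (\<chi> j. pdb (Some j) (lift c H) q)"
  using pairP_lift[OF assms(1-3), of "fst q" "snd q"] assms(4) by (simp add: lift_def[of c "\<lambda>t. pairP t (F t) (H t)"] mem_Times_iff)

lemma prod_subset: "q \<in> U \<times> chart_image c (W i) \<Longrightarrow> q \<in> U \<times> chart_image c UNIV"
  using chart_image_subset[of c "W i"] by (auto simp: mem_Times_iff)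

lemma dop_lift_dtop_psi:
  assumes c: "c \<in> atlas" and q: "q \<in> U \<times> chart_image c (W i)"
  shows "dop \<kappa> v w (lift c (dtop \<mu> psi)) q = dop \<kappa> v w (dop \<mu> (tz_axis None 1) (tz_axis None \<i>) (Phi i c)) q"
  by (rule dop_cong[OF open_prod_W[OF c] q]) (rule dop_None_Phi[OF c, symmetric])

lemma lift_FT:
  assumes c: "c \<in> atlas" and F: "psm F" and q: "q \<in> U \<times> chart_image c (W i)"
  shows "lift c (FT F) q = local_family.T (Phi i c) (Gm c) (lift c F) q"
proof -
  interpret local_family "U \<times> chart_image c (W i)" "Phi i c" "Gm c" by (rule local_family[OF c])
  have "lift c (FT F) q = lift c (dt F) q - lift c (\<lambda>t. pairP t (F t) (dt psi t)) q"
    by (simp add: lift_def FT_def)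
  also have "lift c (\<lambda>t. pairP t (F t) (dt psi t)) q = (\<Sum>k\<in>UNIV. V k q * pd (Some k) (lift c F) q)"
    unfolding lift_pairP[OF F psm_dtop[OF psm_psi] c prod_subset[OF q]] pform_def vec_lambda_beta V_def sum_distrib_right
      dop_lift_dtop_psi[OF c q] by (rule sum.swap)
  finally show ?thesis by (simp add: T_def lift_dtop[OF F c prod_subset[OF q]])
qed

lemma lift_FTb:
  assumes c: "c \<in> atlas" and F: "psm F" and q: "q \<in> U \<times> chart_image c (W i)"
  shows "lift c (FTb F) q = local_family.Tb (Phi i c) (Gm c) (lift c F) q"
proof -
  interpret local_family "U \<times> chart_image c (W i)" "Phi i c" "Gm c" by (rule local_family[OF c])
  have cV: "cnj (V j q) = (\<Sum>k\<in>UNIV. matrix_inv (Gm c q) $ j $ k * pd (Some k) (pdb None (Phi i c)) q)" for j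
    using hermitian_matrix_inv[OF Gherm[OF q] Gdet[OF q]] by (simp add: V_def dop_cnj_\<Phi>2[OF q] hermitian_def)
  have "lift c (FTb F) q = lift c (dtb F) q - lift c (\<lambda>t. pairP t (dtb psi t) (F t)) q"
    by (simp add: lift_def FTb_def)
  also have "lift c (\<lambda>t. pairP t (dtb psi t) (F t)) q = (\<Sum>k\<in>UNIV. cnj (V k q) * pdb (Some k) (lift c F) q)"
    unfolding lift_pairP[OF psm_dtop[OF psm_psi] F c prod_subset[OF q]] pform_def vec_lambda_beta cV sum_distrib_right
      dop_lift_dtop_psi[OF c q] by (simp add: mult_ac)
  finally show ?thesis by (simp add: Tb_def lift_dtop[OF F c prod_subset[OF q]])
qed

lemma lift_Cphi:
  assumes c: "c \<in> atlas" and q: "q \<in> U \<times> chart_image c (W i)"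
  shows "lift c Cphi q = local_family.cc (Phi i c) (Gm c) q"
proof -
  interpret local_family "U \<times> chart_image c (W i)" "Phi i c" "Gm c" by (rule local_family[OF c])
  have "lift c Cphi q = lift c (dt (dtb psi)) q - lift c (\<lambda>t. pairP t (dtb psi t) (dt psi t)) q"
    by (simp add: lift_def Cphi_def)
  also have "lift c (dt (dtb psi)) q = pdb None (pd None (Phi i c)) q"
    unfolding lift_dtop[OF psm_dtop[OF psm_psi] c prod_subset[OF q]] dop_lift_dtop_psi[OF c q]
    by (rule dop_commute[OF oN c\<Phi> q])
  also have "lift c (\<lambda>t. pairP t (dtb psi t) (dt psi t)) q
    = pform (Gm c q) (\<chi> k. pd (Some k) (pdb None (Phi i c)) q) (\<chi> j. pdb (Some j) (pd None (Phi i c)) q)"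
    unfolding lift_pairP[OF psm_dtop[OF psm_psi] psm_dtop[OF psm_psi] c prod_subset[OF q]] dop_lift_dtop_psi[OF c q] ..
  finally show ?thesis by (simp add: cc_form[OF q])
qed

lemma FTb_eq_cnj_FT:
  assumes F: "psm F" and t: "t \<in> U"
  shows "FTb F t z = cnj (FT (\<lambda>t z. cnj (F t z)) t z)"
proof -
  obtain c i w where ciw: "c \<in> atlas" "w \<in> chart_image c (W i)" "z = chart_inv c w" by (rule point_exists)
  interpret local_family "U \<times> chart_image c (W i)" "Phi i c" "Gm c" by (rule local_family[OF ciw(1)])
  have q: "(t, w) \<in> U \<times> chart_image c (W i)" using t ciw by simp
  have cF: "Cinf_on (U \<times> chart_image c (W i)) (lift c F)"
    by (rule Cinf_on_subset[OF psm_lift[OF F ciw(1)]]) (use prod_subset in blast)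
  have "lift c (FT (\<lambda>t z. cnj (F t z))) (t, w) = T (\<lambda>q. cnj (lift c F q)) (t, w)"
    using lift_FT[OF ciw(1) psm_cnj[OF F] q] by (simp add: lift_def[abs_def])
  also have "\<dots> = cnj (lift c (FTb F) (t, w))"
    by (simp add: T_cnj[OF cF q] lift_FTb[OF ciw(1) F q])
  finally show ?thesis by (simp add: lift_def ciw(3))
qed

lemma integral_cnj': "integral\<^sup>L M (\<lambda>z. cnj (f z)) = cnj (integral\<^sup>L M f)" if "integrable M f"
  by (simp add: that)

text \<open>Obtained from \<open>variation\<close> by conjugating the integrand and the result, in
  place of a second integration by parts.\<close>

lemma variation_bar:
  assumes F: "psm F" and t: "t \<in> U"
  shows "dop \<i> 1 \<i> (\<lambda>\<tau>. integral\<^sup>L (volt \<tau>) (F \<tau>)) t = integral\<^sup>L (volt t) (FTb F t)"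
proof -
  have int: "integrable (volt \<tau>) (F \<tau>)" if "\<tau> \<in> U" for \<tau>
    by (rule integrable_continuous_vol[OF that psm_continuous[OF F that]])
  have int': "integrable (volt t) (FTb F t)"
    by (rule integrable_continuous_vol[OF t psm_continuous[OF psm_FTb[OF F] t]])
  have "dop (- \<i>) 1 \<i> (\<lambda>\<tau>. cnj (integral\<^sup>L (volt \<tau>) (F \<tau>))) t = dop (- \<i>) 1 \<i> (\<lambda>\<tau>. integral\<^sup>L (volt \<tau>) (\<lambda>z. cnj (F \<tau> z))) t"
    by (rule dop_cong[OF open_U t]) (rule integral_cnj'[OF int, symmetric])
  also have "\<dots> = integral\<^sup>L (volt t) (FT (\<lambda>t z. cnj (F t z)) t)"
    using first_variation(2)[OF psm_cnj[OF F] t] by (simp add: FT_def[abs_def])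
  also have "\<dots> = integral\<^sup>L (volt t) (\<lambda>z. cnj (FTb F t z))"
    by (simp add: FTb_eq_cnj_FT[OF F t])
  also have "\<dots> = cnj (integral\<^sup>L (volt t) (FTb F t))" by (rule integral_cnj'[OF int'])
  finally show ?thesis
    using dop_cnj[OF first_variation(1)[OF F t], of "- \<i>" 1 \<i>] by simp
qed

lemma variation:
  assumes F: "psm F" and t: "t \<in> U"
  shows "dop (- \<i>) 1 \<i> (\<lambda>\<tau>. integral\<^sup>L (volt \<tau>) (F \<tau>)) t = integral\<^sup>L (volt t) (FT F t)"
  using first_variation(2)[OF F t] by (simp add: FT_def[abs_def])

lemma dt_psi_cnj: "t \<in> U \<Longrightarrow> cnj (dt psi t z) = dtb psi t z"
proof -
  assume t: "t \<in> U"
  obtain c i w where ciw: "c \<in> atlas" "w \<in> chart_image c (W i)" "z = chart_inv c w" by (rule point_exists)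
  interpret local_family "U \<times> chart_image c (W i)" "Phi i c" "Gm c" by (rule local_family[OF ciw(1)])
  have q: "(t, w) \<in> U \<times> chart_image c (W i)" using t ciw by simp
  have "cnj (lift c (dt psi) (t, w)) = lift c (dtb psi) (t, w)"
    using dop_cnj_\<Phi>[OF q, of "- \<i>" "tz_axis None 1" "tz_axis None \<i>"] dop_None_Phi[OF ciw(1) q] by simp
  then show ?thesis by (simp add: lift_def ciw(3))
qed

lemma cnj_pairP:
  assumes t: "t \<in> U" and a: "CkM (Suc 0) a" and b: "CkM (Suc 0) b"
    and a': "CkM (Suc 0) (\<lambda>z. cnj (a z))" and b': "CkM (Suc 0) (\<lambda>z. cnj (b z))"
  shows "cnj (pairP t a b z) = pairP t (\<lambda>z. cnj (b z)) (\<lambda>z. cnj (a z)) z"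
proof -
  interpret metric atlas W g "\<phi> t" by (rule metric_\<phi>[OF t])
  obtain c where c: "c \<in> atlas" "z \<in> fst c" by (rule chart_exists)
  show ?thesis
    unfolding pairP_chart[OF t c a b] pairP_chart[OF t c b' a']
      pform_hermitian[OF curvature_matrix_hermitian[OF c] curvature_matrix_det(1)[OF c]]
    by (simp add: dop_cnj[OF CkM_differentiable[OF a c]] dop_cnj[OF CkM_differentiable[OF b c]])
qed

lemma c_phi_eq:
  assumes t: "t \<in> U"
  shows "c_phi atlas W \<phi> \<psi> t z = Re (Cphi t z)"
proof -
  define c where "c = (SOME c. c \<in> atlas \<and> z \<in> fst c)"
  have "\<exists>c. c \<in> atlas \<and> z \<in> fst c" using chart_exists by metis
  then have c: "c \<in> atlas" "z \<in> fst c" unfolding c_def by (metis (mono_tags, lifting) someI_ex)+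
  let ?p = "dt psi t"
  have p: "(\<lambda>z'. wirtinger 1 \<i> (\<lambda>\<tau>. complex_of_real (\<psi> \<tau> z')) t) = ?p"
    by (simp add: fun_eq_iff dtop_def wirtinger_eq_dop psi_def)
  have pp: "wirtinger 1 \<i> (wirtinger_bar 1 \<i> (\<lambda>\<tau>. complex_of_real (\<psi> \<tau> z))) t = dt (dtb psi) t z"
    by (simp add: dtop_def wirtinger_eq_dop wirtinger_bar_eq_dop psi_def)
  have 1: "CkM (Suc 0) ?p" by (rule psm_CkM[OF psm_dtop[OF psm_psi] t])
  \<comment> \<open>\<psi> is real, so its two t-derivatives are conjugate, and the pairing becomes
    a squared norm.\<close>
  have 2: "dz k (\<lambda>w. dtb psi t (chart_inv c w)) (snd c z) = cnj (dzb k (\<lambda>w. ?p (chart_inv c w)) (snd c z))" for k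
    using dop_cnj[OF CkM_differentiable[OF 1 c], of "- \<i>" "axis k 1" "axis k \<i>"] by (simp add: dt_psi_cnj[OF t])
  have "form01_normsq (curvature_matrix W (\<phi> t) c z) (\<chi> j. dzb j (\<lambda>w. ?p (chart_inv c w)) (snd c z)) = Re (pairP t (dtb psi t) ?p z)"
    unfolding pairP_def c_def[symmetric] Let_def form01_normsq_def pform_def vec_lambda_beta 2 ..
  then show ?thesis
    unfolding c_phi_def c_def[symmetric] Let_def p pp unfolding wirtinger_bar_eq_dop Cphi_def by simp
qed

lemma Cphi_nonneg:
  assumes t: "t \<in> U"
  shows "0 \<le> Cphi t z"
proof -
  obtain c i w where ciw: "c \<in> atlas" "w \<in> chart_image c (W i)" "z = chart_inv c w" by (rule point_exists)
  interpret local_family "U \<times> chart_image c (W i)" "Phi i c" "Gm c" by (rule local_family[OF ciw(1)])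
  have q: "(t, w) \<in> U \<times> chart_image c (W i)" using t ciw by simp
  have psd: "positive_semidefinite (complex_hessian tz_axis (\<lambda>(s, w'). \<phi> s i (chart_inv c w')) (t, w))"
    using semipositive t ciw unfolding semipositive_on_product_def by blast
  have "complex_hessian tz_axis (\<lambda>(s, w'). \<phi> s i (chart_inv c w')) (t, w) $ k $ l = pd k (pdb l (Phi i c)) (t, w)" for k l
    unfolding complex_hessian_def vec_lambda_beta wirtinger_eq_dop wirtinger_bar_eq_dop Phi_def[abs_def] case_prod_unfold ..
  then have "0 \<le> cc (t, w)" using psd unfolding positive_semidefinite_def by (intro cc_nonneg[OF q]) simp
  then show ?thesis using lift_Cphi[OF ciw(1) q] by (simp add: lift_def ciw(3))
qed

section \<open>Positivity and the integrated estimate\<close>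

lemma PI_nonneg:
  assumes u: "u \<in> H0" and t: "t \<in> U"
  shows "0 \<le> PI u u t z" "PI u u t z = complex_of_real (pointwise_normsq W (\<phi> t) u z)"
proof -
  show eq: "PI u u t z = complex_of_real (pointwise_normsq W (\<phi> t) u z)"
    by (simp add: pointwise_inner_def pointwise_normsq_def Let_def complex_norm_square del: of_real_power)
  show "0 \<le> PI u u t z"
    unfolding eq by (simp add: less_eq_complex_def pointwise_normsq_def Let_def)
qed

lemma complex_nonneg_iff: "0 \<le> (x::complex) \<longleftrightarrow> 0 \<le> Re x \<and> Im x = 0"
  by (auto simp: less_eq_complex_def)

lemma cnj_nonneg: "0 \<le> (x::complex) \<Longrightarrow> cnj x = x"
  by (simp add: complex_eq_iff complex_nonneg_iff)

lemma mult_nonneg_complex: "0 \<le> (x::complex) \<Longrightarrow> 0 \<le> y \<Longrightarrow> 0 \<le> x * y"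
  by (simp add: complex_nonneg_iff)

text \<open>The function \<open>|\<eta>|\<^sup>2 exp (-\<phi>)\<close>, where \<open>\<eta>\<close> is the covariant derivative of \<open>u\<close> along the horizontal
  lift of \<open>\<partial>/\<partial>t\<close>.\<close>

definition Eta2 :: "('i \<Rightarrow> 'z \<Rightarrow> complex) \<Rightarrow> complex \<Rightarrow> 'z \<Rightarrow> complex" where
  "Eta2 u t z = FTb (FT (PI u u)) t z + Cphi t z * PI u u t z + pairP t (PI u u t) (Cphi t) z"

lemma psm_Eta2: "u \<in> H0 \<Longrightarrow> psm (Eta2 u)"
  unfolding Eta2_def[abs_def] by (intro psm_add psm_mult psm_pairP psm_FT psm_FTb psm_Cphi psm_PI)

text \<open>The expression is |\<eta> - v|^2 exp (-\<phi>), expanded. Here \<eta> is formed only in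
  local trivialisations, but each term of the expansion is a global function that can be
  integrated.\<close>

lemma Eta2_bound:
  assumes u: "u \<in> H0" and v: "v \<in> H0" and t: "t \<in> U"
  shows "0 \<le> Eta2 u t z - FT (PI u v) t z - cnj (FT (PI u v) t z) + PI v v t z"
proof -
  obtain c i w where ciw: "c \<in> atlas" "w \<in> chart_image c (W i)" "z = chart_inv c w" by (rule point_exists)
  interpret local_family "U \<times> chart_image c (W i)" "Phi i c" "Gm c" by (rule local_family[OF ciw(1)])
  note c = ciw(1)
  define q where "q = (t, w)"
  have q: "q \<in> U \<times> chart_image c (W i)" using t ciw by (simp add: q_def)
  define a where "a = rep u i c"
  define b where "b = rep v i c"
  have a: "holo a" and b: "holo b" unfolding a_def b_def by (rule rep_holo[OF c u], rule rep_holo[OF c v])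
  have dTb: "Tb X q = Tb Y q" if "\<And>p. p \<in> U \<times> chart_image c (W i) \<Longrightarrow> X p = Y p" for X Y
    unfolding Tb_def by (intro arg_cong2[where f="(-)"] sum.cong refl arg_cong2[where f="(*)"] dop_cong[OF oN q] that)
  have dT: "T X p = T Y p" if "\<And>p. p \<in> U \<times> chart_image c (W i) \<Longrightarrow> X p = Y p" "p \<in> U \<times> chart_image c (W i)" for X Y p
    unfolding T_def by (intro arg_cong2[where f="(-)"] sum.cong refl arg_cong2[where f="(*)"] dop_cong[OF oN that(2)] that(1))
  have 1: "lift c (FT (PI u v)) p = T (ip (rep u i c) (rep v i c)) p" if v: "v \<in> H0" and p: "p \<in> U \<times> chart_image c (W i)" for p v
    unfolding lift_FT[OF c psm_PI[OF u v] p] by (rule dT[OF lift_PI[OF c u v] p])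
  have 2: "lift c (FTb (FT (PI u u))) q = Tb (T (ip a a)) q"
    unfolding lift_FTb[OF c psm_FT[OF psm_PI[OF u u]] q] a_def by (rule dTb[OF 1[OF u]])
  have 3: "lift c (\<lambda>t. pairP t (PI u u t) (Cphi t)) q = pform (Gm c q) (\<chi> k. pd (Some k) (ip a a) q) (\<chi> j. pdb (Some j) cc q)"
  proof -
    have "pd (Some k) (lift c (PI u u)) q = pd (Some k) (ip a a) q" for k
      unfolding a_def by (rule dop_cong[OF oN q]) (rule lift_PI[OF c u u])
    moreover have "pdb (Some j) (lift c Cphi) q = pdb (Some j) cc q" for j
      by (rule dop_cong[OF oN q]) (rule lift_Cphi[OF c])
    ultimately show ?thesis using lift_pairP[OF psm_PI[OF u u] psm_Cphi c prod_subset[OF q]] by simp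
  qed
  have "lift c (Eta2 u) q = Tb (T (ip a a)) q + cc q * ip a a q + pform (Gm c q) (\<chi> k. pd (Some k) (ip a a) q) (\<chi> j. pdb (Some j) cc q)"
    using 2 3 lift_Cphi[OF c q] lift_PI[OF c u u q] by (simp add: Eta2_def lift_def a_def)
  then have E: "Eta2 u t z = eta a q * cnj (eta a q) * exp (- Phi i c q)"
    unfolding Tb_T_ip[OF a q] by (simp add: lift_def q_def ciw(3))
  have F: "FT (PI u v) t z = eta a q * cnj (b q) * exp (- Phi i c q)"
    using 1[OF v q] T_ip[OF a b q] by (simp add: lift_def q_def ciw(3) a_def b_def)
  have B: "PI v v t z = b q * cnj (b q) * exp (- Phi i c q)"
    using lift_PI[OF c v v q] by (simp add: lift_def q_def ciw(3) b_def ip_def)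
  have e: "cnj (exp (- Phi i c q)) = exp (- Phi i c q)" "exp (- Phi i c q) = complex_of_real (exp (- \<phi> (fst q) i (chart_inv c (snd q))))"
    by (simp_all add: exp_cnj real\<Phi>[OF q]) (simp add: Phi_def exp_of_real[symmetric])
  have "Eta2 u t z - FT (PI u v) t z - cnj (FT (PI u v) t z) + PI v v t z
    = ((eta a q - b q) * cnj (eta a q - b q)) * exp (- Phi i c q)"
    unfolding E F B by (simp add: e(1) algebra_simps)
  also have "\<dots> = complex_of_real ((cmod (eta a q - b q))\<^sup>2 * exp (- \<phi> (fst q) i (chart_inv c (snd q))))"
    unfolding complex_norm_square[symmetric] e(2) by simp
  finally show ?thesis by (simp add: complex_nonneg_iff)
qed

text \<open>What remains is the squared length of the fibrewise covariant derivative of u for the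
  inverse of \<omega>, times exp (-\<phi>).\<close>

lemma Lap_PI_bound:
  assumes u: "u \<in> H0" and t: "t \<in> U" and c: "c \<in> atlas" and w: "w \<in> chart_image c (W i)"
  shows "0 \<le> Lap c (PI u u) (t, w) + of_nat CARD('n) * PI u u t (chart_inv c w)"
proof -
  interpret local_family "U \<times> chart_image c (W i)" "Phi i c" "Gm c" by (rule local_family[OF c])
  define q where "q = (t, w)"
  have q: "q \<in> U \<times> chart_image c (W i)" using t w by (simp add: q_def)
  define a where "a = rep u i c"
  have a: "holo a" unfolding a_def by (rule rep_holo[OF c u])
  have "Lap c (PI u u) q = (\<Sum>j\<in>UNIV. \<Sum>k\<in>UNIV. matrix_inv (Gm c q) $ j $ k * pd (Some k) (pdb (Some j) (ip a a)) q)"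
    unfolding Lap_def a_def
    by (intro sum.cong refl arg_cong2[where f="(*)"] dop_cong[OF oN q] dop_cong[OF oN] lift_PI[OF c u u])
  moreover have "PI u u t (chart_inv c w) = ip a a q"
    using lift_PI[OF c u u q] by (simp add: lift_def q_def a_def)
  ultimately have eq: "Lap c (PI u u) (t, w) + of_nat CARD('n) * PI u u t (chart_inv c w)
    = (\<Sum>j\<in>UNIV. \<Sum>k\<in>UNIV. matrix_inv (Gm c q) $ j $ k * cnj (nab j a q) * nab k a q) * exp (- Phi i c q)"
    using laplacian_ip[OF a q] by (simp add: q_def)
  have "0 \<le> (\<Sum>j\<in>UNIV. \<Sum>k\<in>UNIV. matrix_inv (Gm c q) $ j $ k * cnj (nab j a q) * nab k a q)"
    using inverse_form_nonneg[OF Gm_positive[OF c prod_subset[OF q]] Gm_hermitian[OF c prod_subset[OF q]], of "\<chi> j. cnj (nab j a q)"]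
    by simp
  moreover have "0 \<le> exp (- Phi i c q)"
    unfolding Phi_def of_real_minus[symmetric] exp_of_real by (simp add: complex_nonneg_iff)
  ultimately show ?thesis unfolding eq by (rule mult_nonneg_complex)
qed

text \<open>Conjugation swaps the slots of the pairing, so that integration by parts puts both
  derivatives on the norm of u, whose Laplacian has a lower bound; c \<ge> 0 preserves the bound
  when it is multiplied in. The imaginary part is tracked because the order on complex numbers
  demands equal imaginary parts.\<close>

lemma integral_pairP_bound:
  assumes u: "u \<in> H0" and t: "t \<in> U"
  shows "Re (integral\<^sup>L (volt t) (pairP t (PI u u t) (Cphi t))) \<le> real CARD('n) * Re (integral\<^sup>L (volt t) (\<lambda>z. Cphi t z * PI u u t z))"
    and "Im (integral\<^sup>L (volt t) (pairP t (PI u u t) (Cphi t))) = 0"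
proof -
  obtain P cc ii KK \<rho> where pu: "partition_of_unity P cc ii KK \<rho>" using partition_of_unity_exists by blast
  note pu' = pu_atlas[OF pu] pu_compact[OF pu] pu_subset[OF pu]
  define O' where "O' p = chart_image (cc p) (W (ii p))" for p
  define R where "R p w = complex_of_real (\<rho> p (chart_inv (cc p) w)) * Cphi t (chart_inv (cc p) w) * (2 ^ CARD('n) * det (Gm (cc p) (t, w)))" for p w
  define X where "X p = (\<lambda>w. if w \<in> O' p then R p w * Lap (cc p) (PI u u) (t, w) else 0)" for p
  define Y where "Y p = (\<lambda>w. if w \<in> O' p then R p w * PI u u t (chart_inv (cc p) w) else 0)" for p
  have PIc: "CkM k (PI u u t)" for k by (rule psm_CkM[OF psm_PI[OF u u] t])
  have Cc: "CkM k (Cphi t)" for k by (rule psm_CkM[OF psm_Cphi t])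
  have cnjC: "(\<lambda>z. cnj (Cphi t z)) = Cphi t" and cnjP: "(\<lambda>z. cnj (PI u u t z)) = PI u u t"
    using cnj_nonneg[OF Cphi_nonneg[OF t]] cnj_nonneg[OF PI_nonneg(1)[OF u t]] by auto
  have cnj: "cnj (pairP t (PI u u t) (Cphi t) z) = pairP t (Cphi t) (PI u u t) z" for z
    using cnj_pairP[OF t PIc Cc, unfolded cnjC cnjP, OF PIc Cc] .
  have int: "integrable (volt t) (pairP t (PI u u t) (Cphi t))"
    by (rule integrable_continuous_vol[OF t psm_continuous[OF psm_pairP[OF psm_PI[OF u u] psm_Cphi] t]])
  have R0: "0 \<le> R p w" if "p \<in> P" "w \<in> O' p" for p w
  proof -
    have w: "w \<in> chart_image (cc p) UNIV" using that(2) chart_image_subset unfolding O'_def by blast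
    interpret metric atlas W g "\<phi> t" by (rule metric_\<phi>[OF t])
    have "0 \<le> complex_of_real (volume_density W (\<phi> t) (cc p) w)"
      using dens_pos[OF pu'(1)[OF that(1)] w] by (simp add: complex_nonneg_iff)
    then have d: "0 \<le> 2 ^ CARD('n) * det (Gm (cc p) (t, w))"
      using Gm_dens[OF pu'(1)[OF that(1)], of "(t, w)"] t w by simp
    have "0 \<le> complex_of_real (\<rho> p (chart_inv (cc p) w))" using pu_nonneg[OF pu that(1)] by (simp add: complex_nonneg_iff)
    from mult_nonneg_complex[OF mult_nonneg_complex[OF this Cphi_nonneg[OF t]] d]
    show ?thesis unfolding R_def .
  qed
  have CM: "CkM (Suc 0) (\<lambda>z. complex_of_real (\<rho> p z) * Cphi t z)" if "p \<in> P" for p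
    by (rule CkM_mult[OF CkM_of_real[OF pu_CkM[OF pu that]] Cc])
  have iX: "integrable lborel (X p)" if p: "p \<in> P" for p
    using integral_pairP_supported(1)[OF t pu'[OF p] CM[OF p] supported_in_mult_left[OF pu_supported[OF pu p]] psm_PI[OF u u]]
    unfolding X_def R_def O'_def by (simp add: mult_ac cong: if_cong)
  have CM2: "CkM 0 (\<lambda>z. complex_of_real (\<rho> p z) * (Cphi t z * PI u u t z))" if "p \<in> P" for p
    by (rule CkM_mult[OF CkM_of_real[OF CkM_Suc_imp[OF pu_CkM[OF pu that]]] CkM_mult[OF Cc PIc]])
  have iY: "integrable lborel (Y p)" "integral\<^sup>L (volt t) (\<lambda>z. complex_of_real (\<rho> p z) * (Cphi t z * PI u u t z)) = integral\<^sup>L lborel (Y p)" if p: "p \<in> P" for p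
    using integral_supported[OF t pu'[OF p] CM2[OF p] supported_in_mult_left[OF pu_supported[OF pu p]]]
      integrable_supported_chart[OF t pu'[OF p] CM2[OF p] supported_in_mult_left[OF pu_supported[OF pu p]]]
    unfolding Y_def R_def O'_def by (simp_all add: mult_ac cong: if_cong)
  have LapR: "0 \<le> R p w * (Lap (cc p) (PI u u) (t, w) + of_nat CARD('n) * PI u u t (chart_inv (cc p) w))" if "p \<in> P" "w \<in> O' p" for p w
    using that(2) by (intro mult_nonneg_complex R0[OF that] Lap_PI_bound[OF u t pu'(1)[OF that(1)]]) (auto simp: O'_def)
  have eqX: "cnj (integral\<^sup>L (volt t) (pairP t (PI u u t) (Cphi t))) = - (\<Sum>p\<in>P. integral\<^sup>L lborel (X p))"
  proof -
    have "cnj (integral\<^sup>L (volt t) (pairP t (PI u u t) (Cphi t))) = integral\<^sup>L (volt t) (pairP t (Cphi t) (PI u u t))"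
    unfolding integral_cnj'[OF int, symmetric] cnj ..
    also have "\<dots> = - (\<Sum>p\<in>P. integral\<^sup>L lborel (X p))"
      unfolding integral_pairP_partition[OF t psm_Cphi psm_PI[OF u u] pu] X_def R_def O'_def by (simp add: mult_ac cong: if_cong)
    finally show ?thesis .
  qed
  have "Im (integral\<^sup>L lborel (X p)) = 0" if p: "p \<in> P" for p
  proof -
    have "Im (X p w) = 0" for w
    proof (cases "w \<in> O' p")
      case True
      have "0 \<le> R p w * PI u u t (chart_inv (cc p) w)"
        by (rule mult_nonneg_complex[OF R0[OF p True] PI_nonneg(1)[OF u t]])
      then show ?thesis using LapR[OF p True] True by (simp add: X_def complex_nonneg_iff algebra_simps)
    qed (simp add: X_def)
    then have "integral\<^sup>L lborel (\<lambda>w. Im (X p w)) = 0" by simp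
    then show ?thesis using integral_Im[OF iX[OF p]] by simp
  qed
  then have "Im (cnj (integral\<^sup>L (volt t) (pairP t (PI u u t) (Cphi t)))) = 0" unfolding eqX by simp
  then show "Im (integral\<^sup>L (volt t) (pairP t (PI u u t) (Cphi t))) = 0" by simp
  have "Re (integral\<^sup>L (volt t) (pairP t (PI u u t) (Cphi t))) = Re (cnj (integral\<^sup>L (volt t) (pairP t (PI u u t) (Cphi t))))" by simp
  also have "\<dots> = (\<Sum>p\<in>P. - Re (integral\<^sup>L lborel (X p)))" unfolding eqX by (simp add: sum_negf)
  also have "\<dots> \<le> (\<Sum>p\<in>P. real CARD('n) * Re (integral\<^sup>L lborel (Y p)))"
  proof (rule sum_mono)
    fix p assume p: "p \<in> P"
    have "0 \<le> integral\<^sup>L lborel (\<lambda>w. Re (X p w + of_nat CARD('n) * Y p w))"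
    proof (rule integral_nonneg_AE, rule AE_I2)
      fix w
      show "0 \<le> Re (X p w + of_nat CARD('n) * Y p w)"
      proof (cases "w \<in> O' p")
        case True
        show ?thesis using LapR[OF p True] True by (simp add: X_def Y_def complex_nonneg_iff algebra_simps)
      qed (simp add: X_def Y_def)
    qed
    also have "\<dots> = Re (integral\<^sup>L lborel (\<lambda>w. X p w + of_nat CARD('n) * Y p w))"
      using iX[OF p] iY(1)[OF p] by (intro integral_Re) auto
    also have "\<dots> = Re (integral\<^sup>L lborel (X p)) + real CARD('n) * Re (integral\<^sup>L lborel (Y p))"
      using iX[OF p] iY(1)[OF p] by simp
    finally show "- Re (integral\<^sup>L lborel (X p)) \<le> real CARD('n) * Re (integral\<^sup>L lborel (Y p))" by simp
  qed
  also have "\<dots> = real CARD('n) * Re (\<Sum>p\<in>P. integral\<^sup>L lborel (Y p))" by (simp add: sum_distrib_left)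
  also have "(\<Sum>p\<in>P. integral\<^sup>L lborel (Y p)) = integral\<^sup>L (volt t) (\<lambda>z. Cphi t z * PI u u t z)"
    using integral_partition[OF t psm_continuous[OF psm_mult[OF psm_Cphi psm_PI[OF u u]] t] pu] iY(2) by simp
  finally show "Re (integral\<^sup>L (volt t) (pairP t (PI u u t) (Cphi t))) \<le> real CARD('n) * Re (integral\<^sup>L (volt t) (\<lambda>z. Cphi t z * PI u u t z))" .
qed

text \<open>v will be D'u. The projection enters only through \<open>proj\<close>, the equality of
  \<langle>\<eta>, v\<rangle> and \<langle>v, v\<rangle>. The second term on the left is the mixed
  t-derivative of the squared norm of u, with its first derivative already in horizontal
  form.\<close>

theorem curvature_bound:
  assumes u: "u \<in> H0" and v: "v \<in> H0" and t: "t \<in> U"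
    and proj: "integral\<^sup>L (volt t) (FT (PI u v) t) = integral\<^sup>L (volt t) (PI v v t)"
  shows "Re (integral\<^sup>L (volt t) (PI v v t)) - Re (dop \<i> 1 \<i> (\<lambda>\<tau>. integral\<^sup>L (volt \<tau>) (FT (PI u u) \<tau>)) t)
     \<le> real (CARD('n) + 1) * (LINT z|volt t. pointwise_normsq W (\<phi> t) u z * c_phi atlas W \<phi> \<psi> t z)"
    and "Im (dop \<i> 1 \<i> (\<lambda>\<tau>. integral\<^sup>L (volt \<tau>) (FT (PI u u) \<tau>)) t) = 0"
proof -
  have i: "integrable (volt t) (F t)" if "psm F" for F
    by (rule integrable_continuous_vol[OF t psm_continuous[OF that t]])
  note iE = i[OF psm_Eta2[OF u]] and iF = i[OF psm_FT[OF psm_PI[OF u v]]] and iV = i[OF psm_PI[OF v v]]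
    and iB = i[OF psm_FTb[OF psm_FT[OF psm_PI[OF u u]]]] and iC = i[OF psm_mult[OF psm_Cphi psm_PI[OF u u]]]
    and iP = i[OF psm_pairP[OF psm_PI[OF u u] psm_Cphi]]
  have iF': "integrable (volt t) (\<lambda>z. cnj (FT (PI u v) t z))" using iF by simp
  let ?I = "integral\<^sup>L (volt t)"
  have "0 \<le> integral\<^sup>L (volt t) (\<lambda>z. Re (Eta2 u t z - FT (PI u v) t z - cnj (FT (PI u v) t z) + PI v v t z))"
    by (rule integral_nonneg_AE, rule AE_I2) (use Eta2_bound[OF u v t] complex_nonneg_iff in blast)
  also have "\<dots> = Re (?I (\<lambda>z. Eta2 u t z - FT (PI u v) t z - cnj (FT (PI u v) t z) + PI v v t z))"
    using iE iF iF' iV by (intro integral_Re) auto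
  also have "?I (\<lambda>z. Eta2 u t z - FT (PI u v) t z - cnj (FT (PI u v) t z) + PI v v t z)
     = ?I (Eta2 u t) - ?I (FT (PI u v) t) - cnj (?I (FT (PI u v) t)) + ?I (PI v v t)"
    using iE iF iF' iV by simp
  \<comment> \<open>By \<open>proj\<close> each cross term has the squared norm of v as its real
    part, so the square of \<eta> - v integrates to that of \<eta> minus that of v.\<close>
  finally have 1: "Re (?I (PI v v t)) \<le> Re (?I (Eta2 u t))" by (simp add: proj)
  have 2: "?I (Eta2 u t) = ?I (FTb (FT (PI u u)) t) + ?I (\<lambda>z. Cphi t z * PI u u t z) + ?I (pairP t (PI u u t) (Cphi t))"
    unfolding Eta2_def[abs_def] using iB iC iP by simp
  have 3: "dop \<i> 1 \<i> (\<lambda>\<tau>. integral\<^sup>L (volt \<tau>) (FT (PI u u) \<tau>)) t = ?I (FTb (FT (PI u u)) t)"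
    by (rule variation_bar[OF psm_FT[OF psm_PI[OF u u]] t])
  have "Cphi t z * PI u u t z = complex_of_real (pointwise_normsq W (\<phi> t) u z * c_phi atlas W \<phi> \<psi> t z)" for z
    using Cphi_nonneg[OF t, of z] PI_nonneg(2)[OF u t, of z] by (simp add: c_phi_eq[OF t] complex_eq_iff complex_nonneg_iff)
  then have 4: "Re (?I (\<lambda>z. Cphi t z * PI u u t z)) = (LINT z|volt t. pointwise_normsq W (\<phi> t) u z * c_phi atlas W \<phi> \<psi> t z)"
    by (simp only: integral_complex_of_real Re_complex_of_real)
  show "Re (?I (PI v v t)) - Re (dop \<i> 1 \<i> (\<lambda>\<tau>. integral\<^sup>L (volt \<tau>) (FT (PI u u) \<tau>)) t)
     \<le> real (CARD('n) + 1) * (LINT z|volt t. pointwise_normsq W (\<phi> t) u z * c_phi atlas W \<phi> \<psi> t z)"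
    using 1 integral_pairP_bound(1)[OF u t] unfolding 2 3 4[symmetric] by (simp add: algebra_simps)
  \<comment> \<open>In \<open>Eta2_bound\<close> with v = u the two cross terms are conjugate and
    the norm is real, so \<open>Eta2\<close> must be real.\<close>
  have "Im (Eta2 u t z) = 0" for z
    using Eta2_bound[OF u u t, of z] PI_nonneg(1)[OF u t, of z] by (simp add: complex_nonneg_iff)
  then have "integral\<^sup>L (volt t) (\<lambda>z. Im (Eta2 u t z)) = 0" by simp
  then have "Im (?I (Eta2 u t)) = 0" using integral_Im[OF iE] by simp
  moreover have "Im (Cphi t z * PI u u t z) = 0" for z
    using Cphi_nonneg[OF t, of z] PI_nonneg(1)[OF u t, of z] by (simp add: complex_nonneg_iff)
  then have "integral\<^sup>L (volt t) (\<lambda>z. Im (Cphi t z * PI u u t z)) = 0" by simp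
  then have "Im (?I (\<lambda>z. Cphi t z * PI u u t z)) = 0" using integral_Im[OF iC] by simp
  ultimately show "Im (dop \<i> 1 \<i> (\<lambda>\<tau>. integral\<^sup>L (volt \<tau>) (FT (PI u u) \<tau>)) t) = 0"
    using integral_pairP_bound(2)[OF u t] unfolding 2 3 by simp
qed

end

section \<open>Finite-dimensional Hermitian spaces of sections\<close>

definition lincomb :: "nat \<Rightarrow> (nat \<Rightarrow> complex) \<Rightarrow> (nat \<Rightarrow> 'i \<Rightarrow> 'z \<Rightarrow> complex) \<Rightarrow> 'i \<Rightarrow> 'z \<Rightarrow> complex" where
  "lincomb N a e = (\<lambda>i z. \<Sum>k<N. a k * e k i z)"

locale hermitian_space =
  fixes V :: "('i \<Rightarrow> 'z \<Rightarrow> complex) set" and ip :: "('i \<Rightarrow> 'z \<Rightarrow> complex) \<Rightarrow> ('i \<Rightarrow> 'z \<Rightarrow> complex) \<Rightarrow> complex"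
  assumes zero: "(\<lambda>_ _. 0) \<in> V"
    and lin: "u \<in> V \<Longrightarrow> v \<in> V \<Longrightarrow> (\<lambda>i z. a * u i z + b * v i z) \<in> V"
    and ip_lin: "u \<in> V \<Longrightarrow> v \<in> V \<Longrightarrow> w \<in> V \<Longrightarrow> ip (\<lambda>i z. a * u i z + b * v i z) w = a * ip u w + b * ip v w"
    and ip_cnj: "u \<in> V \<Longrightarrow> v \<in> V \<Longrightarrow> ip v u = cnj (ip u v)"
    and ip_nonneg: "u \<in> V \<Longrightarrow> 0 \<le> ip u u"
    and ip_definite: "u \<in> V \<Longrightarrow> ip u u = 0 \<Longrightarrow> u = (\<lambda>_ _. 0)"
begin

lemma ip_zero: "w \<in> V \<Longrightarrow> ip (\<lambda>_ _. 0) w = 0"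
  using ip_lin[OF zero zero, of w 0 0] by simp

lemma lincomb_in:
  "(\<And>k. k < N \<Longrightarrow> e k \<in> V) \<Longrightarrow> lincomb N a e \<in> V"
proof (induction N)
  case 0
  then show ?case using zero by (simp add: lincomb_def)
next
  case (Suc N)
  have "lincomb (Suc N) a e = (\<lambda>i z. 1 * lincomb N a e i z + a N * e N i z)"
    by (simp add: lincomb_def fun_eq_iff)
  then show ?case using lin[of "lincomb N a e" "e N" 1 "a N"] Suc by simp
qed

lemma ip_lincomb:
  "(\<And>k. k < N \<Longrightarrow> e k \<in> V) \<Longrightarrow> w \<in> V \<Longrightarrow> ip (lincomb N a e) w = (\<Sum>k<N. a k * ip (e k) w)"
proof (induction N)
  case 0
  then show ?case using ip_zero by (simp add: lincomb_def)
next
  case (Suc N)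
  have "lincomb (Suc N) a e = (\<lambda>i z. 1 * lincomb N a e i z + a N * e N i z)"
    by (simp add: lincomb_def fun_eq_iff)
  then show ?case using ip_lin[of "lincomb N a e" "e N" w 1 "a N"] lincomb_in[of N e a] Suc by simp
qed

lemma ip_lincomb_right:
  assumes "\<And>k. k < N \<Longrightarrow> e k \<in> V" "w \<in> V"
  shows "ip w (lincomb N a e) = (\<Sum>k<N. cnj (a k) * ip w (e k))"
proof -
  have "ip w (lincomb N a e) = cnj (ip (lincomb N a e) w)"
    by (rule ip_cnj[OF lincomb_in[OF assms(1)] assms(2)])
  also have "\<dots> = (\<Sum>k<N. cnj (a k) * cnj (ip (e k) w))" by (simp add: ip_lincomb[OF assms])
  also have "\<dots> = (\<Sum>k<N. cnj (a k) * ip w (e k))"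
    by (intro sum.cong refl) (simp add: ip_cnj[OF assms(1) assms(2), symmetric])
  finally show ?thesis .
qed

text \<open>Spanning is stated as the expansion formula itself, the form in which it is
  applied.\<close>

definition onb :: "nat \<Rightarrow> (nat \<Rightarrow> 'i \<Rightarrow> 'z \<Rightarrow> complex) \<Rightarrow> bool" where
  "onb N e \<longleftrightarrow> (\<forall>k<N. e k \<in> V) \<and> (\<forall>j<N. \<forall>k<N. ip (e j) (e k) = (if j = k then 1 else 0)) \<and>
     (\<forall>u\<in>V. u = lincomb N (\<lambda>k. ip u (e k)) e)"

text \<open>The representing vector has the coefficients l (e k). Conjugate linearity of l is asked
  on combinations of e; the expansion in \<open>onb\<close> extends it to the whole space.\<close>

lemma riesz:
  assumes e: "onb N e" and l: "\<And>a. l (lincomb N a e) = (\<Sum>k<N. cnj (a k) * l (e k))"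
  shows "\<exists>!w. w \<in> V \<and> (\<forall>v\<in>V. l v = ip w v)"
proof (rule ex1I)
  have eV: "e k \<in> V" if "k < N" for k using e that by (simp add: onb_def)
  let ?w = "lincomb N (\<lambda>k. l (e k)) e"
  show "?w \<in> V \<and> (\<forall>v\<in>V. l v = ip ?w v)"
  proof (intro conjI ballI)
    show "?w \<in> V" by (rule lincomb_in[OF eV])
    fix v assume v: "v \<in> V"
    have "l v = l (lincomb N (\<lambda>k. ip v (e k)) e)" using e v by (metis onb_def)
    also have "\<dots> = (\<Sum>k<N. l (e k) * ip (e k) v)"
      unfolding l by (intro sum.cong refl) (simp add: ip_cnj[OF v eV] mult.commute)
    also have "\<dots> = ip ?w v" by (rule ip_lincomb[OF eV v, symmetric])
    finally show "l v = ip ?w v" .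
  qed
  fix w' assume w': "w' \<in> V \<and> (\<forall>v\<in>V. l v = ip w' v)"
  define d where "d = (\<lambda>i z. 1 * w' i z + (- 1) * ?w i z)"
  have wV: "?w \<in> V" by (rule lincomb_in[OF eV])
  have dV: "d \<in> V" unfolding d_def using w' wV by (intro lin) auto
  have "ip d d = 1 * ip w' d + (- 1) * ip ?w d"
    using ip_lin[of w' ?w d 1 "- 1", folded d_def] w' wV dV by blast
  also have "\<dots> = 0"
  proof -
    have "l d = ip ?w d"
    proof -
      have "l d = l (lincomb N (\<lambda>k. ip d (e k)) e)" using e dV by (metis onb_def)
      also have "\<dots> = (\<Sum>k<N. l (e k) * ip (e k) d)"
        unfolding l by (intro sum.cong refl) (simp add: ip_cnj[OF dV eV] mult.commute)
      also have "\<dots> = ip ?w d" by (rule ip_lincomb[OF eV dV, symmetric])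
      finally show ?thesis .
    qed
    then show ?thesis using w' dV by simp
  qed
  finally have "d = (\<lambda>_ _. 0)" by (rule ip_definite[OF dV])
  then show "w' = ?w" by (auto simp: d_def fun_eq_iff)
qed

end

text \<open>Gram--Schmidt, by induction over a finite set of points at which no nonzero element of the
  space vanishes simultaneously.\<close>

lemma onb_exists:
  assumes "finite P" "hermitian_space V ip"
    "\<And>u. u \<in> V \<Longrightarrow> (\<And>x. x \<in> P \<Longrightarrow> u (fst x) (snd x) = 0) \<Longrightarrow> u = (\<lambda>_ _. 0)"
  shows "\<exists>N e. hermitian_space.onb V ip N e"
  using assms
proof (induction P arbitrary: V rule: finite_induct)
  case empty
  interpret hermitian_space V ip by (rule empty.prems(1))
  have "u = (\<lambda>_ _. 0)" if "u \<in> V" for u by (rule empty.prems(2)[OF that]) simp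
  then have "onb 0 undefined" unfolding onb_def lincomb_def by auto
  then show ?case by blast
next
  case (insert x P)
  interpret hermitian_space V ip by (rule insert.prems(1))
  let ?at = "\<lambda>u :: 'a \<Rightarrow> 'b \<Rightarrow> complex. u (fst x) (snd x)"
  \<comment> \<open>The kernel of evaluation at x has codimension at most one, so its basis needs at
    most one more vector.\<close>
  define V' where "V' = {u\<in>V. ?at u = 0}"
  have sub: "V' \<subseteq> V" by (auto simp: V'_def)
  have "hermitian_space V' ip"
  proof
    show "(\<lambda>_ _. 0) \<in> V'" using zero by (simp add: V'_def)
    show "(\<lambda>i z. a * u i z + b * v i z) \<in> V'" if "u \<in> V'" "v \<in> V'" for u v a b
      using that lin by (simp add: V'_def)
    show "ip (\<lambda>i z. a * u i z + b * v i z) w = a * ip u w + b * ip v w" if "u \<in> V'" "v \<in> V'" "w \<in> V'" for u v w a b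
      using that sub by (intro ip_lin) auto
    show "ip v u = cnj (ip u v)" if "u \<in> V'" "v \<in> V'" for u v using that sub ip_cnj by blast
    show "0 \<le> ip u u" if "u \<in> V'" for u using that sub ip_nonneg by blast
    show "u = (\<lambda>_ _. 0)" if "u \<in> V'" "ip u u = 0" for u using that sub ip_definite by blast
  qed
  moreover have "u = (\<lambda>_ _. 0)" if "u \<in> V'" "\<And>y. y \<in> P \<Longrightarrow> u (fst y) (snd y) = 0" for u
    by (rule insert.prems(2)) (use that V'_def in auto)
  ultimately obtain N e where e: "hermitian_space.onb V' ip N e" using insert.IH[of V'] by blast
  interpret V': hermitian_space V' ip by fact
  have eV': "e k \<in> V'" if "k < N" for k using e that by (simp add: V'.onb_def)
  have eV: "e k \<in> V" and eat: "?at (e k) = 0" if "k < N" for k using eV'[OF that] by (auto simp: V'_def)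
  have eo: "ip (e j) (e k) = (if j = k then 1 else 0)" if "j < N" "k < N" for j k using e that by (simp add: V'.onb_def)
  have ex: "u = lincomb N (\<lambda>k. ip u (e k)) e" if "u \<in> V'" for u using e that unfolding V'.onb_def by blast
  show ?case
  proof (cases "V' = V")
    case True
    then show ?thesis using e by blast
  next
    case False
    then obtain u0 where u0: "u0 \<in> V" "?at u0 \<noteq> 0" using sub by (auto simp: V'_def)
    \<comment> \<open>The part of u0 orthogonal to V'. Its value at x is that of u0, since every e k
      vanishes at x, so it is not zero.\<close>
    define v where "v = (\<lambda>i z. 1 * u0 i z + (- 1) * lincomb N (\<lambda>k. ip u0 (e k)) e i z)"
    have vV: "v \<in> V" unfolding v_def by (intro lin u0 lincomb_in eV)
    have vat: "?at v = ?at u0" by (simp add: v_def lincomb_def eat)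
    have ve: "ip v (e k) = 0" if k: "k < N" for k
    proof -
      have "ip v (e k) = ip u0 (e k) - (\<Sum>j<N. ip u0 (e j) * ip (e j) (e k))"
        unfolding v_def using ip_lin[OF u0(1) lincomb_in eV[OF k], of N e 1 "- 1" "\<lambda>k. ip u0 (e k)"] eV ip_lincomb[OF eV eV[OF k]] by simp
      also have "(\<Sum>j<N. ip u0 (e j) * ip (e j) (e k)) = (\<Sum>j<N. if j = k then ip u0 (e k) else 0)"
        by (intro sum.cong refl) (simp add: eo k)
      finally show ?thesis using k by simp
    qed
    have ev: "ip (e k) v = 0" if "k < N" for k using ip_cnj[OF vV eV[OF that]] ve[OF that] by simp
    have vv: "ip v v \<noteq> 0"
    proof
      assume "ip v v = 0"
      then have "v = (\<lambda>_ _. 0)" by (rule ip_definite[OF vV])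
      then have "?at v = 0" by simp
      with vat u0(2) show False by simp
    qed
    define s where "s = sqrt (Re (ip v v))"
    have "0 \<le> Re (ip v v)" "Im (ip v v) = 0" using ip_nonneg[OF vV] by (auto simp: less_eq_complex_def)
    then have s: "ip v v = of_real s * of_real s" "s \<noteq> 0"
      using vv by (auto simp: s_def complex_eq_iff simp flip: of_real_mult)
    \<comment> \<open>The summand with coefficient 0 brings the multiple of v into the shape of
      \<open>lin\<close>.\<close>
    define e' where "e' = (\<lambda>k. if k < N then e k else (\<lambda>i z. (1 / of_real s) * v i z + 0 * v i z))"
    have e'N: "e' N = (\<lambda>i z. (1 / of_real s) * v i z + 0 * v i z)" by (simp add: e'_def)
    have e'V: "e' k \<in> V" if "k < Suc N" for k
      unfolding e'_def using eV lin[OF vV vV, of "1 / of_real s" 0] by (simp split: if_split)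
    have ipN: "ip (e' N) w = ip v w / of_real s" if "w \<in> V" for w
      unfolding e'N using ip_lin[OF vV vV that, of "1 / of_real s" 0] by simp
    have ipN': "ip w (e' N) = ip w v / of_real s" if "w \<in> V" for w
      using ip_cnj[OF e'V[of N] that] ip_cnj[OF vV that] ipN[OF that] by simp
    have o: "ip (e' j) (e' k) = (if j = k then 1 else 0)" if jk: "j < Suc N" "k < Suc N" for j k
    proof -
      consider "j < N" "k < N" | "j < N" "k = N" | "j = N" "k < N" | "j = N" "k = N" using jk by linarith
      then show ?thesis
      proof cases
        case 1 then show ?thesis by (simp add: e'_def eo)
      next
        case 2 then show ?thesis using ipN'[OF eV[of j]] ev[of j] by (simp add: e'_def)
      next
        case 3 then show ?thesis using ipN[OF eV[of k]] ve[of k] by (simp add: e'_def)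
      next
        case 4 then show ?thesis using ipN[OF e'V[of N]] ipN'[OF vV] s by simp
      qed
    qed
    have "u = lincomb (Suc N) (\<lambda>k. ip u (e' k)) e'" if u: "u \<in> V" for u
    proof -
      \<comment> \<open>This b makes u - b v vanish at x, which puts it into V'.\<close>
      define b where "b = ?at u / ?at v"
      define u' where "u' = (\<lambda>i z. 1 * u i z + (- b) * v i z)"
      have u'V: "u' \<in> V" unfolding u'_def by (intro lin u vV)
      have "?at u' = 0" using u0(2) by (simp add: u'_def b_def vat)
      then have u'V': "u' \<in> V'" using u'V by (simp add: V'_def)
      have u'e: "ip u' (e k) = ip u (e k)" if "k < N" for k
        unfolding u'_def using ip_lin[OF u vV eV[OF that], of 1 "- b"] ve[OF that] by simp
      have "ip u' v = (\<Sum>k<N. ip u' (e k) * ip (e k) v)"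
        by (subst ex[OF u'V']) (rule ip_lincomb[OF eV vV])
      also have "\<dots> = 0" by (simp add: ev)
      finally have "ip u v = b * ip v v"
        using ip_lin[OF u vV vV, of 1 "- b"] by (simp add: u'_def)
      then have bs: "ip u (e' N) * (1 / of_real s) = b"
        using s by (simp add: ipN'[OF u])
      have "u i z = lincomb (Suc N) (\<lambda>k. ip u (e' k)) e' i z" for i z
      proof -
        have "u i z = u' i z + b * v i z" by (simp add: u'_def)
        also have "u' i z = (\<Sum>k<N. ip u' (e k) * e k i z)" by (subst ex[OF u'V']) (simp add: lincomb_def)
        also have "\<dots> = (\<Sum>k<N. ip u (e' k) * e' k i z)"
          by (intro sum.cong refl) (simp add: u'e e'_def)
        also have "b * v i z = ip u (e' N) * e' N i z" unfolding bs[symmetric] e'N by simp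
        finally show ?thesis by (simp add: lincomb_def)
      qed
      then show ?thesis by blast
    qed
    then have "onb (Suc N) e'" unfolding onb_def using e'V o by blast
    then show ?thesis by blast
  qed
qed

section \<open>Perturbation of a Gram matrix\<close>

text \<open>At a zero of h continuity of f is enough: h is O(|x - t|), so (f - f t) h is o(|x -
  t|).\<close>

lemma has_derivative_mult_vanishing:
  fixes f h :: "'a::real_normed_vector \<Rightarrow> complex"
  assumes f: "isCont f t" and h: "(h has_derivative h') (at t)" "h t = 0"
  shows "((\<lambda>x. f x * h x) has_derivative (\<lambda>v. f t * h' v)) (at t)"
proof -
  obtain K where K: "K > 0" "\<And>v. norm (h' v) \<le> norm v * K"
    using bounded_linear.pos_bounded[OF has_derivative_bounded_linear[OF h(1)]] by blast
  have "((\<lambda>x. (f x - f t) * h x) has_derivative (\<lambda>v. 0)) (at t)"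
    unfolding has_derivative_at_alt
  proof (intro conjI allI impI)
    show "bounded_linear (\<lambda>v. 0 :: complex)" by (rule bounded_linear_zero)
    fix e :: real assume e: "e > 0"
    obtain d1 where d1: "d1 > 0" "\<And>y. norm (y - t) < d1 \<Longrightarrow> norm (h y - h t - h' (y - t)) \<le> 1 * norm (y - t)"
      using h(1) unfolding has_derivative_at_alt by (metis zero_less_one)
    have "e / (K + 1) > 0" using e K by simp
    then obtain d2 where d2: "d2 > 0" "\<And>y. dist y t < d2 \<Longrightarrow> dist (f y) (f t) < e / (K + 1)"
      using f unfolding continuous_at_eps_delta by blast
    show "\<exists>d>0. \<forall>y. norm (y - t) < d \<longrightarrow> norm ((f y - f t) * h y - (f t - f t) * h t - 0) \<le> e * norm (y - t)"
    proof (intro exI[of _ "min d1 d2"] conjI allI impI)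
      fix y assume y: "norm (y - t) < min d1 d2"
      have "norm (h y) \<le> norm (h y - h t - h' (y - t)) + norm (h' (y - t))"
        using norm_triangle_ineq[of "h y - h t - h' (y - t)" "h' (y - t)"] h(2) by simp
      also have "\<dots> \<le> (K + 1) * norm (y - t)" using d1(2)[of y] K(2)[of "y - t"] y by (simp add: algebra_simps)
      finally have 1: "norm (h y) \<le> (K + 1) * norm (y - t)" .
      have 2: "norm (f y - f t) \<le> e / (K + 1)" using d2(2)[of y] y by (simp add: dist_norm)
      have "norm (f y - f t) * norm (h y) \<le> e / (K + 1) * ((K + 1) * norm (y - t))"
        using e K by (intro mult_mono 1 2) auto
      also have "\<dots> = e * norm (y - t)" using K by simp
      finally show "norm ((f y - f t) * h y - (f t - f t) * h t - 0) \<le> e * norm (y - t)" by (simp add: norm_mult)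
    qed (use d1 d2 in auto)
  qed
  from has_derivative_add[OF this has_derivative_mult_right[OF h(1), of "f t"]]
  show ?thesis by (simp add: algebra_simps)
qed

text \<open>Read c as the solution of c (1 + h) = b with h vanishing at t. Differentiability is
  bootstrapped: c is bounded near t, because the small h can be absorbed; hence it is continuous at
  t; hence differentiable, because in c h only the vanishing factor has to be
  differentiated.\<close>

lemma gram_perturbation:
  fixes c b :: "nat \<Rightarrow> 'a::real_normed_vector \<Rightarrow> complex" and h :: "nat \<Rightarrow> nat \<Rightarrow> 'a \<Rightarrow> complex"
  assumes U: "open U" "t \<in> U"
    and eq: "\<And>\<tau> j. \<tau> \<in> U \<Longrightarrow> j < N \<Longrightarrow> c j \<tau> = b j \<tau> - (\<Sum>k<N. c k \<tau> * h k j \<tau>)"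
    and h: "\<And>j k. j < N \<Longrightarrow> k < N \<Longrightarrow> h k j differentiable (at t)" "\<And>j k. j < N \<Longrightarrow> k < N \<Longrightarrow> h k j t = 0"
    and b: "\<And>j. j < N \<Longrightarrow> b j differentiable (at t)" and j: "j < N"
  shows "c j differentiable (at t)"
    "dop \<kappa> v w (c j) t = dop \<kappa> v w (b j) t - (\<Sum>k<N. c k t * dop \<kappa> v w (h k j) t)"
proof -
  have hc: "isCont (h k j) t" if "j < N" "k < N" for j k
    using differentiable_imp_continuous_within[OF h(1)[OF that]] .
  have bc: "isCont (b j) t" if "j < N" for j
    using differentiable_imp_continuous_within[OF b[OF that]] .
  define C where "C \<tau> = (\<Sum>j<N. norm (c j \<tau>))" for \<tau>
  define Bs where "Bs \<tau> = (\<Sum>j<N. norm (b j \<tau>))" for \<tau>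
  define Hs where "Hs \<tau> = (\<Sum>k<N. \<Sum>j<N. norm (h k j \<tau>))" for \<tau>
  have C0: "0 \<le> C \<tau>" for \<tau> by (simp add: C_def sum_nonneg)
  have CB: "C \<tau> \<le> Bs \<tau> + C \<tau> * Hs \<tau>" if "\<tau> \<in> U" for \<tau>
  proof -
    have "C \<tau> \<le> (\<Sum>j<N. norm (b j \<tau>) + (\<Sum>k<N. norm (c k \<tau>) * norm (h k j \<tau>)))"
      unfolding C_def
    proof (rule sum_mono)
      fix j assume "j \<in> {..<N}"
      then have "norm (c j \<tau>) \<le> norm (b j \<tau>) + norm (\<Sum>k<N. c k \<tau> * h k j \<tau>)"
        using eq[OF that, of j] norm_triangle_ineq4 by auto
      also have "norm (\<Sum>k<N. c k \<tau> * h k j \<tau>) \<le> (\<Sum>k<N. norm (c k \<tau>) * norm (h k j \<tau>))"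
        by (rule order_trans[OF norm_sum]) (simp add: norm_mult)
      finally show "norm (c j \<tau>) \<le> norm (b j \<tau>) + (\<Sum>k<N. norm (c k \<tau>) * norm (h k j \<tau>))" by simp
    qed
    also have "\<dots> = Bs \<tau> + (\<Sum>k<N. norm (c k \<tau>) * (\<Sum>j<N. norm (h k j \<tau>)))"
      unfolding Bs_def sum.distrib sum_distrib_left by (subst sum.swap) simp
    also have "(\<Sum>k<N. norm (c k \<tau>) * (\<Sum>j<N. norm (h k j \<tau>))) \<le> (\<Sum>k<N. norm (c k \<tau>) * Hs \<tau>)"
    proof (rule sum_mono, rule mult_left_mono)
      fix k assume "k \<in> {..<N}"
      then show "(\<Sum>j<N. norm (h k j \<tau>)) \<le> Hs \<tau>"
        unfolding Hs_def by (intro member_le_sum) (auto intro: sum_nonneg)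
    qed simp
    also have "\<dots> = C \<tau> * Hs \<tau>" by (simp add: C_def sum_distrib_right)
    finally show ?thesis by simp
  qed
  have "isCont Hs t" unfolding Hs_def by (intro continuous_intros hc) auto
  moreover have "Hs t = 0" unfolding Hs_def using h(2) by simp
  ultimately have "(Hs \<longlongrightarrow> 0) (at t)" by (simp add: isCont_def)
  \<comment> \<open>Below 1/2 the term C * Hs takes at most half of C, which leaves C \<le> 2 *
    Bs.\<close>
  then have evH: "\<forall>\<^sub>F \<tau> in at t. Hs \<tau> < 1 / 2" by (rule order_tendstoD) simp
  have "isCont Bs t" unfolding Bs_def by (intro continuous_intros bc) auto
  then have "(Bs \<longlongrightarrow> Bs t) (at t)" by (simp add: isCont_def)
  then have evB: "\<forall>\<^sub>F \<tau> in at t. Bs \<tau> < Bs t + 1" by (rule order_tendstoD) simp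
  have evU: "\<forall>\<^sub>F \<tau> in at t. \<tau> \<in> U" by (rule eventually_at_in_open'[OF U])
  have evC: "\<forall>\<^sub>F \<tau> in at t. C \<tau> \<le> 2 * (Bs t + 1)"
    using evH evB evU
  proof eventually_elim
    case (elim \<tau>)
    have "C \<tau> * Hs \<tau> \<le> C \<tau> * (1 / 2)" using elim(1) C0 by (intro mult_left_mono) auto
    with CB[OF elim(3)] have "C \<tau> \<le> Bs \<tau> + C \<tau> * (1 / 2)" by linarith
    with elim(2) show ?case by argo
  qed
  have cb: "c j t = b j t" if "j < N" for j using eq[OF U(2) that] h(2)[OF that] by simp
  have ct: "isCont (c j) t" if j: "j < N" for j
  proof -
    have z: "((\<lambda>\<tau>. c k \<tau> * h k j \<tau>) \<longlongrightarrow> 0) (at t)" if k: "k < N" for k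
    proof (rule Lim_null_comparison)
      show "\<forall>\<^sub>F \<tau> in at t. norm (c k \<tau> * h k j \<tau>) \<le> 2 * (Bs t + 1) * norm (h k j \<tau>)"
        using evC
      proof eventually_elim
        case (elim \<tau>)
        have "norm (c k \<tau>) \<le> C \<tau>" unfolding C_def using k by (intro member_le_sum) auto
        then have "norm (c k \<tau>) \<le> 2 * (Bs t + 1)" using elim by simp
        then show ?case by (simp add: norm_mult mult_right_mono)
      qed
      have "((\<lambda>\<tau>. norm (h k j \<tau>)) \<longlongrightarrow> 0) (at t)"
        using hc[OF j k] h(2)[OF j k] tendsto_norm_zero by (fastforce simp: isCont_def)
      from tendsto_mult_right_zero[OF this] show "((\<lambda>\<tau>. 2 * (Bs t + 1) * norm (h k j \<tau>)) \<longlongrightarrow> 0) (at t)" .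
    qed
    have "((\<lambda>\<tau>. b j \<tau> - (\<Sum>k<N. c k \<tau> * h k j \<tau>)) \<longlongrightarrow> b j t - (\<Sum>k<N. 0)) (at t)"
      using bc[OF j] z by (intro tendsto_diff tendsto_sum) (auto simp: isCont_def)
    moreover have "\<forall>\<^sub>F \<tau> in at t. b j \<tau> - (\<Sum>k<N. c k \<tau> * h k j \<tau>) = c j \<tau>"
      using evU by eventually_elim (simp add: eq j)
    ultimately have "(c j \<longlongrightarrow> b j t) (at t)" using tendsto_cong by force
    then show ?thesis by (simp add: isCont_def cb[OF j])
  qed
  define D where "D v = frechet_derivative (b j) (at t) v - (\<Sum>k<N. c k t * frechet_derivative (h k j) (at t) v)" for v
  have "((\<lambda>\<tau>. b j \<tau> - (\<Sum>k<N. c k \<tau> * h k j \<tau>)) has_derivative D) (at t)"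
    unfolding D_def
    by (intro has_derivative_diff has_derivative_sum has_derivative_mult_vanishing)
      (use b h ct j in \<open>auto simp: frechet_derivative_works[symmetric]\<close>)
  then have d: "(c j has_derivative D) (at t)"
    by (rule has_derivative_transform_within_open[OF _ U]) (simp add: eq j)
  then show "c j differentiable (at t)" by (rule differentiableI)
  show "dop \<kappa> v w (c j) t = dop \<kappa> v w (b j) t - (\<Sum>k<N. c k t * dop \<kappa> v w (h k j) t)"
  proof -
    have "(\<Sum>k<N. c k t * dop \<kappa> v w (h k j) t) =
        ((\<Sum>k<N. c k t * frechet_derivative (h k j) (at t) v) + \<kappa> * (\<Sum>k<N. c k t * frechet_derivative (h k j) (at t) w)) / 2"
      unfolding dop_def sum_distrib_left sum.distrib[symmetric] sum_divide_distrib
      by (intro sum.cong refl) (simp add: algebra_simps)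
    then show ?thesis
      unfolding dop_def frechet_derivative_at[OF d, symmetric] D_def
      by (simp add: algebra_simps add_divide_distrib diff_divide_distrib)
  qed
qed

section \<open>Global sections\<close>

lemma norm_vector_scalar: "norm (c *s (v::complex^'n)) = cmod c * norm v"
  by (simp add: norm_vec_def norm_mult L2_set_right_distrib)

text \<open>Cauchy's estimate: around every point of the small ball a circle of radius r still lies
  in the ball of radius 2 r, which bounds the derivative by B / r.\<close>

lemma several_holomorphic_lipschitz:
  fixes f :: "complex^'n \<Rightarrow> complex"
  assumes f: "several_holomorphic_on f S" "open S" and r: "r > 0" "cball a (2 * r) \<subseteq> S"
    and B: "\<And>w. w \<in> cball a (2 * r) \<Longrightarrow> cmod (f w) \<le> B" and xy: "x \<in> cball a r" "y \<in> cball a r"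
  shows "cmod (f x - f y) \<le> B / r * norm (x - y)"
proof (rule differentiable_bound[of "cball a r" f "\<lambda>q. frechet_derivative f (at q)"])
  have "cmod (f a) \<le> B" by (rule B) (use r(1) in simp)
  then have B0: "0 \<le> B" using norm_ge_zero[of "f a"] by linarith
  fix q assume q: "q \<in> cball a r"
  then have qS: "q \<in> S" using r by auto
  show "(f has_derivative frechet_derivative f (at q)) (at q within cball a r)"
    using several_holomorphic_on_has_derivative[OF f(1) qS] has_derivative_at_withinI by blast
  show "onorm (frechet_derivative f (at q)) \<le> B / r"
  proof (rule onorm_bound)
    show "0 \<le> B / r" using B0 r(1) by simp
    fix v :: "complex^'n"
    show "norm (frechet_derivative f (at q) v) \<le> B / r * norm v"
    proof (cases "v = 0")
      case True
      then show ?thesis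
        using linear_0[OF has_derivative_linear[OF several_holomorphic_on_has_derivative[OF f(1) qS]]] by simp
    next
      case False
      \<comment> \<open>With this radius for z the points z v lie at distance r from 0, whatever the
        length of v.\<close>
      define \<rho> where "\<rho> = r / norm v"
      have \<rho>: "\<rho> > 0" using r(1) False by (simp add: \<rho>_def)
      have inb: "q + z *s v \<in> cball a (2 * r)" if "norm z \<le> \<rho>" for z
      proof -
        have "norm (z *s v) \<le> r" using mult_right_mono[OF that, of "norm v"] False by (simp add: norm_vector_scalar \<rho>_def)
        then show ?thesis using q dist_triangle[of a "q + z *s v" q] by (simp add: dist_norm)
      qed
      define E where "E x = of_real \<rho> * exp (2 * of_real pi * \<i> * of_real x)" for x
      have E: "norm (E x) = \<rho>" for x using \<rho> by (simp add: E_def norm_mult)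
      have E0: "E x \<noteq> 0" for x using E[of x] \<rho> by auto
      have "frechet_derivative f (at q) v = integral {0..1} (\<lambda>x. f (q + E x *s v) / E x)"
        unfolding E_def by (rule circle_integral_derivative[OF f(1) \<rho> _ f(2)]) (use inb r(2) in blast)
      also have "norm \<dots> \<le> (B / \<rho>) * (1 - 0)"
      proof (rule integral_bound)
        show "continuous_on {0..1} (\<lambda>x. f (q + E x *s v) / E x)"
          using inb[OF eq_refl[OF E]] r(2) E0 unfolding E_def
          by (intro continuous_on_divide continuous_on_compose2[OF several_holomorphic_on_continuous[OF f(1)]] continuous_intros) auto
        show "norm (f (q + E x *s v) / E x) \<le> B / \<rho>" for x
          using B[OF inb[OF eq_refl[OF E]]] \<rho> by (simp add: norm_divide E divide_right_mono)
      qed simp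
      finally show ?thesis using False r(1) by (simp add: \<rho>_def field_simps)
    qed
  qed
qed (use xy in auto)

lemma several_holomorphic_lin:
  assumes "several_holomorphic_on f S" "several_holomorphic_on h S"
  shows "several_holomorphic_on (\<lambda>w. a * f w + b * h w) S"
  unfolding several_holomorphic_on_def
proof
  fix p assume p: "p \<in> S"
  note d = several_holomorphic_on_has_derivative[OF assms(1) p] several_holomorphic_on_has_derivative[OF assms(2) p]
  have "((\<lambda>w. a * f w + b * h w) has_derivative
     (\<lambda>v. a * frechet_derivative f (at p) v + b * frechet_derivative h (at p) v)) (at p)"
    by (intro has_derivative_add has_derivative_mult_right d)
  then show "\<exists>f'. ((\<lambda>w. a * f w + b * h w) has_derivative f') (at p) \<and> (\<forall>c v. f' (c *s v) = c * f' v)"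
    by (intro exI conjI allI, assumption)
      (simp add: several_holomorphic_on_derivative_scale[OF assms(1) p] several_holomorphic_on_derivative_scale[OF assms(2) p] algebra_simps)
qed

context family
begin

lemma normsq_eq:
  assumes u: "u \<in> H0" and t: "t \<in> U" and z: "z \<in> W i"
  shows "pointwise_normsq W (\<phi> t) u z = (cmod (u i z))\<^sup>2 * exp (- \<phi> t i z)"
proof -
  have "complex_of_real (pointwise_normsq W (\<phi> t) u z) = complex_of_real ((cmod (u i z))\<^sup>2 * exp (- \<phi> t i z))"
    using PI_nonneg(2)[OF u t, of z] PI_eq[OF u u t z] by (simp add: complex_norm_square del: of_real_power)
  then show ?thesis by (simp only: of_real_eq_iff)
qed

lemma normsq_continuous: "u \<in> H0 \<Longrightarrow> t \<in> U \<Longrightarrow> continuous_on UNIV (pointwise_normsq W (\<phi> t) u)"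
  using continuous_on_Re[OF psm_continuous[OF psm_PI, of u u t]] PI_nonneg(2)[of u t] by simp

lemma sections_lin: "u \<in> H0 \<Longrightarrow> v \<in> H0 \<Longrightarrow> (\<lambda>i z. a * u i z + b * v i z) \<in> H0"
proof -
  assume "u \<in> H0" "v \<in> H0"
  then have u: "\<And>i. manifold_holomorphic_on atlas (u i) (W i)"
      "\<And>i j z. z \<in> W i \<inter> W j \<Longrightarrow> u i z = g i j z * u j z" "\<And>i z. z \<notin> W i \<Longrightarrow> u i z = 0"
    and v: "\<And>i. manifold_holomorphic_on atlas (v i) (W i)"
      "\<And>i j z. z \<in> W i \<inter> W j \<Longrightarrow> v i z = g i j z * v j z" "\<And>i z. z \<notin> W i \<Longrightarrow> v i z = 0"
    unfolding global_sections_def by blast+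
  have "manifold_holomorphic_on atlas (\<lambda>z. a * u i z + b * v i z) (W i)" for i
    using u(1)[of i] v(1)[of i] unfolding manifold_holomorphic_on_def by (metis several_holomorphic_lin)
  moreover have "a * u i z + b * v i z = g i j z * (a * u j z + b * v j z)" if "z \<in> W i \<inter> W j" for i j z
    by (simp only: u(2)[OF that] v(2)[OF that]) (simp only: algebra_simps)
  moreover have "a * u i z + b * v i z = 0" if "z \<notin> W i" for i z
    by (simp only: u(3)[OF that] v(3)[OF that]) simp
  ultimately show ?thesis unfolding global_sections_def by blast
qed

lemma sections_zero: "(\<lambda>_ _. 0) \<in> H0"
  unfolding global_sections_def manifold_holomorphic_on_def several_holomorphic_on_def
  by (auto intro!: exI[of _ "\<lambda>_. 0"])

text \<open>A Schwarz-type lemma: a section that vanishes on a fine net is small near p compared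
  with any bound of its norm over Z, because that bound controls its Lipschitz constant. The net is
  chosen before the section.\<close>

lemma section_decay:
  assumes t: "t \<in> U"
  shows "\<exists>A Y i. open A \<and> p \<in> A \<and> finite Y \<and> (\<forall>u\<in>H0. (\<forall>y\<in>Y. u i y = 0) \<longrightarrow>
     (\<forall>S. (\<forall>z. pointwise_normsq W (\<phi> t) u z \<le> S) \<longrightarrow> (\<forall>z\<in>A. pointwise_normsq W (\<phi> t) u z \<le> S / 4)))"
proof -
  obtain c where c: "c \<in> atlas" "p \<in> fst c" by (rule chart_exists)
  obtain i where i: "p \<in> W i" by (rule W_exists)
  interpret metric atlas W g "\<phi> t" by (rule metric_\<phi>[OF t])
  define S0 where "S0 = chart_image c (W i)"
  define a where "a = snd c p"
  have S0: "open S0" "a \<in> S0" unfolding S0_def a_def by (rule open_chart_image[OF c(1) open_W], rule chart_in_image[OF c(2) i])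
  obtain R where R: "R > 0" "cball a R \<subseteq> S0" using S0 open_contains_cball by blast
  define r where "r = R / 2"
  have r: "r > 0" "cball a (2 * r) \<subseteq> S0" using R by (auto simp: r_def)
  define f where "f w = \<phi> t i (chart_inv c w)" for w
  have "continuous_on (cball a (2 * r)) f"
    unfolding f_def by (rule continuous_on_subset[OF Cinf_on_continuous[OF metric_Cinf[OF c(1)]]]) (use r(2) S0_def in blast)
  then have "bounded (f ` cball a (2 * r))" by (intro compact_imp_bounded compact_continuous_image compact_cball)
  then obtain M where M: "\<And>w. w \<in> cball a (2 * r) \<Longrightarrow> \<bar>f w\<bar> \<le> M" unfolding bounded_iff by (metis imageI real_norm_def)
  \<comment> \<open>Bounding |h|^2 by the weighted norm costs a factor exp M and returning to the
    weighted norm another; the square of exp (- M) / 2 absorbs both and leaves 1/4.\<close>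
  define \<delta> where "\<delta> = r * exp (- M) / 2"
  have \<delta>: "\<delta> > 0" using r(1) by (simp add: \<delta>_def)
  obtain Y0 where Y0: "Y0 \<subseteq> cball a r" "finite Y0" "cball a r \<subseteq> (\<Union>y\<in>Y0. ball y \<delta>)"
    by (rule compactE_image[OF compact_cball[of a r], of "cball a r" "\<lambda>y. ball y \<delta>"]) (use \<delta> in auto)
  define A where "A = fst c \<inter> snd c -` ball a r"
  have A: "open A" "p \<in> A"
    unfolding A_def using continuous_open_preimage[OF continuous_chart[OF c(1)] open_chart[OF c(1)] open_ball] c r(1)
    by (auto simp: a_def)
  have main: "pointwise_normsq W (\<phi> t) u z \<le> S / 4"
    if u: "u \<in> H0" "\<forall>y\<in>chart_inv c ` Y0. u i y = 0" and S: "\<forall>z. pointwise_normsq W (\<phi> t) u z \<le> S" and z: "z \<in> A" for u S z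
  proof -
    define h where "h w = u i (chart_inv c w)" for w
    have h: "several_holomorphic_on h S0" unfolding h_def S0_def by (rule section_holomorphic[OF u(1) c(1)])
    have n: "pointwise_normsq W (\<phi> t) u (chart_inv c w) = (cmod (h w))\<^sup>2 * exp (- f w)" if "w \<in> cball a (2 * r)" for w
    proof -
      have "chart_inv c w \<in> W i" using chart_imageD(2)[OF c(1)] that r(2) S0_def by blast
      from normsq_eq[OF u(1) t this] show ?thesis by (simp add: h_def f_def)
    qed
    have S0': "0 \<le> S"
      using S[rule_format, of z] by (rule order_trans[rotated]) (simp add: pointwise_normsq_def Let_def)
    define B where "B = sqrt (S * exp M)"
    have B2: "B\<^sup>2 = S * exp M" using S0' by (simp add: B_def)
    have B: "cmod (h w) \<le> B" if w: "w \<in> cball a (2 * r)" for w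
    proof -
      have "(cmod (h w))\<^sup>2 = ((cmod (h w))\<^sup>2 * exp (- f w)) * exp (f w)" by (simp add: exp_minus)
      also have "\<dots> \<le> S * exp M"
        using S[rule_format, of "chart_inv c w"] M[OF w] S0' unfolding n[OF w] by (intro mult_mono) auto
      finally show ?thesis unfolding B_def by (rule real_le_rsqrt)
    qed
    have B0: "0 \<le> B" using S0' by (simp add: B_def)
    define x where "x = snd c z"
    have x: "x \<in> ball a r" "chart_inv c x = z" using z c(1) by (auto simp: A_def x_def)
    then obtain y where y: "y \<in> Y0" "norm (x - y) < \<delta>" using Y0(3) by (force simp: dist_norm norm_minus_commute)
    have xr: "x \<in> cball a (2 * r)" using x(1) r(1) by auto
    have "cmod (h x - h y) \<le> B / r * norm (x - y)"
      by (rule several_holomorphic_lipschitz[OF h S0(1) r B]) (use x y Y0 in auto)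
    also have "\<dots> \<le> B / r * \<delta>" using y(2) B0 r(1) by (intro mult_left_mono) auto
    also have "\<dots> = B * exp (- M) / 2" using r(1) by (simp add: \<delta>_def)
    finally have "cmod (h x) \<le> B * exp (- M) / 2" using u(2) y(1) by (simp add: h_def)
    then have "(cmod (h x))\<^sup>2 \<le> (B * exp (- M) / 2)\<^sup>2" by (intro power_mono) auto
    also have "\<dots> = B\<^sup>2 * (exp (- M) * exp (- M)) / 4" by (simp add: power2_eq_square)
    also have "\<dots> = S * exp (- M) / 4" unfolding B2 by (simp add: exp_minus)
    finally have 1: "(cmod (h x))\<^sup>2 \<le> S * exp (- M) / 4" .
    have "pointwise_normsq W (\<phi> t) u z = (cmod (h x))\<^sup>2 * exp (- f x)" using n[OF xr] x(2) by simp
    also have "\<dots> \<le> (S * exp (- M) / 4) * exp M"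
      using 1 M[OF xr] S0' by (intro mult_mono) auto
    also have "\<dots> = S / 4" by (simp add: exp_minus)
    finally show ?thesis .
  qed
  show ?thesis
    by (rule exI[of _ A], rule exI[of _ "chart_inv c ` Y0"], rule exI[of _ i]) (use A Y0(2) main in blast)
qed

text \<open>At the maximum of its norm a section vanishing on all the nets satisfies max \<le> max /
  4, so it is zero. Evaluation at finitely many points is thus injective, which is the finite
  dimension of the space of sections.\<close>

lemma finite_determining_set:
  assumes t: "t \<in> U"
  obtains P where "finite P" "\<And>u. u \<in> H0 \<Longrightarrow> (\<And>x. x \<in> P \<Longrightarrow> u (fst x) (snd x) = 0) \<Longrightarrow> u = (\<lambda>_ _. 0)"
proof -
  obtain A Y i where AY: "\<And>p. open (A p)" "\<And>p. p \<in> A p" "\<And>p. finite (Y p)"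
    "\<And>p u S z. u \<in> H0 \<Longrightarrow> \<forall>y\<in>Y p. u (i p) y = 0 \<Longrightarrow> \<forall>z. pointwise_normsq W (\<phi> t) u z \<le> S \<Longrightarrow> z \<in> A p \<Longrightarrow> pointwise_normsq W (\<phi> t) u z \<le> S / 4"
    using section_decay[OF t] by metis
  obtain Q where Q: "finite Q" "UNIV \<subseteq> (\<Union>p\<in>Q. A p)"
    by (rule compactE_image[OF compact_space, of UNIV A]) (use AY(1,2) in auto)
  define P where "P = (\<Union>p\<in>Q. {i p} \<times> Y p)"
  have "finite P" unfolding P_def using Q(1) AY(3) by auto
  moreover have "u = (\<lambda>_ _. 0)" if u: "u \<in> H0" and z: "\<And>x. x \<in> P \<Longrightarrow> u (fst x) (snd x) = 0" for u
  proof -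
    let ?n = "pointwise_normsq W (\<phi> t) u"
    have n0: "0 \<le> ?n z" for z by (simp add: pointwise_normsq_def Let_def)
    obtain z0 where z0: "\<And>z. ?n z \<le> ?n z0"
      using continuous_attains_sup[OF compact_space _ normsq_continuous[OF u t]] by auto
    obtain p where p: "p \<in> Q" "z0 \<in> A p" using Q(2) by blast
    have "\<forall>y\<in>Y p. u (i p) y = 0"
    proof
      fix y assume "y \<in> Y p"
      then have "(i p, y) \<in> P" using p(1) by (auto simp: P_def)
      from z[OF this] show "u (i p) y = 0" by simp
    qed
    from AY(4)[OF u this _ p(2), of "?n z0"] z0 have "?n z0 \<le> ?n z0 / 4" by blast
    then have nz: "?n z = 0" for z using n0[of z0] n0[of z] z0[of z] by simp
    have "u j z = 0" for j z
    proof (cases "z \<in> W j")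
      case True
      then show ?thesis using normsq_eq[OF u t True] nz[of z] by simp
    next
      case False
      then show ?thesis using u unfolding global_sections_def by blast
    qed
    then show ?thesis by blast
  qed
  ultimately show ?thesis using that by blast
qed

section \<open>The inner product on the space of sections\<close>

lemma L2_inner_eq: "L2_inner atlas W (\<phi> t) u v = integral\<^sup>L (volt t) (PI u v t)"
  by (simp add: L2_inner_def)

lemma integrable_PI: "u \<in> H0 \<Longrightarrow> v \<in> H0 \<Longrightarrow> t \<in> U \<Longrightarrow> integrable (volt t) (PI u v t)"
  by (rule integrable_continuous_vol[OF _ psm_continuous[OF psm_PI]])

text \<open>Definiteness of the inner product rests on this: a continuous norm that is zero almost
  everywhere is zero everywhere.\<close>

lemma vol_open_pos:
  assumes t: "t \<in> U" and A: "open A" "A \<noteq> {}"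
  shows "emeasure (volt t) A \<noteq> 0"
proof
  assume 0: "emeasure (volt t) A = 0"
  interpret metric atlas W g "\<phi> t" by (rule metric_\<phi>[OF t])
  obtain z where z: "z \<in> A" using A(2) by blast
  obtain c where c: "c \<in> atlas" "z \<in> fst c" by (rule chart_exists)
  define A' where "A' = A \<inter> fst c"
  have A': "open A'" "A' \<subseteq> fst c" "z \<in> A'" using A z c open_chart[OF c(1)] by (auto simp: A'_def)
  have "emeasure (volt t) A' \<le> emeasure (volt t) A" by (rule emeasure_mono) (use A in \<open>auto simp: A'_def sets_vol\<close>)
  then have "nu c A' = 0" using 0 emeasure_vol[OF c(1) _ A'(2)] A'(1) by simp
  then have "AE w in lborel. ennreal (indicator (chart_image c A') w * volume_density W (\<phi> t) c w) = 0"
    unfolding nu_def using dens_borel[OF c(1), of A'] A'(1)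
    by (subst nn_integral_0_iff_AE[symmetric]) (auto simp: indicator_def if_distrib cong: if_cong intro!: nn_integral_cong elim!: back_subst[of "\<lambda>x. x = 0"])
  then have "AE w in lborel. w \<notin> chart_image c A'"
  proof eventually_elim
    case (elim w)
    show ?case
    proof
      assume w: "w \<in> chart_image c A'"
      have "0 < volume_density W (\<phi> t) c w" by (rule dens_pos[OF c(1)]) (use w chart_image_subset in blast)
      with elim w show False by simp
    qed
  qed
  then have "chart_image c A' \<in> null_sets lborel"
    using borel_chart_image[OF c(1), of A'] A'(1) by (subst AE_iff_null_sets) auto
  then have "negligible (chart_image c A')" by (simp add: negligible_iff_null_sets null_sets_completionI)
  moreover have "open (chart_image c A')" "chart_image c A' \<noteq> {}"
    using open_chart_image[OF c(1) A'(1)] chart_in_image[OF c(2) A'(3)] by auto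
  ultimately show False using open_not_negligible by blast
qed

lemma hermitian_space_sections:
  assumes t: "t \<in> U"
  shows "hermitian_space H0 (L2_inner atlas W (\<phi> t))"
proof
  show "(\<lambda>_ _. 0) \<in> H0" by (rule sections_zero)
  show "(\<lambda>i z. a * u i z + b * v i z) \<in> H0" if "u \<in> H0" "v \<in> H0" for u v a b by (rule sections_lin[OF that])
  show "L2_inner atlas W (\<phi> t) (\<lambda>i z. a * u i z + b * v i z) w = a * L2_inner atlas W (\<phi> t) u w + b * L2_inner atlas W (\<phi> t) v w"
    if "u \<in> H0" "v \<in> H0" "w \<in> H0" for u v w a b
  proof -
    have "PI (\<lambda>i z. a * u i z + b * v i z) w t = (\<lambda>z. a * PI u w t z + b * PI v w t z)"
      by (rule ext) (simp add: pointwise_inner_def Let_def algebra_simps)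
    then show ?thesis unfolding L2_inner_eq using integrable_PI[OF that(1,3) t] integrable_PI[OF that(2,3) t] by simp
  qed
  show "L2_inner atlas W (\<phi> t) v u = cnj (L2_inner atlas W (\<phi> t) u v)" if "u \<in> H0" "v \<in> H0" for u v
  proof -
    have "PI v u t = (\<lambda>z. cnj (PI u v t z))" by (rule ext) (simp add: pointwise_inner_def Let_def)
    then show ?thesis unfolding L2_inner_eq by (simp only: integral_cnj'[OF integrable_PI[OF that t]])
  qed
  fix u assume u: "u \<in> H0"
  have eq: "L2_inner atlas W (\<phi> t) u u = complex_of_real (LINT z|volt t. pointwise_normsq W (\<phi> t) u z)"
    unfolding L2_inner_eq PI_nonneg(2)[OF u t] by (rule integral_complex_of_real)
  have n0: "0 \<le> pointwise_normsq W (\<phi> t) u z" for z by (simp add: pointwise_normsq_def Let_def)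
  show "0 \<le> L2_inner atlas W (\<phi> t) u u" unfolding eq using n0 by (simp add: complex_nonneg_iff)
  assume "L2_inner atlas W (\<phi> t) u u = 0"
  then have i0: "(LINT z|volt t. pointwise_normsq W (\<phi> t) u z) = 0" unfolding eq by simp
  interpret metric atlas W g "\<phi> t" by (rule metric_\<phi>[OF t])
  have int: "integrable (volt t) (pointwise_normsq W (\<phi> t) u)"
    using integrable_Re[OF integrable_PI[OF u u t]] PI_nonneg(2)[OF u t] by simp
  have "AE z in volt t. pointwise_normsq W (\<phi> t) u z = 0"
    using integral_nonneg_eq_0_iff_AE[OF int] n0 i0 by simp
  then have ae: "AE z in volt t. z \<notin> {z. 0 < pointwise_normsq W (\<phi> t) u z}" by eventually_elim simp
  have o: "open {z. 0 < pointwise_normsq W (\<phi> t) u z}"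
    by (rule open_Collect_less[OF continuous_on_const normsq_continuous[OF u t]])
  have "{z. 0 < pointwise_normsq W (\<phi> t) u z} \<in> null_sets (volt t)"
    using ae o by (subst AE_iff_null_sets) (auto simp: sets_vol)
  then have "{z. 0 < pointwise_normsq W (\<phi> t) u z} = {}"
    using vol_open_pos[OF t o] by blast
  then have nz: "pointwise_normsq W (\<phi> t) u z = 0" for z using n0[of z] by (metis (mono_tags) empty_Collect_eq order_le_less)
  have "u j z = 0" for j z
  proof (cases "z \<in> W j")
    case True
    then show ?thesis using normsq_eq[OF u t True] nz[of z] by simp
  next
    case False
    then show ?thesis using u unfolding global_sections_def by blast
  qed
  then show "u = (\<lambda>_ _. 0)" by blast
qed

section \<open>The Chern curvature\<close>

abbreviation "L2 \<equiv> (\<lambda>t. L2_inner atlas W (\<phi> t))"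

definition dL2 :: "complex \<Rightarrow> ('i \<Rightarrow> 'z \<Rightarrow> complex) \<Rightarrow> ('i \<Rightarrow> 'z \<Rightarrow> complex) \<Rightarrow> complex" where
  "dL2 t u v = dop (- \<i>) 1 \<i> (\<lambda>\<tau>. L2 \<tau> u v) t"

lemma L2_differentiable: "u \<in> H0 \<Longrightarrow> v \<in> H0 \<Longrightarrow> t \<in> U \<Longrightarrow> (\<lambda>\<tau>. L2 \<tau> u v) differentiable (at t)"
  unfolding L2_inner_eq by (rule first_variation(1)[OF psm_PI])

lemma dL2_eq: "u \<in> H0 \<Longrightarrow> v \<in> H0 \<Longrightarrow> t \<in> U \<Longrightarrow> dL2 t u v = integral\<^sup>L (volt t) (FT (PI u v) t)"
  unfolding dL2_def L2_inner_eq by (rule variation[OF psm_PI])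

lemma dL2_differentiable:
  assumes "u \<in> H0" "v \<in> H0" "t \<in> U"
  shows "(\<lambda>\<tau>. dL2 \<tau> u v) differentiable (at t)"
  using differentiable_cong_open[OF open_U assms(3), of "\<lambda>\<tau>. dL2 \<tau> u v" "\<lambda>\<tau>. integral\<^sup>L (volt \<tau>) (FT (PI u v) \<tau>)"]
    dL2_eq[OF assms(1,2)] first_variation(1)[OF psm_FT[OF psm_PI[OF assms(1,2)]] assms(3)] by blast

lemma dL2_lincomb:
  assumes e: "\<And>k. k < N \<Longrightarrow> e k \<in> H0" and u: "u \<in> H0" and t: "t \<in> U"
  shows "dL2 t u (lincomb N a e) = (\<Sum>k<N. cnj (a k) * dL2 t u (e k))"
proof -
  have "dL2 t u (lincomb N a e) = dop (- \<i>) 1 \<i> (\<lambda>\<tau>. \<Sum>k<N. cnj (a k) * L2 \<tau> u (e k)) t"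
    unfolding dL2_def
    by (rule dop_cong[OF open_U t]) (rule hermitian_space.ip_lincomb_right[OF hermitian_space_sections e u])
  also have "\<dots> = (\<Sum>k<N. dop (- \<i>) 1 \<i> (\<lambda>\<tau>. cnj (a k) * L2 \<tau> u (e k)) t)"
    by (rule dop_sum) (auto intro!: differentiable_mult L2_differentiable[OF u e t])
  also have "\<dots> = (\<Sum>k<N. cnj (a k) * dL2 t u (e k))"
    unfolding dL2_def by (intro sum.cong refl dop_cmult L2_differentiable[OF u e t]) simp
  finally show ?thesis .
qed

lemma onb_sections:
  assumes t: "t \<in> U"
  obtains N e where "hermitian_space.onb H0 (L2 t) N e"
proof -
  obtain P where "finite P" "\<And>u. u \<in> H0 \<Longrightarrow> (\<And>x. x \<in> P \<Longrightarrow> u (fst x) (snd x) = 0) \<Longrightarrow> u = (\<lambda>_ _. 0)"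
    by (rule finite_determining_set[OF t]) blast
  from onb_exists[OF this(1) hermitian_space_sections[OF t] this(2)] show ?thesis using that by blast
qed

text \<open>The \<open>THE\<close> in \<open>chern_D1\<close> is resolved by \<open>riesz\<close>,
  applied to the t-derivative of the product of u and v as a function of v, which is conjugate
  linear.\<close>

lemma chern_D1_const:
  assumes u: "u \<in> H0" and t: "t \<in> U"
  shows "chern_D1 atlas W g \<phi> (\<lambda>_. u) t \<in> H0"
    "v \<in> H0 \<Longrightarrow> dL2 t u v = L2 t (chern_D1 atlas W g \<phi> (\<lambda>_. u) t) v"
proof -
  interpret H: hermitian_space H0 "L2 t" by (rule hermitian_space_sections[OF t])
  obtain N e where e: "H.onb N e" by (rule onb_sections[OF t])
  have eH: "e k \<in> H0" if "k < N" for k using e that by (simp add: H.onb_def)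
  have "\<exists>!w. w \<in> H0 \<and> (\<forall>v\<in>H0. dL2 t u v = L2 t w v)"
    by (rule H.riesz[OF e]) (rule dL2_lincomb[OF eH u t])
  from theI'[OF this]
  show "chern_D1 atlas W g \<phi> (\<lambda>_. u) t \<in> H0"
    "v \<in> H0 \<Longrightarrow> dL2 t u v = L2 t (chern_D1 atlas W g \<phi> (\<lambda>_. u) t) v"
    unfolding chern_D1_def wirtinger_eq_dop dL2_def by blast+
qed

text \<open>For the constant extension D''u = 0, so the term D'D'' of the curvature is D' of the
  zero section.\<close>

lemma chern_D1_zero:
  assumes t: "t \<in> U"
  shows "chern_D1 atlas W g \<phi> (\<lambda>_ _ _. 0) t = (\<lambda>_ _. 0)"
proof -
  interpret H: hermitian_space H0 "L2 t" by (rule hermitian_space_sections[OF t])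
  have z: "dL2 t (\<lambda>_ _. 0) v = 0" for v
  proof -
    have "L2 \<tau> (\<lambda>_ _. 0) v = 0" for \<tau> unfolding L2_inner_eq pointwise_inner_def by (simp add: Let_def)
    then show ?thesis by (simp add: dL2_def)
  qed
  have "L2 t (chern_D1 atlas W g \<phi> (\<lambda>_ _ _. 0) t) (chern_D1 atlas W g \<phi> (\<lambda>_ _ _. 0) t) = 0"
    using chern_D1_const[OF sections_zero t] z by metis
  then show ?thesis using H.ip_definite chern_D1_const(1)[OF sections_zero t] by blast
qed

text \<open>With a basis orthonormal at t, the Gram matrix at \<tau> is the identity plus h, and h
  vanishes at t. The coefficients a of D'u then solve the system of
  \<open>gram_perturbation\<close>, which gives both the differentiability of D'u at t and its dbar
  derivative, that is, the curvature.\<close>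

lemma curvature_estimate:
  assumes u: "u \<in> H0" and t: "t \<in> U"
  shows "L2 t (chern_curvature atlas W g \<phi> t u) u
    \<le> complex_of_real (real (CARD('n) + 1) * (LINT z|volt t. pointwise_normsq W (\<phi> t) u z * c_phi atlas W \<phi> \<psi> t z))"
proof -
  interpret H: hermitian_space H0 "L2 t" by (rule hermitian_space_sections[OF t])
  obtain N e where e: "H.onb N e" by (rule onb_sections[OF t])
  have eH: "e k \<in> H0" if "k < N" for k using e that by (simp add: H.onb_def)
  have eo: "L2 t (e j) (e k) = (if j = k then 1 else 0)" if "j < N" "k < N" for j k using e that by (simp add: H.onb_def)
  have ex: "v = lincomb N (\<lambda>k. L2 t v (e k)) e" if "v \<in> H0" for v using e that unfolding H.onb_def by blast
  define D where "D \<tau> = chern_D1 atlas W g \<phi> (\<lambda>_. u) \<tau>" for \<tau>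
  have D: "D \<tau> \<in> H0" "\<And>v. v \<in> H0 \<Longrightarrow> dL2 \<tau> u v = L2 \<tau> (D \<tau>) v" if "\<tau> \<in> U" for \<tau>
    unfolding D_def by (rule chern_D1_const[OF u that], rule chern_D1_const(2)[OF u that])
  define a where "a k \<tau> = L2 t (D \<tau>) (e k)" for k \<tau>
  define b where "b j \<tau> = dL2 \<tau> u (e j)" for j \<tau>
  define h where "h k j \<tau> = L2 \<tau> (e k) (e j) - (if k = j then 1 else 0)" for k j \<tau>
  have Da: "D \<tau> = lincomb N (\<lambda>k. a k \<tau>) e" if "\<tau> \<in> U" for \<tau> unfolding a_def by (rule ex[OF D(1)[OF that]])
  have eq: "a j \<tau> = b j \<tau> - (\<Sum>k<N. a k \<tau> * h k j \<tau>)" if \<tau>: "\<tau> \<in> U" and j: "j < N" for \<tau> j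
  proof -
    have "b j \<tau> = L2 \<tau> (lincomb N (\<lambda>k. a k \<tau>) e) (e j)"
      unfolding b_def using D(2)[OF \<tau> eH[OF j]] Da[OF \<tau>] by simp
    also have "\<dots> = (\<Sum>k<N. a k \<tau> * L2 \<tau> (e k) (e j))"
      by (rule hermitian_space.ip_lincomb[OF hermitian_space_sections[OF \<tau>] eH eH[OF j]])
    also have "\<dots> = (\<Sum>k<N. a k \<tau> * h k j \<tau>) + (\<Sum>k<N. if k = j then a j \<tau> else 0)"
      unfolding sum.distrib[symmetric] by (intro sum.cong refl) (simp add: h_def algebra_simps)
    finally show ?thesis using j by simp
  qed
  have hd: "h k j differentiable (at t)" if "j < N" "k < N" for j k
    unfolding h_def[abs_def] using L2_differentiable[OF eH[OF that(2)] eH[OF that(1)] t] by (intro differentiable_diff) auto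
  have h0: "h k j t = 0" if "j < N" "k < N" for j k by (simp add: h_def eo that)
  have bd: "b j differentiable (at t)" if "j < N" for j unfolding b_def by (rule dL2_differentiable[OF u eH[OF that] t])
  note gp = gram_perturbation[OF open_U t eq hd h0 bd]
  define \<gamma> where "\<gamma> k = dop \<i> 1 \<i> (a k) t" for k
  have curv: "chern_curvature atlas W g \<phi> t u = lincomb N (\<lambda>k. - \<gamma> k) e"
  proof -
    have c0: "chern_D2 (\<lambda>_. u) = (\<lambda>_ _ _. 0)" by (simp add: chern_D2_def fun_eq_iff wirtinger_bar_eq_dop)
    have "chern_D2 (chern_D1 atlas W g \<phi> (\<lambda>_. u)) t i z = (\<Sum>k<N. \<gamma> k * e k i z)" for i z
    proof -
      have "chern_D2 (chern_D1 atlas W g \<phi> (\<lambda>_. u)) t i z = dop \<i> 1 \<i> (\<lambda>\<tau>. \<Sum>k<N. a k \<tau> * e k i z) t"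
        unfolding chern_D2_def wirtinger_bar_eq_dop D_def[symmetric]
        by (rule dop_cong[OF open_U t]) (simp add: Da lincomb_def)
      also have "\<dots> = (\<Sum>k<N. dop \<i> 1 \<i> (\<lambda>\<tau>. a k \<tau> * e k i z) t)"
        using gp(1) by (intro dop_sum) auto
      also have "\<dots> = (\<Sum>k<N. \<gamma> k * e k i z)"
        unfolding \<gamma>_def using gp(1) by (intro sum.cong refl) (simp add: dop_mult)
      finally show ?thesis .
    qed
    then show ?thesis
      unfolding chern_curvature_def Let_def c0 chern_D1_zero[OF t] by (simp add: lincomb_def fun_eq_iff sum_negf)
  qed
  define w where "w = D t"
  have w: "w \<in> H0" unfolding w_def by (rule D(1)[OF t])
  \<comment> \<open>The mixed derivative of the squared norm of u, its first derivative replaced by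
    the horizontal expression.\<close>
  define K where "K = dop \<i> 1 \<i> (\<lambda>\<tau>. integral\<^sup>L (volt \<tau>) (FT (PI u u) \<tau>)) t"
  have K: "K = (\<Sum>j<N. dop \<i> 1 \<i> (b j) t * L2 t (e j) u)"
  proof -
    have "K = dop \<i> 1 \<i> (\<lambda>\<tau>. \<Sum>j<N. b j \<tau> * L2 t (e j) u) t"
      unfolding K_def
    proof (rule dop_cong[OF open_U t])
      fix \<tau> assume \<tau>: "\<tau> \<in> U"
      have "integral\<^sup>L (volt \<tau>) (FT (PI u u) \<tau>) = dL2 \<tau> u (lincomb N (\<lambda>k. L2 t u (e k)) e)"
        using dL2_eq[OF u u \<tau>] ex[OF u] by simp
      also have "\<dots> = (\<Sum>j<N. b j \<tau> * L2 t (e j) u)"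
        by (rule trans[OF dL2_lincomb[OF eH u \<tau>]], assumption, unfold b_def, intro sum.cong refl) (simp add: H.ip_cnj[OF u eH] mult.commute)
      finally show "integral\<^sup>L (volt \<tau>) (FT (PI u u) \<tau>) = (\<Sum>j<N. b j \<tau> * L2 t (e j) u)" .
    qed
    also have "\<dots> = (\<Sum>j<N. dop \<i> 1 \<i> (\<lambda>\<tau>. b j \<tau> * L2 t (e j) u) t)" using bd by (intro dop_sum) auto
    also have "\<dots> = (\<Sum>j<N. dop \<i> 1 \<i> (b j) t * L2 t (e j) u)" using bd by (intro sum.cong refl) (simp add: dop_mult)
    finally show ?thesis .
  qed
  \<comment> \<open>The squared norm of D'u is the dbar derivative at t of the product of D'u,
    frozen at t, with u; expanding both in the basis leaves only derivatives of the Gram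
    matrix.\<close>
  have ww: "L2 t w w = (\<Sum>j<N. \<Sum>k<N. a k t * dop \<i> 1 \<i> (h k j) t * L2 t (e j) u)"
  proof -
    have "L2 t w w = cnj (L2 t w w)" by (rule H.ip_cnj[OF w w])
    also have "\<dots> = cnj (dL2 t u w)" using D(2)[OF t w] by (simp add: w_def)
    also have "\<dots> = dop \<i> 1 \<i> (\<lambda>\<tau>. cnj (L2 \<tau> u w)) t"
      unfolding dL2_def using dop_cnj[OF L2_differentiable[OF u w t], of \<i>] by simp
    also have "\<dots> = dop \<i> 1 \<i> (\<lambda>\<tau>. \<Sum>j<N. \<Sum>k<N. a k t * L2 t (e j) u * L2 \<tau> (e k) (e j)) t"
    proof (rule dop_cong[OF open_U t])
      fix \<tau> assume \<tau>: "\<tau> \<in> U"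
      interpret H\<tau>: hermitian_space H0 "L2 \<tau>" by (rule hermitian_space_sections[OF \<tau>])
      have "cnj (L2 \<tau> u w) = L2 \<tau> w u" by (rule H\<tau>.ip_cnj[OF u w, symmetric])
      also have "\<dots> = (\<Sum>k<N. a k t * L2 \<tau> (e k) u)"
        unfolding w_def Da[OF t] by (rule H\<tau>.ip_lincomb[OF eH u])
      also have "\<dots> = (\<Sum>k<N. \<Sum>j<N. a k t * L2 t (e j) u * L2 \<tau> (e k) (e j))"
      proof (rule sum.cong[OF refl])
        fix k assume k: "k \<in> {..<N}"
        have "L2 \<tau> (e k) u = L2 \<tau> (e k) (lincomb N (\<lambda>j. L2 t u (e j)) e)" using ex[OF u] by simp
        also have "\<dots> = (\<Sum>j<N. L2 t (e j) u * L2 \<tau> (e k) (e j))"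
          using k by (subst H\<tau>.ip_lincomb_right[OF eH eH]) (auto intro!: sum.cong simp: H.ip_cnj[OF u eH])
        finally show "a k t * L2 \<tau> (e k) u = (\<Sum>j<N. a k t * L2 t (e j) u * L2 \<tau> (e k) (e j))"
          by (simp add: sum_distrib_left mult.assoc)
      qed
      also have "\<dots> = (\<Sum>j<N. \<Sum>k<N. a k t * L2 t (e j) u * L2 \<tau> (e k) (e j))" by (rule sum.swap)
      finally show "cnj (L2 \<tau> u w) = (\<Sum>j<N. \<Sum>k<N. a k t * L2 t (e j) u * L2 \<tau> (e k) (e j))" .
    qed
    also have "\<dots> = (\<Sum>j<N. \<Sum>k<N. dop \<i> 1 \<i> (\<lambda>\<tau>. a k t * L2 t (e j) u * L2 \<tau> (e k) (e j)) t)"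
      using L2_differentiable[OF eH eH t] by (subst dop_sum, simp, simp, intro sum.cong refl dop_sum) auto
    also have "\<dots> = (\<Sum>j<N. \<Sum>k<N. a k t * dop \<i> 1 \<i> (h k j) t * L2 t (e j) u)"
    proof (intro sum.cong refl)
      fix j k assume jk: "j \<in> {..<N}" "k \<in> {..<N}"
      have d: "(\<lambda>\<tau>. L2 \<tau> (e k) (e j)) differentiable (at t)" using L2_differentiable[OF eH eH t] jk by simp
      have "dop \<i> 1 \<i> (h k j) t = dop \<i> 1 \<i> (\<lambda>\<tau>. L2 \<tau> (e k) (e j)) t"
        unfolding h_def[abs_def] using d by (simp add: dop_diff)
      then show "dop \<i> 1 \<i> (\<lambda>\<tau>. a k t * L2 t (e j) u * L2 \<tau> (e k) (e j)) t = a k t * dop \<i> 1 \<i> (h k j) t * L2 t (e j) u"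
        unfolding dop_cmult[OF d] by (simp add: mult_ac)
    qed
    finally show ?thesis .
  qed
  have "L2 t (chern_curvature atlas W g \<phi> t u) u = (\<Sum>j<N. - \<gamma> j * L2 t (e j) u)"
    unfolding curv by (rule H.ip_lincomb[OF eH u])
  \<comment> \<open>\<open>gp(2)\<close> splits the curvature coefficient into the derivative of the
    Gram matrix, which sums to \<open>ww\<close>, and that of b, which sums to
    \<open>K\<close>.\<close>
  also have "\<dots> = (\<Sum>j<N. (\<Sum>k<N. a k t * dop \<i> 1 \<i> (h k j) t) * L2 t (e j) u - dop \<i> 1 \<i> (b j) t * L2 t (e j) u)"
    unfolding \<gamma>_def by (intro sum.cong refl) (simp add: gp(2) algebra_simps)
  also have "\<dots> = L2 t w w - K"
    unfolding K ww by (simp add: sum_subtractf sum_distrib_right)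
  finally have main: "L2 t (chern_curvature atlas W g \<phi> t u) u = L2 t w w - K" .
  have proj: "integral\<^sup>L (volt t) (FT (PI u w) t) = integral\<^sup>L (volt t) (PI w w t)"
    using dL2_eq[OF u w t] D(2)[OF t w] unfolding w_def L2_inner_eq by simp
  have "Im (L2 t w w) = 0" using H.ip_nonneg[OF w] by (simp add: complex_nonneg_iff)
  then show ?thesis
    using curvature_bound[OF u w t proj] unfolding main K_def[symmetric] L2_inner_eq[symmetric]
    by (simp add: less_eq_complex_def)
qed

end

theorem theorem3p1:
  fixes atlas :: "('z::t2_space, 'n::finite) chart set"
    and W :: "'i \<Rightarrow> 'z set"
    and g :: "'i \<Rightarrow> 'i \<Rightarrow> 'z \<Rightarrow> complex"
    and U :: "complex set"
    and \<phi>\<^sub>0 :: "'i \<Rightarrow> 'z \<Rightarrow> real"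
    and \<psi> :: "complex \<Rightarrow> 'z \<Rightarrow> real"
    and \<phi> :: "complex \<Rightarrow> 'i \<Rightarrow> 'z \<Rightarrow> real"
    and t :: complex
    and u :: "'i \<Rightarrow> 'z \<Rightarrow> complex"
  assumes "compact_complex_manifold atlas"
    and "positive_line_bundle atlas W g"
    and "open U" and "connected U"
    and "smooth_metric atlas W g \<phi>\<^sub>0"
    and "product_smooth_on atlas \<psi> U UNIV"
    and "smooth_metric_pullback atlas W g U \<phi>"
    and "\<forall>\<tau>\<in>U. \<forall>i. \<forall>z\<in>W i. \<phi> \<tau> i z = \<phi>\<^sub>0 i z + \<psi> \<tau> z"
    and "\<forall>\<tau>\<in>U. positive_metric atlas W (\<phi> \<tau>)"
    and "semipositive_on_product atlas W U \<phi>"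
    and "t \<in> U"
    and "u \<in> global_sections atlas W g"
  shows "L2_inner atlas W (\<phi> t) (chern_curvature atlas W g \<phi> t u) u
    \<le> complex_of_real (real (CARD('n) + 1) *
        (LINT z|volume_measure atlas W (\<phi> t). pointwise_normsq W (\<phi> t) u z * c_phi atlas W \<phi> \<psi> t z))"
proof -
  have "holomorphic_line_bundle atlas W g" using assms(2) by (simp add: positive_line_bundle_def)
  then interpret family atlas W g U \<phi>\<^sub>0 \<psi> \<phi>
    by unfold_locales (use assms in auto)
  show ?thesis by (rule curvature_estimate[OF assms(12,11)])
qed

end
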